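(* Let $\overline{A}=(A_0,A_1)$, $\overline{B}=(B_0,B_1)$, $\overline{C}=(C_0,C_1)$ be compatible couples of Banach spaces and let $T$ be a bounded bilinear operator acting between these couples, i.e. $T:A_i\times B_i\to C_i$ for $i=0,1$ and there are constants $k_0,k_1$ such that $\|T(a,b)\|_{C_i}\le k_i\|a\|_{A_i}\|b\|_{B_i}$ for all $(a,b)\in A_i\times B_i$, $i=0,1$. Let $0\le\theta\le1$, let $\varphi$ be a slowly varying function on $(0,\infty)$, and let $E$ be a rearrangement invariant space on $\mathbb{R}$ with associate space $E'$. Then, for any interpolation functor $\mathcal{F}$, $$T:\ \overline{A}^{J}_{\theta,\varphi,E}\times\overline{B}^{J}_{\theta,m_\varphi,\mathcal{F}(L^1,E')}\longrightarrow\overline{C}^{J}_{\theta,\varphi,\mathcal{F}(E,L^\infty)}$$ is a bounded bilinear operator with norm no greater than $\|T\|=\max\{\|T\|_0,\|T\|_1\}$, where $\|T\|_i$ is the norm of $T:A_i\times B_i\to C_i$.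
   Context: $L^1$, $L^\infty$, $E$, $E'$ are over $\mathbb{R}$ with Lebesgue measure; $E'$ is normed by $\|g\|_{E'}=\sup\{\int_{\mathbb{R}}|fg|:\|f\|_E\le1\}$. A compatible couple $(X_0,X_1)$ consists of Banach spaces continuously embedded in a common Hausdorff topological vector space. An interpolation functor $\mathcal{F}$ assigns to each compatible couple $(X_0,X_1)$ a Banach space $\mathcal{F}(X_0,X_1)$ with $X_0\cap X_1\hookrightarrow\mathcal{F}(X_0,X_1)\hookrightarrow X_0+X_1$ such that each linear $S:X_0+X_1\to Y_0+Y_1$ bounded from $X_i$ to $Y_i$ ($i=0,1$) maps $\mathcal{F}(X_0,X_1)$ boundedly into $\mathcal{F}(Y_0,Y_1)$. A positive measurable $b$ on $(0,\infty)$ is slowly varying if for every $\varepsilon>0$ the function $t^\varepsilon b(t)$ is equivalent (up to multiplicative constants) to an increasing function and $t^{-\varepsilon}b(t)$ to a decreasing function. For slowly varying $\varphi$, $m_\varphi(t)=\sup_{s>0}\frac{\varphi(ts)}{\varphi(s)}$, $t>0$. For a compatible couple $\overline{X}=(X_0,X_1)$, $J(t,f)=\max\{\|f\|_{X_0},t\|f\|_{X_1}\}$ for $f\in X_0\cap X_1$, $t>0$. For a function space $G$ on $\mathbb{R}$ (here $G=E$, $\mathcal{F}(L^1,E')$ or $\mathcal{F}(E,L^\infty)$), $\overline{X}^{J}_{\theta,b,G}$ is the set of $a\in X_0+X_1$ that admit a representation $a=\int_{\mathbb{R}}u(e^t)\,dt$ with $u$ strongly measurable with values in $X_0\cap X_1$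 and $\|e^{-\theta t}b(e^t)J(e^t,u(e^t))\|_G<\infty$ (norm in the variable $t\in\mathbb{R}$); $\|a\|^J_{\theta,b,G}$ is the infimum of these quantities over all such representations.
   Formalization: The norm bound by ‖T‖ is claimed only for exact functors (boundedness for all); for θ=0 or 1 it is assumed that finiteness of the weighted J-functional in F(E,L^∞) forces absolute convergence of the integral in the sum space. Without these the claim fails. *)

theory Defs
  imports "HOL-Analysis.Analysis" "HOL-Probability.Essential_Supremum"
begin

section \<open>Banach spaces inside a vector space, compatible couples\<close>

text \<open>
  A space is a subspace of an ambient real vector space together with its own norm; the values
  of \<open>nrm\<close> outside \<open>carr\<close> are irrelevant. All spaces are over the reals.
\<close>

record 'v nspace =
  carr :: "'v set"
  nrm :: "'v \<Rightarrow> real"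

type_synonym 'v couple = "'v nspace \<times> 'v nspace"

definition normed_sp :: "'v::real_vector nspace \<Rightarrow> bool" where
  "normed_sp X \<longleftrightarrow> subspace (carr X) \<and>
     (\<forall>x\<in>carr X. 0 \<le> nrm X x) \<and>
     (\<forall>x\<in>carr X. nrm X x = 0 \<longleftrightarrow> x = 0) \<and>
     (\<forall>x\<in>carr X. \<forall>c. nrm X (c *\<^sub>R x) = \<bar>c\<bar> * nrm X x) \<and>
     (\<forall>x\<in>carr X. \<forall>y\<in>carr X. nrm X (x + y) \<le> nrm X x + nrm X y)"

text \<open>The locale \<open>Metric_space\<close> wants a symmetric nonnegative distance on the whole type, hence the guard.\<close>

definition ndist :: "'v::real_vector nspace \<Rightarrow> 'v \<Rightarrow> 'v \<Rightarrow> real" where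
  "ndist X x y = (if x \<in> carr X \<and> y \<in> carr X then nrm X (x - y) else 0)"

definition ntop :: "'v::real_vector nspace \<Rightarrow> 'v topology" where
  "ntop X = Metric_space.mtopology (carr X) (ndist X)"

definition banach_sp :: "'v::real_vector nspace \<Rightarrow> bool" where
  "banach_sp X \<longleftrightarrow> normed_sp X \<and> Metric_space.mcomplete (carr X) (ndist X)"

definition hausdorff_tvs :: "'v::real_vector topology \<Rightarrow> bool" where
  "hausdorff_tvs \<tau> \<longleftrightarrow> subspace (topspace \<tau>) \<and> Hausdorff_space \<tau> \<and>
     continuous_map (prod_topology \<tau> \<tau>) \<tau> (\<lambda>(x, y). x + y) \<and>
     continuous_map (prod_topology (euclidean :: real topology) \<tau>) \<tau> (\<lambda>(c, x). c *\<^sub>R x)"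

definition compatible_couple :: "'v::real_vector couple \<Rightarrow> bool" where
  "compatible_couple X \<longleftrightarrow> banach_sp (fst X) \<and> banach_sp (snd X) \<and>
     (\<exists>\<tau>. hausdorff_tvs \<tau> \<and>
          continuous_map (ntop (fst X)) \<tau> (\<lambda>x. x) \<and> continuous_map (ntop (snd X)) \<tau> (\<lambda>x. x))"

definition inter_sp :: "'v::real_vector couple \<Rightarrow> 'v nspace" where
  "inter_sp X = \<lparr>carr = carr (fst X) \<inter> carr (snd X),
                 nrm = (\<lambda>x. max (nrm (fst X) x) (nrm (snd X) x))\<rparr>"

definition sum_sp :: "'v::real_vector couple \<Rightarrow> 'v nspace" where
  "sum_sp X =
     \<lparr>carr = {x0 + x1 | x0 x1. x0 \<in> carr (fst X) \<and> x1 \<in> carr (snd X)},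
      nrm = (\<lambda>x. Inf {nrm (fst X) x0 + nrm (snd X) x1 | x0 x1.
                        x0 \<in> carr (fst X) \<and> x1 \<in> carr (snd X) \<and> x = x0 + x1})\<rparr>"

definition cont_embedded :: "'v nspace \<Rightarrow> 'v nspace \<Rightarrow> bool" where
  "cont_embedded X Y \<longleftrightarrow> carr X \<subseteq> carr Y \<and> (\<exists>K. \<forall>x\<in>carr X. nrm Y x \<le> K * nrm X x)"


section \<open>Linear and bilinear operators\<close>

definition linear_btw :: "'v::real_vector nspace \<Rightarrow> 'w::real_vector nspace \<Rightarrow> ('v \<Rightarrow> 'w) \<Rightarrow> bool" where
  "linear_btw X Y S \<longleftrightarrow> (\<forall>x\<in>carr X. S x \<in> carr Y) \<and>
     (\<forall>x\<in>carr X. \<forall>y\<in>carr X. S (x + y) = S x + S y) \<and>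
     (\<forall>x\<in>carr X. \<forall>c. S (c *\<^sub>R x) = c *\<^sub>R S x)"

definition maps_with_bound :: "real \<Rightarrow> 'v nspace \<Rightarrow> 'w nspace \<Rightarrow> ('v \<Rightarrow> 'w) \<Rightarrow> bool" where
  "maps_with_bound K X Y S \<longleftrightarrow> (\<forall>x\<in>carr X. S x \<in> carr Y \<and> nrm Y (S x) \<le> K * nrm X x)"

definition bilinear_btw ::
  "'a::real_vector nspace \<Rightarrow> 'b::real_vector nspace \<Rightarrow> 'c::real_vector nspace \<Rightarrow> ('a \<Rightarrow> 'b \<Rightarrow> 'c) \<Rightarrow> bool"
where
  "bilinear_btw X Y Z T \<longleftrightarrow>
     (\<forall>x\<in>carr X. \<forall>y\<in>carr Y. T x y \<in> carr Z) \<and>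
     (\<forall>x\<in>carr X. \<forall>x'\<in>carr X. \<forall>y\<in>carr Y. T (x + x') y = T x y + T x' y) \<and>
     (\<forall>x\<in>carr X. \<forall>y\<in>carr Y. \<forall>y'\<in>carr Y. T x (y + y') = T x y + T x y') \<and>
     (\<forall>x\<in>carr X. \<forall>y\<in>carr Y. \<forall>c. T (c *\<^sub>R x) y = c *\<^sub>R T x y \<and> T x (c *\<^sub>R y) = c *\<^sub>R T x y)"

definition bounded_bilinear_btw ::
  "'a::real_vector nspace \<Rightarrow> 'b::real_vector nspace \<Rightarrow> 'c::real_vector nspace \<Rightarrow> ('a \<Rightarrow> 'b \<Rightarrow> 'c) \<Rightarrow> bool"
where
  "bounded_bilinear_btw X Y Z T \<longleftrightarrow> bilinear_btw X Y Z T \<and>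
     (\<exists>k. \<forall>x\<in>carr X. \<forall>y\<in>carr Y. nrm Z (T x y) \<le> k * nrm X x * nrm Y y)"

definition bilinear_norm ::
  "'a nspace \<Rightarrow> 'b nspace \<Rightarrow> 'c nspace \<Rightarrow> ('a \<Rightarrow> 'b \<Rightarrow> 'c) \<Rightarrow> real"
where
  "bilinear_norm X Y Z T =
     Sup {nrm Z (T x y) | x y. x \<in> carr X \<and> nrm X x \<le> 1 \<and> y \<in> carr Y \<and> nrm Y y \<le> 1}"


section \<open>Interpolation functors\<close>

text \<open>
  A functor acts on the couples of one ambient type; every functor on all Banach couples
  restricts to such an operation. The spaces \<open>\<F>(X\<^sub>0,X\<^sub>1)\<close> are subspaces of \<open>X\<^sub>0 + X\<^sub>1\<close>.
\<close>

definition interpolation_functor :: "('v::real_vector couple \<Rightarrow> 'v nspace) \<Rightarrow> bool" where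
  "interpolation_functor F \<longleftrightarrow>
     (\<forall>X. compatible_couple X \<longrightarrow>
        banach_sp (F X) \<and> cont_embedded (inter_sp X) (F X) \<and> cont_embedded (F X) (sum_sp X)) \<and>
     (\<forall>X Y S. compatible_couple X \<longrightarrow> compatible_couple Y \<longrightarrow>
        linear_btw (sum_sp X) (sum_sp Y) S \<longrightarrow>
        (\<exists>K. maps_with_bound K (fst X) (fst Y) S) \<longrightarrow>
        (\<exists>K. maps_with_bound K (snd X) (snd Y) S) \<longrightarrow>
        (\<exists>K. maps_with_bound K (F X) (F Y) S))"

text \<open>Exactness: the norm of \<open>S\<close> on the interpolation spaces is at most the larger of its two endpoint norms.\<close>

definition exact_functor :: "('v::real_vector couple \<Rightarrow> 'v nspace) \<Rightarrow> bool" where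
  "exact_functor F \<longleftrightarrow>
     (\<forall>X Y S K. compatible_couple X \<longrightarrow> compatible_couple Y \<longrightarrow>
        linear_btw (sum_sp X) (sum_sp Y) S \<longrightarrow>
        maps_with_bound K (fst X) (fst Y) S \<longrightarrow> maps_with_bound K (snd X) (snd Y) S \<longrightarrow>
        maps_with_bound K (F X) (F Y) S)"


section \<open>Measurable functions on the line modulo null sets\<close>

definition l0_rel :: "(real \<Rightarrow> real) \<Rightarrow> (real \<Rightarrow> real) \<Rightarrow> bool" where
  "l0_rel f g \<longleftrightarrow> f \<in> borel_measurable lebesgue \<and> g \<in> borel_measurable lebesgue \<and>
     (AE t in lebesgue. f t = g t)"

quotient_type l0 = "real \<Rightarrow> real" / partial: l0_rel
proof (rule part_equivpI)
  show "\<exists>x. l0_rel x x"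
    by (rule exI[of _ "\<lambda>_. 0"]) (simp add: l0_rel_def)
  show "symp l0_rel"
    by (rule sympI) (auto simp: l0_rel_def)
  show "transp l0_rel"
    by (rule transpI) (auto simp: l0_rel_def)
qed

instantiation l0 :: real_vector
begin

lift_definition zero_l0 :: l0 is "\<lambda>_. 0"
  by (simp add: l0_rel_def)

lift_definition plus_l0 :: "l0 \<Rightarrow> l0 \<Rightarrow> l0" is "\<lambda>f g t. f t + g t"
  by (auto simp: l0_rel_def)

lift_definition uminus_l0 :: "l0 \<Rightarrow> l0" is "\<lambda>f t. - f t"
  by (auto simp: l0_rel_def)

lift_definition minus_l0 :: "l0 \<Rightarrow> l0 \<Rightarrow> l0" is "\<lambda>f g t. f t - g t"
  by (auto simp: l0_rel_def)

lift_definition scaleR_l0 :: "real \<Rightarrow> l0 \<Rightarrow> l0" is "\<lambda>c f t. c * f t"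
  by (auto simp: l0_rel_def)

instance
  by standard (transfer, force simp: l0_rel_def algebra_simps)+

end

text \<open>
  Banach function norms are defined on nonnegative measurable functions (with value \<open>\<infinity>\<close> allowed),
  following Bennett and Sharpley; in particular they have the Fatou property.
\<close>

definition ri_norm :: "((real \<Rightarrow> ennreal) \<Rightarrow> ennreal) \<Rightarrow> bool" where
  "ri_norm \<rho> \<longleftrightarrow>
     (\<forall>f\<in>borel_measurable lebesgue. \<rho> f = 0 \<longleftrightarrow> (AE t in lebesgue. f t = 0)) \<and>
     (\<forall>f\<in>borel_measurable lebesgue. \<forall>c\<ge>0. \<rho> (\<lambda>t. ennreal c * f t) = ennreal c * \<rho> f) \<and>
     (\<forall>f\<in>borel_measurable lebesgue. \<forall>g\<in>borel_measurable lebesgue.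
        \<rho> (\<lambda>t. f t + g t) \<le> \<rho> f + \<rho> g) \<and>
     (\<forall>f\<in>borel_measurable lebesgue. \<forall>g\<in>borel_measurable lebesgue.
        (AE t in lebesgue. f t \<le> g t) \<longrightarrow> \<rho> f \<le> \<rho> g) \<and>
     (\<forall>h f. (\<forall>n::nat. h n \<in> borel_measurable lebesgue) \<longrightarrow> f \<in> borel_measurable lebesgue \<longrightarrow>
        (AE t in lebesgue. incseq (\<lambda>n. h n t) \<and> (\<lambda>n. h n t) \<longlonglongrightarrow> f t) \<longrightarrow>
        (\<lambda>n. \<rho> (h n)) \<longlonglongrightarrow> \<rho> f) \<and>
     (\<forall>A\<in>sets lebesgue. emeasure lebesgue A < \<infinity> \<longrightarrow> \<rho> (indicator A) < \<infinity>) \<and>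
     (\<forall>A\<in>sets lebesgue. emeasure lebesgue A < \<infinity> \<longrightarrow>
        (\<exists>K>0. \<forall>f\<in>borel_measurable lebesgue. (\<integral>\<^sup>+t\<in>A. f t \<partial>lebesgue) \<le> ennreal K * \<rho> f)) \<and>
     (\<forall>f\<in>borel_measurable lebesgue. \<forall>g\<in>borel_measurable lebesgue.
        (\<forall>s. emeasure lebesgue {t. s < f t} = emeasure lebesgue {t. s < g t}) \<longrightarrow> \<rho> f = \<rho> g)"

definition fspace :: "((real \<Rightarrow> ennreal) \<Rightarrow> ennreal) \<Rightarrow> l0 nspace" where
  "fspace \<rho> = \<lparr>carr = {f. \<rho> (\<lambda>t. ennreal \<bar>rep_l0 f t\<bar>) < \<infinity>},
               nrm = (\<lambda>f. enn2real (\<rho> (\<lambda>t. ennreal \<bar>rep_l0 f t\<bar>)))\<rparr>"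

definition assoc_norm :: "((real \<Rightarrow> ennreal) \<Rightarrow> ennreal) \<Rightarrow> (real \<Rightarrow> ennreal) \<Rightarrow> ennreal" where
  "assoc_norm \<rho> g = (SUP f\<in>{f \<in> borel_measurable lebesgue. \<rho> f \<le> 1}. \<integral>\<^sup>+t. f t * g t \<partial>lebesgue)"

definition L1_sp :: "l0 nspace" where
  "L1_sp = fspace (\<lambda>f. \<integral>\<^sup>+t. f t \<partial>lebesgue)"

definition Linf_sp :: "l0 nspace" where
  "Linf_sp = fspace (esssup lebesgue)"


section \<open>Slowly varying functions\<close>

definition equiv_pos :: "(real \<Rightarrow> real) \<Rightarrow> (real \<Rightarrow> real) \<Rightarrow> bool" where
  "equiv_pos f g \<longleftrightarrow> (\<exists>c>0. \<exists>C>0. \<forall>t>0. c * g t \<le> f t \<and> f t \<le> C * g t)"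

definition slowly_varying :: "(real \<Rightarrow> real) \<Rightarrow> bool" where
  "slowly_varying b \<longleftrightarrow>
     b \<in> borel_measurable (lebesgue_on {0<..}) \<and> (\<forall>t>0. 0 < b t) \<and>
     (\<forall>\<epsilon>>0. (\<exists>g. mono_on {0<..} g \<and> equiv_pos (\<lambda>t. t powr \<epsilon> * b t) g) \<and>
            (\<exists>g. antimono_on {0<..} g \<and> equiv_pos (\<lambda>t. t powr (- \<epsilon>) * b t) g))"

definition m_fun :: "(real \<Rightarrow> real) \<Rightarrow> real \<Rightarrow> real" where
  "m_fun \<phi> t = (SUP s\<in>{0<..}. \<phi> (t * s) / \<phi> s)"


section \<open>Vector-valued integration with respect to an explicit norm\<close>

text \<open>
  These mirror the library's Bochner integral, which is only available for type-class Banach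
  spaces; \<open>simple_function\<close> and \<open>simple_bochner_integral\<close> need no norm and are reused.
\<close>

definition strongly_measurable :: "'m measure \<Rightarrow> 'v::real_vector nspace \<Rightarrow> ('m \<Rightarrow> 'v) \<Rightarrow> bool" where
  "strongly_measurable M X f \<longleftrightarrow> (\<forall>t\<in>space M. f t \<in> carr X) \<and>
     (\<exists>s. (\<forall>n::nat. simple_function M (s n) \<and> s n ` space M \<subseteq> carr X) \<and>
          (AE t in M. (\<lambda>n. nrm X (f t - s n t)) \<longlonglongrightarrow> 0))"

definition has_bochner_int :: "'m measure \<Rightarrow> 'v::real_vector nspace \<Rightarrow> ('m \<Rightarrow> 'v) \<Rightarrow> 'v \<Rightarrow> bool" where
  "has_bochner_int M X f x \<longleftrightarrow> strongly_measurable M X f \<and> x \<in> carr X \<and>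
     (\<exists>s. (\<forall>n::nat. Bochner_Integration.simple_bochner_integrable M (s n) \<and> s n ` space M \<subseteq> carr X) \<and>
          (\<lambda>n. \<integral>\<^sup>+t. ennreal (nrm X (f t - s n t)) \<partial>M) \<longlonglongrightarrow> 0 \<and>
          (\<lambda>n. nrm X (Bochner_Integration.simple_bochner_integral M (s n) - x)) \<longlonglongrightarrow> 0)"


section \<open>J-spaces\<close>

definition J_fun :: "'v couple \<Rightarrow> real \<Rightarrow> 'v \<Rightarrow> real" where
  "J_fun X t f = max (nrm (fst X) f) (t * nrm (snd X) f)"

definition J_weighted :: "'v couple \<Rightarrow> real \<Rightarrow> (real \<Rightarrow> real) \<Rightarrow> (real \<Rightarrow> 'v) \<Rightarrow> real \<Rightarrow> real" where
  "J_weighted X \<theta> b u t = exp (- \<theta> * t) * b (exp t) * J_fun X (exp t) (u (exp t))"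

definition J_rep ::
  "'v::real_vector couple \<Rightarrow> real \<Rightarrow> (real \<Rightarrow> real) \<Rightarrow> l0 nspace \<Rightarrow> 'v \<Rightarrow> (real \<Rightarrow> 'v) \<Rightarrow> bool"
where
  "J_rep X \<theta> b G a u \<longleftrightarrow>
     strongly_measurable (lebesgue_on {0<..}) (inter_sp X) u \<and>
     has_bochner_int lebesgue (sum_sp X) (\<lambda>t. u (exp t)) a \<and>
     J_weighted X \<theta> b u \<in> borel_measurable lebesgue \<and>
     abs_l0 (J_weighted X \<theta> b u) \<in> carr G"

definition J_space ::
  "'v::real_vector couple \<Rightarrow> real \<Rightarrow> (real \<Rightarrow> real) \<Rightarrow> l0 nspace \<Rightarrow> 'v nspace"
where
  "J_space X \<theta> b G =
     \<lparr>carr = {a. \<exists>u. J_rep X \<theta> b G a u},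
      nrm = (\<lambda>a. Inf {nrm G (abs_l0 (J_weighted X \<theta> b u)) | u. J_rep X \<theta> b G a u})\<rparr>"

text \<open>
  The parameter condition under which the J-construction yields normed spaces: since the norm of
  \<open>x\<close> in \<open>X\<^sub>0 + X\<^sub>1\<close> is at most \<open>min 1 (1/t) * J t x\<close>, it makes \<open>\<integral> u(e\<^sup>t) dt\<close> converge absolutely in
  \<open>X\<^sub>0 + X\<^sub>1\<close> as soon as the weighted J-functional of \<open>u\<close> lies in \<open>G\<close>. For \<open>0 < \<theta> < 1\<close> and
  \<open>G = \<F>(E,L\<^sup>\<infinity>)\<close> it holds automatically. If it fails for such a \<open>G\<close>, spreading \<open>x \<in> X\<^sub>0 \<inter> X\<^sub>1\<close> over
  long intervals shows that the J-functional norm vanishes on all of \<open>X\<^sub>0 \<inter> X\<^sub>1\<close>.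
\<close>

definition J_admissible :: "real \<Rightarrow> (real \<Rightarrow> real) \<Rightarrow> l0 nspace \<Rightarrow> bool" where
  "J_admissible \<theta> b G \<longleftrightarrow>
     (\<forall>g\<in>carr G. (\<integral>\<^sup>+t. ennreal (min 1 (exp (- t)) * exp (\<theta> * t) / b (exp t) * \<bar>rep_l0 g t\<bar>) \<partial>lebesgue) < \<infinity>)"


section \<open>The operator on the J-spaces\<close>

text \<open>
  \<open>T\<close> is only given on \<open>A\<^sub>0 \<times> B\<^sub>0\<close> and \<open>A\<^sub>1 \<times> B\<^sub>1\<close>, and a pair of elements of the J-spaces need not lie in
  either. Its action \<open>T'\<close> on the J-spaces agrees with \<open>T\<close> wherever both are defined, and
  \<open>T'(\<integral> u(e\<^sup>s) ds, \<integral> v(e\<^sup>t) dt) = \<integral>\<integral> T(u(e\<^sup>s), v(e\<^sup>t)) ds dt\<close> for all admitted representations; the second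
  condition determines \<open>T'\<close> on the J-spaces.
\<close>

definition J_extension ::
  "'a::real_vector couple \<Rightarrow> 'b::real_vector couple \<Rightarrow> 'c::real_vector couple \<Rightarrow> ('a \<Rightarrow> 'b \<Rightarrow> 'c) \<Rightarrow>
   real \<Rightarrow> (real \<Rightarrow> real) \<Rightarrow> l0 nspace \<Rightarrow> (real \<Rightarrow> real) \<Rightarrow> l0 nspace \<Rightarrow> ('a \<Rightarrow> 'b \<Rightarrow> 'c) \<Rightarrow> bool"
where
  "J_extension A B C T \<theta> b1 G1 b2 G2 T' \<longleftrightarrow>
     (\<forall>a\<in>carr (J_space A \<theta> b1 G1). \<forall>b\<in>carr (J_space B \<theta> b2 G2).
        (a \<in> carr (fst A) \<and> b \<in> carr (fst B) \<or> a \<in> carr (snd A) \<and> b \<in> carr (snd B)) \<longrightarrow>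
        T' a b = T a b) \<and>
     (\<forall>a b u v. J_rep A \<theta> b1 G1 a u \<longrightarrow> J_rep B \<theta> b2 G2 b v \<longrightarrow>
        has_bochner_int (lebesgue \<Otimes>\<^sub>M lebesgue) (sum_sp C)
          (\<lambda>(s, t). T (u (exp s)) (v (exp t))) (T' a b))"

end

theory Submission
  imports Defs
begin

text \<open>
  A strongly measurable \<open>u\<close> can be written as a series \<open>u(e\<^sup>t) = \<Sum> 1\<^bsub>E n\<^esub>(t) x\<^sub>n\<close> with \<open>x\<^sub>n \<in> A\<^sub>0 \<inter> A\<^sub>1\<close> and
  \<open>\<Sum> 1\<^bsub>E n\<^esub>(t) J(e\<^sup>t, x\<^sub>n) \<le> q J(e\<^sup>t, u(e\<^sup>t))\<close>, for any \<open>q > 1\<close>; then \<open>\<integral> u(e\<^sup>t) dt = \<Sum> |E\<^sub>n| x\<^sub>n\<close>. For two such series the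
  vector-valued convolution \<open>w(e\<^sup>r) = \<Sum> (1\<^bsub>E n\<^esub> * 1\<^bsub>H m\<^esub>)(r) T(x\<^sub>n, y\<^sub>m)\<close> represents \<open>\<Sum> |E\<^sub>n| |H\<^sub>m| T(x\<^sub>n, y\<^sub>m)\<close>.
  From \<open>J(e\<^bsup>s+t\<^esup>, T(x, y)) \<le> \<parallel>T\<parallel> J(e\<^sup>s, x) J(e\<^sup>t, y)\<close> and \<open>\<phi>(e\<^bsup>s+t\<^esup>) \<le> \<phi>(e\<^sup>s) m(e\<^sup>t)\<close> its weighted J-functional is
  at most \<open>q\<^sup>2 \<parallel>T\<parallel> f * g\<close> pointwise, where \<open>f\<close> and \<open>g\<close> are the weighted J-functionals of the factors. Convolution
  with \<open>f \<in> E\<close> maps \<open>L\<^sup>1\<close> into \<open>E\<close> and \<open>E'\<close> into \<open>L\<^sup>\<infinity>\<close>, both with norm at most \<open>\<parallel>f\<parallel>\<close>, so \<open>f * g\<close> lies in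
  \<open>\<F>(E, L\<^sup>\<infinity>)\<close>; for a functor that is not exact, the norms of these operators are controlled by a uniform
  boundedness argument. Convolving with \<open>1\<^bsub>[0,1]\<^esub>\<close> transfers the admissibility of \<open>\<F>(E, L\<^sup>\<infinity>)\<close> to the two factors.
\<close>

section \<open>Normed spaces given by a carrier\<close>

text \<open>The space \<open>F (fspace \<rho>, Linf_sp)\<close> is not known to be a lattice, so a
  function lying pointwise below a convolution need not belong to it. The weighted J-functional is
  therefore written as \<open>m\<close> times a convolution with \<open>|m| <= 1\<close>, and
  multiplication by \<open>m\<close> is built into the convolution operator before the functor is
  applied. A functor bounds each of these operators separately, whereas the norm estimate needs one
  constant times the norm of \<open>f\<close>, for all \<open>f\<close> and \<open>m\<close>. Series
  replace the integral of \<open>T(u(e^s), v(e^(r-s)))\<close> over \<open>s\<close> because then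
  only scalar coefficients are convolved: scalar Tonelli and rearrangement of double series take the
  place of vector-valued Fubini theorems. Summing a double series by rows or by columns shows that
  its value does not depend on the chosen series and is linear in each argument. Agreement with
  \<open>T\<close> comes from cutting at \<open>t = 0\<close>: \<open>J(e^t, x)\<close> controls the
  norm of \<open>X_0\<close> for \<open>t < 0\<close> and, up to \<open>e^(-t)\<close>, that of
  \<open>X_1\<close> for \<open>t >= 0\<close>. The factor \<open>q\<close> disappears by letting it
  tend to 1, once the value of the operator is fixed.\<close>

locale nsp =
  fixes X :: "'v::real_vector nspace"
  assumes normed: "normed_sp X"
begin

lemma subsp: "subspace (carr X)" using normed by (simp add: normed_sp_def)
lemma zero_mem [simp]: "0 \<in> carr X" using subsp by (rule subspace_0)
lemma add_mem [simp]: "x \<in> carr X \<Longrightarrow> y \<in> carr X \<Longrightarrow> x + y \<in> carr X" using subsp by (rule subspace_add)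
lemma diff_mem [simp]: "x \<in> carr X \<Longrightarrow> y \<in> carr X \<Longrightarrow> x - y \<in> carr X" using subsp by (rule subspace_diff)
lemma minus_mem [simp]: "x \<in> carr X \<Longrightarrow> - x \<in> carr X" using subsp by (rule subspace_neg)
lemma scale_mem [simp]: "x \<in> carr X \<Longrightarrow> c *\<^sub>R x \<in> carr X" using subsp by (rule subspace_scale)
lemma sum_mem [simp]: "(\<And>i. i \<in> I \<Longrightarrow> f i \<in> carr X) \<Longrightarrow> sum f I \<in> carr X" using subsp by (rule subspace_sum)
lemma nrm_ge0 [simp]: "x \<in> carr X \<Longrightarrow> 0 \<le> nrm X x" using normed by (simp add: normed_sp_def)
lemma nrm_eq0: "x \<in> carr X \<Longrightarrow> nrm X x = 0 \<longleftrightarrow> x = 0" using normed by (simp add: normed_sp_def)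
lemma nrm_zero [simp]: "nrm X 0 = 0" using nrm_eq0[of 0] by simp
lemma nrm_scale: "x \<in> carr X \<Longrightarrow> nrm X (c *\<^sub>R x) = \<bar>c\<bar> * nrm X x" using normed by (simp add: normed_sp_def)
lemma nrm_triangle: "x \<in> carr X \<Longrightarrow> y \<in> carr X \<Longrightarrow> nrm X (x + y) \<le> nrm X x + nrm X y"
  using normed by (simp add: normed_sp_def)
lemma nrm_minus: "x \<in> carr X \<Longrightarrow> nrm X (- x) = nrm X x" using nrm_scale[of x "-1"] by simp
lemma nrm_commute: "x \<in> carr X \<Longrightarrow> y \<in> carr X \<Longrightarrow> nrm X (x - y) = nrm X (y - x)"
  using nrm_minus[of "x - y"] diff_mem by simp
lemma nrm_diff_triangle:
  "x \<in> carr X \<Longrightarrow> y \<in> carr X \<Longrightarrow> z \<in> carr X \<Longrightarrow> nrm X (x - z) \<le> nrm X (x - y) + nrm X (y - z)"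
  using nrm_triangle[of "x - y" "y - z"] diff_mem by simp
lemma nrm_sum_le: "(\<And>i. i \<in> I \<Longrightarrow> f i \<in> carr X) \<Longrightarrow> nrm X (sum f I) \<le> (\<Sum>i\<in>I. nrm X (f i))"
proof (induction I rule: infinite_finite_induct)
  case (insert i I)
  then have "nrm X (f i + sum f I) \<le> nrm X (f i) + nrm X (sum f I)"
    by (intro nrm_triangle sum_mem) auto
  with insert show ?case by fastforce
qed auto

lemma metric: "Metric_space (carr X) (ndist X)"
proof
  show "0 \<le> ndist X x y" for x y
    using diff_mem by (simp add: ndist_def)
  show "ndist X x y = ndist X y x" for x y
    using nrm_commute by (auto simp: ndist_def)
  show "ndist X x y = 0 \<longleftrightarrow> x = y" if "x \<in> carr X" "y \<in> carr X" for x y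
    using that nrm_eq0[of "x - y"] diff_mem by (simp add: ndist_def)
  show "ndist X x z \<le> ndist X x y + ndist X y z" if "x \<in> carr X" "y \<in> carr X" "z \<in> carr X" for x y z
    using that nrm_diff_triangle by (simp add: ndist_def)
qed

sublocale Met: Metric_space "carr X" "ndist X" by (rule metric)

lemma limitin_ntop:
  "limitin (ntop X) f x sequentially \<longleftrightarrow>
    x \<in> carr X \<and> (\<forall>e>0. \<forall>\<^sub>F n in sequentially. f n \<in> carr X \<and> nrm X (f n - x) < e)"
  unfolding ntop_def Met.limitin_metric
  by (intro conj_cong refl all_cong imp_cong eventually_cong arg_cong2[where f = eventually] ext)
     (auto simp: ndist_def fun_eq_iff)

end

section \<open>Convergence of sequences and series in a carrier norm\<close>

definition nlim :: "'v::real_vector nspace \<Rightarrow> (nat \<Rightarrow> 'v) \<Rightarrow> 'v \<Rightarrow> bool" where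
  "nlim X f x \<longleftrightarrow> (\<forall>n. f n \<in> carr X) \<and> x \<in> carr X \<and> (\<lambda>n. nrm X (f n - x)) \<longlonglongrightarrow> 0"

definition nsums :: "'v::real_vector nspace \<Rightarrow> (nat \<Rightarrow> 'v) \<Rightarrow> 'v \<Rightarrow> bool" where
  "nsums X f x \<longleftrightarrow> (\<forall>i. f i \<in> carr X) \<and> nlim X (\<lambda>n. sum f {..<n}) x"

lemma nsumsD: assumes "nsums X f x"
  shows "f i \<in> carr X" "x \<in> carr X" "nlim X (\<lambda>n. sum f {..<n}) x"
    "(\<lambda>n. nrm X (sum f {..<n} - x)) \<longlonglongrightarrow> 0"
  using assms by (auto simp: nsums_def nlim_def)

context nsp
begin

lemma nlim_limitin: "nlim X f x \<Longrightarrow> limitin (ntop X) f x sequentially"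
  by (auto simp: nlim_def limitin_ntop order_tendsto_iff)

lemma nlim_iff_limitin: "(\<And>n. f n \<in> carr X) \<Longrightarrow> nlim X f x \<longleftrightarrow> limitin (ntop X) f x sequentially"
proof
  assume *: "\<And>n. f n \<in> carr X" "limitin (ntop X) f x sequentially"
  then have x: "x \<in> carr X" by (auto simp: limitin_ntop)
  have "(\<lambda>n. nrm X (f n - x)) \<longlonglongrightarrow> 0"
  proof (rule order_tendstoI)
    fix a :: real assume "a < 0"
    then show "\<forall>\<^sub>F n in sequentially. a < nrm X (f n - x)"
      using *(1) x by (intro always_eventually allI order.strict_trans2[OF \<open>a < 0\<close>] nrm_ge0 diff_mem)
  next
    fix a :: real assume "0 < a"
    then have "\<forall>\<^sub>F n in sequentially. f n \<in> carr X \<and> nrm X (f n - x) < a"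
      using *(2) by (simp add: limitin_ntop)
    then show "\<forall>\<^sub>F n in sequentially. nrm X (f n - x) < a"
      by (rule eventually_mono) simp
  qed
  then show "nlim X f x" using * x by (auto simp: nlim_def)
qed (rule nlim_limitin)

lemma nlimI_le: "(\<And>n. f n \<in> carr X) \<Longrightarrow> x \<in> carr X \<Longrightarrow> (\<And>n. nrm X (f n - x) \<le> g n) \<Longrightarrow> g \<longlonglongrightarrow> 0 \<Longrightarrow> nlim X f x"
  unfolding nlim_def
  by (auto intro!: tendsto_sandwich[of "\<lambda>_. 0" "\<lambda>n. nrm X (f n - x)" sequentially g] always_eventually nrm_ge0)

lemma nlim_unique: assumes "nlim X f x" "nlim X f y" shows "x = y"
proof -
  have "(\<lambda>n. nrm X (f n - x) + nrm X (f n - y)) \<longlonglongrightarrow> 0 + 0"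
    using assms by (intro tendsto_add) (auto simp: nlim_def)
  moreover have "nrm X (x - y) \<le> nrm X (f n - x) + nrm X (f n - y)" for n
    using nrm_diff_triangle[of x "f n" y] nrm_commute[of x "f n"] assms by (auto simp: nlim_def)
  ultimately have "nrm X (x - y) \<le> 0 + 0"
    by (intro LIMSEQ_le_const) auto
  moreover have "x - y \<in> carr X" using assms by (auto simp: nlim_def)
  ultimately show ?thesis using nrm_ge0[of "x - y"] nrm_eq0[of "x - y"] by (metis antisym add_0 right_minus_eq)
qed

lemma nlim_const [intro]: "x \<in> carr X \<Longrightarrow> nlim X (\<lambda>_. x) x"
  by (simp add: nlim_def)

lemma nlim_add: assumes "nlim X f x" "nlim X g y" shows "nlim X (\<lambda>n. f n + g n) (x + y)"
proof (rule nlimI_le)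
  show "nrm X (f n + g n - (x + y)) \<le> nrm X (f n - x) + nrm X (g n - y)" for n
    using nrm_triangle[of "f n - x" "g n - y"] assms by (auto simp: nlim_def algebra_simps)
  show "(\<lambda>n. nrm X (f n - x) + nrm X (g n - y)) \<longlonglongrightarrow> 0"
    using assms tendsto_add[of "\<lambda>n. nrm X (f n - x)" 0 _ "\<lambda>n. nrm X (g n - y)" 0] by (auto simp: nlim_def)
qed (use assms in \<open>auto simp: nlim_def\<close>)

lemma nlim_scale: assumes "nlim X f x" shows "nlim X (\<lambda>n. c *\<^sub>R f n) (c *\<^sub>R x)"
proof (rule nlimI_le)
  show "nrm X (c *\<^sub>R f n - c *\<^sub>R x) \<le> \<bar>c\<bar> * nrm X (f n - x)" for n
    using nrm_scale[of "f n - x" c] assms by (simp add: nlim_def scaleR_diff_right)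
  show "(\<lambda>n. \<bar>c\<bar> * nrm X (f n - x)) \<longlonglongrightarrow> 0"
    using assms tendsto_mult_right_zero by (auto simp: nlim_def)
qed (use assms in \<open>auto simp: nlim_def\<close>)

lemma nlim_subseq: "nlim X f x \<Longrightarrow> strict_mono r \<Longrightarrow> nlim X (\<lambda>n. f (r n)) x"
  using LIMSEQ_subseq_LIMSEQ[of "\<lambda>n. nrm X (f n - x)" 0 r] by (auto simp: nlim_def o_def)

lemma nsums_unique: "nsums X f x \<Longrightarrow> nsums X f y \<Longrightarrow> x = y"
  using nlim_unique nsumsD(3) by blast

lemma nsums_add: "nsums X f x \<Longrightarrow> nsums X g y \<Longrightarrow> nsums X (\<lambda>n. f n + g n) (x + y)"
  using nlim_add by (auto simp: nsums_def sum.distrib)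

lemma nsums_scale: "nsums X f x \<Longrightarrow> nsums X (\<lambda>n. c *\<^sub>R f n) (c *\<^sub>R x)"
  using nlim_scale by (auto simp: nsums_def scaleR_sum_right[symmetric])

text \<open>\<open>N x <= N (f n) + C * nrm X (f n - x)\<close>, and the last term vanishes in the
  limit. This serves the norm itself and, through \<open>nsums_seminorm_le\<close>, the functionals
  \<open>J(e^r, .)\<close>.\<close>

lemma nlim_seminorm_le:
  assumes f: "nlim X f x"
    and tri: "\<And>x y. x \<in> carr X \<Longrightarrow> y \<in> carr X \<Longrightarrow> N (x + y) \<le> N x + N y"
    and bd: "\<And>x. x \<in> carr X \<Longrightarrow> N x \<le> C * nrm X x"
    and le: "\<And>n. N (f n) \<le> B"
  shows "N x \<le> (B::real)"
proof -
  have "(\<lambda>n. B + C * nrm X (f n - x)) \<longlonglongrightarrow> B + C * 0"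
    using f by (intro tendsto_intros) (auto simp: nlim_def)
  moreover have "N x \<le> B + C * nrm X (f n - x)" for n
    using tri[of "f n" "x - f n"] bd[of "x - f n"] nrm_commute[of x "f n"] le[of n] f
    by (auto simp: nlim_def diff_mem)
  ultimately show ?thesis
    by (intro LIMSEQ_le_const[of _ "B + C * 0", simplified]) auto
qed

lemma nsums_seminorm_le:
  assumes f: "nsums X f x"
    and tri: "\<And>x y. x \<in> carr X \<Longrightarrow> y \<in> carr X \<Longrightarrow> N (x + y) \<le> N x + N y"
    and bd: "\<And>x. x \<in> carr X \<Longrightarrow> N x \<le> C * nrm X x"
    and nn: "\<And>x. x \<in> carr X \<Longrightarrow> 0 \<le> N x"
  shows "ennreal (N x) \<le> (\<Sum>i. ennreal (N (f i)))"
proof (cases "(\<Sum>i. ennreal (N (f i))) = \<infinity>")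
  case False
  have N0: "N 0 = 0" using bd[of 0] nn[of 0] by simp
  have fc: "f i \<in> carr X" for i using f by (rule nsumsD)
  have sm: "summable (\<lambda>i. N (f i))"
    using False nn fc by (intro summable_suminf_not_top) (auto simp: top_unique)
  have le: "N (sum f {..<n}) \<le> (\<Sum>i. N (f i))" for n
  proof -
    have "N (sum f {..<n}) \<le> (\<Sum>i<n. N (f i))"
    proof (induction n)
      case (Suc n)
      then show ?case using tri[of "sum f {..<n}" "f n"] fc by (auto simp: sum_mem intro: order_trans)
    qed (simp add: N0)
    also have "\<dots> \<le> (\<Sum>i. N (f i))" using sm nn fc by (intro sum_le_suminf) auto
    finally show ?thesis .
  qed
  have "N x \<le> (\<Sum>i. N (f i))"
    by (rule nlim_seminorm_le[OF nsumsD(3)[OF f] tri bd le])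
  then show ?thesis
    using sm nn fc by (subst suminf_ennreal2) (auto intro: ennreal_leI)
qed simp

lemma nsums_nrm_le: "nsums X f x \<Longrightarrow> ennreal (nrm X x) \<le> (\<Sum>i. ennreal (nrm X (f i)))"
  by (rule nsums_seminorm_le[where C = 1]) (auto intro: nrm_triangle)

lemma nsums_tail:
  assumes f: "nsums X f x"
  shows "ennreal (nrm X (x - sum f {..<k})) \<le> (\<Sum>i. ennreal (nrm X (f (i + k))))"
proof (rule nsums_nrm_le)
  have "(\<lambda>n. nrm X (sum f {..<n + k} - x)) \<longlonglongrightarrow> 0"
    using LIMSEQ_ignore_initial_segment[OF nsumsD(4)[OF f]] .
  moreover have *: "(\<Sum>i<n. f (i + k)) - (x - sum f {..<k}) = sum f {..<n + k} - x" for n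
    using sum.atLeastLessThan_concat[of 0 k "n + k" f] sum.shift_bounds_nat_ivl[of f 0 k n]
    by (simp add: lessThan_atLeast0 algebra_simps)
  then have "(\<lambda>n. nrm X ((\<Sum>i<n. f (i + k)) - (x - sum f {..<k}))) = (\<lambda>n. nrm X (sum f {..<n + k} - x))"
    by (simp only: *)
  ultimately show "nsums X (\<lambda>i. f (i + k)) (x - sum f {..<k})"
    unfolding nsums_def nlim_def using nsumsD(1,2)[OF f] by simp
qed

end

text \<open>A Cauchy sequence has a subsequence with increments below \<open>(1/2)^n\<close>; the
  series of increments telescopes to that subsequence, and a Cauchy sequence with a convergent
  subsequence converges.\<close>

lemma banach_spI:
  assumes X: "normed_sp X"
    and conv: "\<And>d. (\<And>n. d n \<in> carr X) \<Longrightarrow> (\<And>n. nrm X (d n) \<le> (1/2)^n) \<Longrightarrow> \<exists>x. nsums X d x"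
  shows "banach_sp X"
proof -
  interpret nsp X by standard (rule X)
  have "Met.mcomplete" unfolding Met.mcomplete_def
  proof (intro allI impI)
    fix \<sigma> assume c: "Met.MCauchy \<sigma>"
    then have mem: "\<sigma> n \<in> carr X" for n by (auto simp: Met.MCauchy_def)
    have "\<exists>N. \<forall>n\<ge>N. \<forall>n'\<ge>N. nrm X (\<sigma> n - \<sigma> n') < (1/2)^k" for k
    proof -
      have "0 < (1/2 :: real)^k" by simp
      then obtain N where "\<forall>n n'. N \<le> n \<longrightarrow> N \<le> n' \<longrightarrow> ndist X (\<sigma> n) (\<sigma> n') < (1/2)^k"
        using c unfolding Met.MCauchy_def by meson
      then show ?thesis using mem by (auto simp: ndist_def)
    qed
    then obtain N where N: "\<And>k n n'. n \<ge> N k \<Longrightarrow> n' \<ge> N k \<Longrightarrow> nrm X (\<sigma> n - \<sigma> n') < (1/2)^k"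
      by metis
    \<comment> \<open>Adding up the thresholds makes \<open>r\<close> dominate every
      \<open>N k\<close>; the extra \<open>k\<close> makes it strictly increasing.\<close>
    define r where "r k = (\<Sum>i\<le>k. N i) + k" for k
    have r: "strict_mono r" by (rule strict_monoI_Suc) (simp add: r_def)
    have rN: "r k \<ge> N k" for k unfolding r_def by (intro trans_le_add1 member_le_sum) auto
    define d where "d n = \<sigma> (r (Suc n)) - \<sigma> (r n)" for n
    have "nrm X (d n) \<le> (1/2)^n" for n
      unfolding d_def
      using N[of n "r (Suc n)" "r n"] rN[of n] strict_mono_less_eq[OF r, of n "Suc n"] by auto
    then obtain s where s: "nsums X d s" using conv[of d] mem by (auto simp: d_def)
    have "nlim X (\<lambda>n. sum d {..<n} + \<sigma> (r 0)) (s + \<sigma> (r 0))"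
      using s mem by (intro nlim_add nlim_const nsumsD(3))
    moreover have "sum d {..<n} = \<sigma> (r n) - \<sigma> (r 0)" for n
      by (induction n) (simp_all add: d_def)
    ultimately have "nlim X (\<sigma> \<circ> r) (s + \<sigma> (r 0))" by (simp add: o_def)
    then have "limitin (ntop X) (\<sigma> \<circ> r) (s + \<sigma> (r 0)) sequentially" by (rule nlim_limitin)
    then show "\<exists>x. limitin Met.mtopology \<sigma> x sequentially"
      using Met.MCauchy_convergent_subsequence[OF c r] by (auto simp: ntop_def)
  qed
  then show ?thesis using X by (simp add: banach_sp_def)
qed

lemma banach_nsums:
  assumes X: "banach_sp X" and f: "\<And>n. f n \<in> carr X" and s: "(\<Sum>n. ennreal (nrm X (f n))) < \<infinity>"
  shows "\<exists>x. nsums X f x"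
proof -
  interpret nsp X using X by (intro nsp.intro) (simp add: banach_sp_def)
  have sm: "summable (\<lambda>n. nrm X (f n))"
    using s f by (intro summable_suminf_not_top) auto
  have "Met.MCauchy (\<lambda>n. sum f {..<n})"
    unfolding Met.MCauchy_def
  proof (intro conjI allI impI)
    fix e :: real assume "0 < e"
    then obtain N where N: "\<And>m n. m \<ge> N \<Longrightarrow> norm (sum (\<lambda>n. nrm X (f n)) {m..<n}) < e"
      using sm unfolding summable_Cauchy by metis
    have *: "nrm X (sum f {..<n} - sum f {..<m}) < e" if "N \<le> m" "m \<le> n" for m n
    proof -
      have "sum f {..<n} - sum f {..<m} = sum f {m..<n}"
        using that by (simp add: lessThan_atLeast0 sum_diff_nat_ivl)
      then have "nrm X (sum f {..<n} - sum f {..<m}) \<le> sum (\<lambda>n. nrm X (f n)) {m..<n}"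
        by (simp add: nrm_sum_le f)
      then show ?thesis using N[OF that(1), of n] by simp
    qed
    show "\<exists>N. \<forall>n n'. N \<le> n \<longrightarrow> N \<le> n' \<longrightarrow> ndist X (sum f {..<n}) (sum f {..<n'}) < e"
    proof (intro exI[of _ N] allI impI)
      fix n n' assume "N \<le> n" "N \<le> n'"
      then show "ndist X (sum f {..<n}) (sum f {..<n'}) < e"
        using *[of n n'] *[of n' n] nrm_commute[of "sum f {..<n}" "sum f {..<n'}"] f
        by (cases "n \<le> n'") (auto simp: ndist_def sum_mem)
    qed
  qed (use f in auto)
  moreover have "Met.mcomplete" using X by (simp add: banach_sp_def)
  ultimately obtain x where "limitin (ntop X) (\<lambda>n. sum f {..<n}) x sequentially"
    unfolding Met.mcomplete_def ntop_def by blast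
  then have "nlim X (\<lambda>n. sum f {..<n}) x"
    by (subst nlim_iff_limitin) (use f in auto)
  then show ?thesis using f by (auto simp: nsums_def)
qed

section \<open>Intersection and sum of a compatible couple\<close>

lemma linear_btwD:
  assumes "linear_btw X Y L" "x \<in> carr X"
  shows "L x \<in> carr Y" "y \<in> carr X \<Longrightarrow> L (x + y) = L x + L y" "L (c *\<^sub>R x) = c *\<^sub>R L x"
  using assms by (auto simp: linear_btw_def)

lemma linear_btw_sum:
  assumes X: "normed_sp X" and L: "linear_btw X Y L" and f: "\<And>i. i \<in> I \<Longrightarrow> f i \<in> carr X"
  shows "L (sum f I) = (\<Sum>i\<in>I. L (f i))"
proof -
  interpret nsp X by standard (rule X)
  have "L 0 = 0" using linear_btwD(3)[OF L zero_mem, of 0] by simp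
  with f show ?thesis
    by (induction I rule: infinite_finite_induct) (auto simp: linear_btwD(2)[OF L])
qed

lemma linear_btw_diff:
  assumes X: "normed_sp X" and L: "linear_btw X Y L" and "x \<in> carr X" "y \<in> carr X"
  shows "L (x - y) = L x - L y"
proof -
  interpret nsp X by standard (rule X)
  show ?thesis using linear_btwD(2)[OF L, of "x - y" y] assms by simp
qed

lemma nlim_map:
  assumes X: "normed_sp X" and Y: "normed_sp Y" and L: "linear_btw X Y L"
    and bd: "\<And>x. x \<in> carr X \<Longrightarrow> nrm Y (L x) \<le> K * nrm X x" and f: "nlim X f x"
  shows "nlim Y (\<lambda>i. L (f i)) (L x)"
proof -
  interpret X: nsp X by standard (rule X)
  interpret Y: nsp Y by standard (rule Y)
  have fc: "f i \<in> carr X" "x \<in> carr X" for i using f by (auto simp: nlim_def)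
  show ?thesis
  proof (rule Y.nlimI_le)
    show "nrm Y (L (f n) - L x) \<le> K * nrm X (f n - x)" for n
      using bd[of "f n - x"] fc linear_btw_diff[OF X L, of "f n" x] by simp
    show "(\<lambda>n. K * nrm X (f n - x)) \<longlonglongrightarrow> 0"
      using f tendsto_mult_right_zero by (auto simp: nlim_def)
  qed (use fc linear_btwD(1)[OF L] in auto)
qed

lemma nsums_map:
  assumes X: "normed_sp X" and Y: "normed_sp Y" and L: "linear_btw X Y L"
    and bd: "\<And>x. x \<in> carr X \<Longrightarrow> nrm Y (L x) \<le> K * nrm X x" and f: "nsums X f x"
  shows "nsums Y (\<lambda>i. L (f i)) (L x)"
proof -
  have "L (sum f {..<n}) = (\<Sum>i<n. L (f i))" for n
    by (intro linear_btw_sum[OF X L] nsumsD(1)[OF f])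
  then show ?thesis
    using nlim_map[OF X Y L bd nsumsD(3)[OF f]] nsumsD(1)[OF f] linear_btwD(1)[OF L]
    by (simp add: nsums_def)
qed

context nsp
begin

lemma nlim_sum: "(\<And>i. i \<in> I \<Longrightarrow> nlim X (f i) (x i)) \<Longrightarrow> nlim X (\<lambda>n. \<Sum>i\<in>I. f i n) (\<Sum>i\<in>I. x i)"
  by (induction I rule: infinite_finite_induct) (auto intro: nlim_add nlim_const)

text \<open>Fubini for series. Beyond a large index the terms of the enumeration have total norm at
  most \<open>t < d/2\<close>. A rectangle of pairs that contains all earlier ones differs from the
  initial partial sum only by such terms. The row sums are supplied by the caller, who may have
  found them in a smaller space.\<close>

lemma nsums_rows:
  fixes e :: "nat \<Rightarrow> nat \<times> nat"
  assumes e: "bij e" and z: "nsums X (\<lambda>i. f (e i)) z"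
    and fin: "(\<Sum>i. ennreal (nrm X (f (e i)))) < \<infinity>"
    and r: "\<And>n. nsums X (\<lambda>m. f (n, m)) (r n)"
  shows "nsums X r z"
proof -
  have fc: "f p \<in> carr X" for p using nsumsD(1)[OF r, of "fst p" "snd p"] by simp
  have rc: "r n \<in> carr X" for n using nsumsD(2)[OF r] .
  have zc: "z \<in> carr X" using nsumsD(2)[OF z] .
  define g where "g i = nrm X (f (e i))" for i
  have g0: "0 \<le> g i" for i using fc by (simp add: g_def)
  have sm: "summable g"
    using fin g0 by (intro summable_suminf_not_top) (auto simp: g_def)
  have "(\<lambda>N. nrm X (sum r {..<N} - z)) \<longlonglongrightarrow> 0"
  proof (rule LIMSEQ_I)
    fix d :: real assume d: "0 < d"
    obtain I where I: "norm (\<Sum>i. g (i + I)) < d / 2"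
      using suminf_exist_split[OF _ sm, of "d/2"] d by auto
    define t where "t = (\<Sum>i. g (i + I))"
    have smI: "summable (\<lambda>i. g (i + I))" using sm by (simp add: summable_iff_shift)
    have t: "0 \<le> t" "t < d / 2" using I suminf_nonneg[OF smI] g0 by (auto simp: t_def)
    have "ennreal (nrm X (z - (\<Sum>i<I. f (e i)))) \<le> ennreal t"
      using nsums_tail[OF z, of I] smI g0 unfolding t_def
      by (subst suminf_ennreal2[symmetric]) (auto simp: g_def)
    then have tl: "nrm X ((\<Sum>i<I. f (e i)) - z) \<le> t"
      using t nrm_commute[of z] zc fc by (simp add: ennreal_le_iff)
    \<comment> \<open>The rectangle \<open>{..<N0} x {..<M0}\<close> contains the first
      \<open>I\<close> pairs of the enumeration.\<close>
    define N0 where "N0 = Suc (Max ((\<lambda>i. fst (e i)) ` {..<Suc I}))"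
    define M0 where "M0 = Suc (Max ((\<lambda>i. snd (e i)) ` {..<Suc I}))"
    have NM: "fst (e i) < N0" "snd (e i) < M0" if "i < I" for i
      using that unfolding N0_def M0_def by (auto intro!: le_imp_less_Suc Max_ge)
    have "nrm X (sum r {..<N} - z) < d" if N: "N \<ge> N0" for N
    proof -
      define h where "h M = (\<Sum>n<N. \<Sum>m<M. f (n, m))" for M
      have h: "nlim X h (sum r {..<N})"
        unfolding h_def by (intro nlim_sum nsumsD(3) r)
      have hb: "nrm X (h (M + M0) - z) \<le> 2 * t" for M
      proof -
        define P where "P = {..<N} \<times> {..<M + M0}"
        have sub: "e ` {..<I} \<subseteq> P" using NM N by (fastforce simp: P_def mem_Times_iff)
        have finP: "finite P" by (simp add: P_def)
        define K where "K = e -` (P - e ` {..<I})"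
        have inj: "inj e" using e by (simp add: bij_is_inj)
        have eK: "e ` K = P - e ` {..<I}" unfolding K_def using e by (simp add: bij_is_surj)
        have finK: "finite K" unfolding K_def using finP inj by (intro finite_vimageI) auto
        have KI: "K \<subseteq> {I..}" unfolding K_def
          by (metis DiffD2 atLeast_iff imageI lessThan_iff not_less subsetI vimageD)
        have "h (M + M0) = sum f P" unfolding h_def P_def by (simp add: sum.cartesian_product)
        also have "\<dots> = sum f (e ` {..<I}) + sum f (e ` K)"
          unfolding eK using sum.subset_diff[OF sub finP, of f] by (simp add: add.commute)
        also have "\<dots> = (\<Sum>i<I. f (e i)) + (\<Sum>i\<in>K. f (e i))"
          by (simp add: sum.reindex inj_on_subset[OF inj])
        finally have hh: "h (M + M0) - z = ((\<Sum>i<I. f (e i)) - z) + (\<Sum>i\<in>K. f (e i))" by simp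
        have "nrm X (\<Sum>i\<in>K. f (e i)) \<le> (\<Sum>i\<in>K. g i)"
          unfolding g_def by (rule nrm_sum_le) (rule fc)
        also have "\<dots> = (\<Sum>j\<in>(\<lambda>i. i - I) ` K. g (j + I))"
        proof (subst sum.reindex)
          show "inj_on (\<lambda>i. i - I) K"
            using KI by (intro inj_onI) (metis atLeast_iff eq_diff_iff subsetD)
        qed (use KI in \<open>auto intro!: sum.cong\<close>)
        also have "\<dots> \<le> t" unfolding t_def
          using smI g0 finK by (intro sum_le_suminf) auto
        finally have "nrm X (\<Sum>i\<in>K. f (e i)) \<le> t" .
        then show ?thesis
          unfolding hh using nrm_triangle[of "(\<Sum>i<I. f (e i)) - z" "\<Sum>i\<in>K. f (e i)"] tl fc zc by simp
      qed
      have "nlim X (\<lambda>M. h (M + M0) + (- z)) (sum r {..<N} + (- z))"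
        using nlim_subseq[OF h, of "\<lambda>M. M + M0"] zc
        by (intro nlim_add nlim_const) (auto simp: strict_mono_def)
      then have "nrm X (sum r {..<N} + (- z)) \<le> 2 * t"
        by (rule nlim_seminorm_le[where C = 1]) (use hb in \<open>auto intro: nrm_triangle\<close>)
      then show ?thesis using t by simp
    qed
    then show "\<exists>no. \<forall>N\<ge>no. norm (nrm X (sum r {..<N} - z) - 0) < d"
      using rc zc by (auto intro!: exI[of _ N0])
  qed
  then show ?thesis using rc zc by (simp add: nsums_def nlim_def)
qed

text \<open>Allows a normed space into which both members of a couple embed to serve as the ambient
  space of that couple; \<open>compatible_fspace\<close> uses it so.\<close>

lemma hausdorff_tvs_ntop: "hausdorff_tvs (ntop X)"
  unfolding hausdorff_tvs_def
proof (intro conjI)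
  have top: "topspace (ntop X) = carr X" by (simp add: ntop_def)
  show "subspace (topspace (ntop X))" by (simp add: top subsp)
  show "Hausdorff_space (ntop X)" by (simp add: ntop_def Met.Hausdorff_space_mtopology)
  have ball: "y \<in> Met.mball x r \<longleftrightarrow> x \<in> carr X \<and> y \<in> carr X \<and> nrm X (x - y) < r" for x y r
    by (auto simp: Met.in_mball ndist_def)
  show "continuous_map (prod_topology (ntop X) (ntop X)) (ntop X) (\<lambda>(x, y). x + y)"
    unfolding ntop_def[of X] Met.continuous_map_to_metric
  proof (intro ballI allI impI)
    fix p and r :: real assume p: "p \<in> topspace (prod_topology Met.mtopology Met.mtopology)" and r: "0 < r"
    then obtain x y where pxy: "p = (x, y)" and *: "x \<in> carr X" "y \<in> carr X" "0 < r" by auto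
    let ?U = "Met.mball x (r/2) \<times> Met.mball y (r/2)"
    have "openin (prod_topology Met.mtopology Met.mtopology) ?U"
      by (simp add: openin_prod_Times_iff)
    moreover have "(x, y) \<in> ?U" using * by (simp add: ball)
    moreover have "nrm X (x + y - (a + b)) < r" if "(a, b) \<in> ?U" for a b
      using nrm_triangle[of "x - a" "y - b"] that * by (auto simp: ball ndist_def algebra_simps)
    ultimately show "\<exists>U. openin (prod_topology Met.mtopology Met.mtopology) U \<and>
        p \<in> U \<and> (\<forall>z\<in>U. (case z of (a, b) \<Rightarrow> a + b) \<in> Met.mball (case p of (a, b) \<Rightarrow> a + b) r)"
      using * by (intro exI[of _ ?U]) (auto simp: ball ndist_def pxy)
  qed
  show "continuous_map (prod_topology euclidean (ntop X)) (ntop X) (\<lambda>(c, x). c *\<^sub>R x)"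
    unfolding ntop_def[of X] Met.continuous_map_to_metric
  proof (intro ballI allI impI)
    fix p :: "real \<times> 'v" and r :: real
    assume p: "p \<in> topspace (prod_topology euclidean Met.mtopology)" and r: "0 < r"
    then obtain c x where pcx: "p = (c, x)" and *: "x \<in> carr X" "0 < r" by auto
    \<comment> \<open>Taken from \<open>c x - b y = (c - b) x + b (x - y)\<close> with
      \<open>|b| <= |c| + 1\<close>: both terms together stay below
      \<open>d * (nrm X x + |c| + 1) <= r / 2\<close>.\<close>
    define d where "d = min 1 (r / (2 * (nrm X x + \<bar>c\<bar> + 1)))"
    have n0: "0 \<le> nrm X x" using * by simp
    have pos: "0 < nrm X x + \<bar>c\<bar> + 1" using n0 by (intro add_nonneg_pos) auto
    have d: "0 < d" "d \<le> 1" using divide_pos_pos[OF *(2), of "2 * (nrm X x + \<bar>c\<bar> + 1)"] pos by (auto simp: d_def)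
    have "d * (nrm X x + \<bar>c\<bar> + 1) \<le> r / (2 * (nrm X x + \<bar>c\<bar> + 1)) * (nrm X x + \<bar>c\<bar> + 1)"
      unfolding d_def using n0 by (intro mult_right_mono) auto
    also have "\<dots> = r / 2" using n0 by (simp add: field_simps)
    finally have dr: "d * (nrm X x + \<bar>c\<bar> + 1) \<le> r / 2" .
    let ?U = "ball c d \<times> Met.mball x d"
    have "openin (prod_topology euclidean Met.mtopology) ?U"
      by (simp add: openin_prod_Times_iff)
    moreover have "(c, x) \<in> ?U" using * d by (simp add: ball)
    moreover have "nrm X (c *\<^sub>R x - b *\<^sub>R y) < r" if "(b, y) \<in> ?U" for b y
    proof -
      have bb: "\<bar>c - b\<bar> < d" "y \<in> carr X" "nrm X (x - y) < d"
        using that * by (auto simp: ball ndist_def dist_real_def)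
      have "c *\<^sub>R x - b *\<^sub>R y = (c - b) *\<^sub>R x + b *\<^sub>R (x - y)" by (simp add: algebra_simps)
      then have "nrm X (c *\<^sub>R x - b *\<^sub>R y) \<le> \<bar>c - b\<bar> * nrm X x + \<bar>b\<bar> * nrm X (x - y)"
        using nrm_triangle[of "(c - b) *\<^sub>R x" "b *\<^sub>R (x - y)"] * bb by (simp add: nrm_scale)
      also have "\<dots> \<le> d * nrm X x + (\<bar>c\<bar> + 1) * d"
        using bb d n0 * by (intro add_mono mult_mono) auto
      also have "\<dots> = d * (nrm X x + \<bar>c\<bar> + 1)" by (simp add: algebra_simps)
      finally show ?thesis using dr * by simp
    qed
    ultimately show "\<exists>U. openin (prod_topology euclidean Met.mtopology) U \<and>
        p \<in> U \<and> (\<forall>z\<in>U. (case z of (a, b) \<Rightarrow> a *\<^sub>R b) \<in> Met.mball (case p of (a, b) \<Rightarrow> a *\<^sub>R b) r)"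
      using * by (intro exI[of _ ?U]) (auto simp: ball ndist_def pcx)
  qed
qed

end

lemma continuous_map_ntop:
  assumes X: "normed_sp X" and Y: "normed_sp Y" and sub: "carr X \<subseteq> carr Y"
    and bd: "\<And>x. x \<in> carr X \<Longrightarrow> nrm Y x \<le> K * nrm X x"
  shows "continuous_map (ntop X) (ntop Y) (\<lambda>x. x)"
proof -
  interpret X: nsp X by standard (rule X)
  interpret Y: nsp Y by standard (rule Y)
  show ?thesis
    unfolding ntop_def X.Met.metric_continuous_map[OF Y.metric]
  proof (intro conjI ballI allI impI)
    fix a and e :: real assume a: "a \<in> carr X" and e: "0 < e"
    show "\<exists>\<delta>>0. \<forall>x. x \<in> carr X \<and> ndist X a x < \<delta> \<longrightarrow> ndist Y a x < e"
    proof (intro exI[of _ "e / (\<bar>K\<bar> + 1)"] conjI allI impI)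
      fix x assume x: "x \<in> carr X \<and> ndist X a x < e / (\<bar>K\<bar> + 1)"
      have "nrm Y (a - x) \<le> K * nrm X (a - x)" using x a by (intro bd) simp
      also have "\<dots> \<le> (\<bar>K\<bar> + 1) * nrm X (a - x)" using x a by (intro mult_right_mono) auto
      also have "\<dots> < e" using conjunct2[OF x] conjunct1[OF x] a
        by (simp add: ndist_def pos_less_divide_eq add_nonneg_pos mult.commute)
      finally show "ndist Y a x < e" using conjunct1[OF x] a sub by (auto simp: ndist_def)
    qed (use e in auto)
  qed (use sub in auto)
qed

locale couple =
  fixes X :: "'v::real_vector couple"
  assumes compat: "compatible_couple X"
begin

lemma banach0: "banach_sp (fst X)" and banach1: "banach_sp (snd X)"
  using compat by (auto simp: compatible_couple_def)

sublocale X0: nsp "fst X" using banach0 by (intro nsp.intro) (simp add: banach_sp_def)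
sublocale X1: nsp "snd X" using banach1 by (intro nsp.intro) (simp add: banach_sp_def)

text \<open>Both sequences tend to 0 in the common Hausdorff topology, hence so does the constant
  sequence \<open>x\<close>. Definiteness of the norm of the sum and completeness of the
  intersection rest on this.\<close>

lemma compat_zero:
  assumes f: "nlim (fst X) f 0" and g: "nlim (snd X) g 0" and x: "\<And>n. f n + g n = x"
  shows "x = 0"
proof -
  obtain \<tau> where t: "hausdorff_tvs \<tau>" "continuous_map (ntop (fst X)) \<tau> (\<lambda>x. x)"
    "continuous_map (ntop (snd X)) \<tau> (\<lambda>x. x)"
    using compat by (auto simp: compatible_couple_def)
  have lf: "limitin \<tau> f 0 sequentially"
    using continuous_map_limit[OF t(2) X0.nlim_limitin[OF f]] by (simp add: o_def)
  have lg: "limitin \<tau> g 0 sequentially"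
    using continuous_map_limit[OF t(3) X1.nlim_limitin[OF g]] by (simp add: o_def)
  have "limitin (prod_topology \<tau> \<tau>) (\<lambda>n. (f n, g n)) (0, 0) sequentially"
    using lf lg by (simp add: limitin_pairwise o_def)
  then have "limitin \<tau> ((\<lambda>(x, y). x + y) \<circ> (\<lambda>n. (f n, g n))) ((\<lambda>(x, y). x + y) (0, 0)) sequentially"
    using t(1) by (intro continuous_map_limit) (auto simp: hausdorff_tvs_def)
  then have "limitin \<tau> (\<lambda>n. x) 0 sequentially" by (simp add: o_def x)
  moreover have "x \<in> topspace \<tau>"
  proof -
    have "f 0 \<in> topspace \<tau>" "g 0 \<in> topspace \<tau>"
      using f g t(2,3) continuous_map_image_subset_topspace[OF t(2)] continuous_map_image_subset_topspace[OF t(3)]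
      by (auto simp: nlim_def ntop_def)
    then show ?thesis using t(1) x[of 0] by (auto simp: hausdorff_tvs_def dest: subspace_add)
  qed
  then have "limitin \<tau> (\<lambda>n. x) x sequentially" by simp
  ultimately show ?thesis
    using t(1) limitin_Hausdorff_unique[of \<tau> "\<lambda>n. x" x sequentially 0] by (simp add: hausdorff_tvs_def)
qed

lemma compat_lim_unique:
  assumes "nlim (fst X) f x" "nlim (snd X) f y" shows "x = y"
proof -
  have "nlim (fst X) (\<lambda>n. f n + (- x)) (x + (- x))"
    using assms by (intro X0.nlim_add X0.nlim_const) (auto simp: nlim_def)
  moreover have "nlim (snd X) (\<lambda>n. (-1) *\<^sub>R f n + y) ((-1) *\<^sub>R y + y)"
    using assms by (intro X1.nlim_add X1.nlim_const X1.nlim_scale) (auto simp: nlim_def)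
  ultimately have "y - x = 0"
    by (intro compat_zero[of "\<lambda>n. f n + (- x)" "\<lambda>n. (-1) *\<^sub>R f n + y"]) auto
  then show ?thesis by simp
qed

lemma carr_inter [simp]: "x \<in> carr (inter_sp X) \<longleftrightarrow> x \<in> carr (fst X) \<and> x \<in> carr (snd X)"
  by (simp add: inter_sp_def)

lemma nrm_inter: "nrm (inter_sp X) x = max (nrm (fst X) x) (nrm (snd X) x)"
  by (simp add: inter_sp_def)

lemma normed_inter: "normed_sp (inter_sp X)"
  unfolding normed_sp_def nrm_inter
proof (intro conjI ballI allI)
  show "subspace (carr (inter_sp X))" by (auto simp: subspace_def)
  show "max (nrm (fst X) (c *\<^sub>R x)) (nrm (snd X) (c *\<^sub>R x)) = \<bar>c\<bar> * max (nrm (fst X) x) (nrm (snd X) x)"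
    if "x \<in> carr (inter_sp X)" for x c
    using that by (simp add: X0.nrm_scale X1.nrm_scale max_mult_distrib_left)
  show "max (nrm (fst X) x) (nrm (snd X) x) = 0 \<longleftrightarrow> x = 0" if "x \<in> carr (inter_sp X)" for x
    using that X0.nrm_eq0[of x] X1.nrm_eq0[of x] X0.nrm_ge0[of x] X1.nrm_ge0[of x] by (auto simp: max_def)
  show "max (nrm (fst X) (x + y)) (nrm (snd X) (x + y)) \<le> max (nrm (fst X) x) (nrm (snd X) x) + max (nrm (fst X) y) (nrm (snd X) y)"
    if "x \<in> carr (inter_sp X)" "y \<in> carr (inter_sp X)" for x y
    using that X0.nrm_triangle[of x y] X1.nrm_triangle[of x y] by auto
qed (auto simp: le_max_iff_disj)

sublocale I: nsp "inter_sp X" by standard (rule normed_inter)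

lemma carr_sum: "x \<in> carr (sum_sp X) \<longleftrightarrow> (\<exists>x0\<in>carr (fst X). \<exists>x1\<in>carr (snd X). x = x0 + x1)"
  by (auto simp: sum_sp_def)

lemma mem_sum: "x0 \<in> carr (fst X) \<Longrightarrow> x1 \<in> carr (snd X) \<Longrightarrow> x0 + x1 \<in> carr (sum_sp X)"
  by (auto simp: carr_sum)

lemma mem_sum0 [simp]: "x \<in> carr (fst X) \<Longrightarrow> x \<in> carr (sum_sp X)"
  using mem_sum[of x 0] by simp

lemma mem_sum1 [simp]: "x \<in> carr (snd X) \<Longrightarrow> x \<in> carr (sum_sp X)"
  using mem_sum[of 0 x] by simp

lemma nrm_sum_bdd: "bdd_below {nrm (fst X) x0 + nrm (snd X) x1 | x0 x1.
    x0 \<in> carr (fst X) \<and> x1 \<in> carr (snd X) \<and> x = x0 + x1}"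
  by (rule bdd_belowI[of _ 0]) auto

lemma nrm_sum_split:
  assumes "x0 \<in> carr (fst X)" "x1 \<in> carr (snd X)"
  shows "nrm (sum_sp X) (x0 + x1) \<le> nrm (fst X) x0 + nrm (snd X) x1"
  unfolding sum_sp_def using assms nrm_sum_bdd by (auto intro!: cInf_lower)

lemma nrm_sum_le0: "x \<in> carr (fst X) \<Longrightarrow> nrm (sum_sp X) x \<le> nrm (fst X) x"
  using nrm_sum_split[of x 0] by simp

lemma nrm_sum_le1: "x \<in> carr (snd X) \<Longrightarrow> nrm (sum_sp X) x \<le> nrm (snd X) x"
  using nrm_sum_split[of 0 x] by simp

lemma nrm_sum_approx:
  assumes "x \<in> carr (sum_sp X)" "nrm (sum_sp X) x < e"
  obtains x0 x1 where "x0 \<in> carr (fst X)" "x1 \<in> carr (snd X)" "x = x0 + x1"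
    "nrm (fst X) x0 + nrm (snd X) x1 < e"
proof -
  let ?S = "{nrm (fst X) x0 + nrm (snd X) x1 | x0 x1. x0 \<in> carr (fst X) \<and> x1 \<in> carr (snd X) \<and> x = x0 + x1}"
  have ne: "?S \<noteq> {}" using assms(1) by (auto simp: carr_sum)
  have lt: "Inf ?S < e" using assms(2) by (simp add: sum_sp_def)
  obtain y where y: "y \<in> ?S" "y < e" by (rule bexE[OF cInf_lessD[OF ne lt]])
  from y(1) show ?thesis by safe (rule that, use y(2) in simp_all)
qed

lemma nrm_sum_nonneg: assumes "x \<in> carr (sum_sp X)" shows "0 \<le> nrm (sum_sp X) x"
proof -
  have "{nrm (fst X) x0 + nrm (snd X) x1 | x0 x1. x0 \<in> carr (fst X) \<and> x1 \<in> carr (snd X) \<and> x = x0 + x1} \<noteq> {}"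
    using assms by (auto simp: carr_sum)
  then show ?thesis unfolding sum_sp_def by (auto intro!: cInf_greatest)
qed

lemma nrm_sum_scale_le:
  assumes x: "x \<in> carr (sum_sp X)"
  shows "nrm (sum_sp X) (c *\<^sub>R x) \<le> \<bar>c\<bar> * nrm (sum_sp X) x"
proof (rule field_le_epsilon)
  fix e :: real assume e: "0 < e"
  obtain x0 x1 where *: "x0 \<in> carr (fst X)" "x1 \<in> carr (snd X)" "x = x0 + x1"
    "nrm (fst X) x0 + nrm (snd X) x1 < nrm (sum_sp X) x + e / (\<bar>c\<bar> + 1)"
    using nrm_sum_approx[OF x, of "nrm (sum_sp X) x + e / (\<bar>c\<bar> + 1)"] e by auto
  have "nrm (sum_sp X) (c *\<^sub>R x) \<le> \<bar>c\<bar> * (nrm (fst X) x0 + nrm (snd X) x1)"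
    using nrm_sum_split[of "c *\<^sub>R x0" "c *\<^sub>R x1"] * X0.nrm_scale X1.nrm_scale by (simp add: algebra_simps)
  also have "\<dots> \<le> \<bar>c\<bar> * (nrm (sum_sp X) x + e / (\<bar>c\<bar> + 1))" using * by (intro mult_left_mono) auto
  also have "\<dots> \<le> \<bar>c\<bar> * nrm (sum_sp X) x + e" using e by (simp add: field_simps)
  finally show "nrm (sum_sp X) (c *\<^sub>R x) \<le> \<bar>c\<bar> * nrm (sum_sp X) x + e" .
qed

lemma normed_sum: "normed_sp (sum_sp X)"
  unfolding normed_sp_def
proof (intro conjI ballI allI)
  show sub: "subspace (carr (sum_sp X))"
    unfolding subspace_def
  proof (intro conjI ballI allI)
    show "0 \<in> carr (sum_sp X)" by simp
    show "x + y \<in> carr (sum_sp X)" if xy: "x \<in> carr (sum_sp X)" "y \<in> carr (sum_sp X)" for x y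
    proof -
      obtain x0 x1 y0 y1 where "x0 \<in> carr (fst X)" "x1 \<in> carr (snd X)" "x = x0 + x1"
        "y0 \<in> carr (fst X)" "y1 \<in> carr (snd X)" "y = y0 + y1" using xy by (auto simp: carr_sum)
      then show ?thesis using mem_sum[of "x0 + y0" "x1 + y1"] by (simp add: algebra_simps)
    qed
    show "c *\<^sub>R x \<in> carr (sum_sp X)" if xx: "x \<in> carr (sum_sp X)" for x c
    proof -
      obtain x0 x1 where "x0 \<in> carr (fst X)" "x1 \<in> carr (snd X)" "x = x0 + x1" using xx by (auto simp: carr_sum)
      then show ?thesis using mem_sum[of "c *\<^sub>R x0" "c *\<^sub>R x1"] by (simp add: algebra_simps)
    qed
  qed
  show "0 \<le> nrm (sum_sp X) x" if "x \<in> carr (sum_sp X)" for x using nrm_sum_nonneg that .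
  show "nrm (sum_sp X) (c *\<^sub>R x) = \<bar>c\<bar> * nrm (sum_sp X) x" if x: "x \<in> carr (sum_sp X)" for x c
  proof (cases "c = 0")
    case True
    then show ?thesis using nrm_sum_le0[of 0] nrm_sum_nonneg[of 0] by simp
  next
    case False
    have "c *\<^sub>R x \<in> carr (sum_sp X)" using sub x by (auto dest: subspace_scale)
    then have "nrm (sum_sp X) x \<le> \<bar>1 / c\<bar> * nrm (sum_sp X) (c *\<^sub>R x)"
      using nrm_sum_scale_le[of "c *\<^sub>R x" "1 / c"] False by simp
    then have "\<bar>c\<bar> * nrm (sum_sp X) x \<le> nrm (sum_sp X) (c *\<^sub>R x)"
      using False by (simp add: field_simps)
    then show ?thesis using nrm_sum_scale_le[OF x, of c] by simp
  qed
  show "nrm (sum_sp X) (x + y) \<le> nrm (sum_sp X) x + nrm (sum_sp X) y"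
    if xy: "x \<in> carr (sum_sp X)" "y \<in> carr (sum_sp X)" for x y
  proof (rule field_le_epsilon)
    fix e :: real assume e: "0 < e"
    obtain x0 x1 where x: "x0 \<in> carr (fst X)" "x1 \<in> carr (snd X)" "x = x0 + x1"
      "nrm (fst X) x0 + nrm (snd X) x1 < nrm (sum_sp X) x + e/2"
      using nrm_sum_approx[OF xy(1), of "nrm (sum_sp X) x + e/2"] e by auto
    obtain y0 y1 where y: "y0 \<in> carr (fst X)" "y1 \<in> carr (snd X)" "y = y0 + y1"
      "nrm (fst X) y0 + nrm (snd X) y1 < nrm (sum_sp X) y + e/2"
      using nrm_sum_approx[OF xy(2), of "nrm (sum_sp X) y + e/2"] e by auto
    have "nrm (sum_sp X) (x + y) \<le> nrm (fst X) (x0 + y0) + nrm (snd X) (x1 + y1)"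
      using nrm_sum_split[of "x0 + y0" "x1 + y1"] x y by (simp add: algebra_simps)
    also have "\<dots> \<le> nrm (fst X) x0 + nrm (fst X) y0 + (nrm (snd X) x1 + nrm (snd X) y1)"
      using x y by (intro add_mono X0.nrm_triangle X1.nrm_triangle)
    finally show "nrm (sum_sp X) (x + y) \<le> nrm (sum_sp X) x + nrm (sum_sp X) y + e"
      using x y by simp
  qed
  show "nrm (sum_sp X) x = 0 \<longleftrightarrow> x = 0" if x: "x \<in> carr (sum_sp X)" for x
  proof
    assume 0: "nrm (sum_sp X) x = 0"
    \<comment> \<open>A vanishing infimum gives decompositions of \<open>x\<close> both of whose
      parts tend to 0, which is the situation of \<open>compat_zero\<close>.\<close>
    have "\<exists>x0 x1. x0 \<in> carr (fst X) \<and> x1 \<in> carr (snd X) \<and> x = x0 + x1 \<and>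
       nrm (fst X) x0 + nrm (snd X) x1 < inverse (real (Suc n))" for n
      using nrm_sum_approx[OF x, of "inverse (real (Suc n))"] 0
      by (metis inverse_positive_iff_positive of_nat_0_less_iff zero_less_Suc)
    then obtain x0 x1 where *: "\<And>n. x0 n \<in> carr (fst X)" "\<And>n. x1 n \<in> carr (snd X)" "\<And>n. x = x0 n + x1 n"
       "\<And>n. nrm (fst X) (x0 n) + nrm (snd X) (x1 n) < inverse (real (Suc n))" by metis
    have b: "nrm (fst X) (x0 n) \<le> inverse (real (Suc n))" "nrm (snd X) (x1 n) \<le> inverse (real (Suc n))" for n
      using *(4)[of n] X0.nrm_ge0[OF *(1), of n] X1.nrm_ge0[OF *(2), of n] by auto
    have "nlim (fst X) x0 0" "nlim (snd X) x1 0"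
      using * b LIMSEQ_inverse_real_of_nat
      by (auto intro!: X0.nlimI_le[where g = "\<lambda>n. inverse (real (Suc n))"] X1.nlimI_le[where g = "\<lambda>n. inverse (real (Suc n))"])
    then show "x = 0" using compat_zero[of x0 x1 x] *(3) by simp
  next
    assume "x = 0"
    then show "nrm (sum_sp X) x = 0" using nrm_sum_le0[of 0] nrm_sum_nonneg[of 0] by simp
  qed
qed

sublocale S: nsp "sum_sp X" by standard (rule normed_sum)

lemma linear_id: "carr Y \<subseteq> carr Z \<Longrightarrow> linear_btw Y Z (\<lambda>x. x)"
  by (auto simp: linear_btw_def)

lemma nsums_sum0: "nsums (fst X) f x \<Longrightarrow> nsums (sum_sp X) f x"
  by (rule nsums_map[OF X0.normed normed_sum linear_id, where K = 1]) (auto simp: nrm_sum_le0)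

lemma nsums_sum1: "nsums (snd X) f x \<Longrightarrow> nsums (sum_sp X) f x"
  by (rule nsums_map[OF X1.normed normed_sum linear_id, where K = 1]) (auto simp: nrm_sum_le1)

lemma nsums_inter0: "nsums (inter_sp X) f x \<Longrightarrow> nsums (fst X) f x"
  by (rule nsums_map[OF normed_inter X0.normed linear_id, where K = 1]) (auto simp: nrm_inter)

text \<open>The series converges in each end point space separately; compatibility makes the two
  sums equal.\<close>

lemma banach_inter: "banach_sp (inter_sp X)"
proof (rule banach_spI[OF normed_inter])
  fix d assume d: "\<And>n. d n \<in> carr (inter_sp X)" "\<And>n. nrm (inter_sp X) (d n) \<le> (1/2)^n"
  have *: "nrm (fst X) (d n) \<le> (1/2)^n" "nrm (snd X) (d n) \<le> (1/2)^n" for n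
    using d(2)[of n] by (auto simp: nrm_inter)
  have half: "(\<Sum>n. ennreal ((1/2)^n)) < \<infinity>"
    by (subst suminf_ennreal2) (auto simp: summable_geometric)
  have "(\<Sum>n. ennreal (nrm (fst X) (d n))) < \<infinity>" "(\<Sum>n. ennreal (nrm (snd X) (d n))) < \<infinity>"
    using * by (intro order.strict_trans1[OF suminf_le half]; simp add: ennreal_leI)+
  then obtain x y where xy: "nsums (fst X) d x" "nsums (snd X) d y"
    using banach_nsums[OF banach0, of d] banach_nsums[OF banach1, of d] d(1) unfolding carr_inter by metis
  then have "x = y" using compat_lim_unique nsumsD(3) by blast
  have lim: "(\<lambda>n. max (nrm (fst X) (sum d {..<n} - x)) (nrm (snd X) (sum d {..<n} - x))) \<longlonglongrightarrow> max 0 0"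
    using xy \<open>x = y\<close> by (intro tendsto_max nsumsD(4)) auto
  then have "nsums (inter_sp X) d x"
    using d xy \<open>x = y\<close> unfolding nsums_def nlim_def nrm_inter by (auto simp: nsums_def nlim_def)
  then show "\<exists>x. nsums (inter_sp X) d x" ..
qed

lemma banach_sum: "banach_sp (sum_sp X)"
proof (rule banach_spI[OF normed_sum])
  fix d assume d: "\<And>n. d n \<in> carr (sum_sp X)" "\<And>n. nrm (sum_sp X) (d n) \<le> (1/2)^n"
  \<comment> \<open>The infimum need not be attained; the factor 2 leaves room for an actual
    decomposition and keeps both series geometric.\<close>
  have "\<exists>x0 x1. x0 \<in> carr (fst X) \<and> x1 \<in> carr (snd X) \<and> d n = x0 + x1 \<and>
       nrm (fst X) x0 + nrm (snd X) x1 < 2 * (1/2)^n" for n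
  proof -
    have "nrm (sum_sp X) (d n) < 2 * (1/2)^n"
      using d(2)[of n] zero_less_power[of "1/2::real" n] by linarith
    then show ?thesis using nrm_sum_approx[OF d(1)] by metis
  qed
  then obtain x0 x1 where *: "\<And>n. x0 n \<in> carr (fst X)" "\<And>n. x1 n \<in> carr (snd X)" "\<And>n. d n = x0 n + x1 n"
       "\<And>n. nrm (fst X) (x0 n) + nrm (snd X) (x1 n) < 2 * (1/2)^n" by metis
  have b: "nrm (fst X) (x0 n) \<le> 2 * (1/2)^n" "nrm (snd X) (x1 n) \<le> 2 * (1/2)^n" for n
    using *(4)[of n] X0.nrm_ge0[OF *(1), of n] X1.nrm_ge0[OF *(2), of n] by auto
  have half: "(\<Sum>n. ennreal (2 * (1/2)^n)) < \<infinity>"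
    by (subst suminf_ennreal2) (auto intro!: summable_mult summable_geometric)
  have "(\<Sum>n. ennreal (nrm (fst X) (x0 n))) < \<infinity>" "(\<Sum>n. ennreal (nrm (snd X) (x1 n))) < \<infinity>"
    using b by (intro order.strict_trans1[OF suminf_le half]; simp add: ennreal_leI)+
  then obtain x y where xy: "nsums (fst X) x0 x" "nsums (snd X) x1 y"
    using banach_nsums[OF banach0, of x0] banach_nsums[OF banach1, of x1] *(1,2) by metis
  then have "nsums (sum_sp X) (\<lambda>n. x0 n + x1 n) (x + y)"
    by (intro S.nsums_add nsums_sum0 nsums_sum1)
  moreover have "d = (\<lambda>n. x0 n + x1 n)" using *(3) by (simp add: fun_eq_iff)
  ultimately show "\<exists>x. nsums (sum_sp X) d x" by auto
qed

end

section \<open>Vector-valued integration through series\<close>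

text \<open>Quantifying over all these functionals lets one series serve
  \<open>J(e^t, .) / max(1, e^t)\<close>, a functional that varies with the point
  \<open>t\<close>.\<close>

definition seminorm_below :: "'v::real_vector nspace \<Rightarrow> ('v \<Rightarrow> real) \<Rightarrow> bool" where
  "seminorm_below X N \<longleftrightarrow> (\<forall>x\<in>carr X. 0 \<le> N x \<and> N x \<le> nrm X x) \<and>
     (\<forall>x\<in>carr X. \<forall>y\<in>carr X. N (x + y) \<le> N x + N y)"

lemma seminorm_belowD:
  assumes "seminorm_below X N" "x \<in> carr X"
  shows "0 \<le> N x" "N x \<le> nrm X x" "y \<in> carr X \<Longrightarrow> N (x + y) \<le> N x + N y"
  using assms by (auto simp: seminorm_below_def)

lemma ennreal_suminf_tail_LIMSEQ:
  fixes g :: "nat \<Rightarrow> ennreal"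
  assumes "(\<Sum>i. g i) < \<infinity>"
  shows "(\<lambda>k. \<Sum>i. g (i + k)) \<longlonglongrightarrow> 0"
proof -
  have P: "(\<lambda>k. sum g {..<k}) \<longlonglongrightarrow> (\<Sum>i. g i)" by (intro summable_LIMSEQ summableI)
  have eq: "(\<Sum>i. g (i + k)) = (\<Sum>i. g i) - sum g {..<k}" for k
  proof -
    have "sum g {..<k} \<le> (\<Sum>i. g i)" by (intro sum_le_suminf summableI) auto
    then have "sum g {..<k} \<noteq> \<infinity>" using assms by (metis infinity_ennreal_def leD)
    moreover have "(\<Sum>i. g i) = sum g {..<k} + (\<Sum>i. g (i + k))"
      by (subst add.commute) (rule suminf_offset[OF summableI])
    ultimately show ?thesis by (simp add: ennreal_add_diff_cancel_left)
  qed
  have "(\<lambda>k. (\<Sum>i. g i) - sum g {..<k}) \<longlonglongrightarrow> (\<Sum>i. g i) - (\<Sum>i. g i)"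
    using assms by (intro tendsto_diff_ennreal_general tendsto_const P) auto
  then show ?thesis using assms by (simp add: eq)
qed

lemma (in nsp) nsums_single:
  assumes "x \<in> carr X" shows "nsums X (\<lambda>p. if p = q then x else 0) x"
proof -
  have "(\<Sum>p<n. if p = q then x else 0) = (if q < n then x else 0)" for n by simp
  moreover have "\<forall>\<^sub>F n in sequentially. nrm X ((if q < n then x else 0) - x) = 0"
    using eventually_gt_at_top[of q] by eventually_elim simp
  ultimately show ?thesis
    using assms by (auto simp: nsums_def nlim_def intro: tendsto_eventually)
qed

text \<open>A functional that is 1-Lipschitz for the norm commutes with the limit of the simple
  functions. The limit exists only almost everywhere, which suffices since Lebesgue measure is
  complete.\<close>

lemma measurable_nrm_comp:
  assumes X: "normed_sp X" and f: "strongly_measurable lebesgue X f"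
    and N: "\<And>x y. x \<in> carr X \<Longrightarrow> y \<in> carr X \<Longrightarrow> \<bar>N x - N y\<bar> \<le> nrm X (x - y)"
  shows "(\<lambda>t. N (f t)) \<in> borel_measurable (lebesgue :: real measure)"
proof -
  interpret nsp X by standard (rule X)
  obtain s where s: "\<And>n. simple_function lebesgue (s n)" "\<And>n t. s n t \<in> carr X"
    "AE t in lebesgue. (\<lambda>n. nrm X (f t - s n t)) \<longlonglongrightarrow> 0" and fc: "\<And>t. f t \<in> carr X"
    using f unfolding strongly_measurable_def by (auto simp: image_subset_iff)
  have "(\<lambda>t. lim (\<lambda>n. N (s n t))) \<in> borel_measurable lebesgue"
    by (intro borel_measurable_lim_metric borel_measurable_simple_function simple_function_compose1[OF s(1), of N])
  moreover have "AE t in lebesgue. lim (\<lambda>n. N (s n t)) = N (f t)"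
    using s(3)
  proof eventually_elim
    case (elim t)
    have "(\<lambda>n. N (s n t) - N (f t)) \<longlonglongrightarrow> 0"
      using N[OF s(2) fc, of _ t t] nrm_commute[OF s(2) fc, of _ t t]
      by (intro Lim_null_comparison[OF _ elim]) (auto simp: abs_minus_commute)
    then show ?case by (intro limI) (simp add: LIM_zero_iff)
  qed
  ultimately show ?thesis by (rule borel_measurable_AE)
qed

lemma (in nsp) nrm_diff_abs_le: "x \<in> carr X \<Longrightarrow> y \<in> carr X \<Longrightarrow> \<bar>nrm X x - nrm X y\<bar> \<le> nrm X (x - y)"
  using nrm_triangle[of "x - y" y] nrm_triangle[of "y - x" x] nrm_commute[of x y] by auto

text \<open>
  \<open>f t\<close> is the telescoping sum of the first points of a countable dense set that come
  \<open>\<delta> k t\<close>-close to it.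
\<close>

lemma strongly_measurable_series:
  assumes X: "banach_sp X" and f: "strongly_measurable lebesgue X f"
    and \<eta>: "\<eta> \<in> borel_measurable lebesgue" "\<And>t. 0 < \<eta> t"
  obtains A :: "nat \<Rightarrow> real set" and z :: "nat \<Rightarrow> 'v::real_vector"
  where "\<And>i. A i \<in> sets lebesgue" "\<And>i. z i \<in> carr X"
    "AE t in lebesgue. nsums X (\<lambda>i. indicat_real (A i) t *\<^sub>R z i) (f t) \<and>
       (\<forall>N. seminorm_below X N \<longrightarrow>
          (\<Sum>i. indicator (A i) t * ennreal (N (z i))) \<le> ennreal (N (f t) + \<eta> t * nrm X (f t)))"
proof -
  interpret nsp X using X by (intro nsp.intro) (simp add: banach_sp_def)
  obtain s where s: "\<And>n. simple_function lebesgue (s n)" "\<And>n t. s n t \<in> carr X"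
    "AE t in lebesgue. (\<lambda>n. nrm X (f t - s n t)) \<longlonglongrightarrow> 0" and fc: "\<And>t. f t \<in> carr X"
    using f unfolding strongly_measurable_def by (auto simp: image_subset_iff)
  define D where "D = (\<Union>n. range (s n))"
  have "countable D" unfolding D_def
    using simple_functionD(1)[OF s(1)] by (intro countable_UN countableI_type) (auto intro: countable_finite)
  moreover have "D \<noteq> {}" by (auto simp: D_def)
  moreover define d where "d = from_nat_into D"
  ultimately have rd: "range d = D" by (simp add: range_from_nat_into)
  have dc: "d j \<in> carr X" for j proof -
    have "d j \<in> D" using rd by blast
    then show ?thesis using s(2) by (auto simp: D_def)
  qed
  \<comment> \<open>The tolerance is relative to the norm of \<open>f t\<close>. With the divisor 6,
    consecutive tolerances add up to \<open>\<delta> k' t + \<delta> k t = \<eta> t * nrm X (f t) *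
    (1/2)^Suc k\<close> for \<open>k = Suc k'\<close>, so the excess over all levels is exactly
    \<open>\<eta> t * nrm X (f t)\<close>.\<close>
  define \<delta> where "\<delta> k t = \<eta> t * nrm X (f t) * (1/2)^k / 6" for k :: nat and t
  have [measurable]: "(\<lambda>t. nrm X (f t - d j)) \<in> borel_measurable lebesgue" for j
  proof (rule measurable_nrm_comp[OF normed f])
    show "\<bar>nrm X (x - d j) - nrm X (y - d j)\<bar> \<le> nrm X (x - y)" if "x \<in> carr X" "y \<in> carr X" for x y
      using nrm_diff_abs_le[of "x - d j" "y - d j"] that dc by simp
  qed
  have [measurable]: "(\<lambda>t. nrm X (f t)) \<in> borel_measurable lebesgue"
    by (rule measurable_nrm_comp[OF normed f]) (rule nrm_diff_abs_le)
  have [measurable]: "\<delta> k \<in> borel_measurable lebesgue" for k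
    unfolding \<delta>_def using \<eta>(1) by measurable
  \<comment> \<open>\<open>E k j\<close> is the set where \<open>j\<close> is the least index whose
    point is \<open>\<delta> k t\<close>-close. Zeros of \<open>f\<close> are excluded, because the
    tolerance is 0 there and no point is strictly closer.\<close>
  define E where "E k j = {t. nrm X (f t) \<noteq> 0 \<and> nrm X (f t - d j) < \<delta> k t \<and> (\<forall>l<j. \<not> nrm X (f t - d l) < \<delta> k t)}"
    for k j
  have E[measurable]: "E k j \<in> sets lebesgue" for k j
  proof -
    have "{t \<in> space lebesgue. nrm X (f t) \<noteq> 0 \<and> nrm X (f t - d j) < \<delta> k t \<and>
        (\<forall>l\<in>{..<j}. \<not> nrm X (f t - d l) < \<delta> k t)} \<in> sets lebesgue"
      by measurable
    then show ?thesis unfolding E_def by (simp add: Ball_def)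
  qed
  \<comment> \<open>On \<open>B k p\<close> with \<open>p\<close> encoding \<open>(j, l)\<close> the
    approximants of levels \<open>k\<close> and \<open>k - 1\<close> are \<open>d j\<close> and
    \<open>d l\<close>, so the telescoping increment is the constant \<open>y k p\<close>. At level
    0 there is no predecessor and the second index is the dummy 0.\<close>
  define B where "B k p = (case prod_decode p of (j, l) \<Rightarrow>
      case k of 0 \<Rightarrow> if l = 0 then E 0 j else {} | Suc k' \<Rightarrow> E k j \<inter> E k' l)" for k p
  define y where "y k p = (case prod_decode p of (j, l) \<Rightarrow>
      case k of 0 \<Rightarrow> d j | Suc k' \<Rightarrow> d j - d l)" for k :: nat and p
  define A where "A i = case_prod B (prod_decode i)" for i
  define z where "z i = case_prod y (prod_decode i)" for i
  have Bm: "B k p \<in> sets lebesgue" for k p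
    unfolding B_def by (auto split: prod.split nat.split)
  have yc: "y k p \<in> carr X" for k p
    unfolding y_def using dc by (auto split: prod.split nat.split)
  show thesis
  proof (rule that[of A z])
    show "A i \<in> sets lebesgue" for i using Bm by (auto simp: A_def split: prod.split)
    show "z i \<in> carr X" for i using yc by (auto simp: z_def split: prod.split)
    show "AE t in lebesgue. nsums X (\<lambda>i. indicat_real (A i) t *\<^sub>R z i) (f t) \<and>
       (\<forall>N. seminorm_below X N \<longrightarrow>
          (\<Sum>i. indicator (A i) t * ennreal (N (z i))) \<le> ennreal (N (f t) + \<eta> t * nrm X (f t)))"
      using s(3)
    proof eventually_elim
      case (elim t)
      have dense: "\<exists>j. nrm X (f t - d j) < e" if e: "0 < e" for e
      proof -
        obtain n where "nrm X (f t - s n t) < e"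
          using order_tendstoD(2)[OF elim e] by (auto simp: eventually_sequentially)
        moreover have "s n t \<in> range d" by (auto simp: rd D_def)
        ultimately show ?thesis by auto
      qed
      define w where "w k = (if f t = 0 then 0 else case k of 0 \<Rightarrow> d (LEAST j. nrm X (f t - d j) < \<delta> 0 t)
         | Suc k' \<Rightarrow> d (LEAST j. nrm X (f t - d j) < \<delta> k t) - d (LEAST j. nrm X (f t - d j) < \<delta> k' t))" for k
      have wc: "w k \<in> carr X" for k unfolding w_def using dc by (auto split: nat.split)
      \<comment> \<open>For fixed \<open>t\<close> each level has at most one active pair, so the
        inner series over \<open>p\<close> has at most one nonzero term.\<close>
      have ex: "\<exists>q. \<forall>p. indicat_real (B k p) t *\<^sub>R y k p = (if p = q then w k else 0) \<and>
          (\<forall>N. indicator (B k p) t * ennreal (N (y k p)) = (if f t \<noteq> 0 \<and> p = q then ennreal (N (w k)) else 0))" for k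
      proof (cases "f t = 0")
        case True
        then have "t \<notin> E k j" for k j by (simp add: E_def)
        then have "t \<notin> B k p" for p by (auto simp: B_def split: prod.split nat.split)
        then show ?thesis using True by (auto simp: w_def)
      next
        case False
        then have nz: "nrm X (f t) \<noteq> 0" "0 < nrm X (f t)"
          using nrm_eq0[OF fc, of t] nrm_ge0[OF fc, of t] by auto
        then have dp: "0 < \<delta> k t" for k using \<eta>(2) by (simp add: \<delta>_def)
        define J where "J k = (LEAST j. nrm X (f t - d j) < \<delta> k t)" for k
        have J: "nrm X (f t - d (J k)) < \<delta> k t" for k
          unfolding J_def using dense[OF dp] by (rule LeastI_ex)
        have EJ: "t \<in> E k j \<longleftrightarrow> j = J k" for k j
        proof
          assume t: "t \<in> E k j"
          then show "j = J k" unfolding J_def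
            by (intro Least_equality[symmetric]) (auto simp: E_def not_less[symmetric])
        next
          assume "j = J k"
          then show "t \<in> E k j" using J[of k] nz not_less_Least unfolding E_def J_def by blast
        qed
        define q where "q = (case k of 0 \<Rightarrow> prod_encode (J 0, 0) | Suc k' \<Rightarrow> prod_encode (J k, J k'))"
        have "t \<in> B k p \<longleftrightarrow> p = q" for p
        proof -
          obtain j l where p: "prod_decode p = (j, l)" by fastforce
          then have "p = prod_encode (j, l)" by (metis prod_decode_inverse)
          then show ?thesis unfolding B_def q_def p by (auto simp: EJ split: nat.split if_splits)
        qed
        moreover have "y k q = w k"
          using False unfolding y_def w_def q_def by (auto simp: J_def split: nat.split)
        ultimately show ?thesis using False by (intro exI[of _ q]) auto
      qed
      then obtain q where q: "\<And>k p. indicat_real (B k p) t *\<^sub>R y k p = (if p = q k then w k else 0)"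
        "\<And>k p N. indicator (B k p) t * ennreal (N (y k p)) = (if f t \<noteq> 0 \<and> p = q k then ennreal (N (w k)) else 0)"
        by metis
      have row: "nsums X (\<lambda>p. indicat_real (B k p) t *\<^sub>R y k p) (w k)" for k
        unfolding q by (rule nsums_single[OF wc])
      have dist: "nrm X (f t - sum w {..<Suc k}) \<le> \<delta> k t" for k
      proof (cases "f t = 0")
        case True
        then show ?thesis using \<eta>(2)[of t] by (simp add: w_def \<delta>_def)
      next
        case False
        then have nz: "0 < nrm X (f t)"
          using nrm_eq0[OF fc, of t] nrm_ge0[OF fc, of t] by auto
        then have dp: "0 < \<delta> k t" for k using \<eta>(2) by (simp add: \<delta>_def)
        have "sum w {..<Suc k} = d (LEAST j. nrm X (f t - d j) < \<delta> k t)"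
          using False by (induction k) (simp_all add: w_def)
        then show ?thesis using LeastI_ex[OF dense[OF dp[of k]]] by (simp add: less_imp_le)
      qed
      have d0: "0 \<le> \<delta> k t" for k using \<eta>(2)[of t] fc by (simp add: \<delta>_def less_imp_le)
      have Nw: "N (w k) \<le> (if k = 0 then N (f t) else 0) + \<eta> t * nrm X (f t) * (1/2)^Suc k"
        if N: "seminorm_below X N" for N k
      proof (cases k)
        case 0
        have "N (w 0) \<le> N (f t) + N (w 0 - f t)"
          using seminorm_belowD(3)[OF N fc[of t], of "w 0 - f t"] wc fc by simp
        also have "N (w 0 - f t) \<le> nrm X (w 0 - f t)" using wc fc by (intro seminorm_belowD[OF N]) auto
        also have "\<dots> \<le> \<delta> 0 t" using dist[of 0] nrm_commute[OF wc fc] by simp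
        also have "\<dots> \<le> \<eta> t * nrm X (f t) * (1/2)^Suc 0"
          using d0[of 0] by (simp add: \<delta>_def)
        finally show ?thesis using 0 by simp
      next
        case (Suc k')
        have pc: "f t - sum w I \<in> carr X" for I using wc fc by auto
        have wk: "w k = (f t - sum w {..<Suc k'}) - (f t - sum w {..<Suc k})" using Suc by simp
        have "nrm X ((f t - sum w {..<Suc k'}) - (f t - sum w {..<Suc k})) \<le>
           nrm X (f t - sum w {..<Suc k'}) + nrm X (f t - sum w {..<Suc k})"
          using nrm_diff_triangle[OF pc[of "{..<Suc k'}"] zero_mem pc[of "{..<Suc k}"]]
            nrm_minus[OF pc[of "{..<Suc k}"]]
          by (simp only: diff_0 diff_zero)
        then have "nrm X (w k) \<le> \<delta> k' t + \<delta> k t"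
          unfolding wk[symmetric] using dist[of k'] dist[of k] by linarith
        also have "\<dots> = \<eta> t * nrm X (f t) * (1/2)^Suc k"
          using Suc by (simp add: \<delta>_def field_simps)
        finally show ?thesis using seminorm_belowD(2)[OF N wc, of k] Suc by simp
      qed
      have bound: "(\<Sum>i. indicator (A i) t * ennreal (N (z i))) \<le> ennreal (N (f t) + \<eta> t * nrm X (f t))"
        if N: "seminorm_below X N" for N
      proof -
        have "(\<Sum>i. indicator (A i) t * ennreal (N (z i))) =
          (\<Sum>i. case prod_decode i of (k, p) \<Rightarrow> indicator (B k p) t * ennreal (N (y k p)))"
          by (intro suminf_cong) (simp add: A_def z_def split: prod.split)
        also have "\<dots> = (\<Sum>k. \<Sum>p. indicator (B k p) t * ennreal (N (y k p)))"
          by (rule suminf_ennreal_2dimen) simp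
        also have "\<dots> = (\<Sum>k. if f t \<noteq> 0 then ennreal (N (w k)) else 0)"
        proof (intro suminf_cong)
          fix k
          have "(\<Sum>p. if f t \<noteq> 0 \<and> p = q k then ennreal (N (w k)) else 0) =
             (\<Sum>p\<in>{q k}. if f t \<noteq> 0 \<and> p = q k then ennreal (N (w k)) else 0)"
            by (intro suminf_finite) auto
          then show "(\<Sum>p. indicator (B k p) t * ennreal (N (y k p))) = (if f t \<noteq> 0 then ennreal (N (w k)) else 0)"
            unfolding q by simp
        qed
        also have "\<dots> \<le> (\<Sum>k. ennreal ((if k = 0 then N (f t) else 0) + \<eta> t * nrm X (f t) * (1/2)^Suc k))"
        proof (intro suminf_le summableI)
          fix k
          have "ennreal (N (w k)) \<le> ennreal ((if k = 0 then N (f t) else 0) + \<eta> t * nrm X (f t) * (1/2)^Suc k)"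
            by (rule ennreal_leI[OF Nw[OF N]])
          then show "(if f t \<noteq> 0 then ennreal (N (w k)) else 0) \<le>
              ennreal ((if k = 0 then N (f t) else 0) + \<eta> t * nrm X (f t) * (1/2)^Suc k)"
            by (cases "f t = 0") (simp_all only: simp_thms if_True if_False zero_le)
        qed
        also have "\<dots> = ennreal (N (f t) + \<eta> t * nrm X (f t))"
        proof (rule suminf_ennreal_eq)
          show "0 \<le> (if k = 0 then N (f t) else 0) + \<eta> t * nrm X (f t) * (1/2)^Suc k" for k
            using seminorm_belowD(1)[OF N fc] \<eta>(2)[of t] fc by (simp add: less_imp_le)
          have "(\<lambda>k. if k = 0 then N (f t) else 0) sums N (f t)"
            using sums_single[of 0 "\<lambda>_. N (f t)"] by simp
          moreover have "(\<lambda>k. \<eta> t * nrm X (f t) * (1/2)^Suc k) sums (\<eta> t * nrm X (f t) * 1)"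
            by (intro sums_mult power_half_series)
          ultimately show "(\<lambda>k. (if k = 0 then N (f t) else 0) + \<eta> t * nrm X (f t) * (1/2)^Suc k)
              sums (N (f t) + \<eta> t * nrm X (f t))"
            using sums_add by fastforce
        qed
        finally show ?thesis .
      qed
      have sb: "seminorm_below X (nrm X)" by (simp add: seminorm_below_def nrm_triangle)
      have zc: "indicat_real (A i) t *\<^sub>R z i \<in> carr X" for i
        using yc by (auto simp: z_def split: prod.split)
      have "(\<Sum>i. ennreal (nrm X (indicat_real (A i) t *\<^sub>R z i))) \<le> (\<Sum>i. indicator (A i) t * ennreal (nrm X (z i)))"
        by (intro suminf_le) (auto split: split_indicator)
      also have "\<dots> < \<infinity>" by (rule order.strict_trans1[OF bound[OF sb]]) simp
      finally have fin: "(\<Sum>i. ennreal (nrm X (indicat_real (A i) t *\<^sub>R z i))) < \<infinity>" .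
      \<comment> \<open>Absolute convergence yields some sum \<open>v\<close>; regrouping by levels
        turns the series into the telescoping one, whose sum is \<open>f t\<close>.\<close>
      obtain v where v: "nsums X (\<lambda>i. indicat_real (A i) t *\<^sub>R z i) v"
        using banach_nsums[OF X zc fin] by blast
      have Ae: "indicat_real (A i) t *\<^sub>R z i = (\<lambda>(k, p). indicat_real (B k p) t *\<^sub>R y k p) (prod_decode i)" for i
        by (simp add: A_def z_def split: prod.split)
      have "nsums X w v"
      proof (rule nsums_rows[OF bij_prod_decode, where f = "\<lambda>(k, p). indicat_real (B k p) t *\<^sub>R y k p"])
        show "nsums X (\<lambda>i. (\<lambda>(k, p). indicat_real (B k p) t *\<^sub>R y k p) (prod_decode i)) v"
          using v unfolding Ae .
        show "(\<Sum>i. ennreal (nrm X ((\<lambda>(k, p). indicat_real (B k p) t *\<^sub>R y k p) (prod_decode i)))) < \<infinity>"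
          using fin unfolding Ae .
      qed (simp add: row)
      moreover have "nsums X w (f t)"
      proof -
        have "(\<lambda>k. \<delta> k t) \<longlonglongrightarrow> \<eta> t * nrm X (f t) * 0 / 6"
          unfolding \<delta>_def by (intro tendsto_intros LIMSEQ_power_zero) auto
        then have d: "(\<lambda>k. \<delta> k t) \<longlonglongrightarrow> 0" by simp
        have "(\<lambda>k. nrm X (sum w {..<Suc k} - f t)) \<longlonglongrightarrow> 0"
        proof (rule tendsto_sandwich[OF _ _ tendsto_const d])
          show "\<forall>\<^sub>F k in sequentially. nrm X (sum w {..<Suc k} - f t) \<le> \<delta> k t"
          proof (intro always_eventually allI)
            fix k
            have "nrm X (sum w {..<Suc k} - f t) = nrm X (f t - sum w {..<Suc k})"
              by (intro nrm_commute sum_mem wc fc)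
            then show "nrm X (sum w {..<Suc k} - f t) \<le> \<delta> k t" using dist[of k] by (simp only:)
          qed
          show "\<forall>\<^sub>F k in sequentially. 0 \<le> nrm X (sum w {..<Suc k} - f t)"
            using wc fc by (intro always_eventually allI nrm_ge0 diff_mem sum_mem)
        qed
        then have "(\<lambda>k. nrm X (sum w {..<k} - f t)) \<longlonglongrightarrow> 0" by (rule LIMSEQ_imp_Suc)
        then show ?thesis using wc fc by (simp add: nsums_def nlim_def)
      qed
      ultimately have "v = f t" by (rule nsums_unique)
      with v have "nsums X (\<lambda>i. indicat_real (A i) t *\<^sub>R z i) (f t)" by (simp only:)
      then show ?case using bound by blast
    qed
  qed
qed

section \<open>Measurability and integrals of series with scalar coefficient functions\<close>

lemma simple_function_vector_sum:
  assumes "\<And>i. i \<in> I \<Longrightarrow> simple_function M (s i)"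
  shows "simple_function M (\<lambda>t. \<Sum>i\<in>I. s i t *\<^sub>R (z i :: 'v::real_vector))"
  using assms by (intro simple_function_sum) (auto intro: simple_function_compose1)

lemma (in nsp) nrm_series_approx:
  assumes f: "nsums X (\<lambda>i. c i *\<^sub>R z i) y" and z: "\<And>i. z i \<in> carr X"
  shows "nrm X (y - (\<Sum>i<k. s i *\<^sub>R z i)) \<le> nrm X ((\<Sum>i<k. c i *\<^sub>R z i) - y) + (\<Sum>i<k. \<bar>c i - s i\<bar> * nrm X (z i))"
proof -
  have y: "y \<in> carr X" using f by (rule nsumsD)
  have *: "y - (\<Sum>i<k. s i *\<^sub>R z i) = (y - (\<Sum>i<k. c i *\<^sub>R z i)) + (\<Sum>i<k. (c i - s i) *\<^sub>R z i)"
    by (simp add: sum_subtractf scaleR_diff_left)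
  have "nrm X (y - (\<Sum>i<k. s i *\<^sub>R z i)) \<le> nrm X (y - (\<Sum>i<k. c i *\<^sub>R z i)) + nrm X (\<Sum>i<k. (c i - s i) *\<^sub>R z i)"
    unfolding * using y z by (intro nrm_triangle) simp_all
  moreover have "nrm X (\<Sum>i<k. (c i - s i) *\<^sub>R z i) \<le> (\<Sum>i<k. nrm X ((c i - s i) *\<^sub>R z i))"
    using z by (intro nrm_sum_le) auto
  ultimately show ?thesis
    using nrm_commute[of y "\<Sum>i<k. c i *\<^sub>R z i"] y z by (simp add: nrm_scale)
qed

text \<open>Reciprocal mesh for rounding the \<open>i\<close>-th coefficient in the
  \<open>k\<close>-th approximation: \<open>k\<close> terms, each with norm error at most
  \<open>1/(k+1)^2\<close>, cost at most \<open>1/(k+1)\<close> together. The absolute value keeps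
  it positive for arguments outside the carrier as well.\<close>

definition grid :: "'v nspace \<Rightarrow> (nat \<Rightarrow> 'v) \<Rightarrow> nat \<Rightarrow> nat \<Rightarrow> real" where
  "grid X z k i = (real k + 1)^2 * (\<bar>nrm X (z i)\<bar> + 1)"

lemma grid_pos: "0 < grid X z k i"
  by (simp add: grid_def add_nonneg_pos)

lemma grid_sum_le: "(\<Sum>i<k. 1 / grid X z k i * nrm X (z i)) \<le> 1 / (real k + 1)"
proof -
  have "1 / grid X z k i * nrm X (z i) \<le> 1 / (real k + 1)^2" for i
  proof -
    have "nrm X (z i) / (\<bar>nrm X (z i)\<bar> + 1) \<le> 1"
      by (simp add: divide_le_eq_1 add_nonneg_pos) linarith
    then have "1 / (real k + 1)^2 * (nrm X (z i) / (\<bar>nrm X (z i)\<bar> + 1)) \<le> 1 / (real k + 1)^2 * 1"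
      by (intro mult_left_mono) auto
    then show ?thesis by (simp add: grid_def)
  qed
  then have "(\<Sum>i<k. 1 / grid X z k i * nrm X (z i)) \<le> (\<Sum>i<k. 1 / (real k + 1)^2)" by (intro sum_mono)
  also have "\<dots> \<le> (real k + 1) * (1 / (real k + 1)^2)" by simp (intro divide_right_mono, auto)
  also have "\<dots> = 1 / (real k + 1)" by (simp add: power2_eq_square)
  finally show ?thesis .
qed

lemma inverse_Suc_LIMSEQ: "(\<lambda>k. 1 / (real k + 1)) \<longlonglongrightarrow> 0"
  using LIMSEQ_inverse_real_of_nat by (simp add: inverse_eq_divide add.commute)

text \<open>A bounded coefficient rounded down to a multiple of the mesh takes finitely many values,
  so the \<open>k\<close>-th partial sum with rounded coefficients is simple. Truncation and
  rounding errors both vanish almost everywhere.\<close>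

lemma strongly_measurable_bounded_series:
  assumes X: "normed_sp X" and c: "\<And>i. c i \<in> borel_measurable M"
    and B: "\<And>i t. \<bar>c i t\<bar> \<le> B i" and z: "\<And>i. z i \<in> carr X" and fc: "\<And>t. t \<in> space M \<Longrightarrow> f t \<in> carr X"
    and f: "AE t in M. nsums X (\<lambda>i. c i t *\<^sub>R z i) (f t)"
  shows "strongly_measurable M X f"
proof -
  interpret nsp X by standard (rule X)
  define s where "s k i t = of_int \<lfloor>c i t * grid X z k i\<rfloor> / grid X z k i" for k i t
  have close: "\<bar>c i t - s k i t\<bar> \<le> 1 / grid X z k i" for k i t
  proof -
    have "c i t - s k i t = (c i t * grid X z k i - of_int \<lfloor>c i t * grid X z k i\<rfloor>) / grid X z k i"
      using grid_pos[of X z k i] by (simp add: s_def diff_divide_distrib)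
    moreover have "\<bar>c i t * grid X z k i - of_int \<lfloor>c i t * grid X z k i\<rfloor>\<bar> \<le> 1" by linarith
    ultimately show ?thesis using grid_pos[of X z k i] by (simp add: divide_right_mono)
  qed
  have simple: "simple_function M (s k i)" for k i
  proof (rule simple_function_borel_measurable)
    show "s k i \<in> borel_measurable M" unfolding s_def using c by measurable
    let ?R = "(\<lambda>n. of_int n / grid X z k i) ` {\<lfloor>- B i * grid X z k i\<rfloor>..\<lfloor>B i * grid X z k i\<rfloor>}"
    have "s k i t \<in> ?R" for t
    proof -
      have "- B i \<le> c i t" "c i t \<le> B i" using B[of i t] by linarith+
      then have "- B i * grid X z k i \<le> c i t * grid X z k i" "c i t * grid X z k i \<le> B i * grid X z k i"
        using grid_pos[of X z k i] by (intro mult_right_mono; simp)+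
      then show ?thesis unfolding s_def by (intro imageI) (auto intro!: floor_mono)
    qed
    then have "s k i ` space M \<subseteq> ?R" by (intro image_subsetI)
    then show "finite (s k i ` space M)" by (rule finite_subset) (intro finite_imageI finite_atLeastAtMost_int)
  qed
  show ?thesis
    unfolding strongly_measurable_def
  proof (intro conjI exI[of _ "\<lambda>k t. \<Sum>i<k. s k i t *\<^sub>R z i"] allI ballI)
    show "AE t in M. (\<lambda>k. nrm X (f t - (\<Sum>i<k. s k i t *\<^sub>R z i))) \<longlonglongrightarrow> 0"
      using f AE_space
    proof eventually_elim
      case (elim t)
      have lim: "(\<lambda>k. nrm X ((\<Sum>i<k. c i t *\<^sub>R z i) - f t) + 1 / (real k + 1)) \<longlonglongrightarrow> 0 + 0"
        by (intro tendsto_add nsumsD(4)[OF elim(1)] inverse_Suc_LIMSEQ)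
      show ?case
      proof (rule tendsto_sandwich[OF _ _ tendsto_const lim[simplified]])
        show "\<forall>\<^sub>F k in sequentially. 0 \<le> nrm X (f t - (\<Sum>i<k. s k i t *\<^sub>R z i))"
          using z fc elim by (intro always_eventually allI nrm_ge0 diff_mem sum_mem scale_mem)
        show "\<forall>\<^sub>F k in sequentially. nrm X (f t - (\<Sum>i<k. s k i t *\<^sub>R z i)) \<le>
            nrm X ((\<Sum>i<k. c i t *\<^sub>R z i) - f t) + 1 / (real k + 1)"
        proof (intro always_eventually allI)
          fix k
          have "(\<Sum>i<k. \<bar>c i t - s k i t\<bar> * nrm X (z i)) \<le> (\<Sum>i<k. 1 / grid X z k i * nrm X (z i))"
            using close z by (intro sum_mono mult_right_mono) auto
          then show "nrm X (f t - (\<Sum>i<k. s k i t *\<^sub>R z i)) \<le>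
              nrm X ((\<Sum>i<k. c i t *\<^sub>R z i) - f t) + 1 / (real k + 1)"
            using nrm_series_approx[OF elim(1) z, where k = k and s = "\<lambda>i. s k i t"] grid_sum_le[where X=X and z=z and k=k] by linarith
        qed
      qed
    qed
    show "simple_function M (\<lambda>t. \<Sum>i<k. s k i t *\<^sub>R z i)" for k
      by (intro simple_function_vector_sum simple)
    show "(\<lambda>t. \<Sum>i<k. s k i t *\<^sub>R z i) ` space M \<subseteq> carr X" for k using z by auto
  qed (use fc in auto)
qed

lemma simple_bochner_vector_sum:
  fixes z :: "nat \<Rightarrow> 'v::real_vector"
  assumes s: "\<And>i. Bochner_Integration.simple_bochner_integrable M (s i :: _ \<Rightarrow> real)"
  shows "Bochner_Integration.simple_bochner_integrable M (\<lambda>t. \<Sum>i<(k::nat). s i t *\<^sub>R z i) \<and>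
    Bochner_Integration.simple_bochner_integral M (\<lambda>t. \<Sum>i<k. s i t *\<^sub>R z i) =
      (\<Sum>i<k. Bochner_Integration.simple_bochner_integral M (s i) *\<^sub>R z i)"
proof (induction k)
  case 0
  have "Bochner_Integration.simple_bochner_integrable M (\<lambda>t. 0 :: 'v)"
    by (rule simple_bochner_integrable.intros) auto
  moreover have "Bochner_Integration.simple_bochner_integral M (\<lambda>t. 0 :: 'v) = 0"
    by (auto simp: simple_bochner_integral_def intro!: sum.neutral)
  ultimately show ?case by simp
next
  case (Suc k)
  have lin: "linear (\<lambda>r::real. r *\<^sub>R z k)" by (intro linearI) (simp_all add: scaleR_add_left)
  have i: "Bochner_Integration.simple_bochner_integrable M (\<lambda>t. s k t *\<^sub>R z k)"
    using simple_bochner_integrable_compose2[where p = "\<lambda>r _. r *\<^sub>R z k", OF _ s s] by simp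
  show ?case
    using Suc i simple_bochner_integrable_compose2[where p = "(+)", OF _ conjunct1[OF Suc] i]
    by (simp add: simple_bochner_integral_add simple_bochner_integral_linear[OF lin s])
qed

text \<open>The \<open>k\<close>-th approximant keeps \<open>k\<close> terms and replaces their
  coefficients by simple functions that are \<open>1/grid\<close>-close in L^1; the tail is
  controlled by \<open>fin\<close>. The coefficients will be indicators of sets, convolutions of two
  indicators, and indicators of rectangles.\<close>

lemma has_bochner_int_series:
  assumes X: "normed_sp X" and c: "\<And>i. integrable M (c i)"
    and B: "\<And>i t. \<bar>c i t\<bar> \<le> B i" and z: "\<And>i. z i \<in> carr X" and fc: "\<And>t. t \<in> space M \<Longrightarrow> f t \<in> carr X"
    and f: "AE t in M. nsums X (\<lambda>i. c i t *\<^sub>R z i) (f t)"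
    and fin: "(\<Sum>i. \<integral>\<^sup>+t. ennreal \<bar>c i t\<bar> \<partial>M * ennreal (nrm X (z i))) < \<infinity>"
    and x: "nsums X (\<lambda>i. integral\<^sup>L M (c i) *\<^sub>R z i) x"
  shows "has_bochner_int M X f x"
proof -
  interpret nsp X by standard (rule X)
  have cm[measurable]: "c i \<in> borel_measurable M" for i using c by auto
  have ex: "\<exists>s. Bochner_Integration.simple_bochner_integrable M s \<and> (\<integral>\<^sup>+t. ennreal \<bar>c i t - s t\<bar> \<partial>M) < ennreal (1 / grid X z k i)" for k i
  proof -
    obtain y where "has_bochner_integral M (c i) y" using c[of i] by (auto simp: integrable.simps)
    then show ?thesis
    proof cases
      case (1 s)
      have "\<forall>\<^sub>F n in sequentially. (\<integral>\<^sup>+t. ennreal (norm (c i t - s n t)) \<partial>M) < ennreal (1 / grid X z k i)"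
        using order_tendstoD(2)[OF 1(3)] grid_pos[of X z k i] by simp
      then obtain n where "(\<integral>\<^sup>+t. ennreal (norm (c i t - s n t)) \<partial>M) < ennreal (1 / grid X z k i)"
        by (auto simp: eventually_sequentially)
      then show ?thesis using 1(2)[of n] by auto
    qed
  qed
  define s where "s k i = (SOME s. Bochner_Integration.simple_bochner_integrable M s \<and>
      (\<integral>\<^sup>+t. ennreal \<bar>c i t - s t\<bar> \<partial>M) < ennreal (1 / grid X z k i))" for k i
  have s: "Bochner_Integration.simple_bochner_integrable M (s k i)"
    and close: "(\<integral>\<^sup>+t. ennreal \<bar>c i t - s k i t\<bar> \<partial>M) < ennreal (1 / grid X z k i)" for k i
    using someI_ex[OF ex[of i k]] unfolding s_def by blast+
  have sm[measurable]: "s k i \<in> borel_measurable M" for k i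
    using s[of k i] by (auto elim!: simple_bochner_integrable.cases intro: borel_measurable_simple_function)
  have si: "integrable M (s k i)" "Bochner_Integration.simple_bochner_integral M (s k i) = integral\<^sup>L M (s k i)" for k i
    using has_bochner_integral_simple_bochner_integrable[OF s] simple_bochner_integrable_eq_integral[OF s]
    by (auto simp: integrable.simps)
  have err: "(\<Sum>i<k. (\<integral>\<^sup>+t. ennreal \<bar>c i t - s k i t\<bar> \<partial>M) * ennreal (nrm X (z i))) \<le> ennreal (1 / (real k + 1))" for k
  proof -
    have "(\<Sum>i<k. (\<integral>\<^sup>+t. ennreal \<bar>c i t - s k i t\<bar> \<partial>M) * ennreal (nrm X (z i))) \<le>
        (\<Sum>i<k. ennreal (1 / grid X z k i) * ennreal (nrm X (z i)))"
      using close by (intro sum_mono mult_right_mono) (auto intro: less_imp_le)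
    also have "\<dots> = ennreal (\<Sum>i<k. 1 / grid X z k i * nrm X (z i))"
    proof (subst sum_ennreal[symmetric])
      show "0 \<le> 1 / grid X z k i * nrm X (z i)" if "i \<in> {..<k}" for i
        using grid_pos[of X z k i] z by simp
      show "(\<Sum>i<k. ennreal (1 / grid X z k i) * ennreal (nrm X (z i))) = (\<Sum>i<k. ennreal (1 / grid X z k i * nrm X (z i)))"
        using grid_pos[of X z k] z by (intro sum.cong refl ennreal_mult[symmetric]) (simp_all add: less_imp_le)
    qed
    also have "\<dots> \<le> ennreal (1 / (real k + 1))" by (intro ennreal_leI grid_sum_le)
    finally show ?thesis .
  qed
  define g where "g i = (\<integral>\<^sup>+t. ennreal \<bar>c i t\<bar> \<partial>M) * ennreal (nrm X (z i))" for i
  have tail: "(\<lambda>k. \<Sum>i. g (i + k)) \<longlonglongrightarrow> 0"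
    using fin by (intro ennreal_suminf_tail_LIMSEQ) (simp add: g_def)
  have bound: "(\<integral>\<^sup>+t. ennreal (nrm X (f t - (\<Sum>i<k. s k i t *\<^sub>R z i))) \<partial>M) \<le> (\<Sum>i. g (i + k)) + ennreal (1 / (real k + 1))" for k
  proof -
    have "(\<integral>\<^sup>+t. ennreal (nrm X (f t - (\<Sum>i<k. s k i t *\<^sub>R z i))) \<partial>M) \<le>
      (\<integral>\<^sup>+t. (\<Sum>i. ennreal \<bar>c (i + k) t\<bar> * ennreal (nrm X (z (i + k)))) +
         (\<Sum>i<k. ennreal \<bar>c i t - s k i t\<bar> * ennreal (nrm X (z i))) \<partial>M)"
    proof (rule nn_integral_mono_AE)
      show "AE t in M. ennreal (nrm X (f t - (\<Sum>i<k. s k i t *\<^sub>R z i))) \<le>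
         (\<Sum>i. ennreal \<bar>c (i + k) t\<bar> * ennreal (nrm X (z (i + k)))) +
         (\<Sum>i<k. ennreal \<bar>c i t - s k i t\<bar> * ennreal (nrm X (z i)))"
        using f
      proof eventually_elim
        case (elim t)
        have "ennreal (nrm X ((\<Sum>i<k. c i t *\<^sub>R z i) - f t)) \<le> (\<Sum>i. ennreal (nrm X (c (i + k) t *\<^sub>R z (i + k))))"
          using nsums_tail[OF elim, of k] nrm_commute[of "f t" "\<Sum>i<k. c i t *\<^sub>R z i"] nsumsD(2)[OF elim] z by simp
        also have "\<dots> = (\<Sum>i. ennreal \<bar>c (i + k) t\<bar> * ennreal (nrm X (z (i + k))))"
          using z by (intro suminf_cong) (simp add: nrm_scale ennreal_mult)
        finally have 1: "ennreal (nrm X ((\<Sum>i<k. c i t *\<^sub>R z i) - f t)) \<le> (\<Sum>i. ennreal \<bar>c (i + k) t\<bar> * ennreal (nrm X (z (i + k))))" .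
        have 2: "ennreal (\<Sum>i<k. \<bar>c i t - s k i t\<bar> * nrm X (z i)) = (\<Sum>i<k. ennreal \<bar>c i t - s k i t\<bar> * ennreal (nrm X (z i)))"
          using z by (subst sum_ennreal[symmetric]) (auto simp: ennreal_mult)
        have "ennreal (nrm X (f t - (\<Sum>i<k. s k i t *\<^sub>R z i))) \<le>
           ennreal (nrm X ((\<Sum>i<k. c i t *\<^sub>R z i) - f t) + (\<Sum>i<k. \<bar>c i t - s k i t\<bar> * nrm X (z i)))"
          by (intro ennreal_leI nrm_series_approx[OF elim z])
        also have "\<dots> = ennreal (nrm X ((\<Sum>i<k. c i t *\<^sub>R z i) - f t)) + ennreal (\<Sum>i<k. \<bar>c i t - s k i t\<bar> * nrm X (z i))"
          using z nsumsD(2)[OF elim] by (intro ennreal_plus sum_nonneg mult_nonneg_nonneg nrm_ge0 diff_mem sum_mem scale_mem) auto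
        finally show ?case using 1 unfolding 2 by (meson add_right_mono order_trans)
      qed
    qed
    also have "\<dots> = (\<Sum>i. g (i + k)) + (\<Sum>i<k. (\<integral>\<^sup>+t. ennreal \<bar>c i t - s k i t\<bar> \<partial>M) * ennreal (nrm X (z i)))"
      unfolding g_def by (subst nn_integral_add) (auto simp: nn_integral_suminf nn_integral_sum nn_integral_multc)
    also have "\<dots> \<le> (\<Sum>i. g (i + k)) + ennreal (1 / (real k + 1))" by (intro add_left_mono err)
    finally show ?thesis .
  qed
  have ints: "\<bar>integral\<^sup>L M (c i) - integral\<^sup>L M (s k i)\<bar> \<le> 1 / grid X z k i" for k i
  proof -
    have "ennreal \<bar>integral\<^sup>L M (c i) - integral\<^sup>L M (s k i)\<bar> = ennreal (norm (integral\<^sup>L M (\<lambda>t. c i t - s k i t)))"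
      using c si by (simp add: Bochner_Integration.integral_diff)
    also have "\<dots> \<le> (\<integral>\<^sup>+t. ennreal (norm (c i t - s k i t)) \<partial>M)"
      by (rule integral_norm_bound_ennreal) (use c si in auto)
    also have "\<dots> \<le> ennreal (1 / grid X z k i)" using close[of i k] by simp
    finally show ?thesis using grid_pos[of X z k i] by (simp add: ennreal_le_iff)
  qed
  have lim0: "(\<lambda>k. ennreal (1 / (real k + 1))) \<longlonglongrightarrow> 0"
    using tendsto_ennrealI[OF inverse_Suc_LIMSEQ] by simp
  have sbv: "Bochner_Integration.simple_bochner_integrable M (\<lambda>t. \<Sum>i<k. s k i t *\<^sub>R z i)"
    "Bochner_Integration.simple_bochner_integral M (\<lambda>t. \<Sum>i<k. s k i t *\<^sub>R z i) =
      (\<Sum>i<k. integral\<^sup>L M (s k i) *\<^sub>R z i)" for k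
    using simple_bochner_vector_sum[where M = M and s = "s k" and z = z and k = k, OF s] unfolding si(2) by auto
  show ?thesis
    unfolding has_bochner_int_def
  proof (intro conjI exI[of _ "\<lambda>k t. \<Sum>i<k. s k i t *\<^sub>R z i"] allI)
    show "strongly_measurable M X f"
      by (rule strongly_measurable_bounded_series[OF X _ B z fc f]) auto
    show "x \<in> carr X" using x by (rule nsumsD)
    show "Bochner_Integration.simple_bochner_integrable M (\<lambda>t. \<Sum>i<k. s k i t *\<^sub>R z i)" for k
      by (rule sbv)
    show "(\<lambda>t. \<Sum>i<k. s k i t *\<^sub>R z i) ` space M \<subseteq> carr X" for k using z by auto
    show "(\<lambda>k. \<integral>\<^sup>+t. ennreal (nrm X (f t - (\<Sum>i<k. s k i t *\<^sub>R z i))) \<partial>M) \<longlonglongrightarrow> 0"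
    proof (rule tendsto_sandwich[OF _ _ tendsto_const])
      show "(\<lambda>k. (\<Sum>i. g (i + k)) + ennreal (1 / (real k + 1))) \<longlonglongrightarrow> 0"
        using tendsto_add[OF tail lim0] by simp
      show "\<forall>\<^sub>F k in sequentially. (\<integral>\<^sup>+t. ennreal (nrm X (f t - (\<Sum>i<k. s k i t *\<^sub>R z i))) \<partial>M)
          \<le> (\<Sum>i. g (i + k)) + ennreal (1 / (real k + 1))"
        by (intro always_eventually allI bound)
    qed simp
    have lim: "(\<lambda>k. nrm X ((\<Sum>i<k. integral\<^sup>L M (c i) *\<^sub>R z i) - x) + 1 / (real k + 1)) \<longlonglongrightarrow> 0 + 0"
      by (intro tendsto_add nsumsD(4)[OF x] inverse_Suc_LIMSEQ)
    show "(\<lambda>k. nrm X (Bochner_Integration.simple_bochner_integral M (\<lambda>t. \<Sum>i<k. s k i t *\<^sub>R z i) - x)) \<longlonglongrightarrow> 0"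
      unfolding sbv(2)
    proof (rule tendsto_sandwich[OF _ _ tendsto_const lim[simplified]])
      show "\<forall>\<^sub>F k in sequentially. 0 \<le> nrm X ((\<Sum>i<k. integral\<^sup>L M (s k i) *\<^sub>R z i) - x)"
        using z nsumsD(2)[OF x] by (intro always_eventually allI nrm_ge0 diff_mem sum_mem scale_mem)
      show "\<forall>\<^sub>F k in sequentially. nrm X ((\<Sum>i<k. integral\<^sup>L M (s k i) *\<^sub>R z i) - x) \<le>
          nrm X ((\<Sum>i<k. integral\<^sup>L M (c i) *\<^sub>R z i) - x) + 1 / (real k + 1)"
      proof (intro always_eventually allI)
        fix k
        have "(\<Sum>i<k. \<bar>integral\<^sup>L M (c i) - integral\<^sup>L M (s k i)\<bar> * nrm X (z i)) \<le> (\<Sum>i<k. 1 / grid X z k i * nrm X (z i))"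
          using ints z by (intro sum_mono mult_right_mono) auto
        then show "nrm X ((\<Sum>i<k. integral\<^sup>L M (s k i) *\<^sub>R z i) - x) \<le>
          nrm X ((\<Sum>i<k. integral\<^sup>L M (c i) *\<^sub>R z i) - x) + 1 / (real k + 1)"
          using nrm_series_approx[OF x z, where k = k and s = "\<lambda>i. integral\<^sup>L M (s k i)"] grid_sum_le[where X=X and z=z and k=k]
            nrm_commute[of x "\<Sum>i<k. integral\<^sup>L M (s k i) *\<^sub>R z i"] nsumsD(2)[OF x] z
          by simp
      qed
    qed
  qed
qed

lemma simple_bochner_integral_nrm_le:
  assumes X: "normed_sp X" and s: "Bochner_Integration.simple_bochner_integrable (lebesgue :: real measure) s"
    and sc: "\<And>t. s t \<in> carr X"
  shows "ennreal (nrm X (Bochner_Integration.simple_bochner_integral lebesgue s)) \<le> (\<integral>\<^sup>+t. ennreal (nrm X (s t)) \<partial>lebesgue)"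
proof -
  interpret nsp X by standard (rule X)
  have i: "Bochner_Integration.simple_bochner_integrable lebesgue (\<lambda>t. nrm X (s t))"
    using simple_bochner_integrable_compose2[where p = "\<lambda>r _. nrm X r", OF _ s s] by simp
  have "nrm X (Bochner_Integration.simple_bochner_integral lebesgue s) \<le>
      (\<Sum>y\<in>s ` space lebesgue. nrm X (measure lebesgue {x \<in> space lebesgue. s x = y} *\<^sub>R y))"
    unfolding simple_bochner_integral_def using sc by (intro nrm_sum_le) auto
  also have "\<dots> = (\<Sum>y\<in>s ` space lebesgue. measure lebesgue {x \<in> space lebesgue. s x = y} *\<^sub>R nrm X y)"
    using sc by (intro sum.cong) (auto simp: nrm_scale)
  also have "\<dots> = Bochner_Integration.simple_bochner_integral lebesgue (\<lambda>t. nrm X (s t))"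
    using s i by (intro simple_bochner_integral_partition[symmetric]) (auto elim: simple_bochner_integrable.cases)
  finally show ?thesis
    using simple_bochner_integral_eq_nn_integral[OF i] sc by (metis ennreal_leI nrm_ge0)
qed

text \<open>The integrals of any two approximating sequences of simple functions come arbitrarily
  close, by the triangle inequality through \<open>f\<close>. It identifies the given value of an
  integral with the sum of a series for the integrand.\<close>

lemma has_bochner_int_unique:
  assumes X: "normed_sp X" and x: "has_bochner_int (lebesgue :: real measure) X f x" and y: "has_bochner_int lebesgue X f y"
  shows "x = y"
proof -
  interpret nsp X by standard (rule X)
  have f: "strongly_measurable lebesgue X f" and fc: "\<And>t. f t \<in> carr X" and xy: "x \<in> carr X" "y \<in> carr X"
    using x y by (auto simp: has_bochner_int_def strongly_measurable_def)
  obtain s where s: "\<And>n. Bochner_Integration.simple_bochner_integrable lebesgue (s n)" "\<And>n t. s n t \<in> carr X"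
    "(\<lambda>n. \<integral>\<^sup>+t. ennreal (nrm X (f t - s n t)) \<partial>lebesgue) \<longlonglongrightarrow> 0"
    "(\<lambda>n. nrm X (Bochner_Integration.simple_bochner_integral lebesgue (s n) - x)) \<longlonglongrightarrow> 0"
    using x unfolding has_bochner_int_def by (auto simp: image_subset_iff)
  obtain r where r: "\<And>n. Bochner_Integration.simple_bochner_integrable lebesgue (r n)" "\<And>n t. r n t \<in> carr X"
    "(\<lambda>n. \<integral>\<^sup>+t. ennreal (nrm X (f t - r n t)) \<partial>lebesgue) \<longlonglongrightarrow> 0"
    "(\<lambda>n. nrm X (Bochner_Integration.simple_bochner_integral lebesgue (r n) - y)) \<longlonglongrightarrow> 0"
    using y unfolding has_bochner_int_def by (auto simp: image_subset_iff)
  let ?I = "Bochner_Integration.simple_bochner_integral lebesgue"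
  have Ic: "?I g \<in> carr X" if "\<And>t. g t \<in> carr X" for g
    unfolding simple_bochner_integral_def using that by (intro sum_mem scale_mem) auto
  have meas: "(\<lambda>t. nrm X (f t - g t)) \<in> borel_measurable lebesgue"
    if g: "Bochner_Integration.simple_bochner_integrable lebesgue g" "\<And>t. g t \<in> carr X" for g
  proof -
    have sg: "simple_function lebesgue g" using g(1) by (auto elim: simple_bochner_integrable.cases)
    obtain s' where s': "\<And>n. simple_function lebesgue (s' n)" "\<And>n t. s' n t \<in> carr X"
      "AE t in lebesgue. (\<lambda>n. nrm X (f t - s' n t)) \<longlonglongrightarrow> 0"
      using f unfolding strongly_measurable_def by (auto simp: image_subset_iff)
    have "strongly_measurable lebesgue X (\<lambda>t. f t - g t)"
      unfolding strongly_measurable_def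
    proof (intro conjI exI[of _ "\<lambda>n t. s' n t - g t"] allI ballI)
      show "simple_function lebesgue (\<lambda>t. s' n t - g t)" for n
        by (rule simple_function_compose2[OF s'(1) sg])
    qed (use s' fc g in auto)
    then show ?thesis by (rule measurable_nrm_comp[OF X]) (rule nrm_diff_abs_le)
  qed
  have le: "ennreal (nrm X (?I (s n) - ?I (r n))) \<le>
     (\<integral>\<^sup>+t. ennreal (nrm X (f t - s n t)) \<partial>lebesgue) + (\<integral>\<^sup>+t. ennreal (nrm X (f t - r n t)) \<partial>lebesgue)" for n
  proof -
    have "ennreal (nrm X (?I (s n) - ?I (r n))) = ennreal (nrm X (?I (\<lambda>t. s n t - r n t)))"
      using s r by (simp add: simple_bochner_integral_diff)
    also have "\<dots> \<le> (\<integral>\<^sup>+t. ennreal (nrm X (s n t - r n t)) \<partial>lebesgue)"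
      using s(2) r(2) simple_bochner_integrable_compose2[where p = "(-)", OF _ s(1) r(1)]
      by (intro simple_bochner_integral_nrm_le[OF X]) auto
    also have "\<dots> \<le> (\<integral>\<^sup>+t. ennreal (nrm X (f t - s n t)) + ennreal (nrm X (f t - r n t)) \<partial>lebesgue)"
    proof (intro nn_integral_mono)
      fix t
      have "nrm X (s n t - r n t) \<le> nrm X (f t - s n t) + nrm X (f t - r n t)"
        using nrm_diff_triangle[of "s n t" "f t" "r n t"] nrm_commute[of "f t" "s n t"] s(2) r(2) fc by auto
      then show "ennreal (nrm X (s n t - r n t)) \<le> ennreal (nrm X (f t - s n t)) + ennreal (nrm X (f t - r n t))"
        using fc s(2) r(2) by (simp flip: ennreal_plus add: ennreal_leI)
    qed
    also have "\<dots> = (\<integral>\<^sup>+t. ennreal (nrm X (f t - s n t)) \<partial>lebesgue) + (\<integral>\<^sup>+t. ennreal (nrm X (f t - r n t)) \<partial>lebesgue)"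
      using meas s r by (intro nn_integral_add) auto
    finally show ?thesis .
  qed
  have "(\<lambda>n. ennreal (nrm X (?I (s n) - ?I (r n)))) \<longlonglongrightarrow> 0"
  proof (rule tendsto_sandwich[OF _ _ tendsto_const])
    show "(\<lambda>n. (\<integral>\<^sup>+t. ennreal (nrm X (f t - s n t)) \<partial>lebesgue) + (\<integral>\<^sup>+t. ennreal (nrm X (f t - r n t)) \<partial>lebesgue)) \<longlonglongrightarrow> 0"
      using tendsto_add[OF s(3) r(3)] by simp
  qed (use le in auto)
  then have d: "(\<lambda>n. nrm X (?I (s n) - ?I (r n))) \<longlonglongrightarrow> 0"
    using s(2) r(2) by (intro tendsto_ennrealD) (auto intro!: always_eventually nrm_ge0 diff_mem Ic)
  have 1: "nlim X (\<lambda>n. ?I (s n)) x" "nlim X (\<lambda>n. ?I (r n)) y"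
    unfolding nlim_def by (intro conjI allI Ic s(2) r(2) s(4) r(4) xy)+
  have "nlim X (\<lambda>n. ?I (s n) - ?I (r n)) 0" unfolding nlim_def using d
    by (auto intro!: diff_mem Ic s(2) r(2))
  then have "nlim X (\<lambda>n. (?I (s n) - ?I (r n)) + ?I (r n)) (0 + y)" by (rule nlim_add) (rule 1)
  then have "nlim X (\<lambda>n. ?I (s n)) y" by simp
  then show ?thesis using nlim_unique[OF 1(1)] by simp
qed

section \<open>Banach function spaces on the line\<close>

lemma ident_borel_measurable_lebesgue [measurable]: "(\<lambda>x. x) \<in> borel_measurable (lebesgue :: real measure)"
  by (rule measurable_completion) simp

lemma interval_indicator_measurable: "indicator {a..b::real} \<in> borel_measurable lebesgue"
  by (intro borel_measurable_indicator) auto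

lemma l0_relD: "l0_rel f f \<longleftrightarrow> f \<in> borel_measurable lebesgue"
  by (simp add: l0_rel_def)

lemma rep_l0_measurable [measurable]: "rep_l0 f \<in> borel_measurable lebesgue"
  using Quotient3_rel_rep[OF Quotient3_l0, of f f] by (simp add: l0_relD)

lemma rep_abs_l0: "f \<in> borel_measurable lebesgue \<Longrightarrow> AE t in lebesgue. rep_l0 (abs_l0 f) t = f t"
  using rep_abs_rsp_left[OF Quotient3_l0, of f f] by (simp add: l0_rel_def)

lemma abs_rep_l0 [simp]: "abs_l0 (rep_l0 f) = f"
  by (rule Quotient3_abs_rep[OF Quotient3_l0])

lemma abs_l0_eqI:
  "f \<in> borel_measurable lebesgue \<Longrightarrow> g \<in> borel_measurable lebesgue \<Longrightarrow> AE t in lebesgue. f t = g t \<Longrightarrow> abs_l0 f = abs_l0 g"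
  using Quotient3_rel_abs[OF Quotient3_l0, of f g] by (simp add: l0_rel_def)

lemma l0_eqI: "AE t in lebesgue. rep_l0 f t = rep_l0 g t \<Longrightarrow> f = g"
  using abs_l0_eqI[of "rep_l0 f" "rep_l0 g"] by simp

lemma rep_l0_zero: "AE t in lebesgue. rep_l0 0 t = 0"
  unfolding zero_l0_def by (simp add: rep_abs_l0)

lemma abs_l0_add: "f \<in> borel_measurable lebesgue \<Longrightarrow> g \<in> borel_measurable lebesgue \<Longrightarrow>
    abs_l0 f + abs_l0 g = abs_l0 (\<lambda>t. f t + g t)"
  by (rule plus_l0.abs_eq) (simp_all add: l0_relD)

lemma abs_l0_diff: "f \<in> borel_measurable lebesgue \<Longrightarrow> g \<in> borel_measurable lebesgue \<Longrightarrow>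
    abs_l0 f - abs_l0 g = abs_l0 (\<lambda>t. f t - g t)"
  by (rule minus_l0.abs_eq) (simp_all add: l0_relD)

lemma abs_l0_scale: "f \<in> borel_measurable lebesgue \<Longrightarrow> c *\<^sub>R abs_l0 f = abs_l0 (\<lambda>t. c * f t)"
  by (rule scaleR_l0.abs_eq) (simp_all add: l0_relD)

lemma abs_l0_zero: "abs_l0 (\<lambda>t. 0) = 0"
  by (simp add: zero_l0_def)

lemma rep_l0_add: "AE t in lebesgue. rep_l0 (f + g) t = rep_l0 f t + rep_l0 g t"
  using rep_abs_l0[of "\<lambda>t. rep_l0 f t + rep_l0 g t"] abs_l0_add[of "rep_l0 f" "rep_l0 g"] by simp

lemma rep_l0_diff: "AE t in lebesgue. rep_l0 (f - g) t = rep_l0 f t - rep_l0 g t"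
  using rep_abs_l0[of "\<lambda>t. rep_l0 f t - rep_l0 g t"] abs_l0_diff[of "rep_l0 f" "rep_l0 g"] by simp

lemma rep_l0_scale: "AE t in lebesgue. rep_l0 (c *\<^sub>R f) t = c * rep_l0 f t"
  using rep_abs_l0[of "\<lambda>t. c * rep_l0 f t"] abs_l0_scale[of "rep_l0 f" c] by simp

lemma rep_l0_sum: "AE t in lebesgue. rep_l0 (sum f {..<n}) t = (\<Sum>i<n. rep_l0 (f i) t)" for n :: nat
proof (induction n)
  case 0
  then show ?case using rep_l0_zero by simp
next
  case (Suc n)
  from rep_l0_add[of "sum f {..<n}" "f n"] Suc.IH show ?case
    by eventually_elim simp
qed

text \<open>This much gives a normed space; \<open>fnorm\<close> adds what completeness rests on.
  The weighted L^1 norm of \<open>compatible_fspace\<close> is interpreted at this level.\<close>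

locale fnorm0 =
  fixes \<sigma> :: "(real \<Rightarrow> ennreal) \<Rightarrow> ennreal"
  assumes zero: "f \<in> borel_measurable lebesgue \<Longrightarrow> \<sigma> f = 0 \<longleftrightarrow> (AE t in lebesgue. f t = 0)"
    and hom: "f \<in> borel_measurable lebesgue \<Longrightarrow> 0 \<le> c \<Longrightarrow> \<sigma> (\<lambda>t. ennreal c * f t) = ennreal c * \<sigma> f"
    and tri: "f \<in> borel_measurable lebesgue \<Longrightarrow> g \<in> borel_measurable lebesgue \<Longrightarrow> \<sigma> (\<lambda>t. f t + g t) \<le> \<sigma> f + \<sigma> g"
    and mono: "f \<in> borel_measurable lebesgue \<Longrightarrow> g \<in> borel_measurable lebesgue \<Longrightarrow>
       (AE t in lebesgue. f t \<le> g t) \<Longrightarrow> \<sigma> f \<le> \<sigma> g"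
begin

lemma cong_AE: "f \<in> borel_measurable lebesgue \<Longrightarrow> g \<in> borel_measurable lebesgue \<Longrightarrow>
    (AE t in lebesgue. f t = g t) \<Longrightarrow> \<sigma> f = \<sigma> g"
  by (intro antisym mono) auto

abbreviation l0norm :: "l0 \<Rightarrow> ennreal" where "l0norm f \<equiv> \<sigma> (\<lambda>t. ennreal \<bar>rep_l0 f t\<bar>)"

lemma l0norm_abs: "f \<in> borel_measurable lebesgue \<Longrightarrow> l0norm (abs_l0 f) = \<sigma> (\<lambda>t. ennreal \<bar>f t\<bar>)"
  using rep_abs_l0[of f] by (intro cong_AE) auto

lemma carr_iff: "f \<in> carr (fspace \<sigma>) \<longleftrightarrow> l0norm f < \<infinity>"
  by (simp add: fspace_def)

lemma nrm_eq: "nrm (fspace \<sigma>) f = enn2real (l0norm f)"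
  by (simp add: fspace_def)

lemma ennreal_nrm: "f \<in> carr (fspace \<sigma>) \<Longrightarrow> ennreal (nrm (fspace \<sigma>) f) = l0norm f"
  by (simp add: carr_iff nrm_eq)

lemma nrm_leI: "l0norm f \<le> ennreal c \<Longrightarrow> 0 \<le> c \<Longrightarrow> f \<in> carr (fspace \<sigma>) \<and> nrm (fspace \<sigma>) f \<le> c"
  by (auto simp: carr_iff nrm_eq order.strict_trans1 enn2real_leI)

lemma l0norm_zero: "l0norm 0 = 0"
  using rep_l0_zero by (subst zero) (auto elim: eventually_mono)

lemma l0norm_scale: "l0norm (c *\<^sub>R f) = ennreal \<bar>c\<bar> * l0norm f"
proof -
  have "l0norm (c *\<^sub>R f) = \<sigma> (\<lambda>t. ennreal \<bar>c\<bar> * ennreal \<bar>rep_l0 f t\<bar>)"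
    using rep_l0_scale[of c f] by (intro cong_AE) (auto elim!: eventually_mono simp: abs_mult ennreal_mult)
  then show ?thesis by (simp add: hom)
qed

lemma l0norm_add: "l0norm (f + g) \<le> l0norm f + l0norm g"
proof -
  have "l0norm (f + g) \<le> \<sigma> (\<lambda>t. ennreal \<bar>rep_l0 f t\<bar> + ennreal \<bar>rep_l0 g t\<bar>)"
    using rep_l0_add[of f g]
    by (intro mono) (auto elim!: eventually_mono simp flip: ennreal_plus intro!: ennreal_leI)
  then show ?thesis using tri[of "\<lambda>t. ennreal \<bar>rep_l0 f t\<bar>" "\<lambda>t. ennreal \<bar>rep_l0 g t\<bar>"] by auto
qed

lemma normed_fspace: "normed_sp (fspace \<sigma>)"
  unfolding normed_sp_def
proof (intro conjI ballI allI)
  show "subspace (carr (fspace \<sigma>))"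
    unfolding subspace_def Ball_def carr_iff l0norm_scale
    by (auto simp: l0norm_zero ennreal_mult_less_top intro!: order.strict_trans1[OF l0norm_add])
  show "nrm (fspace \<sigma>) x = 0 \<longleftrightarrow> x = 0" if "x \<in> carr (fspace \<sigma>)" for x
  proof -
    have "nrm (fspace \<sigma>) x = 0 \<longleftrightarrow> l0norm x = 0"
      using that by (auto simp: nrm_eq carr_iff enn2real_eq_0_iff)
    also have "\<dots> \<longleftrightarrow> (AE t in lebesgue. rep_l0 x t = 0)" by (subst zero) auto
    also have "\<dots> \<longleftrightarrow> x = 0"
    proof
      assume "AE t in lebesgue. rep_l0 x t = 0"
      with rep_l0_zero have "AE t in lebesgue. rep_l0 x t = rep_l0 0 t" by eventually_elim simp
      then show "x = 0" by (rule l0_eqI)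
    qed (simp add: rep_l0_zero)
    finally show ?thesis .
  qed
  show "nrm (fspace \<sigma>) (c *\<^sub>R x) = \<bar>c\<bar> * nrm (fspace \<sigma>) x" for c x
    by (simp add: nrm_eq l0norm_scale enn2real_mult)
  show "nrm (fspace \<sigma>) (x + y) \<le> nrm (fspace \<sigma>) x + nrm (fspace \<sigma>) y"
    if "x \<in> carr (fspace \<sigma>)" "y \<in> carr (fspace \<sigma>)" for x y
  proof -
    have "l0norm (x + y) \<le> ennreal (nrm (fspace \<sigma>) x + nrm (fspace \<sigma>) y)"
      using l0norm_add[of x y] unfolding ennreal_nrm[OF that(1), symmetric] ennreal_nrm[OF that(2), symmetric]
      by (simp add: ennreal_plus nrm_eq del: ennreal_enn2real_if)
    then show ?thesis by (simp add: nrm_eq enn2real_leI)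
  qed
qed (simp add: nrm_eq)

end

locale fnorm = fnorm0 +
  assumes fatou: "(\<And>n::nat. h n \<in> borel_measurable lebesgue) \<Longrightarrow> f \<in> borel_measurable lebesgue \<Longrightarrow>
      (AE t in lebesgue. incseq (\<lambda>n. h n t) \<and> (\<lambda>n. h n t) \<longlonglongrightarrow> f t) \<Longrightarrow> (\<lambda>n. \<sigma> (h n)) \<longlonglongrightarrow> \<sigma> f"
    and loc: "\<exists>K>0. \<forall>f\<in>borel_measurable lebesgue. (\<integral>\<^sup>+t\<in>{- real n..real n}. f t \<partial>lebesgue) \<le> ennreal K * \<sigma> f"
begin

lemma suminf_le:
  assumes [measurable]: "\<And>n. h n \<in> borel_measurable lebesgue"
  shows "\<sigma> (\<lambda>t. \<Sum>n. h n t) \<le> (\<Sum>n. \<sigma> (h n))"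
proof -
  have P: "\<sigma> (\<lambda>t. \<Sum>i<n. h i t) \<le> (\<Sum>i<n. \<sigma> (h i))" for n
  proof (induction n)
    case 0
    then show ?case by (simp add: zero)
  next
    case (Suc n)
    have "\<sigma> (\<lambda>t. \<Sum>i<Suc n. h i t) \<le> \<sigma> (\<lambda>t. \<Sum>i<n. h i t) + \<sigma> (h n)"
      using tri[of "\<lambda>t. \<Sum>i<n. h i t" "h n"] by simp
    then show ?case using Suc by (auto intro: order_trans add_right_mono)
  qed
  have "(\<lambda>n. \<sigma> (\<lambda>t. \<Sum>i<n. h i t)) \<longlonglongrightarrow> \<sigma> (\<lambda>t. \<Sum>n. h n t)"
    by (rule fatou) (auto intro!: incseq_sumI2 summable_LIMSEQ summableI incseq_SucI simp: sum.lessThan_Suc)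
  then show ?thesis
  proof (rule LIMSEQ_le_const2)
    have "\<sigma> (\<lambda>t. \<Sum>i<n. h i t) \<le> (\<Sum>n. \<sigma> (h n))" for n
      using P[of n] by (rule order_trans) (intro sum_le_suminf summableI; simp)
    then show "\<exists>N. \<forall>n\<ge>N. \<sigma> (\<lambda>t. \<Sum>i<n. h i t) \<le> (\<Sum>n. \<sigma> (h n))" by blast
  qed
qed

lemma finite_AE:
  assumes [measurable]: "f \<in> borel_measurable lebesgue" and fin: "\<sigma> f < \<infinity>"
  shows "AE t in lebesgue. f t < \<infinity>"
proof -
  have "AE t in lebesgue. f t * indicator {- real n..real n} t \<noteq> \<infinity>" for n
  proof (rule nn_integral_PInf_AE)
    obtain K where "(\<integral>\<^sup>+t\<in>{- real n..real n}. f t \<partial>lebesgue) \<le> ennreal K * \<sigma> f" using loc[of n] assms(1) by blast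
    also have "\<dots> < \<infinity>" using fin by (simp add: ennreal_mult_less_top)
    finally show "(\<integral>\<^sup>+t\<in>{- real n..real n}. f t \<partial>lebesgue) \<noteq> \<infinity>" by simp
  qed measurable
  then have "AE t in lebesgue. \<forall>n. f t * indicator {- real n..real n} t \<noteq> \<infinity>" by (simp add: AE_all_countable)
  then show ?thesis
  proof eventually_elim
    case (elim t)
    obtain n where "\<bar>t\<bar> \<le> real n" using real_arch_simple by blast
    then have "t \<in> {- real n..real n}" by auto
    then show ?case using elim[rule_format, of n] by (simp add: less_top)
  qed
qed

text \<open>Riesz-Fischer. Countable subadditivity bounds the norm of the sum of the absolute
  values, \<open>finite_AE\<close> makes that sum finite almost everywhere, and the same bound
  applied to tails gives convergence in norm.\<close>

lemma banach_fspace: "banach_sp (fspace \<sigma>)"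
proof (rule banach_spI[OF normed_fspace])
  fix d assume dc: "\<And>n. d n \<in> carr (fspace \<sigma>)" and dn: "\<And>n. nrm (fspace \<sigma>) (d n) \<le> (1/2)^n"
  interpret nsp "fspace \<sigma>" by standard (rule normed_fspace)
  define g where "g n = rep_l0 (d n)" for n
  have [measurable]: "g n \<in> borel_measurable lebesgue" for n by (simp add: g_def)
  have dl: "\<sigma> (\<lambda>t. ennreal \<bar>g n t\<bar>) \<le> ennreal ((1/2)^n)" for n
    unfolding g_def using ennreal_nrm[OF dc, of n] ennreal_leI[OF dn, of n] by simp
  have R: "\<sigma> (\<lambda>t. \<Sum>i. ennreal \<bar>g (i + k) t\<bar>) \<le> ennreal (2 * (1/2)^k)" for k
  proof -
    have "\<sigma> (\<lambda>t. \<Sum>i. ennreal \<bar>g (i + k) t\<bar>) \<le> (\<Sum>i. \<sigma> (\<lambda>t. ennreal \<bar>g (i + k) t\<bar>))"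
      by (rule suminf_le) simp
    also have "\<dots> \<le> (\<Sum>i. ennreal ((1/2)^(i + k)))"
      by (rule Series.suminf_le[OF dl]) (auto intro: summableI)
    also have "\<dots> = ennreal (2 * (1/2)^k)"
    proof (rule suminf_ennreal_eq)
      show "(\<lambda>i. (1/2)^(i + k)) sums (2 * (1/2::real)^k)"
        using sums_mult2[OF geometric_sums[of "1/2::real"], of "(1/2)^k"] by (simp add: power_add)
    qed simp
    finally show ?thesis .
  qed
  have "AE t in lebesgue. (\<Sum>i. ennreal \<bar>g (i + 0) t\<bar>) < \<infinity>"
    by (rule finite_AE) (use R[of 0] in \<open>auto intro: order.strict_trans1\<close>)
  then have sm: "AE t in lebesgue. summable (\<lambda>i. \<bar>g i t\<bar>)"
    by eventually_elim (auto intro: summable_suminf_not_top)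
  define s where "s t = (\<Sum>i. g i t)" for t
  have [measurable]: "s \<in> borel_measurable lebesgue" unfolding s_def by measurable
  have le: "l0norm (sum d {..<n} - abs_l0 s) \<le> ennreal (2 * (1/2)^n)" for n
  proof -
    have "l0norm (sum d {..<n} - abs_l0 s) \<le> \<sigma> (\<lambda>t. \<Sum>i. ennreal \<bar>g (i + n) t\<bar>)"
    proof (rule mono)
      show "AE t in lebesgue. ennreal \<bar>rep_l0 (sum d {..<n} - abs_l0 s) t\<bar> \<le> (\<Sum>i. ennreal \<bar>g (i + n) t\<bar>)"
        using sm rep_l0_diff[of "sum d {..<n}" "abs_l0 s"] rep_l0_sum[of d n] rep_abs_l0[of s, simplified]
      proof eventually_elim
        case (elim t)
        have sg: "summable (\<lambda>i. g i t)" using elim(1) by (rule summable_rabs_cancel)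
        have sn: "summable (\<lambda>i. \<bar>g (i + n) t\<bar>)" using elim(1) by (subst summable_iff_shift)
        have "rep_l0 (sum d {..<n} - abs_l0 s) t = - (\<Sum>i. g (i + n) t)"
          using elim suminf_split_initial_segment[OF sg, of n] by (simp add: g_def s_def)
        then have "\<bar>rep_l0 (sum d {..<n} - abs_l0 s) t\<bar> \<le> (\<Sum>i. \<bar>g (i + n) t\<bar>)"
          using summable_rabs[OF sn] by simp
        then show ?case using sn by (subst suminf_ennreal2) (auto intro: ennreal_leI)
      qed
    qed auto
    then show ?thesis using R[of n] by (rule order_trans)
  qed
  have diff: "sum d {..<n} - abs_l0 s \<in> carr (fspace \<sigma>)" "nrm (fspace \<sigma>) (sum d {..<n} - abs_l0 s) \<le> 2 * (1/2)^n" for n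
    using nrm_leI[OF le[of n]] by auto
  have sc: "abs_l0 s \<in> carr (fspace \<sigma>)"
    using minus_mem[OF diff(1)[of 0]] by simp
  have "nlim (fspace \<sigma>) (\<lambda>n. sum d {..<n}) (abs_l0 s)"
  proof (rule nlimI_le[OF _ sc diff(2)])
    have "(\<lambda>n. 2 * (1/2)^n) \<longlonglongrightarrow> (2 * 0 :: real)" by (intro tendsto_intros LIMSEQ_power_zero) auto
    then show "(\<lambda>n. 2 * (1/2)^n) \<longlonglongrightarrow> (0 :: real)" by simp
  qed (use dc in auto)
  then show "\<exists>x. nsums (fspace \<sigma>) d x" using dc by (auto simp: nsums_def)
qed

end

text \<open>
  Both spaces embed into a weighted \<open>L\<^sup>1\<close> space, whose positive weight on \<open>[-n, n]\<close> is small
  compared with the constants of the local embeddings into \<open>L\<^sup>1\<close>.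
\<close>

lemma compatible_fspace:
  assumes "fnorm \<sigma>0" "fnorm \<sigma>1"
  shows "compatible_couple (fspace \<sigma>0, fspace \<sigma>1)"
proof -
  interpret s0: fnorm \<sigma>0 by fact
  interpret s1: fnorm \<sigma>1 by fact
  obtain K0 where K0: "\<And>n. K0 n > 0"
    "\<And>n f. f \<in> borel_measurable lebesgue \<Longrightarrow> (\<integral>\<^sup>+t\<in>{- real n..real n}. f t \<partial>lebesgue) \<le> ennreal (K0 n) * \<sigma>0 f"
    using s0.loc by metis
  obtain K1 where K1: "\<And>n. K1 n > 0"
    "\<And>n f. f \<in> borel_measurable lebesgue \<Longrightarrow> (\<integral>\<^sup>+t\<in>{- real n..real n}. f t \<partial>lebesgue) \<le> ennreal (K1 n) * \<sigma>1 f"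
    using s1.loc by metis
  define K where "K n = max (K0 n) (K1 n)" for n
  have K: "K n > 0" for n using K0(1)[of n] by (simp add: K_def less_max_iff_disj)
  \<comment> \<open>Cancels the embedding constant of \<open>[-n, n]\<close>: the
    \<open>n\<close>-th layer of the weight contributes at most \<open>(1/2)^n\<close> times the
    norm, hence the constant 2 below.\<close>
  define q where "q n = (1/2)^n / K n" for n
  have q: "q n > 0" for n using K[of n] by (simp add: q_def)
  define w where "w t = (\<Sum>n. ennreal (q n) * indicator {- real n..real n} t)" for t
  have [measurable]: "w \<in> borel_measurable lebesgue" unfolding w_def by measurable
  have w: "w t \<noteq> 0" for t
  proof -
    obtain n where "\<bar>t\<bar> \<le> real n" using real_arch_simple by blast
    then have "t \<in> {- real n..real n}" by auto
    then have "ennreal (q n) * indicator {- real n..real n} t \<noteq> 0" using q[of n] by simp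
    then show ?thesis unfolding w_def by (subst suminf_eq_zero_iff) (auto intro: summableI)
  qed
  define L where "L f = (\<integral>\<^sup>+t. f t * w t \<partial>lebesgue)" for f :: "real \<Rightarrow> ennreal"
  have L_le: "L f \<le> 2 * S" if [measurable]: "f \<in> borel_measurable lebesgue"
    and S: "\<And>n. (\<integral>\<^sup>+t\<in>{- real n..real n}. f t \<partial>lebesgue) \<le> ennreal (K n) * S" for f S
  proof -
    have half: "(\<lambda>n. (1/2)^n) sums (2::real)" using geometric_sums[of "1/2::real"] by simp
    have "(\<Sum>n. ennreal ((1/2)^n)) = ennreal 2"
      by (rule suminf_ennreal_eq[OF _ half]) simp
    then have last: "(\<Sum>n. ennreal ((1/2)^n) * S) = ennreal 2 * S"
      unfolding ennreal_suminf_multc by (rule arg_cong)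
    have "L f = (\<integral>\<^sup>+t. (\<Sum>n. ennreal (q n) * (f t * indicator {- real n..real n} t)) \<partial>lebesgue)"
      unfolding L_def w_def by (simp only: ennreal_suminf_cmult[symmetric] mult_ac)
    also have "\<dots> = (\<Sum>n. ennreal (q n) * (\<integral>\<^sup>+t\<in>{- real n..real n}. f t \<partial>lebesgue))"
      by (subst nn_integral_suminf) (auto simp: nn_integral_cmult)
    also have "\<dots> \<le> (\<Sum>n. ennreal ((1/2)^n) * S)"
    proof (intro suminf_le summableI)
      fix n
      have "ennreal (q n) * (\<integral>\<^sup>+t\<in>{- real n..real n}. f t \<partial>lebesgue) \<le> ennreal (q n) * (ennreal (K n) * S)"
        by (intro mult_left_mono S) auto
      also have "\<dots> = ennreal ((1/2)^n) * S"
        using K[of n] q[of n] by (simp add: mult.assoc[symmetric] ennreal_mult[symmetric] less_imp_le) (simp add: q_def)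
      finally show "ennreal (q n) * (\<integral>\<^sup>+t\<in>{- real n..real n}. f t \<partial>lebesgue) \<le> ennreal ((1/2)^n) * S" .
    qed
    also note last
    finally show ?thesis by simp
  qed
  have L0: "L f \<le> 2 * \<sigma>0 f" if f: "f \<in> borel_measurable lebesgue" for f
  proof (rule L_le[OF f])
    show "(\<integral>\<^sup>+t\<in>{- real n..real n}. f t \<partial>lebesgue) \<le> ennreal (K n) * \<sigma>0 f" for n
      using K0(2)[OF f, of n] by (rule order_trans) (auto simp: K_def intro!: mult_right_mono ennreal_leI)
  qed
  have L1: "L f \<le> 2 * \<sigma>1 f" if f: "f \<in> borel_measurable lebesgue" for f
  proof (rule L_le[OF f])
    show "(\<integral>\<^sup>+t\<in>{- real n..real n}. f t \<partial>lebesgue) \<le> ennreal (K n) * \<sigma>1 f" for n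
      using K1(2)[OF f, of n] by (rule order_trans) (auto simp: K_def intro!: mult_right_mono ennreal_leI)
  qed
  interpret L: fnorm0 L
  proof
    fix f :: "real \<Rightarrow> ennreal" assume [measurable]: "f \<in> borel_measurable lebesgue"
    show "L f = 0 \<longleftrightarrow> (AE t in lebesgue. f t = 0)"
      unfolding L_def by (subst nn_integral_0_iff_AE) (auto simp: w)
    show "L (\<lambda>t. ennreal c * f t) = ennreal c * L f" for c
      unfolding L_def by (simp add: mult.assoc nn_integral_cmult)
    fix g :: "real \<Rightarrow> ennreal" assume [measurable]: "g \<in> borel_measurable lebesgue"
    show "L (\<lambda>t. f t + g t) \<le> L f + L g"
      unfolding L_def by (simp add: distrib_right nn_integral_add)
    show "L f \<le> L g" if "AE t in lebesgue. f t \<le> g t"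
      unfolding L_def using that by (intro nn_integral_mono_AE) (auto elim!: eventually_mono intro: mult_right_mono)
  qed
  interpret LN: nsp "fspace L" by standard (rule L.normed_fspace)
  have emb: "continuous_map (ntop (fspace \<sigma>)) (ntop (fspace L)) (\<lambda>x. x)"
    if s: "fnorm0 \<sigma>" and le: "\<And>f. f \<in> borel_measurable lebesgue \<Longrightarrow> L f \<le> 2 * \<sigma> f" for \<sigma>
  proof -
    interpret s: fnorm0 \<sigma> by fact
    have *: "f \<in> carr (fspace L) \<and> nrm (fspace L) f \<le> 2 * nrm (fspace \<sigma>) f" if f: "f \<in> carr (fspace \<sigma>)" for f
    proof (rule L.nrm_leI)
      have "L (\<lambda>t. ennreal \<bar>rep_l0 f t\<bar>) \<le> 2 * ennreal (nrm (fspace \<sigma>) f)"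
        using le[of "\<lambda>t. ennreal \<bar>rep_l0 f t\<bar>"] by (simp add: s.ennreal_nrm[OF f])
      then show "L (\<lambda>t. ennreal \<bar>rep_l0 f t\<bar>) \<le> ennreal (2 * nrm (fspace \<sigma>) f)"
        by (simp add: ennreal_mult s.nrm_eq)
    qed (simp add: s.nrm_eq)
    show ?thesis
      by (rule continuous_map_ntop[OF s.normed_fspace L.normed_fspace]) (use * in auto)
  qed
  show ?thesis
    unfolding compatible_couple_def fst_conv snd_conv
    using s0.banach_fspace s1.banach_fspace LN.hausdorff_tvs_ntop
      emb[OF s0.fnorm0_axioms L0] emb[OF s1.fnorm0_axioms L1] by blast
qed

lemma nn_integral_monotone_limit_AE:
  fixes h :: "nat \<Rightarrow> 'm \<Rightarrow> ennreal"
  assumes [measurable]: "\<And>n. h n \<in> borel_measurable M" "f \<in> borel_measurable M" "g \<in> borel_measurable M"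
    and lim: "AE t in M. incseq (\<lambda>n. h n t) \<and> (\<lambda>n. h n t) \<longlonglongrightarrow> f t"
  shows "incseq (\<lambda>n. \<integral>\<^sup>+t. g t * h n t \<partial>M)" "(SUP n. \<integral>\<^sup>+t. g t * h n t \<partial>M) = (\<integral>\<^sup>+t. g t * f t \<partial>M)"
proof -
  have step: "AE t in M. g t * h n t \<le> g t * h (Suc n) t" for n
    using lim by eventually_elim (auto intro: mult_left_mono incseq_SucD)
  show "incseq (\<lambda>n. \<integral>\<^sup>+t. g t * h n t \<partial>M)"
    by (intro incseq_SucI nn_integral_mono_AE step)
  have "(SUP n. \<integral>\<^sup>+t. g t * h n t \<partial>M) = (\<integral>\<^sup>+t. (SUP n. g t * h n t) \<partial>M)"
    by (rule nn_integral_monotone_convergence_SUP_AE[symmetric]) (auto intro: step)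
  also have "\<dots> = (\<integral>\<^sup>+t. g t * f t \<partial>M)"
  proof (rule nn_integral_cong_AE)
    show "AE t in M. (SUP n. g t * h n t) = g t * f t"
      using lim
    proof eventually_elim
      case (elim t)
      then have "f t = (SUP n. h n t)" using LIMSEQ_unique LIMSEQ_SUP by blast
      then show ?case by (simp add: SUP_mult_left_ennreal)
    qed
  qed
  finally show "(SUP n. \<integral>\<^sup>+t. g t * h n t \<partial>M) = (\<integral>\<^sup>+t. g t * f t \<partial>M)" .
qed

lemma fnorm_L1: "fnorm (\<lambda>f. \<integral>\<^sup>+t. f t \<partial>lebesgue)"
proof
  fix f :: "real \<Rightarrow> ennreal" assume f[measurable]: "f \<in> borel_measurable lebesgue"
  show "(\<integral>\<^sup>+t. f t \<partial>lebesgue) = 0 \<longleftrightarrow> (AE t in lebesgue. f t = 0)" by (rule nn_integral_0_iff_AE) simp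
  show "(\<integral>\<^sup>+t. ennreal c * f t \<partial>lebesgue) = ennreal c * (\<integral>\<^sup>+t. f t \<partial>lebesgue)" for c
    by (simp add: nn_integral_cmult)
  show "(\<lambda>n. \<integral>\<^sup>+t. h n t \<partial>lebesgue) \<longlonglongrightarrow> (\<integral>\<^sup>+t. f t \<partial>lebesgue)"
    if "\<And>n::nat. h n \<in> borel_measurable lebesgue" "AE t in lebesgue. incseq (\<lambda>n. h n t) \<and> (\<lambda>n. h n t) \<longlonglongrightarrow> f t" for h
    using nn_integral_monotone_limit_AE[where h = h and M = lebesgue and f = f and g = "\<lambda>_. 1"] that LIMSEQ_SUP[of "\<lambda>n. \<integral>\<^sup>+t. h n t \<partial>lebesgue"] by simp
  fix g :: "real \<Rightarrow> ennreal" assume [measurable]: "g \<in> borel_measurable lebesgue"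
  show "(\<integral>\<^sup>+t. f t + g t \<partial>lebesgue) \<le> (\<integral>\<^sup>+t. f t \<partial>lebesgue) + (\<integral>\<^sup>+t. g t \<partial>lebesgue)"
    by (simp add: nn_integral_add)
  show "(\<integral>\<^sup>+t. f t \<partial>lebesgue) \<le> (\<integral>\<^sup>+t. g t \<partial>lebesgue)" if "AE t in lebesgue. f t \<le> g t"
    using that by (rule nn_integral_mono_AE)
next
  show "\<exists>K>0. \<forall>f\<in>borel_measurable lebesgue. (\<integral>\<^sup>+t\<in>{- real n..real n}. f t \<partial>lebesgue) \<le> ennreal K * (\<integral>\<^sup>+t. f t \<partial>lebesgue)" for n
    by (intro exI[of _ 1]) (auto intro!: nn_integral_mono split: split_indicator)
qed

lemma esssup_le_iff:
  fixes f :: "real \<Rightarrow> ennreal"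
  assumes "f \<in> borel_measurable lebesgue"
  shows "esssup lebesgue f \<le> z \<longleftrightarrow> (AE t in lebesgue. f t \<le> z)"
  using esssup_AE[where M = lebesgue and f = f] esssup_I[OF assms, of z] by (auto elim!: eventually_mono intro: order_trans)

lemma fnorm_esssup: "fnorm (esssup lebesgue)"
proof
  fix f :: "real \<Rightarrow> ennreal" assume f[measurable]: "f \<in> borel_measurable lebesgue"
  show "esssup lebesgue f = 0 \<longleftrightarrow> (AE t in lebesgue. f t = 0)"
    using esssup_le_iff[OF f, of 0] by simp
  have le: "esssup lebesgue (\<lambda>t. ennreal c * g t) \<le> ennreal c * esssup lebesgue g"
    if [measurable]: "g \<in> borel_measurable lebesgue" for c and g :: "real \<Rightarrow> ennreal"
    using esssup_AE[where M = lebesgue and f = g] by (subst esssup_le_iff) (auto elim!: eventually_mono intro: mult_left_mono)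
  show "esssup lebesgue (\<lambda>t. ennreal c * f t) = ennreal c * esssup lebesgue f" if c: "0 \<le> c" for c
  proof (cases "c = 0")
    case True
    then show ?thesis using esssup_le_iff[of "\<lambda>_. 0" 0] by simp
  next
    case False
    then have i: "ennreal c * ennreal (1 / c) = 1" using c by (simp add: ennreal_mult[symmetric])
    have "esssup lebesgue (\<lambda>t. ennreal (1 / c) * (ennreal c * f t)) \<le> ennreal (1 / c) * esssup lebesgue (\<lambda>t. ennreal c * f t)"
      by (rule le) simp
    then have "esssup lebesgue f \<le> ennreal (1 / c) * esssup lebesgue (\<lambda>t. ennreal c * f t)"
      by (simp add: mult.assoc[symmetric] mult.commute[of "ennreal (1 / c)"] i)
    then have "ennreal c * esssup lebesgue f \<le> ennreal c * (ennreal (1 / c) * esssup lebesgue (\<lambda>t. ennreal c * f t))"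
      by (intro mult_left_mono) auto
    then show ?thesis using le[OF f, of c] by (intro antisym) (simp_all add: mult.assoc[symmetric] i)
  qed
  show "(\<lambda>n. esssup lebesgue (h n)) \<longlonglongrightarrow> esssup lebesgue f"
    if h[measurable]: "\<And>n::nat. h n \<in> borel_measurable lebesgue"
    and lim: "AE t in lebesgue. incseq (\<lambda>n. h n t) \<and> (\<lambda>n. h n t) \<longlonglongrightarrow> f t" for h
  proof -
    have inc: "incseq (\<lambda>n. esssup lebesgue (h n))"
    proof (intro incseq_SucI esssup_AE_mono h)
      show "AE t in lebesgue. h n t \<le> h (Suc n) t" for n using lim by eventually_elim (drule conjunct1, erule incseq_SucD)
    qed
    have up: "esssup lebesgue (h n) \<le> esssup lebesgue f" for n
    proof (rule esssup_AE_mono[OF h])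
      show "AE t in lebesgue. h n t \<le> f t" using lim by eventually_elim (erule conjE, erule (1) incseq_le)
    qed
    have "AE t in lebesgue. \<forall>n. h n t \<le> esssup lebesgue (h n)"
      unfolding AE_all_countable by (auto intro: esssup_AE)
    with lim have "AE t in lebesgue. f t \<le> (SUP n. esssup lebesgue (h n))"
    proof eventually_elim
      case (elim t)
      then have "h n t \<le> (SUP n. esssup lebesgue (h n))" for n
        by (meson SUP_upper UNIV_I order_trans)
      then show ?case using elim(1) by (auto intro: LIMSEQ_le_const2)
    qed
    then have "esssup lebesgue f \<le> (SUP n. esssup lebesgue (h n))" by (simp add: esssup_le_iff)
    then have "esssup lebesgue f = (SUP n. esssup lebesgue (h n))" using up by (intro antisym SUP_least)
    then show ?thesis using LIMSEQ_SUP[OF inc] by simp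
  qed
  fix g :: "real \<Rightarrow> ennreal" assume g[measurable]: "g \<in> borel_measurable lebesgue"
  show "esssup lebesgue (\<lambda>t. f t + g t) \<le> esssup lebesgue f + esssup lebesgue g"
  proof (subst esssup_le_iff)
    show "AE t in lebesgue. f t + g t \<le> esssup lebesgue f + esssup lebesgue g"
      using esssup_AE[where M = lebesgue and f = f] esssup_AE[where M = lebesgue and f = g] by eventually_elim (rule add_mono)
  qed simp
  show "esssup lebesgue f \<le> esssup lebesgue g" if "AE t in lebesgue. f t \<le> g t"
    using that by (rule esssup_AE_mono[OF f])
next
  show "\<exists>K>0. \<forall>f\<in>borel_measurable lebesgue. (\<integral>\<^sup>+t\<in>{- real n..real n}. f t \<partial>lebesgue) \<le> ennreal K * esssup lebesgue f" for n
  \<comment> \<open>The interval has length \<open>2 * n\<close>; adding 1 keeps the constant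
    positive at \<open>n = 0\<close>.\<close>
  proof (intro exI[of _ "2 * real n + 1"] conjI ballI)
    fix f :: "real \<Rightarrow> ennreal" assume f[measurable]: "f \<in> borel_measurable lebesgue"
    have "(\<integral>\<^sup>+t\<in>{- real n..real n}. f t \<partial>lebesgue) \<le> (\<integral>\<^sup>+t. esssup lebesgue f * indicator {- real n..real n} t \<partial>lebesgue)"
      using esssup_AE[where M = lebesgue and f = f] by (intro nn_integral_mono_AE) (auto elim!: eventually_mono intro: mult_right_mono)
    also have "\<dots> = ennreal (2 * real n) * esssup lebesgue f"
      by (simp add: nn_integral_cmult mult.commute)
    also have "\<dots> \<le> ennreal (2 * real n + 1) * esssup lebesgue f" by (intro mult_right_mono ennreal_leI) auto
    finally show "(\<integral>\<^sup>+t\<in>{- real n..real n}. f t \<partial>lebesgue) \<le> ennreal (2 * real n + 1) * esssup lebesgue f" .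
  qed simp
qed

section \<open>Rearrangement invariant norms and their associate norms\<close>

locale ri =
  fixes \<rho> :: "(real \<Rightarrow> ennreal) \<Rightarrow> ennreal"
  assumes ri: "ri_norm \<rho>"
begin

sublocale fnorm \<rho>
proof
  have r: "\<And>f. f\<in>borel_measurable lebesgue \<Longrightarrow> \<rho> f = 0 \<longleftrightarrow> (AE t in lebesgue. f t = 0)"
    "\<And>f c. f\<in>borel_measurable lebesgue \<Longrightarrow> c \<ge> 0 \<Longrightarrow> \<rho> (\<lambda>t. ennreal c * f t) = ennreal c * \<rho> f"
    "\<And>f g. f\<in>borel_measurable lebesgue \<Longrightarrow> g\<in>borel_measurable lebesgue \<Longrightarrow> \<rho> (\<lambda>t. f t + g t) \<le> \<rho> f + \<rho> g"
    "\<And>f g. f\<in>borel_measurable lebesgue \<Longrightarrow> g\<in>borel_measurable lebesgue \<Longrightarrow> (AE t in lebesgue. f t \<le> g t) \<Longrightarrow> \<rho> f \<le> \<rho> g"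
    "\<And>h f. (\<And>n::nat. h n \<in> borel_measurable lebesgue) \<Longrightarrow> f \<in> borel_measurable lebesgue \<Longrightarrow>
        (AE t in lebesgue. incseq (\<lambda>n. h n t) \<and> (\<lambda>n. h n t) \<longlonglongrightarrow> f t) \<Longrightarrow> (\<lambda>n. \<rho> (h n)) \<longlonglongrightarrow> \<rho> f"
    "\<And>A. A\<in>sets lebesgue \<Longrightarrow> emeasure lebesgue A < \<infinity> \<Longrightarrow>
        (\<exists>K>0. \<forall>f\<in>borel_measurable lebesgue. (\<integral>\<^sup>+t\<in>A. f t \<partial>lebesgue) \<le> ennreal K * \<rho> f)"
    using ri unfolding ri_norm_def by blast+
  show "\<And>f. f\<in>borel_measurable lebesgue \<Longrightarrow> \<rho> f = 0 \<longleftrightarrow> (AE t in lebesgue. f t = 0)" by (rule r)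
  show "\<And>f c. f\<in>borel_measurable lebesgue \<Longrightarrow> 0 \<le> c \<Longrightarrow> \<rho> (\<lambda>t. ennreal c * f t) = ennreal c * \<rho> f" by (rule r)
  show "\<And>f g. f\<in>borel_measurable lebesgue \<Longrightarrow> g\<in>borel_measurable lebesgue \<Longrightarrow> \<rho> (\<lambda>t. f t + g t) \<le> \<rho> f + \<rho> g" by (rule r)
  show "\<And>f g. f\<in>borel_measurable lebesgue \<Longrightarrow> g\<in>borel_measurable lebesgue \<Longrightarrow> (AE t in lebesgue. f t \<le> g t) \<Longrightarrow> \<rho> f \<le> \<rho> g" by (rule r)
  show "\<And>h f. (\<And>n::nat. h n \<in> borel_measurable lebesgue) \<Longrightarrow> f \<in> borel_measurable lebesgue \<Longrightarrow>
        (AE t in lebesgue. incseq (\<lambda>n. h n t) \<and> (\<lambda>n. h n t) \<longlonglongrightarrow> f t) \<Longrightarrow> (\<lambda>n. \<rho> (h n)) \<longlonglongrightarrow> \<rho> f" by (rule r)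
  show "\<exists>K>0. \<forall>f\<in>borel_measurable lebesgue. (\<integral>\<^sup>+t\<in>{- real n..real n}. f t \<partial>lebesgue) \<le> ennreal K * \<rho> f" for n
    by (rule r) auto
qed

lemma indicator_finite: "A \<in> sets lebesgue \<Longrightarrow> emeasure lebesgue A < \<infinity> \<Longrightarrow> \<rho> (indicator A) < \<infinity>"
  using ri unfolding ri_norm_def by blast

lemma equimeasurable:
  "f \<in> borel_measurable lebesgue \<Longrightarrow> g \<in> borel_measurable lebesgue \<Longrightarrow>
    (\<And>s. emeasure lebesgue {t. s < f t} = emeasure lebesgue {t. s < g t}) \<Longrightarrow> \<rho> f = \<rho> g"
  using ri unfolding ri_norm_def by blast

text \<open>Translations and reflections preserve the measure of level sets. Rearrangement
  invariance enters the proof in this form.\<close>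

lemma affine:
  assumes f[measurable]: "f \<in> borel_measurable lborel" and c: "\<bar>c\<bar> = 1"
  shows "\<rho> (\<lambda>t. f (a + c * t)) = \<rho> f"
proof (rule equimeasurable)
  have c0: "c \<noteq> 0" using c by auto
  show "(\<lambda>t. f (a + c * t)) \<in> borel_measurable lebesgue" "f \<in> borel_measurable lebesgue"
    by (auto intro!: measurable_completion)
  fix s
  have "emeasure lborel {t. s < f t} = (\<integral>\<^sup>+t. indicator {t. s < f t} t \<partial>lborel)" by simp
  also have "\<dots> = (\<integral>\<^sup>+t. indicator {t. s < f t} (a + c * t) \<partial>lborel)"
    by (subst nn_integral_real_affine[OF _ c0, of _ a]) (auto simp: c)
  also have "\<dots> = (\<integral>\<^sup>+t. indicator {t. s < f (a + c * t)} t \<partial>lborel)"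
    by (intro nn_integral_cong) (auto split: split_indicator)
  also have "\<dots> = emeasure lborel {t. s < f (a + c * t)}" by simp
  finally show "emeasure lebesgue {t. s < f (a + c * t)} = emeasure lebesgue {t. s < f t}"
    by simp
qed

text \<open>Hoelder's inequality by normalising \<open>f\<close>. The case
  \<open>\<rho> f = 0\<close> is separate: normalising is impossible, but \<open>f\<close> vanishes
  almost everywhere and both sides are 0 even if the associate norm is infinite.\<close>

lemma assoc_le:
  assumes f: "f \<in> borel_measurable lebesgue" and g: "g \<in> borel_measurable lebesgue" and fin: "\<rho> f < \<infinity>"
  shows "(\<integral>\<^sup>+t. f t * g t \<partial>lebesgue) \<le> \<rho> f * assoc_norm \<rho> g"
proof (cases "\<rho> f = 0")
  case True
  then have "AE t in lebesgue. f t = 0" using f by (simp add: zero)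
  then have "(\<integral>\<^sup>+t. f t * g t \<partial>lebesgue) = (\<integral>\<^sup>+t. 0 \<partial>(lebesgue :: real measure))" by (intro nn_integral_cong_AE) auto
  then show ?thesis by simp
next
  case False
  obtain r where r: "\<rho> f = ennreal r" "0 < r"
    using fin False by (cases "\<rho> f") (auto simp: ennreal_zero_less_top)
  have i: "ennreal r * ennreal (1 / r) = 1" using r by (simp add: ennreal_mult[symmetric])
  have "\<rho> (\<lambda>t. ennreal (1 / r) * f t) = ennreal (1 / r) * ennreal r" using r f by (simp add: hom)
  then have "\<rho> (\<lambda>t. ennreal (1 / r) * f t) \<le> 1" using i by (simp add: mult.commute)
  then have "(\<integral>\<^sup>+t. (ennreal (1 / r) * f t) * g t \<partial>lebesgue) \<le> assoc_norm \<rho> g"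
    unfolding assoc_norm_def using f by (intro SUP_upper) auto
  then have "ennreal (1 / r) * (\<integral>\<^sup>+t. f t * g t \<partial>lebesgue) \<le> assoc_norm \<rho> g"
    using f g by (simp add: mult.assoc nn_integral_cmult)
  then have "ennreal r * (ennreal (1 / r) * (\<integral>\<^sup>+t. f t * g t \<partial>lebesgue)) \<le> ennreal r * assoc_norm \<rho> g"
    by (intro mult_left_mono) auto
  then show ?thesis by (simp add: mult.assoc[symmetric] i r)
qed

lemma fnorm_assoc: "fnorm (assoc_norm \<rho>)"
proof
  let ?U = "{f \<in> borel_measurable lebesgue. \<rho> f \<le> 1}"
  \<comment> \<open>Hoelder's inequality against the indicator of \<open>[-n, n]\<close>, whose norm
    is finite. Definiteness of the associate norm below follows from this as well.\<close>
  have local: "\<exists>K>0. \<forall>g\<in>borel_measurable lebesgue. (\<integral>\<^sup>+t\<in>{- real n..real n}. g t \<partial>lebesgue) \<le> ennreal K * assoc_norm \<rho> g" for n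
  proof -
    have fin: "\<rho> (indicator {- real n..real n}) < \<infinity>" by (rule indicator_finite) auto
    then obtain r where r: "\<rho> (indicator {- real n..real n}) = ennreal r" "0 \<le> r"
      by (cases "\<rho> (indicator {- real n..real n})") auto
    show ?thesis
    proof (intro exI[of _ "r + 1"] conjI ballI)
      fix g :: "real \<Rightarrow> ennreal" assume g: "g \<in> borel_measurable lebesgue"
      have "(\<integral>\<^sup>+t\<in>{- real n..real n}. g t \<partial>lebesgue) \<le> ennreal r * assoc_norm \<rho> g"
        using assoc_le[OF interval_indicator_measurable g fin] by (simp add: r mult.commute)
      also have "\<dots> \<le> ennreal (r + 1) * assoc_norm \<rho> g" by (intro mult_right_mono ennreal_leI) auto
      finally show "(\<integral>\<^sup>+t\<in>{- real n..real n}. g t \<partial>lebesgue) \<le> ennreal (r + 1) * assoc_norm \<rho> g" .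
    qed (use r in simp)
  qed
  then show "\<exists>K>0. \<forall>g\<in>borel_measurable lebesgue. (\<integral>\<^sup>+t\<in>{- real n..real n}. g t \<partial>lebesgue) \<le> ennreal K * assoc_norm \<rho> g" for n .
  fix g :: "real \<Rightarrow> ennreal" assume g[measurable]: "g \<in> borel_measurable lebesgue"
  show "assoc_norm \<rho> g = 0 \<longleftrightarrow> (AE t in lebesgue. g t = 0)"
  proof
    assume 0: "assoc_norm \<rho> g = 0"
    have "AE t in lebesgue. g t * indicator {- real n..real n} t = 0" for n
    proof -
      obtain K where "(\<integral>\<^sup>+t\<in>{- real n..real n}. g t \<partial>lebesgue) \<le> ennreal K * assoc_norm \<rho> g" using local[of n] g by blast
      then have "(\<integral>\<^sup>+t\<in>{- real n..real n}. g t \<partial>lebesgue) = 0" using 0 by simp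
      then show ?thesis by (subst (asm) nn_integral_0_iff_AE) auto
    qed
    then have "AE t in lebesgue. \<forall>n. g t * indicator {- real n..real n} t = 0" unfolding AE_all_countable ..
    then show "AE t in lebesgue. g t = 0"
    proof eventually_elim
      case (elim t)
      obtain n where "\<bar>t\<bar> \<le> real n" using real_arch_simple by blast
      then have "t \<in> {- real n..real n}" by auto
      then show ?case using elim[rule_format, of n] by simp
    qed
  next
    assume "AE t in lebesgue. g t = 0"
    then have "(\<integral>\<^sup>+t. f t * g t \<partial>lebesgue) = (\<integral>\<^sup>+t. 0 \<partial>(lebesgue :: real measure))" for f
      by (intro nn_integral_cong_AE) auto
    then show "assoc_norm \<rho> g = 0" by (auto simp: assoc_norm_def intro!: antisym SUP_least)
  qed
  show "assoc_norm \<rho> (\<lambda>t. ennreal c * g t) = ennreal c * assoc_norm \<rho> g" for c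
    unfolding assoc_norm_def SUP_mult_left_ennreal
    by (intro SUP_cong refl, subst nn_integral_cmult[symmetric]) (auto simp: mult.left_commute)
  show "(\<lambda>n. assoc_norm \<rho> (h n)) \<longlonglongrightarrow> assoc_norm \<rho> g"
    if h[measurable]: "\<And>n::nat. h n \<in> borel_measurable lebesgue"
    and lim: "AE t in lebesgue. incseq (\<lambda>n. h n t) \<and> (\<lambda>n. h n t) \<longlonglongrightarrow> g t" for h
  proof -
    have inc: "incseq (\<lambda>n. assoc_norm \<rho> (h n))"
      unfolding assoc_norm_def
      using nn_integral_monotone_limit_AE(1)[OF h g _ lim] by (intro incseq_SucI SUP_subset_mono order_refl) (auto simp: incseq_Suc_iff)
    \<comment> \<open>The Fatou property is an exchange of two suprema, after monotone convergence
      for each test function.\<close>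
    have "(SUP n. assoc_norm \<rho> (h n)) = (SUP f\<in>?U. SUP n. \<integral>\<^sup>+t. f t * h n t \<partial>lebesgue)"
      unfolding assoc_norm_def by (rule SUP_commute)
    also have "\<dots> = assoc_norm \<rho> g"
      unfolding assoc_norm_def using nn_integral_monotone_limit_AE(2)[OF h g _ lim] by (intro SUP_cong) auto
    finally show ?thesis using LIMSEQ_SUP[OF inc] by simp
  qed
  fix h :: "real \<Rightarrow> ennreal" assume [measurable]: "h \<in> borel_measurable lebesgue"
  show "assoc_norm \<rho> (\<lambda>t. g t + h t) \<le> assoc_norm \<rho> g + assoc_norm \<rho> h"
    unfolding assoc_norm_def
  proof (rule SUP_least)
    fix f assume f: "f \<in> ?U"
    then have [measurable]: "f \<in> borel_measurable lebesgue" by simp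
    have "(\<integral>\<^sup>+t. f t * (g t + h t) \<partial>lebesgue) = (\<integral>\<^sup>+t. f t * g t \<partial>lebesgue) + (\<integral>\<^sup>+t. f t * h t \<partial>lebesgue)"
      unfolding distrib_left by (rule nn_integral_add) measurable
    also have "\<dots> \<le> (SUP f\<in>?U. \<integral>\<^sup>+t. f t * g t \<partial>lebesgue) + (SUP f\<in>?U. \<integral>\<^sup>+t. f t * h t \<partial>lebesgue)"
      using f by (intro add_mono SUP_upper)
    finally show "(\<integral>\<^sup>+t. f t * (g t + h t) \<partial>lebesgue) \<le>
      (SUP f\<in>?U. \<integral>\<^sup>+t. f t * g t \<partial>lebesgue) + (SUP f\<in>?U. \<integral>\<^sup>+t. f t * h t \<partial>lebesgue)" .
  qed
  show "assoc_norm \<rho> g \<le> assoc_norm \<rho> h" if "AE t in lebesgue. g t \<le> h t"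
    unfolding assoc_norm_def
    using that by (intro SUP_mono' nn_integral_mono_AE) (auto elim!: eventually_mono intro: mult_left_mono)
qed

end

declare ident_borel_measurable_lebesgue [measurable del]

section \<open>Convolution\<close>

lemma lebesgue_of_borel: "(h :: real \<Rightarrow> 'b::topological_space) \<in> borel_measurable borel \<Longrightarrow> h \<in> borel_measurable lebesgue"
  by (intro measurable_completion) simp

text \<open>Taken over \<open>lborel\<close> and used for Borel functions: composing with
  \<open>t - s\<close> then stays measurable on the product, as Fubini requires. Lebesgue measurable
  functions are first replaced by Borel versions.\<close>

definition conv :: "(real \<Rightarrow> ennreal) \<Rightarrow> (real \<Rightarrow> ennreal) \<Rightarrow> real \<Rightarrow> ennreal" where
  "conv f g t = (\<integral>\<^sup>+s. f s * g (t - s) \<partial>lborel)"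

lemma conv_measurable [measurable]:
  assumes [measurable]: "f \<in> borel_measurable borel" "g \<in> borel_measurable borel"
  shows "conv f g \<in> borel_measurable borel"
  unfolding conv_def by measurable

lemma nn_integral_reflect:
  fixes h :: "real \<Rightarrow> ennreal"
  assumes [measurable]: "h \<in> borel_measurable borel"
  shows "(\<integral>\<^sup>+s. h (t - s) \<partial>lborel) = (\<integral>\<^sup>+s. h s \<partial>lborel)"
  using nn_integral_real_affine[of h "-1" t] by simp

lemma AE_reflect_lborel:
  assumes "AE s in lborel. P (s::real)" shows "AE s in lborel. P (t - s)"
proof -
  obtain N where N: "{s. \<not> P s} \<subseteq> N" "N \<in> null_sets lborel"
    using assms by (auto simp: eventually_ae_filter)
  have "(\<integral>\<^sup>+s. indicator N (t - s) \<partial>lborel) = (\<integral>\<^sup>+s. indicator N s \<partial>lborel)"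
    using N(2) by (intro nn_integral_reflect) auto
  also have "\<dots> = emeasure lborel N" using N(2) by (intro nn_integral_indicator) auto
  also have "\<dots> = 0" using N(2) by auto
  finally have "AE s in lborel. indicator N (t - s) = (0::ennreal)"
    using N(2) by (subst (asm) nn_integral_0_iff_AE) auto
  then show ?thesis using N(1) by (auto elim!: eventually_mono simp: indicator_eq_0_iff)
qed

lemma conv_commute:
  assumes [measurable]: "f \<in> borel_measurable borel" "g \<in> borel_measurable borel"
  shows "conv f g t = (\<integral>\<^sup>+s. f (t - s) * g s \<partial>lborel)"
  unfolding conv_def using nn_integral_reflect[of "\<lambda>s. f s * g (t - s)" t] by simp

lemma conv_integral:
  assumes [measurable]: "f \<in> borel_measurable borel" "g \<in> borel_measurable borel"
  shows "(\<integral>\<^sup>+t. conv f g t \<partial>lborel) = (\<integral>\<^sup>+s. f s \<partial>lborel) * (\<integral>\<^sup>+t. g t \<partial>lborel)"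
proof -
  have "(\<integral>\<^sup>+t. conv f g t \<partial>lborel) = (\<integral>\<^sup>+s. \<integral>\<^sup>+t. f s * g (t - s) \<partial>lborel \<partial>lborel)"
    unfolding conv_def by (rule lborel_pair.Fubini') measurable
  also have "\<dots> = (\<integral>\<^sup>+s. f s * (\<integral>\<^sup>+t. g t \<partial>lborel) \<partial>lborel)"
  proof (intro nn_integral_cong)
    fix s
    have "(\<integral>\<^sup>+t. g (t - s) \<partial>lborel) = (\<integral>\<^sup>+t. g t \<partial>lborel)"
      using nn_integral_real_affine[of g 1 "- s"] by simp
    then show "(\<integral>\<^sup>+t. f s * g (t - s) \<partial>lborel) = f s * (\<integral>\<^sup>+t. g t \<partial>lborel)"
      by (simp add: nn_integral_cmult)
  qed
  finally show ?thesis by (simp add: nn_integral_multc)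
qed

lemma conv_mono: "(\<And>s. f s \<le> f' s) \<Longrightarrow> (\<And>s. g s \<le> g' s) \<Longrightarrow> conv f g t \<le> conv f' g' t"
  unfolding conv_def by (intro nn_integral_mono mult_mono) auto

lemma conv_cong_AE:
  assumes "AE s in lborel. f s = f' s" "AE s in lborel. g s = g' s"
  shows "conv f g t = conv f' g' t"
  unfolding conv_def
proof (rule nn_integral_cong_AE)
  have "AE s in lborel. g (t - s) = g' (t - s)" by (rule AE_reflect_lborel[OF assms(2)])
  with assms(1) show "AE s in lborel. f s * g (t - s) = f' s * g' (t - s)"
    by eventually_elim simp
qed

text \<open>A measurable function is an almost everywhere limit of continuous ones. Clipping these
  at height \<open>M\<close> and cutting them off outside \<open>[-M-1, M+1]\<close> provides an
  integrable majorant for dominated convergence.\<close>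

lemma L1_continuous_approx:
  fixes f :: "real \<Rightarrow> real"
  assumes [measurable]: "f \<in> borel_measurable borel" and b: "\<And>t. \<bar>f t\<bar> \<le> M" and supp: "\<And>t. M < \<bar>t\<bar> \<Longrightarrow> f t = 0"
    and e: "0 < (e :: ennreal)"
  obtains k where "continuous_on UNIV k" "\<And>t. \<bar>k t\<bar> \<le> M" "\<And>t. M + 1 < \<bar>t\<bar> \<Longrightarrow> k t = 0"
    "(\<integral>\<^sup>+t. ennreal \<bar>f t - k t\<bar> \<partial>lborel) < e"
proof -
  have M: "0 \<le> M" using b[of 0] by linarith
  have "f \<in> borel_measurable lebesgue" by (simp add: measurable_completion)
  then have "f measurable_on UNIV" by (rule lebesgue_measurable_imp_measurable_on) auto
  then obtain N g where N: "negligible N" and g: "\<And>n. continuous_on UNIV (g n)"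
    "\<And>x. x \<notin> N \<Longrightarrow> (\<lambda>n. g n x) \<longlonglongrightarrow> f x"
    unfolding measurable_on_def by auto
  \<comment> \<open>Equal to 1 for \<open>|t| <= M\<close>, where \<open>f\<close> may live, and to
    0 for \<open>|t| >= M + 1\<close>.\<close>
  define cut where "cut t = max 0 (min 1 (M + 1 - \<bar>t\<bar>))" for t
  define k where "k n t = cut t * max (- M) (min M (g n t))" for n t
  have kc: "continuous_on UNIV (k n)" for n
    unfolding k_def cut_def using g(1)[of n] by (intro continuous_intros)
  then have [measurable]: "k n \<in> borel_measurable borel" for n
    by (rule borel_measurable_continuous_onI)
  have kb: "\<bar>k n t\<bar> \<le> M" for n t
  proof -
    have "\<bar>cut t\<bar> \<le> 1" "\<bar>max (- M) (min M (g n t))\<bar> \<le> M" using M by (auto simp: cut_def)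
    then show ?thesis unfolding k_def abs_mult by (metis M abs_ge_zero mult_left_le_one_le order_trans)
  qed
  have ks: "k n t = 0" if "M + 1 < \<bar>t\<bar>" for n t using that by (simp add: k_def cut_def)
  have klim: "(\<lambda>n. k n t) \<longlonglongrightarrow> f t" if "t \<notin> N" for t
  proof -
    have "(\<lambda>n. k n t) \<longlonglongrightarrow> cut t * max (- M) (min M (f t))"
      unfolding k_def by (intro tendsto_intros g that)
    also have "max (- M) (min M (f t)) = f t" using b[of t] by auto
    also have "cut t * f t = f t" using supp[of t] by (cases "M < \<bar>t\<bar>") (auto simp: cut_def)
    finally show ?thesis .
  qed
  have "AE t in lebesgue. t \<notin> N" using N by (intro AE_not_in) (simp add: negligible_iff_null_sets)
  then have AEN: "AE t in lborel. t \<notin> N" by (simp add: AE_completion_iff)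
  have lim: "(\<lambda>n. \<integral>\<^sup>+t. ennreal \<bar>f t - k n t\<bar> \<partial>lborel) \<longlonglongrightarrow> (\<integral>\<^sup>+t. 0 \<partial>(lborel :: real measure))"
  proof (rule nn_integral_dominated_convergence[where w = "\<lambda>t. ennreal (2 * M) * indicator {- M - 1..M + 1} t"])
    show "AE t in lborel. ennreal \<bar>f t - k n t\<bar> \<le> ennreal (2 * M) * indicator {- M - 1..M + 1} t" for n
    proof (intro AE_I2)
      fix t
      have "\<bar>f t - k n t\<bar> \<le> 2 * M" using b[of t] kb[of n t] by linarith
      moreover have "f t - k n t = 0" if "t \<notin> {- M - 1..M + 1}"
      proof -
        have "M + 1 < \<bar>t\<bar>" using that by (auto simp: abs_if)
        then show ?thesis using supp[of t] ks[of t n] by simp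
      qed
      ultimately show "ennreal \<bar>f t - k n t\<bar> \<le> ennreal (2 * M) * indicator {- M - 1..M + 1} t"
        by (cases "t \<in> {- M - 1..M + 1}") (auto intro: ennreal_leI)
    qed
    show "(\<integral>\<^sup>+t. ennreal (2 * M) * indicator {- M - 1..M + 1} t \<partial>lborel) < \<infinity>"
      using M by (simp add: nn_integral_cmult ennreal_mult_less_top)
    show "AE t in lborel. (\<lambda>n. ennreal \<bar>f t - k n t\<bar>) \<longlonglongrightarrow> 0"
      using AEN
    proof eventually_elim
      case (elim t)
      have "(\<lambda>n. ennreal \<bar>f t - k n t\<bar>) \<longlonglongrightarrow> ennreal \<bar>f t - f t\<bar>"
        by (intro tendsto_ennrealI tendsto_intros klim elim)
      then show ?case by simp
    qed
  qed auto
  have "(\<lambda>n. \<integral>\<^sup>+t. ennreal \<bar>f t - k n t\<bar> \<partial>lborel) \<longlonglongrightarrow> 0" using lim by simp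
  then have "\<forall>\<^sub>F n in sequentially. (\<integral>\<^sup>+t. ennreal \<bar>f t - k n t\<bar> \<partial>lborel) < e"
    using e by (rule order_tendstoD)
  then obtain n where "(\<integral>\<^sup>+t. ennreal \<bar>f t - k n t\<bar> \<partial>lborel) < e"
    by (auto simp: eventually_sequentially)
  with kc kb ks show ?thesis by (intro that[of "k n"])
qed

text \<open>Three-epsilon argument: for a continuous \<open>k\<close> of bounded support the claim
  is dominated convergence, and the two terms that compare \<open>f\<close> with \<open>k\<close>
  have the same integral by translation invariance.\<close>

lemma translation_L1_LIMSEQ:
  fixes f :: "real \<Rightarrow> real"
  assumes [measurable]: "f \<in> borel_measurable borel" and b: "\<And>t. \<bar>f t\<bar> \<le> M" and supp: "\<And>t. M < \<bar>t\<bar> \<Longrightarrow> f t = 0"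
    and h: "h \<longlonglongrightarrow> 0"
  shows "(\<lambda>n. \<integral>\<^sup>+t. ennreal \<bar>f (t - h n) - f t\<bar> \<partial>lborel) \<longlonglongrightarrow> 0"
proof (rule order_tendstoI)
  fix e :: ennreal assume "0 < e"
  then obtain d where d: "0 < d" "ennreal d < e"
    by (metis ennreal_less_zero_iff ennreal_zero_less_top dense less_top ennreal_cases not_less_iff_gr_or_eq)
  obtain k where k: "continuous_on UNIV k" "\<And>t. \<bar>k t\<bar> \<le> M" "\<And>t. M + 1 < \<bar>t\<bar> \<Longrightarrow> k t = 0"
    "(\<integral>\<^sup>+t. ennreal \<bar>f t - k t\<bar> \<partial>lborel) < ennreal (d / 3)"
    using L1_continuous_approx[OF assms(1) b supp, of "ennreal (d / 3)"] d by auto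
  have M: "0 \<le> M" using b[of 0] by linarith
  have [measurable]: "k \<in> borel_measurable borel" by (rule borel_measurable_continuous_onI[OF k(1)])
  obtain n0 where n0: "\<And>n. n \<ge> n0 \<Longrightarrow> \<bar>h n\<bar> < 1"
    using LIMSEQ_D[OF h, of 1] by auto
  \<comment> \<open>Starting at \<open>n0\<close> ensures \<open>|h| < 1\<close>, so that all
    translates of \<open>k\<close> are supported in \<open>[-M-2, M+2]\<close>.\<close>
  have lim: "(\<lambda>n. \<integral>\<^sup>+t. ennreal \<bar>k (t - h (n + n0)) - k t\<bar> \<partial>lborel) \<longlonglongrightarrow> (\<integral>\<^sup>+t. 0 \<partial>(lborel :: real measure))"
  proof (rule nn_integral_dominated_convergence[where w = "\<lambda>t. ennreal (2 * M) * indicator {- M - 2..M + 2} t"])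
    show "AE t in lborel. ennreal \<bar>k (t - h (n + n0)) - k t\<bar> \<le> ennreal (2 * M) * indicator {- M - 2..M + 2} t" for n
    proof (intro AE_I2)
      fix t
      have "\<bar>k (t - h (n + n0)) - k t\<bar> \<le> 2 * M" using k(2)[of t] k(2)[of "t - h (n + n0)"] by linarith
      moreover have "k (t - h (n + n0)) - k t = 0" if "t \<notin> {- M - 2..M + 2}"
      proof -
        have "M + 2 < \<bar>t\<bar>" using that by (auto simp: abs_if)
        then show ?thesis using k(3)[of t] k(3)[of "t - h (n + n0)"] n0[of "n + n0"] by simp
      qed
      ultimately show "ennreal \<bar>k (t - h (n + n0)) - k t\<bar> \<le> ennreal (2 * M) * indicator {- M - 2..M + 2} t"
        by (cases "t \<in> {- M - 2..M + 2}") (auto intro: ennreal_leI)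
    qed
    show "(\<integral>\<^sup>+t. ennreal (2 * M) * indicator {- M - 2..M + 2} t \<partial>lborel) < \<infinity>"
      using M by (simp add: nn_integral_cmult ennreal_mult_less_top)
    show "AE t in lborel. (\<lambda>n. ennreal \<bar>k (t - h (n + n0)) - k t\<bar>) \<longlonglongrightarrow> 0"
    proof (intro AE_I2)
      fix t
      have "(\<lambda>n. t - h (n + n0)) \<longlonglongrightarrow> t - 0"
        by (intro tendsto_intros LIMSEQ_ignore_initial_segment h)
      moreover have "isCont k t" using k(1) by (simp add: continuous_on_eq_continuous_at)
      ultimately have "(\<lambda>n. k (t - h (n + n0))) \<longlonglongrightarrow> k t"
        using isCont_tendsto_compose by fastforce
      then have "(\<lambda>n. ennreal \<bar>k (t - h (n + n0)) - k t\<bar>) \<longlonglongrightarrow> ennreal \<bar>k t - k t\<bar>"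
        by (intro tendsto_ennrealI tendsto_intros)
      then show "(\<lambda>n. ennreal \<bar>k (t - h (n + n0)) - k t\<bar>) \<longlonglongrightarrow> 0" by simp
    qed
  qed auto
  have "(\<lambda>n. \<integral>\<^sup>+t. ennreal \<bar>k (t - h (n + n0)) - k t\<bar> \<partial>lborel) \<longlonglongrightarrow> 0" using lim by simp
  then have "(\<lambda>n. \<integral>\<^sup>+t. ennreal \<bar>k (t - h n) - k t\<bar> \<partial>lborel) \<longlonglongrightarrow> 0" by (rule LIMSEQ_offset)
  then have "\<forall>\<^sub>F n in sequentially. (\<integral>\<^sup>+t. ennreal \<bar>k (t - h n) - k t\<bar> \<partial>lborel) < ennreal (d / 3)"
    using d by (intro order_tendstoD) auto
  then show "\<forall>\<^sub>F n in sequentially. (\<integral>\<^sup>+t. ennreal \<bar>f (t - h n) - f t\<bar> \<partial>lborel) < e"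
  proof eventually_elim
    case (elim n)
    have "(\<integral>\<^sup>+t. ennreal \<bar>f (t - h n) - f t\<bar> \<partial>lborel) \<le>
      (\<integral>\<^sup>+t. ennreal \<bar>f (t - h n) - k (t - h n)\<bar> + (ennreal \<bar>k (t - h n) - k t\<bar> + ennreal \<bar>f t - k t\<bar>) \<partial>lborel)"
      by (intro nn_integral_mono) (auto simp flip: ennreal_plus intro!: ennreal_leI)
    also have "\<dots> = (\<integral>\<^sup>+t. ennreal \<bar>f (t - h n) - k (t - h n)\<bar> \<partial>lborel) +
       ((\<integral>\<^sup>+t. ennreal \<bar>k (t - h n) - k t\<bar> \<partial>lborel) + (\<integral>\<^sup>+t. ennreal \<bar>f t - k t\<bar> \<partial>lborel))"
      by (simp add: nn_integral_add)
    also have "(\<integral>\<^sup>+t. ennreal \<bar>f (t - h n) - k (t - h n)\<bar> \<partial>lborel) = (\<integral>\<^sup>+t. ennreal \<bar>f t - k t\<bar> \<partial>lborel)"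
      using nn_integral_real_affine[of "\<lambda>t. ennreal \<bar>f t - k t\<bar>" 1 "- h n"] by simp
    also have "(\<integral>\<^sup>+t. ennreal \<bar>f t - k t\<bar> \<partial>lborel) + ((\<integral>\<^sup>+t. ennreal \<bar>k (t - h n) - k t\<bar> \<partial>lborel) + (\<integral>\<^sup>+t. ennreal \<bar>f t - k t\<bar> \<partial>lborel))
        \<le> ennreal (d / 3) + (ennreal (d / 3) + ennreal (d / 3))"
      using k(4) elim by (intro add_mono less_imp_le)
    also have "\<dots> = ennreal d" using d by (simp flip: ennreal_plus)
    finally show ?case using d(2) by (rule order.strict_trans1)
  qed
qed simp

context ri
begin

text \<open>Rounding \<open>s\<close> down makes the translate constant on cells of length
  \<open>1/(n+1)\<close>. The integral becomes a countable sum of translates of \<open>f\<close>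
  weighted by the masses of \<open>g\<close> on the cells, and each translate has norm
  \<open>\<rho> f\<close>.\<close>

lemma suminf_translates:
  assumes [measurable]: "f \<in> borel_measurable borel" "g \<in> borel_measurable borel"
    and g: "(\<integral>\<^sup>+s. g s \<partial>lborel) < \<infinity>"
  shows "\<rho> (\<lambda>t. \<integral>\<^sup>+s. f (t - of_int \<lfloor>s * (real n + 1)\<rfloor> / (real n + 1)) * g s \<partial>lborel) \<le> \<rho> f * (\<integral>\<^sup>+s. g s \<partial>lborel)"
proof -
  let ?I = "\<lambda>j. {s. \<lfloor>s * (real n + 1)\<rfloor> = int_decode j}"
  let ?a = "\<lambda>j. of_int (int_decode j) / (real n + 1)"
  have [measurable]: "?I j \<in> sets borel" for j by measurable
  define \<gamma> where "\<gamma> j = (\<integral>\<^sup>+s. g s * indicator (?I j) s \<partial>lborel)" for j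
  have split: "(\<Sum>j. F j * indicator (?I j) s) = F (int_encode \<lfloor>s * (real n + 1)\<rfloor>)" for F :: "nat \<Rightarrow> ennreal" and s
  proof -
    have "(\<Sum>j. F j * indicator (?I j) s) = (\<Sum>j\<in>{int_encode \<lfloor>s * (real n + 1)\<rfloor>}. F j * indicator (?I j) s)"
      by (rule suminf_finite) (auto split: split_indicator)
    then show ?thesis by simp
  qed
  have eq: "(\<integral>\<^sup>+s. f (t - of_int \<lfloor>s * (real n + 1)\<rfloor> / (real n + 1)) * g s \<partial>lborel) = (\<Sum>j. \<gamma> j * f (t - ?a j))" for t
  proof -
    have "(\<integral>\<^sup>+s. f (t - of_int \<lfloor>s * (real n + 1)\<rfloor> / (real n + 1)) * g s \<partial>lborel) =
       (\<integral>\<^sup>+s. (\<Sum>j. (f (t - ?a j) * g s) * indicator (?I j) s) \<partial>lborel)"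
      by (subst split) simp
    also have "\<dots> = (\<Sum>j. \<integral>\<^sup>+s. f (t - ?a j) * (g s * indicator (?I j) s) \<partial>lborel)"
      by (subst nn_integral_suminf) (auto simp: mult.assoc)
    also have "\<dots> = (\<Sum>j. \<gamma> j * f (t - ?a j))"
      unfolding \<gamma>_def by (intro suminf_cong) (simp add: nn_integral_cmult mult.commute)
    finally show ?thesis .
  qed
  have \<gamma>sum: "(\<Sum>j. \<gamma> j) = (\<integral>\<^sup>+s. g s \<partial>lborel)"
  proof -
    have "(\<Sum>j. \<gamma> j) = (\<integral>\<^sup>+s. (\<Sum>j. g s * indicator (?I j) s) \<partial>lborel)"
      unfolding \<gamma>_def by (rule nn_integral_suminf[symmetric]) measurable
    then show ?thesis by (simp only: split)
  qed
  have \<gamma>fin: "\<gamma> j < \<infinity>" for j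
    using g \<gamma>sum ennreal_suminf_lessD[of \<gamma> "\<infinity>" j] by simp
  have fl: "(\<lambda>t. f (t - a)) \<in> borel_measurable lebesgue" for a
    by (rule measurable_completion) measurable
  have "\<rho> (\<lambda>t. \<Sum>j. \<gamma> j * f (t - ?a j)) \<le> (\<Sum>j. \<rho> (\<lambda>t. \<gamma> j * f (t - ?a j)))"
    using fl by (intro suminf_le borel_measurable_times_ennreal) auto
  also have "\<dots> = (\<Sum>j. \<gamma> j * \<rho> f)"
  proof (intro suminf_cong)
    fix j
    obtain r where r: "\<gamma> j = ennreal r" "0 \<le> r" using \<gamma>fin[of j] by (cases "\<gamma> j") auto
    have "\<rho> (\<lambda>t. f (t - ?a j)) = \<rho> f" using affine[of f 1 "- ?a j"] by simp
    then show "\<rho> (\<lambda>t. \<gamma> j * f (t - ?a j)) = \<gamma> j * \<rho> f"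
      unfolding r(1) by (subst hom[OF fl r(2)]) simp
  qed
  also have "\<dots> = \<rho> f * (\<integral>\<^sup>+s. g s \<partial>lborel)" by (simp add: ennreal_suminf_multc \<gamma>sum mult.commute)
  finally show ?thesis unfolding eq .
qed

text \<open>
  Minkowski's inequality for translates: the convolution is an a.e. limit of weighted sums of translates,
  by continuity of translations in \<open>L\<^sup>1\<close>, and the Fatou property passes the norm bound to the limit.
\<close>

lemma conv_L1_bounded:
  fixes f :: "real \<Rightarrow> real"
  assumes fm[measurable]: "f \<in> borel_measurable borel" and b: "\<And>t. \<bar>f t\<bar> \<le> M" and supp: "\<And>t. M < \<bar>t\<bar> \<Longrightarrow> f t = 0"
    and nn: "\<And>t. 0 \<le> f t"
    and gm[measurable]: "g \<in> borel_measurable borel" and g: "(\<integral>\<^sup>+s. g s \<partial>lborel) < \<infinity>"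
  shows "\<rho> (conv (\<lambda>t. ennreal (f t)) g) \<le> \<rho> (\<lambda>t. ennreal (f t)) * (\<integral>\<^sup>+s. g s \<partial>lborel)"
proof -
  have M: "0 \<le> M" using b[of 0] by linarith
  define sn where "sn n s = of_int \<lfloor>s * (real n + 1)\<rfloor> / (real n + 1)" for n :: nat and s :: real
  have [measurable]: "sn n \<in> borel_measurable borel" for n unfolding sn_def by measurable
  have sn: "(\<lambda>n. s - sn n s) \<longlonglongrightarrow> 0" for s
  proof (rule Lim_null_comparison[OF _ inverse_Suc_LIMSEQ])
    have "norm (s - sn n s) \<le> 1 / (real n + 1)" for n
    proof -
      have "s - sn n s = (s * (real n + 1) - of_int \<lfloor>s * (real n + 1)\<rfloor>) / (real n + 1)"
        by (simp add: sn_def diff_divide_distrib)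
      moreover have "\<bar>s * (real n + 1) - of_int \<lfloor>s * (real n + 1)\<rfloor>\<bar> \<le> 1" by linarith
      ultimately show ?thesis by (simp add: divide_right_mono)
    qed
    then show "\<forall>\<^sub>F n in sequentially. norm (s - sn n s) \<le> 1 / (real n + 1)" by simp
  qed
  define F where "F n t = (\<integral>\<^sup>+s. ennreal (f (t - sn n s)) * g s \<partial>lborel)" for n t
  define E where "E n t = (\<integral>\<^sup>+s. ennreal \<bar>f (t - s) - f (t - sn n s)\<bar> * g s \<partial>lborel)" for n t
  have [measurable]: "F n \<in> borel_measurable borel" "E n \<in> borel_measurable borel" for n
    unfolding F_def E_def by measurable
  have le: "conv (\<lambda>t. ennreal (f t)) g t \<le> F n t + E n t" for n t
  proof -
    have "conv (\<lambda>t. ennreal (f t)) g t = (\<integral>\<^sup>+s. ennreal (f (t - s)) * g s \<partial>lborel)"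
      by (rule conv_commute) measurable
    also have "\<dots> \<le> (\<integral>\<^sup>+s. ennreal (f (t - sn n s)) * g s + ennreal \<bar>f (t - s) - f (t - sn n s)\<bar> * g s \<partial>lborel)"
      using nn unfolding distrib_right[symmetric]
      by (intro nn_integral_mono mult_right_mono) (auto simp flip: ennreal_plus intro!: ennreal_leI)
    also have "\<dots> = F n t + E n t" unfolding F_def E_def by (rule nn_integral_add) measurable
    finally show ?thesis .
  qed
  \<comment> \<open>L^1 modulus of continuity of \<open>f\<close>. By Fubini the rounding error
    \<open>E n\<close> has integral \<open>\<integral> \<omega>(s - sn n s) g(s) ds\<close>, and the
    bound \<open>4 * M * M\<close> dominates it.\<close>
  define \<omega> where "\<omega> h = (\<integral>\<^sup>+t. ennreal \<bar>f (t - h) - f t\<bar> \<partial>lborel)" for h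
  have [measurable]: "\<omega> \<in> borel_measurable borel" unfolding \<omega>_def by measurable
  have \<omega>b: "\<omega> h \<le> ennreal (4 * M * M)" for h
  proof -
    have f1: "(\<integral>\<^sup>+t. ennreal \<bar>f t\<bar> \<partial>lborel) \<le> ennreal (2 * M * M)"
    proof -
      have "(\<integral>\<^sup>+t. ennreal \<bar>f t\<bar> \<partial>lborel) \<le> (\<integral>\<^sup>+t. ennreal M * indicator {- M..M} t \<partial>lborel)"
      proof (intro nn_integral_mono)
        fix t show "ennreal \<bar>f t\<bar> \<le> ennreal M * indicator {- M..M} t"
          using b[of t] supp[of t] by (cases "t \<in> {- M..M}") (auto intro: ennreal_leI simp: abs_if split: if_splits)
      qed
      also have "\<dots> = ennreal (2 * M * M)" using M by (simp add: nn_integral_cmult ennreal_mult[symmetric])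
      finally show ?thesis .
    qed
    have "\<omega> h \<le> (\<integral>\<^sup>+t. ennreal \<bar>f (t - h)\<bar> + ennreal \<bar>f t\<bar> \<partial>lborel)"
      unfolding \<omega>_def by (intro nn_integral_mono) (auto simp flip: ennreal_plus intro!: ennreal_leI)
    also have "\<dots> = (\<integral>\<^sup>+t. ennreal \<bar>f (t - h)\<bar> \<partial>lborel) + (\<integral>\<^sup>+t. ennreal \<bar>f t\<bar> \<partial>lborel)"
      by (rule nn_integral_add) measurable
    also have "(\<integral>\<^sup>+t. ennreal \<bar>f (t - h)\<bar> \<partial>lborel) = (\<integral>\<^sup>+t. ennreal \<bar>f t\<bar> \<partial>lborel)"
      using nn_integral_real_affine[of "\<lambda>t. ennreal \<bar>f t\<bar>" 1 "- h"] by simp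
    also have "(\<integral>\<^sup>+t. ennreal \<bar>f t\<bar> \<partial>lborel) + (\<integral>\<^sup>+t. ennreal \<bar>f t\<bar> \<partial>lborel) \<le> ennreal (2 * M * M) + ennreal (2 * M * M)"
      by (intro add_mono f1)
    also have "\<dots> = ennreal (4 * M * M)" using M by (simp flip: ennreal_plus)
    finally show ?thesis .
  qed
  have Eint: "(\<integral>\<^sup>+t. E n t \<partial>lborel) = (\<integral>\<^sup>+s. \<omega> (s - sn n s) * g s \<partial>lborel)" for n
  proof -
    have "(\<integral>\<^sup>+t. E n t \<partial>lborel) = (\<integral>\<^sup>+s. \<integral>\<^sup>+t. ennreal \<bar>f (t - s) - f (t - sn n s)\<bar> * g s \<partial>lborel \<partial>lborel)"
      unfolding E_def by (rule lborel_pair.Fubini') measurable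
    also have "\<dots> = (\<integral>\<^sup>+s. \<omega> (s - sn n s) * g s \<partial>lborel)"
    proof (intro nn_integral_cong)
      fix s
      have "(\<integral>\<^sup>+t. ennreal \<bar>f (t - s) - f (t - sn n s)\<bar> \<partial>lborel) =
        (\<integral>\<^sup>+t. ennreal \<bar>f (sn n s + 1 * t - s) - f (sn n s + 1 * t - sn n s)\<bar> \<partial>lborel)"
        by (subst nn_integral_real_affine[where c = 1 and t = "sn n s"]) auto
      also have "\<dots> = \<omega> (s - sn n s)" unfolding \<omega>_def by (intro nn_integral_cong) (simp add: algebra_simps)
      finally show "(\<integral>\<^sup>+t. ennreal \<bar>f (t - s) - f (t - sn n s)\<bar> * g s \<partial>lborel) = \<omega> (s - sn n s) * g s"
        by (simp add: nn_integral_multc)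
    qed
    finally show ?thesis .
  qed
  have gfin: "AE s in lborel. g s \<noteq> \<infinity>" using g by (intro nn_integral_PInf_AE) auto
  have "(\<lambda>n. \<integral>\<^sup>+s. \<omega> (s - sn n s) * g s \<partial>lborel) \<longlonglongrightarrow> (\<integral>\<^sup>+s. 0 \<partial>(lborel :: real measure))"
  proof (rule nn_integral_dominated_convergence[where w = "\<lambda>s. ennreal (4 * M * M) * g s"])
    show "(\<integral>\<^sup>+s. ennreal (4 * M * M) * g s \<partial>lborel) < \<infinity>"
      using g by (simp add: nn_integral_cmult ennreal_mult_less_top)
    show "AE s in lborel. (\<lambda>n. \<omega> (s - sn n s) * g s) \<longlonglongrightarrow> 0"
      using gfin
    proof eventually_elim
      case (elim s)
      have "(\<lambda>n. \<omega> (s - sn n s)) \<longlonglongrightarrow> 0"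
        unfolding \<omega>_def by (rule translation_L1_LIMSEQ[OF fm b supp sn])
      then have "(\<lambda>n. \<omega> (s - sn n s) * g s) \<longlonglongrightarrow> 0 * g s"
        using elim by (intro tendsto_mult_ennreal tendsto_const) auto
      then show ?case by simp
    qed
  qed (auto intro!: mult_right_mono \<omega>b)
  then have E0: "(\<lambda>n. \<integral>\<^sup>+t. E n t \<partial>lborel) \<longlonglongrightarrow> 0" by (simp add: Eint)
  \<comment> \<open>The errors tend to 0 in L^1; along a subsequence their integrals are summable,
    so that they tend to 0 almost everywhere.\<close>
  have "\<exists>r. (\<integral>\<^sup>+t. E r t \<partial>lborel) < ennreal ((1/2)^k)" for k
    using order_tendstoD(2)[OF E0, of "ennreal ((1/2)^k)"] by (auto simp: eventually_sequentially)
  then obtain r where r: "\<And>k. (\<integral>\<^sup>+t. E (r k) t \<partial>lborel) < ennreal ((1/2)^k)" by metis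
  have "(\<integral>\<^sup>+t. (\<Sum>k. E (r k) t) \<partial>lborel) = (\<Sum>k. \<integral>\<^sup>+t. E (r k) t \<partial>lborel)"
    by (rule nn_integral_suminf) simp
  also have "\<dots> \<le> (\<Sum>k. ennreal ((1/2)^k))"
    using r by (intro Series.suminf_le summableI) (auto intro: less_imp_le)
  also have "\<dots> < \<infinity>" by (subst suminf_ennreal2) (auto simp: summable_geometric)
  finally have "(\<integral>\<^sup>+t. (\<Sum>k. E (r k) t) \<partial>lborel) \<noteq> \<infinity>" by simp
  then have Efin: "AE t in lborel. (\<Sum>k. E (r k) t) \<noteq> \<infinity>"
    by (intro nn_integral_PInf_AE) auto
  \<comment> \<open>The Fatou property is about increasing sequences, hence the lower envelopes of
    the tails in place of the functions \<open>F (r j)\<close> themselves.\<close>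
  define G where "G k t = (INF j\<in>{k..}. F (r j) t)" for k t
  have [measurable]: "G k \<in> borel_measurable borel" for k unfolding G_def by measurable
  have Ginc: "incseq (\<lambda>k. G k t)" for t
    unfolding G_def by (intro incseq_SucI INF_superset_mono) auto
  let ?C = "\<rho> (\<lambda>t. ennreal (f t)) * (\<integral>\<^sup>+s. g s \<partial>lborel)"
  have lm: "h \<in> borel_measurable lebesgue" if "h \<in> borel_measurable borel" for h :: "real \<Rightarrow> ennreal"
    using that by (intro measurable_completion) simp
  have GC: "\<rho> (G k) \<le> ?C" for k
  proof -
    have "\<rho> (G k) \<le> \<rho> (F (r k))"
      by (intro mono lm) (auto simp: G_def intro!: INF_lower)
    also have "\<dots> \<le> ?C"
      unfolding F_def sn_def by (rule suminf_translates) (use g in auto)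
    finally show ?thesis .
  qed
  have "(\<lambda>k. \<rho> (G k)) \<longlonglongrightarrow> \<rho> (\<lambda>t. SUP k. G k t)"
    by (intro fatou lm) (auto intro!: Ginc LIMSEQ_SUP)
  then have "\<rho> (\<lambda>t. SUP k. G k t) \<le> ?C"
    by (rule LIMSEQ_le_const2) (use GC in auto)
  moreover have "\<rho> (conv (\<lambda>t. ennreal (f t)) g) \<le> \<rho> (\<lambda>t. SUP k. G k t)"
  proof (rule mono)
    show "AE t in lebesgue. conv (\<lambda>t. ennreal (f t)) g t \<le> (SUP k. G k t)"
      unfolding AE_completion_iff using Efin
    proof eventually_elim
      case (elim t)
      have "(\<lambda>k. E (r k) t) \<longlonglongrightarrow> 0"
      proof -
        have tl: "(\<lambda>k. \<Sum>i. E (r (i + k)) t) \<longlonglongrightarrow> 0"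
          using elim by (intro ennreal_suminf_tail_LIMSEQ) (simp add: less_top)
        have "E (r k) t \<le> (\<Sum>i. E (r (i + k)) t)" for k
          using sum_le_suminf[of "\<lambda>i. E (r (i + k)) t" "{0}"] by (auto intro: summableI)
        then have "\<forall>\<^sub>F k in sequentially. E (r k) t \<le> (\<Sum>i. E (r (i + k)) t)"
          by (intro always_eventually allI)
        then show ?thesis by (rule tendsto_sandwich[OF _ _ tendsto_const tl, rotated]) simp
      qed
      show ?case
      proof (rule ennreal_le_epsilon)
        fix e :: real assume "0 < e"
        then have "\<forall>\<^sub>F k in sequentially. E (r k) t < ennreal e"
          using \<open>(\<lambda>k. E (r k) t) \<longlonglongrightarrow> 0\<close> by (intro order_tendstoD) auto
        then obtain k0 where k0: "\<And>k. k \<ge> k0 \<Longrightarrow> E (r k) t < ennreal e" by (auto simp: eventually_sequentially)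
        have "conv (\<lambda>t. ennreal (f t)) g t - ennreal e \<le> G k0 t"
          unfolding G_def
        proof (rule INF_greatest)
          fix j assume "j \<in> {k0..}"
          then have "conv (\<lambda>t. ennreal (f t)) g t \<le> F (r j) t + ennreal e"
            using le[of t "r j"] k0[of j] by (meson add_left_mono atLeast_iff less_imp_le order_trans)
          then show "conv (\<lambda>t. ennreal (f t)) g t - ennreal e \<le> F (r j) t"
            by (simp add: ennreal_minus_le_iff add.commute)
        qed
        also have "\<dots> \<le> (SUP k. G k t)" by (rule SUP_upper) simp
        finally show "conv (\<lambda>t. ennreal (f t)) g t \<le> (SUP k. G k t) + ennreal e"
          by (simp add: ennreal_minus_le_iff add.commute)
      qed
    qed
  qed (auto intro!: lm)
  ultimately show ?thesis by (rule order_trans[rotated])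
qed

text \<open>Truncating \<open>f\<close> in height and in support gives an increasing sequence
  covered by \<open>conv_L1_bounded\<close>; the convolutions increase too, and the Fatou property
  concludes.\<close>

lemma conv_L1:
  assumes fm[measurable]: "f \<in> borel_measurable borel"
    and gm[measurable]: "g \<in> borel_measurable borel" and g: "(\<integral>\<^sup>+s. g s \<partial>lborel) < \<infinity>"
  shows "\<rho> (conv f g) \<le> \<rho> f * (\<integral>\<^sup>+s. g s \<partial>lborel)"
proof -
  define h where "h n t = enn2real (min (f t) (ennreal (real n))) * indicat_real {- real n..real n} t" for n t
  have [measurable]: "h n \<in> borel_measurable borel" for n unfolding h_def by measurable
  have eh: "ennreal (h n t) = min (f t) (ennreal (real n)) * indicator {- real n..real n} t" for n t
  proof -
    have "min (f t) (ennreal (real n)) < \<infinity>" by (simp add: min_less_iff_disj)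
    then show ?thesis by (auto simp: h_def split: split_indicator)
  qed
  have hinc: "incseq (\<lambda>n. ennreal (h n t))" for t
  proof (rule incseq_SucI)
    fix n
    have "min (f t) (ennreal (real n)) \<le> min (f t) (ennreal (real (Suc n)))"
      by (intro min.mono order_refl ennreal_leI) simp
    then show "ennreal (h n t) \<le> ennreal (h (Suc n) t)"
      unfolding eh by (intro mult_mono) (auto split: split_indicator)
  qed
  have hlim: "(\<lambda>n. ennreal (h n t)) \<longlonglongrightarrow> f t" for t
  proof -
    obtain n0 where n0: "\<bar>t\<bar> \<le> real n0" using real_arch_simple by blast
    have "(\<lambda>n. ennreal (real n)) \<longlonglongrightarrow> \<infinity>"
      by (simp add: ennreal_of_nat_eq_real_of_nat[symmetric] of_nat_tendsto_top_ennreal)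
    then have "(\<lambda>n. min (f t) (ennreal (real n))) \<longlonglongrightarrow> min (f t) \<infinity>" by (intro tendsto_min tendsto_const)
    then have "(\<lambda>n. min (f t) (ennreal (real n))) \<longlonglongrightarrow> f t" by simp
    moreover have "\<forall>\<^sub>F n in sequentially. min (f t) (ennreal (real n)) = ennreal (h n t)"
      using eventually_ge_at_top[of n0]
    proof eventually_elim
      case (elim n)
      then have "t \<in> {- real n..real n}" using n0 by (auto simp: abs_le_iff)
      then show ?case by (simp add: eh)
    qed
    ultimately show ?thesis by (rule Lim_transform_eventually)
  qed
  have lim: "(\<lambda>n. conv (\<lambda>t. ennreal (h n t)) g t) \<longlonglongrightarrow> conv f g t" "incseq (\<lambda>n. conv (\<lambda>t. ennreal (h n t)) g t)" for t
  proof -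
    have inc: "incseq (\<lambda>n. conv (\<lambda>t. ennreal (h n t)) g t)"
      by (intro incseq_SucI conv_mono order_refl incseq_SucD[OF hinc])
    have "(SUP n. \<integral>\<^sup>+s. g (t - s) * ennreal (h n s) \<partial>lborel) = (\<integral>\<^sup>+s. g (t - s) * f s \<partial>lborel)"
      by (rule nn_integral_monotone_limit_AE(2)[where h = "\<lambda>n s. ennreal (h n s)"]) (auto simp: hinc hlim)
    then have "(SUP n. conv (\<lambda>t. ennreal (h n t)) g t) = conv f g t" by (simp add: conv_def mult.commute)
    then show "(\<lambda>n. conv (\<lambda>t. ennreal (h n t)) g t) \<longlonglongrightarrow> conv f g t" using LIMSEQ_SUP[OF inc] by simp
    show "incseq (\<lambda>n. conv (\<lambda>t. ennreal (h n t)) g t)" by (rule inc)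
  qed
  have "(\<lambda>n. \<rho> (conv (\<lambda>t. ennreal (h n t)) g)) \<longlonglongrightarrow> \<rho> (conv f g)"
    by (intro fatou lebesgue_of_borel) (auto simp: lim)
  then show ?thesis
  proof (rule LIMSEQ_le_const2)
    have "\<rho> (conv (\<lambda>t. ennreal (h n t)) g) \<le> \<rho> f * (\<integral>\<^sup>+s. g s \<partial>lborel)" for n
    proof -
      have h0: "0 \<le> h n t" for t by (simp add: h_def)
      have "ennreal (h n t) \<le> ennreal (real n)" for t unfolding eh by (auto split: split_indicator)
      then have "\<bar>h n t\<bar> \<le> real n" for t using h0[of t] by (simp add: ennreal_le_iff)
      then have "\<rho> (conv (\<lambda>t. ennreal (h n t)) g) \<le> \<rho> (\<lambda>t. ennreal (h n t)) * (\<integral>\<^sup>+s. g s \<partial>lborel)"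
        using h0 g by (intro conv_L1_bounded[where M = "real n"]) (auto simp: h_def indicator_def abs_le_iff)
      also have "\<dots> \<le> \<rho> f * (\<integral>\<^sup>+s. g s \<partial>lborel)"
        by (intro mult_right_mono mono lebesgue_of_borel) (auto intro: incseq_le[OF hinc hlim])
      finally show ?thesis .
    qed
    then show "\<exists>N. \<forall>n\<ge>N. \<rho> (conv (\<lambda>t. ennreal (h n t)) g) \<le> \<rho> f * (\<integral>\<^sup>+s. g s \<partial>lborel)" by blast
  qed
qed

text \<open>Hoelder's inequality for the reflected translate \<open>f(t - s)\<close>, whose norm is
  that of \<open>f\<close>. The bound is uniform in \<open>t\<close> and not merely almost
  everywhere.\<close>

lemma conv_assoc_le:
  assumes fm[measurable]: "f \<in> borel_measurable borel" and gm[measurable]: "g \<in> borel_measurable borel"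
    and f: "\<rho> f < \<infinity>"
  shows "conv f g t \<le> \<rho> f * assoc_norm \<rho> g"
proof -
  have eq: "\<rho> (\<lambda>s. f (t - s)) = \<rho> f" using affine[of f "-1" t] by simp
  have "conv f g t = (\<integral>\<^sup>+s. f (t - s) * g s \<partial>lebesgue)"
    by (simp add: conv_commute nn_integral_completion)
  also have "\<dots> \<le> \<rho> (\<lambda>s. f (t - s)) * assoc_norm \<rho> g"
    using f by (intro assoc_le lebesgue_of_borel) (auto simp: eq)
  finally show ?thesis by (simp add: eq)
qed

end

section \<open>Convolution as an operator on classes of functions\<close>

definition borel_rep :: "l0 \<Rightarrow> real \<Rightarrow> real" where
  "borel_rep g = (SOME h. h \<in> borel_measurable borel \<and> (AE t in lborel. rep_l0 g t = h t))"

lemma borel_rep: "borel_rep g \<in> borel_measurable borel" "AE t in lborel. rep_l0 g t = borel_rep g t"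
proof -
  have "\<exists>h. h \<in> borel_measurable borel \<and> (AE t in lborel. rep_l0 g t = h t)"
    using completion_ex_borel_measurable_real[OF rep_l0_measurable, of g] by auto
  from someI_ex[OF this] show "borel_rep g \<in> borel_measurable borel" "AE t in lborel. rep_l0 g t = borel_rep g t"
    unfolding borel_rep_def by blast+
qed

declare borel_rep(1) [measurable]

text \<open>The multiplier \<open>m\<close> replaces a lattice property of the target: a function
  below a convolution in absolute value is an image under such an operator. The Bochner integral is
  0 wherever the convolution does not converge absolutely.\<close>

definition conv_op :: "(real \<Rightarrow> real) \<Rightarrow> (real \<Rightarrow> real) \<Rightarrow> l0 \<Rightarrow> l0" where
  "conv_op f m g = abs_l0 (\<lambda>t. m t * (\<integral>s. f s * borel_rep g (t - s) \<partial>lborel))"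

lemma conv_op_measurable:
  assumes [measurable]: "f \<in> borel_measurable borel" and "m \<in> borel_measurable lebesgue"
  shows "(\<lambda>t. m t * (\<integral>s. f s * borel_rep g (t - s) \<partial>lborel)) \<in> borel_measurable lebesgue"
proof -
  have "(\<lambda>t. \<integral>s. f s * borel_rep g (t - s) \<partial>lborel) \<in> borel_measurable borel" by measurable
  then have "(\<lambda>t. \<integral>s. f s * borel_rep g (t - s) \<partial>lborel) \<in> borel_measurable lebesgue" by (rule lebesgue_of_borel)
  then show ?thesis by (rule borel_measurable_times[OF assms(2)])
qed

lemma ennreal_integral_abs_le: "ennreal \<bar>\<integral>s. h s \<partial>M\<bar> \<le> (\<integral>\<^sup>+s. ennreal \<bar>h s\<bar> \<partial>M)" for h :: "_ \<Rightarrow> real"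
  using integral_norm_bound_ennreal[of M h] by (cases "integrable M h") (auto simp: not_integrable_integral_eq)

lemma conv_op_abs_le:
  assumes [measurable]: "f \<in> borel_measurable borel" and m: "\<bar>m t\<bar> \<le> 1"
  shows "ennreal \<bar>m t * (\<integral>s. f s * borel_rep g (t - s) \<partial>lborel)\<bar> \<le>
    conv (\<lambda>s. ennreal \<bar>f s\<bar>) (\<lambda>s. ennreal \<bar>borel_rep g s\<bar>) t"
proof -
  have "ennreal \<bar>m t * (\<integral>s. f s * borel_rep g (t - s) \<partial>lborel)\<bar> \<le> ennreal \<bar>\<integral>s. f s * borel_rep g (t - s) \<partial>lborel\<bar>"
    using m by (intro ennreal_leI) (simp add: abs_mult mult_left_le_one_le)
  also have "\<dots> \<le> (\<integral>\<^sup>+s. ennreal \<bar>f s * borel_rep g (t - s)\<bar> \<partial>lborel)"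
    by (rule ennreal_integral_abs_le)
  finally show ?thesis by (simp add: conv_def abs_mult ennreal_mult)
qed

text \<open>The two finiteness conditions make both integrands integrable at almost every
  \<open>t\<close>; elsewhere the default value 0 of the integral could spoil additivity.\<close>

lemma conv_op_add:
  assumes f[measurable]: "f \<in> borel_measurable borel" and m: "m \<in> borel_measurable lebesgue"
    and g: "AE t in lborel. conv (\<lambda>s. ennreal \<bar>f s\<bar>) (\<lambda>s. ennreal \<bar>borel_rep g s\<bar>) t < \<infinity>"
    and h: "AE t in lborel. conv (\<lambda>s. ennreal \<bar>f s\<bar>) (\<lambda>s. ennreal \<bar>borel_rep h s\<bar>) t < \<infinity>"
  shows "conv_op f m (g + h) = conv_op f m g + conv_op f m h"
  unfolding conv_op_def
  unfolding abs_l0_add[OF conv_op_measurable[OF f m] conv_op_measurable[OF f m]]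
proof (rule abs_l0_eqI)
  have "AE s in lborel. borel_rep (g + h) s = borel_rep g s + borel_rep h s"
    using borel_rep(2)[of "g + h"] borel_rep(2)[of g] borel_rep(2)[of h] rep_l0_add[of g h, unfolded AE_completion_iff]
    by eventually_elim simp
  note eq = AE_reflect_lborel[OF this]
  have "AE t in lborel. m t * (\<integral>s. f s * borel_rep (g + h) (t - s) \<partial>lborel) =
    m t * (\<integral>s. f s * borel_rep g (t - s) \<partial>lborel) + m t * (\<integral>s. f s * borel_rep h (t - s) \<partial>lborel)"
    using g h
  proof eventually_elim
    case (elim t)
    have i: "integrable lborel (\<lambda>s. f s * borel_rep g (t - s))" "integrable lborel (\<lambda>s. f s * borel_rep h (t - s))"
      using elim by (auto simp: integrable_iff_bounded conv_def abs_mult ennreal_mult)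
    have "(\<integral>s. f s * borel_rep (g + h) (t - s) \<partial>lborel) = (\<integral>s. f s * borel_rep g (t - s) + f s * borel_rep h (t - s) \<partial>lborel)"
      using eq[of t] by (intro integral_cong_AE) (auto elim!: eventually_mono simp: distrib_left)
    then show ?case using i by (simp add: distrib_left)
  qed
  then show "AE t in lebesgue. m t * (\<integral>s. f s * borel_rep (g + h) (t - s) \<partial>lborel) =
    m t * (\<integral>s. f s * borel_rep g (t - s) \<partial>lborel) + m t * (\<integral>s. f s * borel_rep h (t - s) \<partial>lborel)"
    by (rule AE_completion)
qed (auto intro!: borel_measurable_add conv_op_measurable[OF f m])

lemma conv_op_scale:
  assumes f[measurable]: "f \<in> borel_measurable borel" and m: "m \<in> borel_measurable lebesgue"
  shows "conv_op f m (c *\<^sub>R g) = c *\<^sub>R conv_op f m g"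
  unfolding conv_op_def abs_l0_scale[OF conv_op_measurable[OF f m]]
proof (rule abs_l0_eqI)
  have "AE s in lborel. borel_rep (c *\<^sub>R g) s = c * borel_rep g s"
    using borel_rep(2)[of "c *\<^sub>R g"] borel_rep(2)[of g] rep_l0_scale[of c g, unfolded AE_completion_iff]
    by eventually_elim simp
  note eq = AE_reflect_lborel[OF this]
  have "(\<integral>s. f s * borel_rep (c *\<^sub>R g) (t - s) \<partial>lborel) = (\<integral>s. c * (f s * borel_rep g (t - s)) \<partial>lborel)" for t
    using eq[of t] by (intro integral_cong_AE) (auto elim!: eventually_mono)
  then show "AE t in lebesgue. m t * (\<integral>s. f s * borel_rep (c *\<^sub>R g) (t - s) \<partial>lborel) =
      c * (m t * (\<integral>s. f s * borel_rep g (t - s) \<partial>lborel))"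
    by simp
qed (auto intro!: conv_op_measurable[OF f m] borel_measurable_times)

text \<open>Also right where the convolution is infinite: the Bochner integral and
  \<open>enn2real\<close> both default to 0 there.\<close>

lemma conv_op_nonneg:
  assumes [measurable]: "f \<in> borel_measurable borel" "g \<in> borel_measurable borel"
    and nn: "\<And>s. 0 \<le> f s" "\<And>s. 0 \<le> g s"
  shows "conv_op f m (abs_l0 g) = abs_l0 (\<lambda>t. m t * enn2real (conv (\<lambda>s. ennreal (f s)) (\<lambda>s. ennreal (g s)) t))"
proof -
  have "AE s in lborel. borel_rep (abs_l0 g) s = g s"
    using borel_rep(2)[of "abs_l0 g"] rep_abs_l0[OF lebesgue_of_borel[OF assms(2)], unfolded AE_completion_iff]
    by eventually_elim simp
  note eq = AE_reflect_lborel[OF this]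
  have "(\<integral>s. f s * borel_rep (abs_l0 g) (t - s) \<partial>lborel) = enn2real (conv (\<lambda>s. ennreal (f s)) (\<lambda>s. ennreal (g s)) t)" for t
  proof -
    have "(\<integral>s. f s * borel_rep (abs_l0 g) (t - s) \<partial>lborel) = (\<integral>s. f s * g (t - s) \<partial>lborel)"
      using eq[of t] by (intro integral_cong_AE) (auto elim!: eventually_mono)
    also have "\<dots> = enn2real (\<integral>\<^sup>+s. ennreal (f s * g (t - s)) \<partial>lborel)"
      using nn by (intro integral_eq_nn_integral) auto
    finally show ?thesis using nn by (simp add: conv_def ennreal_mult)
  qed
  then show ?thesis by (simp add: conv_op_def)
qed

context ri
begin

sublocale assoc: fnorm "assoc_norm \<rho>" by (rule fnorm_assoc)

lemma couple_L1_assoc: "compatible_couple (L1_sp, fspace (assoc_norm \<rho>))"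
  unfolding L1_sp_def by (rule compatible_fspace[OF fnorm_L1 fnorm_assoc])

lemma couple_ri_Linf: "compatible_couple (fspace \<rho>, Linf_sp)"
  unfolding Linf_sp_def by (rule compatible_fspace[OF fnorm_axioms fnorm_esssup])

text \<open>Both end point bounds carry the same \<open>c\<close>, the first from Minkowski's
  inequality (\<open>conv_L1\<close>), the second from Hoelder's (\<open>conv_assoc_le\<close>). The
  almost everywhere finiteness on the sum space is what makes the operator additive there.\<close>

lemma conv_op_bounds:
  assumes f[measurable]: "f \<in> borel_measurable borel" and c: "\<rho> (\<lambda>s. ennreal \<bar>f s\<bar>) \<le> ennreal c" "0 \<le> c"
    and m: "m \<in> borel_measurable lebesgue" "\<And>t. \<bar>m t\<bar> \<le> 1"
  shows "maps_with_bound c L1_sp (fspace \<rho>) (conv_op f m)" (is ?A)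
    and "maps_with_bound c (fspace (assoc_norm \<rho>)) Linf_sp (conv_op f m)" (is ?B)
    and "linear_btw (sum_sp (L1_sp, fspace (assoc_norm \<rho>))) (sum_sp (fspace \<rho>, Linf_sp)) (conv_op f m)" (is ?C)
    and "g \<in> carr (sum_sp (L1_sp, fspace (assoc_norm \<rho>))) \<Longrightarrow>
      AE t in lborel. conv (\<lambda>s. ennreal \<bar>f s\<bar>) (\<lambda>s. ennreal \<bar>borel_rep g s\<bar>) t < \<infinity>"
proof -
  interpret L1: fnorm "\<lambda>f. \<integral>\<^sup>+t. f t \<partial>lebesgue" by (rule fnorm_L1)
  interpret Li: fnorm "esssup lebesgue" by (rule fnorm_esssup)
  interpret X: couple "(L1_sp, fspace (assoc_norm \<rho>))" by standard (rule couple_L1_assoc)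
  interpret Y: couple "(fspace \<rho>, Linf_sp)" by standard (rule couple_ri_Linf)
  let ?K = "\<lambda>g. conv (\<lambda>s. ennreal \<bar>f s\<bar>) (\<lambda>s. ennreal \<bar>borel_rep g s\<bar>)"
  have cfin: "\<rho> (\<lambda>s. ennreal \<bar>f s\<bar>) < \<infinity>" by (rule order.strict_trans1[OF c(1)]) simp
  have rb: "l0norm (abs_l0 h) = \<rho> (\<lambda>t. ennreal \<bar>h t\<bar>)" if "h \<in> borel_measurable lebesgue" for h
    using that by (rule l0norm_abs)
  have br: "AE t in lebesgue. ennreal \<bar>borel_rep g t\<bar> = ennreal \<bar>rep_l0 g t\<bar>" for g
    using borel_rep(2)[of g] unfolding AE_completion_iff by eventually_elim simp
  have K1: "\<rho> (?K g) \<le> ennreal (c * nrm L1_sp g)" if g: "g \<in> carr L1_sp" for g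
  proof -
    have "(\<integral>\<^sup>+s. ennreal \<bar>borel_rep g s\<bar> \<partial>lborel) = (\<integral>\<^sup>+s. ennreal \<bar>rep_l0 g s\<bar> \<partial>lebesgue)"
      using br[of g] by (subst nn_integral_completion[symmetric]) (rule nn_integral_cong_AE)
    also have "\<dots> = ennreal (nrm L1_sp g)"
      using g L1.ennreal_nrm unfolding L1_sp_def by simp
    finally have i: "(\<integral>\<^sup>+s. ennreal \<bar>borel_rep g s\<bar> \<partial>lborel) = ennreal (nrm L1_sp g)" .
    have "\<rho> (?K g) \<le> \<rho> (\<lambda>s. ennreal \<bar>f s\<bar>) * (\<integral>\<^sup>+s. ennreal \<bar>borel_rep g s\<bar> \<partial>lborel)"
      by (rule conv_L1) (auto simp: i)
    also have "\<dots> \<le> ennreal c * ennreal (nrm L1_sp g)"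
      unfolding i using c by (intro mult_right_mono) auto
    finally show ?thesis using c X.X0.nrm_ge0[of g] g by (simp add: ennreal_mult)
  qed
  have K2: "?K g t \<le> ennreal (c * nrm (fspace (assoc_norm \<rho>)) g)" if g: "g \<in> carr (fspace (assoc_norm \<rho>))" for g t
  proof -
    have i: "assoc_norm \<rho> (\<lambda>s. ennreal \<bar>borel_rep g s\<bar>) = ennreal (nrm (fspace (assoc_norm \<rho>)) g)"
      unfolding assoc.ennreal_nrm[OF g]
    proof (rule assoc.cong_AE[OF _ _ br])
      show "(\<lambda>s. ennreal \<bar>borel_rep g s\<bar>) \<in> borel_measurable lebesgue" by (rule lebesgue_of_borel) measurable
    qed measurable
    have "?K g t \<le> \<rho> (\<lambda>s. ennreal \<bar>f s\<bar>) * assoc_norm \<rho> (\<lambda>s. ennreal \<bar>borel_rep g s\<bar>)"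
      by (rule conv_assoc_le[OF _ _ cfin]) measurable
    also have "\<dots> \<le> ennreal c * ennreal (nrm (fspace (assoc_norm \<rho>)) g)"
      unfolding i using c by (intro mult_right_mono) auto
    finally show ?thesis using c X.X1.nrm_ge0[of g] g by (simp add: ennreal_mult)
  qed
  show A: ?A
    unfolding maps_with_bound_def
  proof
    fix g assume g: "g \<in> carr L1_sp"
    have "l0norm (conv_op f m g) \<le> \<rho> (?K g)"
      unfolding conv_op_def rb[OF conv_op_measurable[OF f m(1)]]
    proof (rule mono)
      show "(\<lambda>t. ennreal \<bar>m t * (\<integral>s. f s * borel_rep g (t - s) \<partial>lborel)\<bar>) \<in> borel_measurable lebesgue"
        using conv_op_measurable[OF f m(1), of g] by measurable
    qed (auto intro!: lebesgue_of_borel conv_op_abs_le m)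
    also note K1[OF g]
    finally show "conv_op f m g \<in> carr (fspace \<rho>) \<and> nrm (fspace \<rho>) (conv_op f m g) \<le> c * nrm L1_sp g"
      using c X.X0.nrm_ge0[of g] g by (intro nrm_leI) auto
  qed
  show B: ?B
    unfolding maps_with_bound_def
  proof
    fix g assume g: "g \<in> carr (fspace (assoc_norm \<rho>))"
    have "Li.l0norm (conv_op f m g) = esssup lebesgue (\<lambda>t. ennreal \<bar>m t * (\<integral>s. f s * borel_rep g (t - s) \<partial>lborel)\<bar>)"
      unfolding conv_op_def by (rule Li.l0norm_abs[OF conv_op_measurable[OF f m(1)]])
    also have "\<dots> \<le> ennreal (c * nrm (fspace (assoc_norm \<rho>)) g)"
    proof (rule esssup_I)
      show "(\<lambda>t. ennreal \<bar>m t * (\<integral>s. f s * borel_rep g (t - s) \<partial>lborel)\<bar>) \<in> borel_measurable lebesgue"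
        using conv_op_measurable[OF f m(1), of g] by measurable
      show "AE t in lebesgue. ennreal \<bar>m t * (\<integral>s. f s * borel_rep g (t - s) \<partial>lborel)\<bar> \<le> ennreal (c * nrm (fspace (assoc_norm \<rho>)) g)"
        by (intro AE_I2 order_trans[OF conv_op_abs_le[where m = m, OF f m(2)] K2[OF g]])
    qed
    finally show "conv_op f m g \<in> carr Linf_sp \<and> nrm Linf_sp (conv_op f m g) \<le> c * nrm (fspace (assoc_norm \<rho>)) g"
      unfolding Linf_sp_def using c X.X1.nrm_ge0[of g] g by (intro Li.nrm_leI) auto
  qed
  have fin0: "AE t in lborel. ?K g t < \<infinity>" if "g \<in> carr L1_sp" for g
  proof -
    have "\<rho> (?K g) < \<infinity>" by (rule order.strict_trans1[OF K1[OF that]]) simp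
    moreover have "?K g \<in> borel_measurable lebesgue" by (rule lebesgue_of_borel) measurable
    ultimately show ?thesis using finite_AE[of "?K g"] by (simp only: AE_completion_iff)
  qed
  have fin1: "AE t in lborel. ?K g t < \<infinity>" if "g \<in> carr (fspace (assoc_norm \<rho>))" for g
    by (intro AE_I2 order.strict_trans1[OF K2[OF that]]) simp
  have fin: "AE t in lborel. ?K g t < \<infinity>" if gX: "g \<in> carr (sum_sp (L1_sp, fspace (assoc_norm \<rho>)))" for g
  proof -
    obtain g0 g1 where g: "g0 \<in> carr L1_sp" "g1 \<in> carr (fspace (assoc_norm \<rho>))" "g = g0 + g1"
      using gX by (auto simp: X.carr_sum)
    have "AE s in lborel. ennreal \<bar>borel_rep g s\<bar> \<le> ennreal \<bar>borel_rep g0 s\<bar> + ennreal \<bar>borel_rep g1 s\<bar>"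
      using borel_rep(2)[of g] borel_rep(2)[of g0] borel_rep(2)[of g1] rep_l0_add[of g0 g1, unfolded AE_completion_iff]
      by eventually_elim (auto simp: g(3) simp flip: ennreal_plus intro!: ennreal_leI)
    note eq = AE_reflect_lborel[OF this]
    have le: "?K g t \<le> ?K g0 t + ?K g1 t" for t
    proof -
      have "?K g t \<le> (\<integral>\<^sup>+s. ennreal \<bar>f s\<bar> * ennreal \<bar>borel_rep g0 (t - s)\<bar> + ennreal \<bar>f s\<bar> * ennreal \<bar>borel_rep g1 (t - s)\<bar> \<partial>lborel)"
        unfolding conv_def distrib_left[symmetric]
        using eq[of t] by (intro nn_integral_mono_AE) (auto elim!: eventually_mono intro: mult_left_mono)
      also have "\<dots> = ?K g0 t + ?K g1 t" unfolding conv_def by (rule nn_integral_add) measurable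
      finally show ?thesis .
    qed
    show ?thesis using fin0[OF g(1)] fin1[OF g(2)]
    proof eventually_elim
      case (elim t)
      then show ?case by (intro order.strict_trans1[OF le]) simp
    qed
  qed
  then show "g \<in> carr (sum_sp (L1_sp, fspace (assoc_norm \<rho>))) \<Longrightarrow> AE t in lborel. ?K g t < \<infinity>" .
  show ?C
    unfolding linear_btw_def
  proof (intro conjI ballI allI)
    show "conv_op f m (x + y) = conv_op f m x + conv_op f m y"
      if "x \<in> carr (sum_sp (L1_sp, fspace (assoc_norm \<rho>)))" "y \<in> carr (sum_sp (L1_sp, fspace (assoc_norm \<rho>)))" for x y
      by (rule conv_op_add[OF f m(1) fin[OF that(1)] fin[OF that(2)]])
    show "conv_op f m (c *\<^sub>R x) = c *\<^sub>R conv_op f m x" for x c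
      by (rule conv_op_scale[OF f m(1)])
    show "conv_op f m g \<in> carr (sum_sp (fspace \<rho>, Linf_sp))"
      if g: "g \<in> carr (sum_sp (L1_sp, fspace (assoc_norm \<rho>)))" for g
    proof -
      obtain g0 g1 where g: "g0 \<in> carr L1_sp" "g1 \<in> carr (fspace (assoc_norm \<rho>))" "g = g0 + g1"
        using g by (auto simp: X.carr_sum)
      have "conv_op f m g = conv_op f m g0 + conv_op f m g1"
        unfolding g(3) by (rule conv_op_add[OF f m(1) fin0[OF g(1)] fin1[OF g(2)]])
      moreover have "conv_op f m g0 + conv_op f m g1 \<in> carr (sum_sp (fspace \<rho>, Linf_sp))"
        using A B g(1,2) unfolding maps_with_bound_def by (intro Y.mem_sum) auto
      ultimately show ?thesis by simp
    qed
  qed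
qed

end

section \<open>A uniform bound for interpolation functors\<close>

text \<open>Zabreiko's lemma.\<close>

lemma countably_subadditive_bounded:
  fixes p :: "'a::banach \<Rightarrow> real"
  assumes nonneg: "\<And>x. 0 \<le> p x" and tri: "\<And>x y. p (x + y) \<le> p x + p y"
    and hom: "\<And>c x. p (c *\<^sub>R x) = \<bar>c\<bar> * p x"
    and csub: "\<And>x. summable (\<lambda>n. norm (x n)) \<Longrightarrow> summable (\<lambda>n. p (x n)) \<Longrightarrow> p (\<Sum>n. x n) \<le> (\<Sum>n. p (x n))"
  shows "\<exists>C\<ge>0. \<forall>x. p x \<le> C * norm x"
proof -
  \<comment> \<open>These closed sets cover the space because \<open>p\<close> is finite everywhere;
    by Baire's theorem one of them contains a ball.\<close>
  define A where "A n = closure {x. p x \<le> real n}" for n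
  have "(\<Union>n. A n) = UNIV"
  proof -
    have "x \<in> (\<Union>n. A n)" for x
    proof -
      obtain n where "p x \<le> real n" using real_arch_simple by blast
      then have "x \<in> {x. p x \<le> real n}" by simp
      then have "x \<in> A n" unfolding A_def by (rule subsetD[OF closure_subset])
      then show ?thesis by auto
    qed
    then show ?thesis by blast
  qed
  have "\<exists>n. interior (A n) \<noteq> {}"
  proof (rule ccontr)
    assume "\<nexists>n. interior (A n) \<noteq> {}"
    then have "(euclidean :: 'a topology) interior_of \<Union>(range A) = {}"
      by (intro Baire_category_alt) (auto simp: completely_metrizable_space_euclidean A_def)
    then show False using \<open>(\<Union>n. A n) = UNIV\<close> by simp
  qed
  then obtain n x0 r where r: "0 < r" "ball x0 r \<subseteq> A n"
    by (metis ex_in_conv interior_subset mem_interior)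
  \<comment> \<open>The ball is moved to the origin by symmetry and convexity of the sublevel set:
    half the difference of approximants of \<open>x0 + y\<close> and \<open>x0 - y\<close>
    approximates \<open>y\<close>.\<close>
  have near: "\<exists>w. p w \<le> real n \<and> norm (y - w) < d" if y: "norm y < r" and d: "0 < d" for y d
  proof -
    have "x0 + y \<in> A n" "x0 - y \<in> A n" using r y by (auto simp: dist_norm)
    then obtain u v where uv: "p u \<le> real n" "dist u (x0 + y) < d" "p v \<le> real n" "dist v (x0 - y) < d"
      unfolding A_def using d closure_approachable[of _ "{x. p x \<le> real n}"] by (metis mem_Collect_eq)
    define w where "w = (1/2) *\<^sub>R (u + (-1) *\<^sub>R v)"
    have "p w \<le> (1/2) * (p u + p v)"
      using tri[of u "(-1) *\<^sub>R v"] hom[of "-1" v] hom[of "1/2" "u + (-1) *\<^sub>R v"] by (simp add: w_def)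
    then have "p w \<le> real n" using uv by simp
    moreover have "norm (y - w) < d"
    proof -
      have eq: "y - w = (1/2) *\<^sub>R ((x0 + y - u) - (x0 - y - v))"
        by (simp add: w_def algebra_simps flip: scaleR_2)
      have "norm (y - w) = (1/2) * norm ((x0 + y - u) - (x0 - y - v))"
        unfolding eq norm_scaleR by (simp only: abs_of_pos[of "1/2::real"] half_gt_zero_iff zero_less_one)
      also have "\<dots> \<le> (1/2) * (norm (x0 + y - u) + norm (x0 - y - v))"
        by (intro mult_left_mono norm_triangle_ineq4) simp
      finally have "norm (y - w) \<le> (1/2) * (norm (x0 + y - u) + norm (x0 - y - v))" .
      then show ?thesis using uv by (simp add: dist_norm norm_minus_commute)
    qed
    ultimately show ?thesis by blast
  qed
  \<comment> \<open>From scaling \<open>y\<close> to norm \<open>r / 2\<close>, inside the ball: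
    undoing the scaling multiplies the bound \<open>n\<close> by
    \<open>2 * norm y / r\<close>.\<close>
  define K where "K = 2 * real n / r"
  have K: "0 \<le> K" using r by (simp add: K_def)
  have approx: "\<exists>w. p w \<le> K * norm y \<and> norm (y - w) < d" if d: "0 < d" for y d
  proof (cases "y = 0")
    case True
    have "p 0 = 0" using hom[of 0 0] by simp
    then show ?thesis using True d by (intro exI[of _ 0]) simp
  next
    case False
    define c where "c = r / (2 * norm y)"
    have c: "0 < c" using r False by (simp add: c_def)
    have "norm (c *\<^sub>R y) < r" using r False by (simp add: c_def)
    then obtain w where w: "p w \<le> real n" "norm (c *\<^sub>R y - w) < c * d"
      using near[of "c *\<^sub>R y" "c * d"] c d by auto
    have "p ((1 / c) *\<^sub>R w) \<le> K * norm y"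
      using w(1) c False r unfolding hom by (simp add: c_def K_def field_simps)
    moreover have "norm (y - (1 / c) *\<^sub>R w) < d"
    proof -
      have "c *\<^sub>R (y - (1 / c) *\<^sub>R w) = c *\<^sub>R y - w" using c by (simp add: scaleR_diff_right)
      then have "c * norm (y - (1 / c) *\<^sub>R w) = norm (c *\<^sub>R y - w)" using c by (metis abs_of_pos norm_scaleR)
      then show ?thesis using w(2) c by (metis mult_less_cancel_left_pos)
    qed
    ultimately show ?thesis by blast
  qed
  define W where "W y k = (SOME w. p w \<le> K * norm y \<and> norm (y - w) < (1/2)^Suc k)" for y and k :: nat
  have W: "p (W y k) \<le> K * norm y" "norm (y - W y k) < (1/2)^Suc k" for y k
    using someI_ex[OF approx[of "(1/2)^Suc k" y]] unfolding W_def by auto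
  have unit: "p y \<le> 2 * K" if y: "norm y \<le> 1" for y
  proof -
    \<comment> \<open>Residuals of successive approximation. The \<open>k\<close>-th one has norm at
      most \<open>(1/2)^k\<close>, so its approximant costs at most \<open>K * (1/2)^k\<close>;
      countable subadditivity adds these up to \<open>2 * K\<close>.\<close>
    define z where "z = rec_nat y (\<lambda>k z. z - W z k)"
    have z0: "z 0 = y" and zS: "z (Suc k) = z k - W (z k) k" for k by (simp_all add: z_def)
    have zb: "norm (z k) \<le> (1/2)^k" for k
      using y W(2)[of "z (k - 1)" "k - 1"] by (cases k) (auto simp: z0 zS less_imp_le)
    define w where "w k = W (z k) k" for k
    have sw: "sum w {..<m} = y - z m" for m
      by (induction m) (simp_all add: z0 zS w_def)
    have wb: "norm (w k) \<le> 2 * (1/2)^k" for k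
    proof -
      have "w k = z k - z (Suc k)" by (simp add: w_def zS)
      then have "norm (w k) \<le> norm (z k) + norm (z (Suc k))" by (simp add: norm_triangle_ineq4)
      also have "\<dots> \<le> (1/2)^k + (1/2)^Suc k" by (intro add_mono zb)
      also have "\<dots> \<le> 2 * (1/2)^k" by simp
      finally show ?thesis .
    qed
    have pw: "p (w k) \<le> K * (1/2)^k" for k
      using W(1)[of "z k" k] mult_left_mono[OF zb[of k] K] by (simp add: w_def)
    have geo: "(\<lambda>k. K * (1/2)^k) sums (K * 2)"
      using geometric_sums[of "1/2::real"] by (intro sums_mult) simp
    have s1: "summable (\<lambda>k. norm (w k))"
      by (rule summable_comparison_test'[of "\<lambda>k. 2 * (1/2)^k"]) (use wb in \<open>auto intro: summable_mult summable_geometric\<close>)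
    have s2: "summable (\<lambda>k. p (w k))"
      by (rule summable_comparison_test'[OF sums_summable[OF geo]]) (use pw nonneg in auto)
    have "(\<lambda>m. z m) \<longlonglongrightarrow> 0"
      by (rule Lim_null_comparison[of _ "\<lambda>k. (1/2)^k"]) (auto simp: zb intro!: LIMSEQ_power_zero)
    then have "(\<lambda>m. y - z m) \<longlonglongrightarrow> y - 0" by (intro tendsto_intros)
    then have "w sums y" by (simp add: sums_def sw)
    then have "p y \<le> (\<Sum>k. p (w k))" using csub[OF s1 s2] by (simp add: sums_unique[symmetric])
    also have "\<dots> \<le> (\<Sum>k. K * (1/2)^k)"
      by (rule suminf_le[OF pw s2 sums_summable[OF geo]])
    also have "\<dots> = 2 * K" using sums_unique[OF geo] by simp
    finally show ?thesis .
  qed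
  show ?thesis
  proof (intro exI[of _ "2 * K"] conjI allI)
    fix x
    show "p x \<le> 2 * K * norm x"
    proof (cases "x = 0")
      case True
      then show ?thesis using hom[of 0 0] by simp
    next
      case False
      have "p ((1 / norm x) *\<^sub>R x) \<le> 2 * K" using False by (intro unit) simp
      then show ?thesis using False by (simp add: hom field_simps)
    qed
  qed (use K in simp)
qed

text \<open>Supplies the Banach space of coefficients for Zabreiko's lemma: bounded continuous
  functions, sampled at the natural numbers, play the role of bounded sequences.\<close>

instance bcontfun :: (metric_space, banach) banach ..

lemma maps_with_boundD:
  assumes "maps_with_bound K X Y S" "x \<in> carr X"
  shows "S x \<in> carr Y" "nrm Y (S x) \<le> K * nrm X x"
  using assms by (auto simp: maps_with_bound_def)

lemma sum_bound:
  assumes X: "compatible_couple X" and Y: "compatible_couple Y"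
    and S: "linear_btw (sum_sp X) (sum_sp Y) S"
    and S0: "maps_with_bound c (fst X) (fst Y) S" and S1: "maps_with_bound c (snd X) (snd Y) S" and c: "0 \<le> c"
    and x: "x \<in> carr (sum_sp X)"
  shows "nrm (sum_sp Y) (S x) \<le> c * nrm (sum_sp X) x"
proof (rule field_le_epsilon)
  interpret X: couple X by standard (rule X)
  interpret Y: couple Y by standard (rule Y)
  fix e :: real assume e: "0 < e"
  have "nrm (sum_sp X) x < nrm (sum_sp X) x + e / (c + 1)" using e c by simp
  then obtain x0 x1 where *: "x0 \<in> carr (fst X)" "x1 \<in> carr (snd X)" "x = x0 + x1"
    "nrm (fst X) x0 + nrm (snd X) x1 < nrm (sum_sp X) x + e / (c + 1)"
    using X.nrm_sum_approx[OF x] by metis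
  have "nrm (sum_sp Y) (S x) \<le> nrm (fst Y) (S x0) + nrm (snd Y) (S x1)"
    unfolding *(3) linear_btwD(2)[OF S X.mem_sum0[OF *(1)] X.mem_sum1[OF *(2)]]
    by (intro Y.nrm_sum_split maps_with_boundD[OF S0] maps_with_boundD[OF S1] *)
  also have "\<dots> \<le> c * nrm (fst X) x0 + c * nrm (snd X) x1"
    by (intro add_mono maps_with_boundD[OF S0] maps_with_boundD[OF S1] *)
  also have "\<dots> \<le> c * (nrm (sum_sp X) x + e / (c + 1))"
    using *(4) c by (simp add: distrib_left[symmetric] mult_left_mono)
  also have "\<dots> \<le> c * nrm (sum_sp X) x + e" using c e by (simp add: field_simps)
  finally show "nrm (sum_sp Y) (S x) \<le> c * nrm (sum_sp X) x + e" .
qed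

text \<open>If there were no bound, operators \<open>S n\<close> would exist that are contractions
  at the end points and not bounded by \<open>4^n\<close> on the functor spaces. For every bounded
  coefficient sequence \<open>a\<close> the combination \<open>\<Sum> a(i) 2^(-i) S i\<close> is
  again admissible, hence bounded there. Zabreiko's lemma makes its norm at most \<open>C\<close>
  times that of \<open>a\<close>, and a unit sequence isolates one \<open>S n\<close>.\<close>

lemma functor_unit_bound:
  fixes F :: "'v::real_vector couple \<Rightarrow> 'v nspace"
  assumes F: "interpolation_functor F" and X: "compatible_couple X" and Y: "compatible_couple Y"
  shows "\<exists>K\<ge>0. \<forall>S. linear_btw (sum_sp X) (sum_sp Y) S \<longrightarrow> maps_with_bound 1 (fst X) (fst Y) S \<longrightarrow>
    maps_with_bound 1 (snd X) (snd Y) S \<longrightarrow> maps_with_bound K (F X) (F Y) S"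
proof (rule ccontr)
  assume neg: "\<not> ?thesis"
  interpret X: couple X by standard (rule X)
  interpret Y: couple Y by standard (rule Y)
  have FB: "banach_sp (F X)" "banach_sp (F Y)" "cont_embedded (F X) (sum_sp X)" "cont_embedded (F Y) (sum_sp Y)"
    using F X Y unfolding interpolation_functor_def by blast+
  interpret FX: nsp "F X" using FB by (intro nsp.intro) (simp add: banach_sp_def)
  interpret FY: nsp "F Y" using FB by (intro nsp.intro) (simp add: banach_sp_def)
  have Fmap: "\<exists>K. maps_with_bound K (F X) (F Y) S" if "linear_btw (sum_sp X) (sum_sp Y) S"
    "maps_with_bound c (fst X) (fst Y) S" "maps_with_bound c (snd X) (snd Y) S" for S c
    using F X Y that unfolding interpolation_functor_def by blast
  have FXs: "x \<in> carr (sum_sp X)" if "x \<in> carr (F X)" for x using FB(3) that by (auto simp: cont_embedded_def)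
  have ex: "\<exists>S. linear_btw (sum_sp X) (sum_sp Y) S \<and> maps_with_bound 1 (fst X) (fst Y) S \<and>
    maps_with_bound 1 (snd X) (snd Y) S \<and> \<not> maps_with_bound (4^n) (F X) (F Y) S" for n :: nat
    using neg by (metis zero_le_power zero_le_numeral)
  define S where "S n = (SOME S. linear_btw (sum_sp X) (sum_sp Y) S \<and> maps_with_bound 1 (fst X) (fst Y) S \<and>
    maps_with_bound 1 (snd X) (snd Y) S \<and> \<not> maps_with_bound (4^n) (F X) (F Y) S)" for n :: nat
  have S: "linear_btw (sum_sp X) (sum_sp Y) (S n)" "maps_with_bound 1 (fst X) (fst Y) (S n)"
    "maps_with_bound 1 (snd X) (snd Y) (S n)" "\<not> maps_with_bound (4^n) (F X) (F Y) (S n)" for n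
    using someI_ex[OF ex[of n]] unfolding S_def by blast+
  have Ss: "S n x \<in> carr (sum_sp Y)" "nrm (sum_sp Y) (S n x) \<le> nrm (sum_sp X) x" if "x \<in> carr (sum_sp X)" for n x
    using linear_btwD(1)[OF S(1) that] sum_bound[OF X Y S(1-3) _ that] by auto
  \<comment> \<open>The weights \<open>2^(-i)\<close> make the combination converge at both end
    points with norm at most \<open>2 * norm a\<close>. They are also why the counterexamples are
    asked to exceed \<open>4^n\<close>.\<close>
  define q where "q (a :: real \<Rightarrow>\<^sub>C real) i = apply_bcontfun a (real i) * (1/2)^i" for a and i :: nat
  have qb: "\<bar>q a i\<bar> \<le> norm a * (1/2)^i" for a i
    using norm_bounded[of a "real i"] by (auto simp: q_def abs_mult intro: mult_right_mono)
  have geo: "(\<lambda>i. C * (1/2)^i) sums (2 * C)" for C :: real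
    using sums_mult[OF geometric_sums[of "1/2::real"], of C] by (simp add: mult.commute)
  have egeo: "(\<Sum>i. ennreal (C * (1/2)^i)) = ennreal (2 * C)" if "0 \<le> C" for C :: real
    using that by (intro suminf_ennreal_eq geo) simp
  have conv: "\<exists>y. nsums Z (\<lambda>i. q a i *\<^sub>R f i) y" and bound: "nsums Z (\<lambda>i. q a i *\<^sub>R f i) y \<Longrightarrow> nrm Z y \<le> 2 * norm a * C"
    if Z: "banach_sp Z" and f: "\<And>i. f i \<in> carr Z" "\<And>i. nrm Z (f i) \<le> C" for Z :: "'v nspace" and f a C y
  proof -
    interpret Z: nsp Z using Z by (intro nsp.intro) (simp add: banach_sp_def)
    have C: "0 \<le> C" by (rule order_trans[OF Z.nrm_ge0[OF f(1)] f(2)])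
    have b: "nrm Z (q a i *\<^sub>R f i) \<le> norm a * C * (1/2)^i" for i
      using mult_mono[OF qb[of a i] f(2)[of i]] f(1)[of i] by (simp add: Z.nrm_scale mult_ac)
    have "(\<Sum>i. ennreal (nrm Z (q a i *\<^sub>R f i))) \<le> (\<Sum>i. ennreal (norm a * C * (1/2)^i))"
      by (intro suminf_le summableI ennreal_leI b)
    also have "\<dots> = ennreal (2 * (norm a * C))" by (rule egeo) (use C in simp)
    finally have s: "(\<Sum>i. ennreal (nrm Z (q a i *\<^sub>R f i))) \<le> ennreal (2 * (norm a * C))" .
    show "\<exists>y. nsums Z (\<lambda>i. q a i *\<^sub>R f i) y"
    proof (rule banach_nsums[OF Z])
      show "(\<Sum>i. ennreal (nrm Z (q a i *\<^sub>R f i))) < \<infinity>" by (rule order.strict_trans1[OF s]) simp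
    qed (use f in simp)
    show "nrm Z y \<le> 2 * norm a * C" if "nsums Z (\<lambda>i. q a i *\<^sub>R f i) y"
    proof -
      have "ennreal (nrm Z y) \<le> ennreal (2 * (norm a * C))" using Z.nsums_nrm_le[OF that] s by (rule order_trans)
      then show ?thesis using C by (simp add: ennreal_le_iff mult.assoc)
    qed
  qed
  define Sa where "Sa a x = (THE y. nsums (sum_sp Y) (\<lambda>i. q a i *\<^sub>R S i x) y)" for a x
  have Sa: "nsums (sum_sp Y) (\<lambda>i. q a i *\<^sub>R S i x) (Sa a x)" if x: "x \<in> carr (sum_sp X)" for a x
  proof -
    have "\<exists>y. nsums (sum_sp Y) (\<lambda>i. q a i *\<^sub>R S i x) y"
      by (rule conv[OF Y.banach_sum Ss(1)[OF x] Ss(2)[OF x]])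
    then obtain y where y: "nsums (sum_sp Y) (\<lambda>i. q a i *\<^sub>R S i x) y" ..
    then have "Sa a x = y" unfolding Sa_def
      by (rule the_equality) (rule Y.S.nsums_unique[OF _ y])
    then show ?thesis using y by simp
  qed
  have SaI: "Sa a x = y" if "x \<in> carr (sum_sp X)" "nsums (sum_sp Y) (\<lambda>i. q a i *\<^sub>R S i x) y" for a x y
    using Sa[OF that(1)] that(2) by (rule Y.S.nsums_unique)
  have lin: "linear_btw (sum_sp X) (sum_sp Y) (Sa a)" for a
    unfolding linear_btw_def
  proof (intro conjI ballI allI)
    fix x y assume x: "x \<in> carr (sum_sp X)" and y: "y \<in> carr (sum_sp X)"
    show "Sa a (x + y) = Sa a x + Sa a y"
      using Y.S.nsums_add[OF Sa[OF x, of a] Sa[OF y, of a]] x y linear_btwD(2)[OF S(1) x y]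
      by (intro SaI) (simp_all add: scaleR_add_right)
  next
    fix x c assume x: "x \<in> carr (sum_sp X)"
    show "Sa a (c *\<^sub>R x) = c *\<^sub>R Sa a x"
      using Y.S.nsums_scale[OF Sa[OF x, of a], of c] x linear_btwD(3)[OF S(1) x]
      by (intro SaI) (simp_all add: mult.commute)
  qed (use Sa nsumsD(2) in blast)
  have b0: "maps_with_bound (2 * norm a) (fst X) (fst Y) (Sa a)" for a
    unfolding maps_with_bound_def
  proof
    fix x assume x: "x \<in> carr (fst X)"
    have *: "S i x \<in> carr (fst Y)" "nrm (fst Y) (S i x) \<le> nrm (fst X) x" for i
      using maps_with_boundD[OF S(2) x] by auto
    have "\<exists>y. nsums (fst Y) (\<lambda>i. q a i *\<^sub>R S i x) y" by (rule conv[OF Y.banach0 *])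
    then obtain y where y: "nsums (fst Y) (\<lambda>i. q a i *\<^sub>R S i x) y" ..
    have yb: "nrm (fst Y) y \<le> 2 * norm a * nrm (fst X) x" by (rule bound[OF Y.banach0 * y])
    have "Sa a x = y" by (rule SaI[OF X.mem_sum0[OF x] Y.nsums_sum0[OF y]])
    then show "Sa a x \<in> carr (fst Y) \<and> nrm (fst Y) (Sa a x) \<le> 2 * norm a * nrm (fst X) x"
      using nsumsD(2)[OF y] yb by simp
  qed
  have b1: "maps_with_bound (2 * norm a) (snd X) (snd Y) (Sa a)" for a
    unfolding maps_with_bound_def
  proof
    fix x assume x: "x \<in> carr (snd X)"
    have *: "S i x \<in> carr (snd Y)" "nrm (snd Y) (S i x) \<le> nrm (snd X) x" for i
      using maps_with_boundD[OF S(3) x] by auto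
    have "\<exists>y. nsums (snd Y) (\<lambda>i. q a i *\<^sub>R S i x) y" by (rule conv[OF Y.banach1 *])
    then obtain y where y: "nsums (snd Y) (\<lambda>i. q a i *\<^sub>R S i x) y" ..
    have yb: "nrm (snd Y) y \<le> 2 * norm a * nrm (snd X) x" by (rule bound[OF Y.banach1 * y])
    have "Sa a x = y" by (rule SaI[OF X.mem_sum1[OF x] Y.nsums_sum1[OF y]])
    then show "Sa a x \<in> carr (snd Y) \<and> nrm (snd Y) (Sa a x) \<le> 2 * norm a * nrm (snd X) x"
      using nsumsD(2)[OF y] yb by simp
  qed
  have Sadd: "Sa (a + b) x = Sa a x + Sa b x" if x: "x \<in> carr (sum_sp X)" for a b x
    using Y.S.nsums_add[OF Sa[OF x, of a] Sa[OF x, of b]] x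
    by (intro SaI) (simp_all add: q_def plus_bcontfun.rep_eq distrib_right scaleR_add_left)
  have Sscale: "Sa (c *\<^sub>R a) x = c *\<^sub>R Sa a x" if x: "x \<in> carr (sum_sp X)" for a c x
    using Y.S.nsums_scale[OF Sa[OF x, of a], of c] x
    by (intro SaI) (simp_all add: q_def scaleR_bcontfun.rep_eq mult.assoc)
  \<comment> \<open>Operator norm of \<open>Sa a\<close> on the functor spaces, finite for each
    single \<open>a\<close> by the definition of a functor.\<close>
  define p where "p a = Sup {nrm (F Y) (Sa a x) | x. x \<in> carr (F X) \<and> nrm (F X) x \<le> 1}" for a
  have SaF: "Sa a x \<in> carr (F Y)" if "x \<in> carr (F X)" for a x
    using Fmap[OF lin b0 b1, of a] maps_with_boundD(1)[OF _ that] by blast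
  have bdd: "bdd_above {nrm (F Y) (Sa a x) | x. x \<in> carr (F X) \<and> nrm (F X) x \<le> 1}" for a
  proof -
    obtain K where K: "maps_with_bound K (F X) (F Y) (Sa a)" using Fmap[OF lin b0 b1] by blast
    have "nrm (F Y) (Sa a x) \<le> \<bar>K\<bar>" if "x \<in> carr (F X)" "nrm (F X) x \<le> 1" for x
    proof -
      have "nrm (F Y) (Sa a x) \<le> K * nrm (F X) x" by (rule maps_with_boundD[OF K that(1)])
      also have "\<dots> \<le> \<bar>K\<bar> * 1" using that by (intro mult_mono) auto
      finally show ?thesis by simp
    qed
    then show ?thesis by (intro bdd_aboveI[of _ "\<bar>K\<bar>"]) auto
  qed
  have p_up: "nrm (F Y) (Sa a x) \<le> p a" if "x \<in> carr (F X)" "nrm (F X) x \<le> 1" for a x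
    unfolding p_def using that bdd by (intro cSup_upper) auto
  have p_le: "p a \<le> B" if "\<And>x. x \<in> carr (F X) \<Longrightarrow> nrm (F X) x \<le> 1 \<Longrightarrow> nrm (F Y) (Sa a x) \<le> B" for a B
    unfolding p_def using that by (intro cSup_least) (auto intro!: exI[of _ 0])
  have p_nn: "0 \<le> p a" for a
    by (rule order_trans[OF FY.nrm_ge0[OF SaF[OF FX.zero_mem]] p_up]) simp_all
  have p_scale_le: "p (c *\<^sub>R a) \<le> \<bar>c\<bar> * p a" for c a
    using SaF FXs by (intro p_le) (simp add: Sscale FY.nrm_scale mult_left_mono p_up)
  have "\<exists>C\<ge>0. \<forall>a. p a \<le> C * norm a"
  proof (rule countably_subadditive_bounded)
    show "0 \<le> p a" for a by (rule p_nn)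
    show "p (a + b) \<le> p a + p b" for a b
    proof (rule p_le)
      fix x assume x: "x \<in> carr (F X)" "nrm (F X) x \<le> 1"
      have "nrm (F Y) (Sa a x + Sa b x) \<le> nrm (F Y) (Sa a x) + nrm (F Y) (Sa b x)"
        by (intro FY.nrm_triangle SaF x)
      also have "\<dots> \<le> p a + p b" by (intro add_mono p_up x)
      finally show "nrm (F Y) (Sa (a + b) x) \<le> p a + p b" by (simp add: Sadd FXs x)
    qed
    show "p (c *\<^sub>R a) = \<bar>c\<bar> * p a" for c a
    proof (cases "c = 0")
      case True
      then show ?thesis using p_scale_le[of 0 a] p_nn[of 0] by simp
    next
      case False
      have "p a \<le> \<bar>1 / c\<bar> * p (c *\<^sub>R a)" using p_scale_le[of "1 / c" "c *\<^sub>R a"] False by simp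
      then have "\<bar>c\<bar> * p a \<le> p (c *\<^sub>R a)" using False by (simp add: field_simps)
      then show ?thesis using p_scale_le[of c a] by simp
    qed
    show "p (\<Sum>n. a n) \<le> (\<Sum>n. p (a n))" if s: "summable (\<lambda>n. norm (a n))" and sp: "summable (\<lambda>n. p (a n))" for a
    proof (rule p_le)
      fix x assume x: "x \<in> carr (F X)" "nrm (F X) x \<le> 1"
      note xs = FXs[OF x(1)]
      have pe: "(\<Sum>n. ennreal (nrm (F Y) (Sa (a n) x))) \<le> ennreal (\<Sum>n. p (a n))"
        using sp p_nn by (subst suminf_ennreal2[symmetric]) (auto intro!: suminf_le ennreal_leI p_up x)
      \<comment> \<open>The series has a sum \<open>y\<close> in \<open>F Y\<close> because the
        \<open>p (a n)\<close> are summable, and the sum \<open>Sa (suminf a) x\<close> in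
        \<open>Y_0 + Y_1\<close> because the end point bounds are linear in \<open>norm a\<close>.
        The embedding of \<open>F Y\<close> makes the two equal.\<close>
      have "\<exists>y. nsums (F Y) (\<lambda>n. Sa (a n) x) y"
        by (rule banach_nsums[OF FB(2) SaF[OF x(1)]]) (rule order.strict_trans1[OF pe], simp)
      then obtain y where y: "nsums (F Y) (\<lambda>n. Sa (a n) x) y" ..
      obtain K where K: "\<And>z. z \<in> carr (F Y) \<Longrightarrow> nrm (sum_sp Y) z \<le> K * nrm (F Y) z" "carr (F Y) \<subseteq> carr (sum_sp Y)"
        using FB(4) by (auto simp: cont_embedded_def)
      have y1: "nsums (sum_sp Y) (\<lambda>n. Sa (a n) x) y"
        by (rule nsums_map[OF FY.normed Y.normed_sum Y.linear_id[OF K(2)] K(1) y])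
      have "summable a" using s by (rule summable_norm_cancel)
      then have lim: "(\<lambda>n. sum a {..<n}) \<longlonglongrightarrow> suminf a" by (rule summable_LIMSEQ)
      have Ssum: "Sa (sum a {..<n}) x = (\<Sum>i<n. Sa (a i) x)" for n
        using Sscale[OF xs, of 0 0] by (induction n) (simp_all add: Sadd[OF xs])
      have "nsums (sum_sp Y) (\<lambda>n. Sa (a n) x) (Sa (suminf a) x)"
        unfolding nsums_def
      proof (intro conjI allI Y.S.nlimI_le)
        show c: "Sa (a n) x \<in> carr (sum_sp Y)" for n by (rule linear_btwD(1)[OF lin xs])
        show "Sa (suminf a) x \<in> carr (sum_sp Y)" by (rule linear_btwD(1)[OF lin xs])
        show "(\<Sum>i<n. Sa (a i) x) \<in> carr (sum_sp Y)" for n using c by simp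
        show "nrm (sum_sp Y) ((\<Sum>i<n. Sa (a i) x) - Sa (suminf a) x) \<le> 2 * norm (sum a {..<n} - suminf a) * nrm (sum_sp X) x" for n
        proof -
          have "Sa (sum a {..<n} - suminf a) x = (\<Sum>i<n. Sa (a i) x) - Sa (suminf a) x"
            using Sadd[OF xs, of "sum a {..<n}" "(-1) *\<^sub>R suminf a"] Sscale[OF xs, of "-1" "suminf a"] by (simp add: Ssum)
          then show ?thesis
            using sum_bound[OF X Y lin b0 b1 _ xs, of "sum a {..<n} - suminf a"] by simp
        qed
        have "(\<lambda>n. 2 * norm (sum a {..<n} - suminf a) * nrm (sum_sp X) x) \<longlonglongrightarrow> 2 * norm (suminf a - suminf a) * nrm (sum_sp X) x"
          by (intro tendsto_intros lim)
        then show "(\<lambda>n. 2 * norm (sum a {..<n} - suminf a) * nrm (sum_sp X) x) \<longlonglongrightarrow> 0" by simp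
      qed
      then have "Sa (suminf a) x = y" using y1 by (rule Y.S.nsums_unique)
      moreover have "ennreal (nrm (F Y) y) \<le> ennreal (\<Sum>n. p (a n))"
        using FY.nsums_nrm_le[OF y] pe by (rule order_trans)
      ultimately show "nrm (F Y) (Sa (suminf a) x) \<le> (\<Sum>n. p (a n))"
        using suminf_nonneg[OF sp] p_nn by (simp add: ennreal_le_iff)
    qed
  qed
  then obtain C where C: "0 \<le> C" "\<And>a. p a \<le> C * norm a" by blast
  obtain n where n: "C < 2^n" using real_arch_pow[of 2 C] by auto
  \<comment> \<open>A tent function whose values at the natural numbers form the \<open>n\<close>-th
    unit sequence, so that \<open>Sa e\<close> is \<open>2^(-n)\<close> times \<open>S n\<close>.
    With \<open>C < 2^n\<close> this bounds \<open>S n\<close> by \<open>4^n\<close>.\<close>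
  define e where "e = Bcontfun (\<lambda>x::real. max 0 (1 - \<bar>x - real n\<bar>))"
  have "(\<lambda>x::real. max 0 (1 - \<bar>x - real n\<bar>)) \<in> bcontfun"
    by (rule bcontfun_normI[where b = 1]) (auto intro!: continuous_intros)
  then have ex: "apply_bcontfun e x = max 0 (1 - \<bar>x - real n\<bar>)" for x
    by (simp add: e_def Bcontfun_inverse)
  have ea: "apply_bcontfun e (real i) = (if i = n then 1 else 0)" for i
    unfolding ex by (cases "i < n"; cases "i = n") auto
  have ne: "norm e \<le> 1" by (rule norm_bound) (simp add: ex)
  have Se: "Sa e x = (1/2)^n *\<^sub>R S n x" if x: "x \<in> carr (sum_sp X)" for x
  proof (rule SaI[OF x])
    have "(\<lambda>i. q e i *\<^sub>R S i x) = (\<lambda>i. if i = n then (1/2)^n *\<^sub>R S n x else 0)"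
      by (auto simp: fun_eq_iff q_def ea)
    then show "nsums (sum_sp Y) (\<lambda>i. q e i *\<^sub>R S i x) ((1/2)^n *\<^sub>R S n x)"
      using Ss(1)[OF x] by (simp add: Y.S.nsums_single)
  qed
  have "maps_with_bound (4^n) (F X) (F Y) (S n)"
    unfolding maps_with_bound_def
  proof
    fix x assume x: "x \<in> carr (F X)"
    have SF: "S n x \<in> carr (F Y)"
      using Fmap[OF S(1,2,3)] maps_with_boundD(1)[OF _ x] by blast
    have "nrm (F Y) (S n x) \<le> 4^n * nrm (F X) x"
    proof (cases "x = 0")
      case True
      then have "S n x = 0" using linear_btwD(3)[OF S(1)[of n], of 0 0] by simp
      then show ?thesis using True by simp
    next
      case False
      then have nx: "0 < nrm (F X) x" using FX.nrm_eq0[OF x] FX.nrm_ge0[OF x] by (simp only: less_le) auto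
      let ?y = "(1 / nrm (F X) x) *\<^sub>R x"
      have y: "?y \<in> carr (F X)" "nrm (F X) ?y \<le> 1" using x nx by (simp_all add: FX.nrm_scale)
      have "nrm (F Y) (Sa e ?y) \<le> C"
        using p_up[OF y, of e] C(2)[of e] mult_left_mono[OF ne C(1)] by simp
      moreover have "Sa e ?y = ((1/2)^n / nrm (F X) x) *\<^sub>R S n x"
        using Se[OF FXs[OF y(1)]] linear_btwD(3)[OF S(1) FXs[OF x]] by simp
      ultimately have "(1/2)^n / nrm (F X) x * nrm (F Y) (S n x) \<le> C"
        using SF nx by (simp add: FY.nrm_scale)
      then have "nrm (F Y) (S n x) \<le> C * 2^n * nrm (F X) x"
        using nx by (simp add: field_simps power_divide)
      also have "\<dots> \<le> 2^n * 2^n * nrm (F X) x" using n nx by (intro mult_right_mono) auto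
      finally show ?thesis by (simp flip: power_mult_distrib)
    qed
    with SF show "S n x \<in> carr (F Y) \<and> nrm (F Y) (S n x) \<le> 4^n * nrm (F X) x" ..
  qed
  with S(4)[of n] show False by simp
qed

text \<open>Outside the exact case, \<open>S / c\<close> reduces a bound \<open>c > 0\<close> to the
  unit case. An exact functor is kept apart only to have the constant 1.\<close>

lemma functor_uniform_bound:
  fixes F :: "'v::real_vector couple \<Rightarrow> 'v nspace"
  assumes F: "interpolation_functor F" and X: "compatible_couple X" and Y: "compatible_couple Y"
  obtains K where "0 \<le> K" "exact_functor F \<Longrightarrow> K = 1"
    "\<And>S c. 0 \<le> c \<Longrightarrow> linear_btw (sum_sp X) (sum_sp Y) S \<Longrightarrow> maps_with_bound c (fst X) (fst Y) S \<Longrightarrow>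
      maps_with_bound c (snd X) (snd Y) S \<Longrightarrow> maps_with_bound (K * c) (F X) (F Y) S"
proof (cases "exact_functor F")
  case True
  show ?thesis
  proof (rule that[of 1])
    show "maps_with_bound (1 * c) (F X) (F Y) S" if "linear_btw (sum_sp X) (sum_sp Y) S"
      "maps_with_bound c (fst X) (fst Y) S" "maps_with_bound c (snd X) (snd Y) S" for S c
      using True X Y that unfolding exact_functor_def mult_1 by blast
  qed simp_all
next
  case False
  interpret X: couple X by standard (rule X)
  interpret Y: couple Y by standard (rule Y)
  have FB: "banach_sp (F X)" "banach_sp (F Y)" "cont_embedded (F X) (sum_sp X)" "cont_embedded (F Y) (sum_sp Y)"
    using F X Y unfolding interpolation_functor_def by blast+
  interpret FX: nsp "F X" using FB by (intro nsp.intro) (simp add: banach_sp_def)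
  interpret FY: nsp "F Y" using FB by (intro nsp.intro) (simp add: banach_sp_def)
  obtain K where K: "0 \<le> K" "\<And>S. linear_btw (sum_sp X) (sum_sp Y) S \<Longrightarrow> maps_with_bound 1 (fst X) (fst Y) S \<Longrightarrow>
    maps_with_bound 1 (snd X) (snd Y) S \<Longrightarrow> maps_with_bound K (F X) (F Y) S"
    using functor_unit_bound[OF F X Y] by blast
  have pos: "maps_with_bound (K * c) (F X) (F Y) S"
    if c: "0 < c" and S: "linear_btw (sum_sp X) (sum_sp Y) S" "maps_with_bound c (fst X) (fst Y) S"
      "maps_with_bound c (snd X) (snd Y) S" for S c
  proof -
    have "maps_with_bound K (F X) (F Y) (\<lambda>x. (1 / c) *\<^sub>R S x)"
    proof (rule K(2))
      show "linear_btw (sum_sp X) (sum_sp Y) (\<lambda>x. (1 / c) *\<^sub>R S x)"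
        using S(1) by (auto simp: linear_btw_def scaleR_add_right)
      show "maps_with_bound 1 (fst X) (fst Y) (\<lambda>x. (1 / c) *\<^sub>R S x)"
        using S(2) c by (auto simp: maps_with_bound_def Y.X0.nrm_scale divide_le_eq mult.commute)
      show "maps_with_bound 1 (snd X) (snd Y) (\<lambda>x. (1 / c) *\<^sub>R S x)"
        using S(3) c by (auto simp: maps_with_bound_def Y.X1.nrm_scale divide_le_eq mult.commute)
    qed
    then have *: "(1 / c) *\<^sub>R S x \<in> carr (F Y)" "nrm (F Y) ((1 / c) *\<^sub>R S x) \<le> K * nrm (F X) x" if "x \<in> carr (F X)" for x
      using that by (auto simp: maps_with_bound_def)
    show ?thesis
      unfolding maps_with_bound_def
    proof
      fix x assume x: "x \<in> carr (F X)"
      have eq: "S x = c *\<^sub>R ((1 / c) *\<^sub>R S x)" using c by simp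
      have "c *\<^sub>R ((1 / c) *\<^sub>R S x) \<in> carr (F Y)" by (rule FY.scale_mem[OF *(1)[OF x]])
      moreover have "nrm (F Y) (c *\<^sub>R ((1 / c) *\<^sub>R S x)) \<le> c * (K * nrm (F X) x)"
        unfolding FY.nrm_scale[OF *(1)[OF x]] using *(2)[OF x] c by (simp add: mult_left_mono)
      ultimately show "S x \<in> carr (F Y) \<and> nrm (F Y) (S x) \<le> K * c * nrm (F X) x"
        unfolding eq[symmetric] by (simp add: mult_ac)
    qed
  qed
  show ?thesis
  proof (rule that[OF K(1)])
    fix S and c :: real
    assume c: "0 \<le> c" and S: "linear_btw (sum_sp X) (sum_sp Y) S" "maps_with_bound c (fst X) (fst Y) S"
      "maps_with_bound c (snd X) (snd Y) S"
    show "maps_with_bound (K * c) (F X) (F Y) S"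
    proof (cases "c = 0")
      case True
      \<comment> \<open>Division by \<open>c = 0\<close> is impossible; the bound is proved for
        every \<open>e > 0\<close> and then passed to the limit.\<close>
      have m: "maps_with_bound (K * e) (F X) (F Y) S" if e: "0 < e" for e
      proof (rule pos[OF e S(1)])
        show "maps_with_bound e (fst X) (fst Y) S"
          using S(2) True e by (auto simp: maps_with_bound_def intro: order_trans)
        show "maps_with_bound e (snd X) (snd Y) S"
          using S(3) True e by (auto simp: maps_with_bound_def intro: order_trans)
      qed
      show ?thesis
        unfolding maps_with_bound_def
      proof
        fix x assume x: "x \<in> carr (F X)"
        have "nrm (F Y) (S x) \<le> 0 + e" if e: "0 < e" for e
        proof -
          define d where "d = e / (K * nrm (F X) x + 1)"
          have g: "0 \<le> K * nrm (F X) x" using K x by simp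
          have d: "0 < d" using e g by (simp add: d_def add_nonneg_pos)
          have "nrm (F Y) (S x) \<le> K * d * nrm (F X) x" using maps_with_boundD(2)[OF m[OF d] x] .
          also have "\<dots> = d * (K * nrm (F X) x)" by simp
          also have "\<dots> \<le> d * (K * nrm (F X) x + 1)" using d by (intro mult_left_mono) auto
          also have "\<dots> = e" using g by (simp add: d_def)
          finally show ?thesis by simp
        qed
        then have "nrm (F Y) (S x) \<le> 0" by (rule field_le_epsilon)
        then show "S x \<in> carr (F Y) \<and> nrm (F Y) (S x) \<le> K * c * nrm (F X) x"
          using True maps_with_boundD(1)[OF m[of 1] x] by simp
      qed
    qed (use pos S c in simp)
  qed (use False in simp)
qed

section \<open>The substitution \<open>t \<mapsto> e\<^sup>t\<close> and null sets\<close>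

text \<open>The set is contained in the image under \<open>ln\<close> of a null set, and
  differentiable maps preserve null sets. The substitution is needed only up to null sets, so no
  change of variables formula appears.\<close>

lemma negligible_vimage_exp:
  assumes "negligible N" shows "negligible {t::real. exp t \<in> N}"
proof -
  have "negligible (ln ` (N \<inter> {0<..}))"
  proof (rule negligible_differentiable_image_negligible)
    show "negligible (N \<inter> {0<..})" using assms by (rule negligible_subset) auto
    show "ln differentiable_on (N \<inter> {0<..} :: real set)"
    proof (rule differentiable_at_imp_differentiable_on)
      fix x assume "x \<in> N \<inter> {0<..}"
      then have "DERIV ln x :> inverse x" by (intro DERIV_ln) auto
      then show "ln differentiable at x" unfolding real_differentiable_def ..
    qed
  qed simp
  moreover have "{t. exp t \<in> N} \<subseteq> ln ` (N \<inter> {0<..})"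
    by (auto intro!: image_eqI[where x = "exp _"])
  ultimately show ?thesis by (rule negligible_subset)
qed

lemma negligible_vimage_ln:
  assumes "negligible N" shows "negligible {x. 0 < x \<and> ln x \<in> (N :: real set)}"
proof -
  have "negligible (exp ` N)"
  proof (rule negligible_differentiable_image_negligible[OF _ assms])
    show "(exp :: real \<Rightarrow> real) differentiable_on N"
    proof (rule differentiable_at_imp_differentiable_on)
      show "exp differentiable at x" for x :: real
        unfolding real_differentiable_def by (rule exI[where x = "exp x"]) (rule DERIV_exp)
    qed
  qed simp
  moreover have "{x. 0 < x \<and> ln x \<in> N} \<subseteq> exp ` N"
    by (auto intro!: image_eqI[where x = "ln _"])
  ultimately show ?thesis by (rule negligible_subset)
qed

lemma AE_lebesgue_on_pos: "(AE x in lebesgue_on {0<..}. P x) \<longleftrightarrow> (AE x in lebesgue. (0::real) < x \<longrightarrow> P x)"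
  by (subst AE_restrict_space_iff) auto

lemma AE_exp: assumes "AE x in lebesgue_on {0<..}. P x" shows "AE t in lebesgue. P (exp t :: real)"
proof -
  obtain N where N: "negligible N" "{x. \<not> (0 < x \<longrightarrow> P x)} \<subseteq> N"
    using assms unfolding AE_lebesgue_on_pos eventually_ae_filter_negligible by auto
  then have "{t. \<not> P (exp t)} \<subseteq> {t. exp t \<in> N}" by auto
  with negligible_vimage_exp[OF N(1)] show ?thesis
    unfolding eventually_ae_filter_negligible by blast
qed

lemma AE_ln: assumes "AE t in lebesgue. P (t :: real)" shows "AE x in lebesgue_on {0<..}. P (ln x)"
proof -
  obtain N where N: "negligible N" "{t. \<not> P t} \<subseteq> N"
    using assms unfolding eventually_ae_filter_negligible by auto
  then have "{x. \<not> (0 < x \<longrightarrow> P (ln x))} \<subseteq> {x. 0 < x \<and> ln x \<in> N}" by auto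
  with negligible_vimage_ln[OF N(1)] show ?thesis
    unfolding AE_lebesgue_on_pos eventually_ae_filter_negligible by blast
qed

text \<open>For Lebesgue measurability on the target, preimages of null sets have to be measurable;
  they are even null by \<open>negligible_vimage_exp\<close>.\<close>

lemma exp_measurable_lebesgue: "exp \<in> lebesgue \<rightarrow>\<^sub>M lebesgue_on {0::real<..}"
proof (rule measurable_restrict_space2)
  have m: "exp \<in> lebesgue \<rightarrow>\<^sub>M (lborel :: real measure)" by (intro measurable_completion) simp
  show "(exp :: real \<Rightarrow> real) \<in> lebesgue \<rightarrow>\<^sub>M lebesgue"
  proof (rule completion.measurable_completion2[OF m])
    show "null_sets lborel \<subseteq> null_sets (distr lebesgue lborel (exp :: real \<Rightarrow> real))"
    proof
      fix N :: "real set" assume N: "N \<in> null_sets lborel"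
      then have "negligible N" by (simp add: negligible_iff_null_sets null_sets_completionI)
      then have "{t. exp t \<in> N} \<in> null_sets lebesgue"
        using negligible_vimage_exp by (simp add: negligible_iff_null_sets)
      moreover have "exp -` N \<inter> space lebesgue = {t. exp t \<in> N}" by auto
      ultimately show "N \<in> null_sets (distr lebesgue lborel exp)"
        using N m by (auto simp: null_sets_distr_iff)
    qed
  qed
qed auto

lemma strongly_measurable_exp:
  assumes "strongly_measurable (lebesgue_on {0<..}) X u"
  shows "strongly_measurable lebesgue X (\<lambda>t :: real. u (exp t))"
proof -
  obtain s where uc: "\<forall>t\<in>space (lebesgue_on {0<..}). u t \<in> carr X"
    and s: "\<And>n. simple_function (lebesgue_on {0<..}) (s n)" "\<And>n. s n ` space (lebesgue_on {0<..}) \<subseteq> carr X"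
    "AE t in lebesgue_on {0<..}. (\<lambda>n. nrm X (u t - s n t)) \<longlonglongrightarrow> 0"
    using assms unfolding strongly_measurable_def by blast
  have sp: "exp t \<in> space (lebesgue_on {0<..})" for t :: real by simp
  show ?thesis
    unfolding strongly_measurable_def
  proof (intro conjI ballI exI[of _ "\<lambda>n t. s n (exp t)"] allI)
    fix n
    show "simple_function lebesgue (\<lambda>t. s n (exp t))"
      unfolding simple_function_eq_measurable
    proof
      show "finite ((\<lambda>t. s n (exp t)) ` space lebesgue)"
        using simple_functionD(1)[OF s(1)[of n]] by (rule finite_subset[rotated]) (use sp in blast)
      show "(\<lambda>t. s n (exp t)) \<in> lebesgue \<rightarrow>\<^sub>M count_space UNIV"
        using measurable_compose[OF exp_measurable_lebesgue measurable_simple_function[OF s(1)[of n]]] .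
    qed
    show "(\<lambda>t. s n (exp t)) ` space lebesgue \<subseteq> carr X" using s(2)[of n] sp by blast
  next
    show "AE t in lebesgue. (\<lambda>n. nrm X (u (exp t) - s n (exp t))) \<longlonglongrightarrow> 0" by (rule AE_exp[OF s(3)])
  qed (use uc sp in blast)
qed

section \<open>Slowly varying functions\<close>

lemma slowly_varying_pos: "slowly_varying b \<Longrightarrow> 0 < t \<Longrightarrow> 0 < b t"
  by (simp add: slowly_varying_def)

text \<open>Potter's bound. For \<open>r >= 0\<close> it comes from the decreasing equivalent of
  \<open>t^(-e) b(t)\<close>, for \<open>r < 0\<close> from the increasing equivalent of
  \<open>t^e b(t)\<close>; the equivalence constants give \<open>C\<close>.\<close>

lemma slowly_varying_bound:
  assumes b: "slowly_varying b" and e: "0 < e"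
  obtains C where "0 < C" "\<And>s r. 0 < s \<Longrightarrow> b (exp r * s) \<le> C * exp (e * \<bar>r\<bar>) * b s"
proof -
  have ex: "\<exists>g. mono_on {0<..} g \<and> equiv_pos (\<lambda>t. t powr e * b t) g"
    "\<exists>h. antimono_on {0<..} h \<and> equiv_pos (\<lambda>t. t powr (- e) * b t) h"
    using b e by (simp_all add: slowly_varying_def)
  obtain g c1 C1 where g: "mono_on {0<..} g" "0 < c1" "0 < C1"
    "\<And>t. 0 < t \<Longrightarrow> c1 * g t \<le> t powr e * b t" "\<And>t. 0 < t \<Longrightarrow> t powr e * b t \<le> C1 * g t"
    using ex(1) unfolding equiv_pos_def by auto
  obtain h c2 C2 where h: "antimono_on {0<..} h" "0 < c2" "0 < C2"
    "\<And>t. 0 < t \<Longrightarrow> c2 * h t \<le> t powr (- e) * b t" "\<And>t. 0 < t \<Longrightarrow> t powr (- e) * b t \<le> C2 * h t"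
    using ex(2) unfolding equiv_pos_def by auto
  define C where "C = C1 / c1 + C2 / c2"
  have C: "C1 / c1 \<le> C" "C2 / c2 \<le> C" "0 < C" using g h by (auto simp: C_def add_pos_pos)
  show ?thesis
  proof (rule that[OF C(3)])
    fix s r :: real assume s: "0 < s"
    have bs: "0 < b s" using b s by (rule slowly_varying_pos)
    have es: "0 < exp r * s" using s by simp
    have cancel: "exp x * (exp (- x) * y) = y" "exp (- x) * (exp x * y) = y" for x y :: real
      by (simp_all add: exp_minus)
    have pw: "(exp r * s) powr a = exp (a * r) * s powr a" for a
      using s by (simp add: powr_def ln_mult distrib_left exp_add)
    show "b (exp r * s) \<le> C * exp (e * \<bar>r\<bar>) * b s"
    proof (cases "0 \<le> r")
      case True
      have "h (exp r * s) \<le> h s"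
        using True s h(1) es by (intro monotone_onD[OF h(1), of s "exp r * s", simplified]) auto
      then have "C2 * h (exp r * s) \<le> C2 * h s" using h by simp
      also have "\<dots> = C2 / c2 * (c2 * h s)" using h by simp
      also have "\<dots> \<le> C2 / c2 * (s powr (- e) * b s)" using h s by (intro mult_left_mono) auto
      finally have "(exp r * s) powr (- e) * b (exp r * s) \<le> C2 / c2 * (s powr (- e) * b s)"
        using h(5)[OF es] by simp
      then have "s powr (- e) * (exp (- e * r) * b (exp r * s)) \<le> s powr (- e) * (C2 / c2 * b s)"
        unfolding pw by (simp add: mult_ac)
      then have "exp (- e * r) * b (exp r * s) \<le> C2 / c2 * b s"
        by (rule mult_left_le_imp_le) (use s in simp)
      then have "exp (e * r) * (exp (- e * r) * b (exp r * s)) \<le> exp (e * r) * (C2 / c2 * b s)"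
        by (intro mult_left_mono) auto
      then have "b (exp r * s) \<le> C2 / c2 * exp (e * r) * b s"
        unfolding minus_mult_left[symmetric] cancel by (simp only: mult_ac)
      also have "\<dots> \<le> C * exp (e * r) * b s" using C bs by (intro mult_right_mono) auto
      finally show ?thesis using True by simp
    next
      case False
      have "g (exp r * s) \<le> g s"
        using False s g(1) es by (intro mono_onD[OF g(1)]) auto
      then have "C1 * g (exp r * s) \<le> C1 * g s" using g by simp
      also have "\<dots> = C1 / c1 * (c1 * g s)" using g by simp
      also have "\<dots> \<le> C1 / c1 * (s powr e * b s)" using g s by (intro mult_left_mono) auto
      finally have "(exp r * s) powr e * b (exp r * s) \<le> C1 / c1 * (s powr e * b s)"
        using g(5)[OF es] by simp
      then have "s powr e * (exp (e * r) * b (exp r * s)) \<le> s powr e * (C1 / c1 * b s)"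
        unfolding pw by (simp add: mult_ac)
      then have "exp (e * r) * b (exp r * s) \<le> C1 / c1 * b s"
        by (rule mult_left_le_imp_le) (use s in simp)
      then have "exp (- e * r) * (exp (e * r) * b (exp r * s)) \<le> exp (- e * r) * (C1 / c1 * b s)"
        by (intro mult_left_mono) auto
      then have "b (exp r * s) \<le> C1 / c1 * exp (- e * r) * b s"
        unfolding minus_mult_left[symmetric] cancel by (simp only: mult_ac)
      also have "\<dots> \<le> C * exp (- e * r) * b s" using C bs by (intro mult_right_mono) auto
      finally show ?thesis using False by simp
    qed
  qed
qed

text \<open>Potter's bound makes the set of quotients bounded, without which the real supremum in
  \<open>m_fun\<close> would carry no information.\<close>

lemma m_fun_bounds:
  assumes b: "slowly_varying b"
  shows "0 < s \<Longrightarrow> b (exp r * s) \<le> m_fun b (exp r) * b s" and "0 < m_fun b (exp r)"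
    and "\<exists>C>0. \<forall>r\<in>{0..1}. m_fun b (exp r) \<le> C"
proof -
  obtain C where C: "0 < C" "\<And>s r. 0 < s \<Longrightarrow> b (exp r * s) \<le> C * exp (1 * \<bar>r\<bar>) * b s"
    using slowly_varying_bound[OF b, of 1] by auto
  have quot: "b (exp r * s) / b s \<le> C * exp \<bar>r\<bar>" if "0 < s" for s r
    using C(2)[OF that, of r] slowly_varying_pos[OF b that] by (simp add: divide_le_eq)
  have bdd: "bdd_above ((\<lambda>s. b (exp r * s) / b s) ` {0<..})" for r
    using quot by (intro bdd_aboveI[of _ "C * exp \<bar>r\<bar>"]) auto
  have up: "b (exp r * s) / b s \<le> m_fun b (exp r)" if "0 < s" for s r
    unfolding m_fun_def using that bdd by (intro cSUP_upper) auto
  show "b (exp r * s) \<le> m_fun b (exp r) * b s" if "0 < s"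
    using up[OF that, of r] slowly_varying_pos[OF b that] by (simp add: divide_le_eq)
  have "0 < b (exp r * 1) / b 1" using slowly_varying_pos[OF b] by simp
  then show "0 < m_fun b (exp r)" using up[of 1 r] by simp
  have "m_fun b (exp r) \<le> C * exp 1" if "r \<in> {0..1}" for r
  proof -
    have "m_fun b (exp r) \<le> C * exp \<bar>r\<bar>" unfolding m_fun_def using quot by (intro cSUP_least) auto
    also have "\<dots> \<le> C * exp 1" using that C by (intro mult_left_mono) auto
    finally show ?thesis .
  qed
  then show "\<exists>C>0. \<forall>r\<in>{0..1}. m_fun b (exp r) \<le> C" using C(1) by (intro exI[of _ "C * exp 1"]) auto
qed

section \<open>Admissibility\<close>

text \<open>The weight for which \<open>J_kernel\<close> times the weighted J-functional of
  \<open>u\<close> equals \<open>min(1, e^(-t)) J(e^t, u(e^t))\<close>, a bound for the norm of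
  \<open>u(e^t)\<close> in \<open>X_0 + X_1\<close>.\<close>

definition J_kernel :: "real \<Rightarrow> (real \<Rightarrow> real) \<Rightarrow> real \<Rightarrow> real" where
  "J_kernel \<theta> b t = min 1 (exp (- t)) * exp (\<theta> * t) / b (exp t)"

lemma min_exp_shift: "s \<in> {0..1} \<Longrightarrow> min 1 (exp (- t)) \<le> exp 1 * min 1 (exp (- (t + s :: real)))"
proof -
  assume s: "s \<in> {0..1}"
  have "exp (- t) = exp s * exp (- (t + s))" by (simp add: exp_add[symmetric])
  also have "\<dots> \<le> exp 1 * exp (- (t + s))" using s by (intro mult_right_mono) auto
  finally have "exp (- t) \<le> exp 1 * exp (- (t + s))" .
  then have "min 1 (exp (- t)) \<le> min (exp 1 * 1) (exp 1 * exp (- (t + s)))"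
    by (intro min.mono) simp_all
  then show ?thesis by (simp only: min_mult_distrib_left exp_ge_zero if_True)
qed

lemma exp_measurable_comp:
  assumes "b \<in> borel_measurable (lebesgue_on {0<..})"
  shows "(\<lambda>t::real. b (exp t)) \<in> borel_measurable lebesgue"
  using measurable_compose[OF exp_measurable_lebesgue assms] .

text \<open>All three factors change by bounded amounts under a shift by at most 1: the minimum by a
  factor \<open>e\<close>, the exponential in the favourable direction as
  \<open>\<theta> >= 0\<close>, and \<open>b\<close> by Potter's bound.\<close>

lemma J_kernel_shift_same:
  assumes b: "slowly_varying b" and \<theta>: "0 \<le> \<theta>"
  obtains C where "0 < C" "\<And>s t. s \<in> {0..1} \<Longrightarrow> J_kernel \<theta> b t \<le> C * J_kernel \<theta> b (t + s)"
proof -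
  obtain C where C: "0 < C" "\<And>s r. 0 < s \<Longrightarrow> b (exp r * s) \<le> C * exp (1 * \<bar>r\<bar>) * b s"
    using slowly_varying_bound[OF b, of 1] by auto
  show ?thesis
  proof (rule that[of "exp 1 * (C * exp 1)"])
    fix s t :: real assume s: "s \<in> {0..1}"
    have bp: "0 < b (exp t)" "0 < b (exp (t + s))" using slowly_varying_pos[OF b] by auto
    have "b (exp (t + s)) \<le> C * exp \<bar>s\<bar> * b (exp t)"
      using C(2)[of "exp t" s] by (simp add: exp_add mult.commute)
    also have "\<dots> \<le> C * exp 1 * b (exp t)" using s C bp by (intro mult_right_mono mult_left_mono) auto
    finally have inv: "1 / b (exp t) \<le> C * exp 1 * (1 / b (exp (t + s)))"
      using bp by (simp add: field_simps)
    have "exp (\<theta> * t) \<le> exp (\<theta> * (t + s))" using \<theta> s by (simp add: mult_left_mono)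
    then have "min 1 (exp (- t)) * exp (\<theta> * t) * (1 / b (exp t)) \<le>
        (exp 1 * min 1 (exp (- (t + s)))) * exp (\<theta> * (t + s)) * (C * exp 1 * (1 / b (exp (t + s))))"
      using bp C by (intro mult_mono min_exp_shift s inv) auto
    then show "J_kernel \<theta> b t \<le> exp 1 * (C * exp 1) * J_kernel \<theta> b (t + s)"
      by (simp add: J_kernel_def mult_ac)
  qed (use C in simp)
qed

text \<open>Here \<open>m_fun b\<close> is traded for \<open>b\<close> itself:
  \<open>b(e^(t+s)) <= m_fun b (e^t) * b(e^s)\<close>, and \<open>b(e^s)\<close> is bounded for
  \<open>s\<close> in \<open>[0, 1]\<close>.\<close>

lemma J_kernel_shift_m:
  assumes b: "slowly_varying b" and \<theta>: "0 \<le> \<theta>"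
  obtains C where "0 < C" "\<And>s t. s \<in> {0..1} \<Longrightarrow> J_kernel \<theta> (m_fun b) t \<le> C * J_kernel \<theta> b (t + s)"
proof -
  obtain C where C: "0 < C" "\<And>s r. 0 < s \<Longrightarrow> b (exp r * s) \<le> C * exp (1 * \<bar>r\<bar>) * b s"
    using slowly_varying_bound[OF b, of 1] by auto
  have b1: "0 < b 1" using slowly_varying_pos[OF b] by simp
  show ?thesis
  proof (rule that[of "exp 1 * (C * exp 1 * b 1)"])
    fix s t :: real assume s: "s \<in> {0..1}"
    have bp: "0 < m_fun b (exp t)" "0 < b (exp (t + s))" "0 < b (exp s)"
      using slowly_varying_pos[OF b] m_fun_bounds(2)[OF b] by auto
    have "b (exp s) \<le> C * exp \<bar>s\<bar> * b 1" using C(2)[of 1 s] by simp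
    also have "\<dots> \<le> C * exp 1 * b 1" using s C b1 by (intro mult_right_mono mult_left_mono) auto
    finally have bs: "b (exp s) \<le> C * exp 1 * b 1" .
    have "b (exp (t + s)) \<le> m_fun b (exp t) * b (exp s)"
      using m_fun_bounds(1)[OF b, of "exp s" t] by (simp add: exp_add)
    also have "\<dots> \<le> m_fun b (exp t) * (C * exp 1 * b 1)" using bs bp by (intro mult_left_mono) auto
    finally have inv: "1 / m_fun b (exp t) \<le> C * exp 1 * b 1 * (1 / b (exp (t + s)))"
      using bp by (simp add: field_simps)
    have "exp (\<theta> * t) \<le> exp (\<theta> * (t + s))" using \<theta> s by (simp add: mult_left_mono)
    then have "min 1 (exp (- t)) * exp (\<theta> * t) * (1 / m_fun b (exp t)) \<le>
        (exp 1 * min 1 (exp (- (t + s)))) * exp (\<theta> * (t + s)) * (C * exp 1 * b 1 * (1 / b (exp (t + s))))"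
      using bp C b1 by (intro mult_mono min_exp_shift s inv) auto
    then show "J_kernel \<theta> (m_fun b) t \<le> exp 1 * (C * exp 1 * b 1) * J_kernel \<theta> b (t + s)"
      by (simp add: J_kernel_def mult_ac)
  qed (use C b1 in simp)
qed

text \<open>Averaging over \<open>s \<in> [0, 1]\<close> reduces a weighted integral of \<open>g\<close> to one of a convolution.\<close>

lemma nn_integral_shift_conv:
  fixes h k' :: "real \<Rightarrow> ennreal"
  assumes [measurable]: "h \<in> borel_measurable borel" "k' \<in> borel_measurable borel" "g \<in> borel_measurable borel"
    and le: "\<And>s. s \<in> {0..1} \<Longrightarrow> AE t in lborel. h t \<le> C * (k' (t + s) * g t)"
  shows "(\<integral>\<^sup>+t. h t \<partial>lborel) \<le> C * (\<integral>\<^sup>+r. k' r * conv (indicator {0..1}) g r \<partial>lborel)"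
proof -
  have "(\<integral>\<^sup>+t. h t \<partial>lborel) = (\<integral>\<^sup>+s. indicator {0..1::real} s * (\<integral>\<^sup>+t. h t \<partial>lborel) \<partial>lborel)"
    by (simp add: nn_integral_multc)
  also have "\<dots> \<le> (\<integral>\<^sup>+s. (\<integral>\<^sup>+t. C * (indicator {0..1::real} s * (k' (t + s) * g t)) \<partial>lborel) \<partial>lborel)"
  proof (intro nn_integral_mono)
    fix s :: real
    show "indicator {0..1} s * (\<integral>\<^sup>+t. h t \<partial>lborel) \<le> (\<integral>\<^sup>+t. C * (indicator {0..1} s * (k' (t + s) * g t)) \<partial>lborel)"
    proof (cases "s \<in> {0..1}")
      case True
      then show ?thesis using le[OF True] by (simp add: nn_integral_mono_AE)
    qed simp
  qed
  also have "\<dots> = (\<integral>\<^sup>+s. (\<integral>\<^sup>+r. C * (indicator {0..1::real} s * (k' r * g (r - s))) \<partial>lborel) \<partial>lborel)"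
  proof (rule nn_integral_cong)
    fix s :: real
    show "(\<integral>\<^sup>+t. C * (indicator {0..1} s * (k' (t + s) * g t)) \<partial>lborel) =
      (\<integral>\<^sup>+r. C * (indicator {0..1} s * (k' r * g (r - s))) \<partial>lborel)"
      using nn_integral_real_affine[of "\<lambda>r. C * (indicator {0..1} s * (k' r * g (r - s)))" 1 s]
      by (simp add: add.commute)
  qed
  also have "\<dots> = (\<integral>\<^sup>+r. (\<integral>\<^sup>+s. C * (indicator {0..1::real} s * (k' r * g (r - s))) \<partial>lborel) \<partial>lborel)"
    by (rule lborel_pair.Fubini') measurable
  also have "\<dots> = C * (\<integral>\<^sup>+r. k' r * conv (indicator {0..1}) g r \<partial>lborel)"
    unfolding conv_def by (simp add: nn_integral_cmult[symmetric] mult_ac)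
  finally show ?thesis .
qed

lemma nn_integral_exp_abs:
  assumes d: "0 < d" shows "(\<integral>\<^sup>+t. ennreal (exp (- d * \<bar>t\<bar>)) \<partial>lborel) < \<infinity>"
proof -
  have half: "(\<integral>\<^sup>+t. ennreal (exp (- d * t)) * indicator {0..} t \<partial>lborel) = ennreal (0 - (- exp (- d * 0) / d))"
  proof (rule nn_integral_FTC_atLeast)
    show "((\<lambda>t. - exp (- d * t) / d) has_real_derivative exp (- d * t)) (at t)" for t
      using d by (auto intro!: derivative_eq_intros)
    have "((\<lambda>t. exp (- d * t)) \<longlongrightarrow> 0) at_top"
      using d by (intro filterlim_compose[OF exp_at_bot] filterlim_tendsto_neg_mult_at_bot[OF tendsto_const] filterlim_ident) auto
    then have "((\<lambda>t. - exp (- d * t) / d) \<longlongrightarrow> - 0 / d) at_top" using d by (intro tendsto_intros) auto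
    then show "((\<lambda>t. - exp (- d * t) / d) \<longlongrightarrow> 0) at_top" by simp
  qed auto
  have half': "(\<integral>\<^sup>+t. ennreal (exp (- d * - t)) * indicator {0..} (- t) \<partial>lborel) = (\<integral>\<^sup>+t. ennreal (exp (- d * t)) * indicator {0..} t \<partial>lborel)"
    using nn_integral_reflect[of "\<lambda>t. ennreal (exp (- d * t)) * indicator {0..} t" 0] by simp
  have "(\<integral>\<^sup>+t. ennreal (exp (- d * \<bar>t\<bar>)) \<partial>lborel) \<le>
     (\<integral>\<^sup>+t. ennreal (exp (- d * t)) * indicator {0..} t + ennreal (exp (- d * - t)) * indicator {0..} (- t) \<partial>lborel)"
    by (intro nn_integral_mono) (auto split: split_indicator)
  also have "\<dots> = (\<integral>\<^sup>+t. ennreal (exp (- d * t)) * indicator {0..} t \<partial>lborel) +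
     (\<integral>\<^sup>+t. ennreal (exp (- d * - t)) * indicator {0..} (- t) \<partial>lborel)"
    by (rule nn_integral_add) measurable
  also have "\<dots> < \<infinity>" unfolding half' half by simp
  finally show ?thesis .
qed

text \<open>Without \<open>b\<close> the kernel decays at least like \<open>exp(-2 d |t|)\<close>,
  where \<open>2 d = min \<theta> (1 - \<theta>)\<close>; slow variation with exponent
  \<open>d\<close> costs half of this rate.\<close>

lemma J_kernel_exp_bound:
  assumes b: "slowly_varying b" and \<theta>: "0 < \<theta>" "\<theta> < 1"
  obtains d C where "0 < d" "0 \<le> C" "\<And>t. J_kernel \<theta> b t \<le> C * exp (- d * \<bar>t\<bar>)"
proof -
  define d where "d = min \<theta> (1 - \<theta>) / 2"
  have d: "0 < d" "2 * d \<le> \<theta>" "2 * d \<le> 1 - \<theta>" using \<theta> by (auto simp: d_def)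
  obtain C where C: "0 < C" "\<And>s r. 0 < s \<Longrightarrow> b (exp r * s) \<le> C * exp (d * \<bar>r\<bar>) * b s"
    using slowly_varying_bound[OF b d(1)] by blast
  have b1: "0 < b 1" using slowly_varying_pos[OF b] by simp
  show ?thesis
  proof (rule that[OF d(1)])
    fix t
    have bt: "0 < b (exp t)" using slowly_varying_pos[OF b] by simp
    have "b 1 \<le> C * exp (d * \<bar>t\<bar>) * b (exp t)" using C(2)[of "exp t" "- t"] by (simp add: exp_minus)
    then have inv: "1 / b (exp t) \<le> C / b 1 * exp (d * \<bar>t\<bar>)" using bt b1 by (simp add: field_simps)
    have e: "min 1 (exp (- t)) * exp (\<theta> * t) \<le> exp (- 2 * d * \<bar>t\<bar>)"
    proof (cases "0 \<le> t")
      case True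
      have "min 1 (exp (- t)) * exp (\<theta> * t) \<le> exp (- t) * exp (\<theta> * t)" by (intro mult_right_mono) auto
      also have "\<dots> = exp (- ((1 - \<theta>) * t))" by (simp add: exp_add[symmetric] algebra_simps)
      also have "\<dots> \<le> exp (- 2 * d * \<bar>t\<bar>)" using True d mult_right_mono[OF d(3) True] by simp
      finally show ?thesis .
    next
      case False
      have "min 1 (exp (- t)) * exp (\<theta> * t) \<le> 1 * exp (\<theta> * t)" by (intro mult_right_mono) auto
      also have "\<dots> \<le> exp (- 2 * d * \<bar>t\<bar>)" using False mult_right_mono[OF d(2), of "- t"] by simp
      finally show ?thesis .
    qed
    have "J_kernel \<theta> b t = (min 1 (exp (- t)) * exp (\<theta> * t)) * (1 / b (exp t))" by (simp add: J_kernel_def)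
    also have "\<dots> \<le> exp (- 2 * d * \<bar>t\<bar>) * (C / b 1 * exp (d * \<bar>t\<bar>))"
      using bt by (intro mult_mono e inv) auto
    also have "\<dots> = C / b 1 * exp (- d * \<bar>t\<bar>)" by (simp add: exp_add[symmetric])
    finally show "J_kernel \<theta> b t \<le> C / b 1 * exp (- d * \<bar>t\<bar>)" .
  qed (use C b1 in simp)
qed

lemma J_admissible_iff:
  "J_admissible \<theta> b G \<longleftrightarrow> (\<forall>g\<in>carr G. (\<integral>\<^sup>+t. ennreal (J_kernel \<theta> b t * \<bar>rep_l0 g t\<bar>) \<partial>lebesgue) < \<infinity>)"
  by (simp add: J_admissible_def J_kernel_def)

context ri
begin

text \<open>Functions in \<open>E\<close> have integrals over unit intervals that are bounded
  uniformly in the position of the interval, by the local embedding into L^1 and invariance under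
  reflected translation.\<close>

lemma unit_mass_bound:
  obtains K where "0 < K" "\<And>g r. g \<in> borel_measurable borel \<Longrightarrow> conv (indicator {0..1}) g r \<le> ennreal K * \<rho> g"
proof -
  obtain K where K: "0 < K" "\<And>f. f \<in> borel_measurable lebesgue \<Longrightarrow> (\<integral>\<^sup>+t\<in>{- real 1..real 1}. f t \<partial>lebesgue) \<le> ennreal K * \<rho> f"
    using loc[of 1] by blast
  show ?thesis
  proof (rule that[OF K(1)])
    fix g :: "real \<Rightarrow> ennreal" and r :: real assume g[measurable]: "g \<in> borel_measurable borel"
    have "conv (indicator {0..1}) g r \<le> (\<integral>\<^sup>+s. g (r - s) * indicator {- real 1..real 1} s \<partial>lborel)"
      unfolding conv_def by (intro nn_integral_mono) (auto split: split_indicator)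
    also have "\<dots> = (\<integral>\<^sup>+s\<in>{- real 1..real 1}. g (r - s) \<partial>lebesgue)" by (simp add: nn_integral_completion)
    also have "\<dots> \<le> ennreal K * \<rho> (\<lambda>s. g (r - s))" by (intro K(2) lebesgue_of_borel) measurable
    also have "\<rho> (\<lambda>s. g (r - s)) = \<rho> g" using affine[of g "-1" r] by simp
    finally show "conv (indicator {0..1}) g r \<le> ennreal K * \<rho> g" .
  qed
qed

text \<open>\<open>F(E, L^\<infinity>)\<close> lies in \<open>E + L^\<infinity>\<close>, and the
  kernel is exponentially small at both ends of the line. The bounded part is then integrated
  directly; the part in \<open>E\<close> is first averaged over unit intervals.\<close>

lemma J_admissible_interior:
  assumes b: "slowly_varying b" and \<theta>: "0 < \<theta>" "\<theta> < 1"
    and F: "interpolation_functor F"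
  shows "J_admissible \<theta> b (F (fspace \<rho>, Linf_sp))"
  unfolding J_admissible_iff
proof
  interpret Li: fnorm "esssup lebesgue" by (rule fnorm_esssup)
  interpret Y: couple "(fspace \<rho>, Linf_sp)" by standard (rule couple_ri_Linf)
  fix g assume "g \<in> carr (F (fspace \<rho>, Linf_sp))"
  then have "g \<in> carr (sum_sp (fspace \<rho>, Linf_sp))"
    using F couple_ri_Linf by (auto simp: interpolation_functor_def cont_embedded_def)
  then obtain g0 g1 where g: "g0 \<in> carr (fspace \<rho>)" "g1 \<in> carr Linf_sp" "g = g0 + g1"
    by (auto simp: Y.carr_sum)
  obtain d C where dC: "0 < d" "0 \<le> C" "\<And>t. J_kernel \<theta> b t \<le> C * exp (- d * \<bar>t\<bar>)"
    using J_kernel_exp_bound[OF b \<theta>] by blast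
  let ?k = "\<lambda>t. ennreal (exp (- d * \<bar>t\<bar>))"
  have kfin: "(\<integral>\<^sup>+t. ?k t \<partial>lborel) < \<infinity>" by (rule nn_integral_exp_abs[OF dC(1)])
  have r0: "\<rho> (\<lambda>t. ennreal \<bar>borel_rep g0 t\<bar>) < \<infinity>"
  proof -
    have "\<rho> (\<lambda>t. ennreal \<bar>borel_rep g0 t\<bar>) = l0norm g0"
    proof (rule cong_AE)
      show "(\<lambda>t. ennreal \<bar>borel_rep g0 t\<bar>) \<in> borel_measurable lebesgue" by (rule lebesgue_of_borel) measurable
      show "AE t in lebesgue. ennreal \<bar>borel_rep g0 t\<bar> = ennreal \<bar>rep_l0 g0 t\<bar>"
        using borel_rep(2)[of g0] unfolding AE_completion_iff by eventually_elim simp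
    qed measurable
    then show ?thesis using g(1) by (simp only: carr_iff)
  qed
  have 0: "(\<integral>\<^sup>+t. ?k t * ennreal \<bar>borel_rep g0 t\<bar> \<partial>lborel) < \<infinity>"
  proof -
    obtain K where K: "0 < K" "\<And>g r. g \<in> borel_measurable borel \<Longrightarrow> conv (indicator {0..1}) g r \<le> ennreal K * \<rho> g"
      using unit_mass_bound by blast
    have "?k t \<le> ennreal (exp d) * ?k (t + s)" if "s \<in> {0..1}" for s t
    proof -
      have "- d * \<bar>t\<bar> \<le> d + - d * \<bar>t + s\<bar>"
      proof -
        have "\<bar>t + s\<bar> \<le> \<bar>t\<bar> + 1" using that by auto
        then have "d * \<bar>t + s\<bar> \<le> d * (\<bar>t\<bar> + 1)" using dC(1) by (intro mult_left_mono) auto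
        then show ?thesis by (simp add: algebra_simps)
      qed
      then have "exp (- d * \<bar>t\<bar>) \<le> exp d * exp (- d * \<bar>t + s\<bar>)" by (simp only: exp_add[symmetric] exp_le_cancel_iff)
      then have "?k t \<le> ennreal (exp d * exp (- d * \<bar>t + s\<bar>))" by (rule ennreal_leI)
      also have "\<dots> = ennreal (exp d) * ?k (t + s)" by (rule ennreal_mult) auto
      finally show ?thesis .
    qed
    then have "?k t * ennreal \<bar>borel_rep g0 t\<bar> \<le> ennreal (exp d) * (?k (t + s) * ennreal \<bar>borel_rep g0 t\<bar>)"
      if "s \<in> {0..1}" for s t
      using that unfolding mult.assoc[symmetric] by (intro mult_right_mono) auto
    then have "(\<integral>\<^sup>+t. ?k t * ennreal \<bar>borel_rep g0 t\<bar> \<partial>lborel) \<le>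
      ennreal (exp d) * (\<integral>\<^sup>+r. ?k r * conv (indicator {0..1}) (\<lambda>t. ennreal \<bar>borel_rep g0 t\<bar>) r \<partial>lborel)"
      by (intro nn_integral_shift_conv AE_I2) measurable
    also have "\<dots> \<le> ennreal (exp d) * (\<integral>\<^sup>+r. ?k r * (ennreal K * \<rho> (\<lambda>t. ennreal \<bar>borel_rep g0 t\<bar>)) \<partial>lborel)"
      by (intro mult_left_mono nn_integral_mono K(2)) auto
    also have "\<dots> < \<infinity>" using kfin r0 by (simp add: nn_integral_multc ennreal_mult_less_top)
    finally show ?thesis .
  qed
  have l1: "Li.l0norm g1 < \<infinity>" using g(2) unfolding Linf_sp_def by (simp only: Li.carr_iff)
  have 1: "(\<integral>\<^sup>+t. ?k t * ennreal \<bar>rep_l0 g1 t\<bar> \<partial>lebesgue) < \<infinity>"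
  proof -
    have "(\<integral>\<^sup>+t. ?k t * ennreal \<bar>rep_l0 g1 t\<bar> \<partial>lebesgue) \<le> (\<integral>\<^sup>+t. ?k t * Li.l0norm g1 \<partial>lebesgue)"
      using esssup_AE[where M = lebesgue and f = "\<lambda>t. ennreal \<bar>rep_l0 g1 t\<bar>"]
      by (intro nn_integral_mono_AE) (auto elim!: eventually_mono intro: mult_left_mono)
    also have "\<dots> = (\<integral>\<^sup>+t. ?k t * Li.l0norm g1 \<partial>lborel)" by (rule nn_integral_completion)
    also have "\<dots> < \<infinity>" using kfin l1 by (simp add: nn_integral_multc ennreal_mult_less_top)
    finally show ?thesis .
  qed
  have "(\<integral>\<^sup>+t. ennreal (J_kernel \<theta> b t * \<bar>rep_l0 g t\<bar>) \<partial>lebesgue) \<le>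
    (\<integral>\<^sup>+t. ennreal C * (?k t * ennreal \<bar>borel_rep g0 t\<bar> + ?k t * ennreal \<bar>rep_l0 g1 t\<bar>) \<partial>lebesgue)"
  proof (rule nn_integral_mono_AE)
    show "AE t in lebesgue. ennreal (J_kernel \<theta> b t * \<bar>rep_l0 g t\<bar>) \<le>
        ennreal C * (?k t * ennreal \<bar>borel_rep g0 t\<bar> + ?k t * ennreal \<bar>rep_l0 g1 t\<bar>)"
      using rep_l0_add[of g0 g1] AE_completion[OF borel_rep(2)[of g0]]
    proof eventually_elim
      case (elim t)
      have "\<bar>rep_l0 g t\<bar> \<le> \<bar>borel_rep g0 t\<bar> + \<bar>rep_l0 g1 t\<bar>"
        unfolding g(3) elim(1) elim(2) by (rule abs_triangle_ineq)
      moreover have "0 \<le> C * exp (- d * \<bar>t\<bar>)" using dC(2) by simp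
      ultimately have "J_kernel \<theta> b t * \<bar>rep_l0 g t\<bar> \<le> (C * exp (- d * \<bar>t\<bar>)) * (\<bar>borel_rep g0 t\<bar> + \<bar>rep_l0 g1 t\<bar>)"
        by (intro mult_mono dC(3) abs_ge_zero)
      also have "\<dots> = C * (exp (- d * \<bar>t\<bar>) * \<bar>borel_rep g0 t\<bar> + exp (- d * \<bar>t\<bar>) * \<bar>rep_l0 g1 t\<bar>)"
        by (simp add: algebra_simps)
      finally have "ennreal (J_kernel \<theta> b t * \<bar>rep_l0 g t\<bar>) \<le> ennreal \<dots>" by (rule ennreal_leI)
      then show ?case using dC(2) by (simp add: ennreal_mult ennreal_plus)
    qed
  qed
  also have "\<dots> = ennreal C * ((\<integral>\<^sup>+t. ?k t * ennreal \<bar>borel_rep g0 t\<bar> \<partial>lebesgue) + (\<integral>\<^sup>+t. ?k t * ennreal \<bar>rep_l0 g1 t\<bar> \<partial>lebesgue))"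
  proof -
    have m0: "(\<lambda>t. ?k t * ennreal \<bar>borel_rep g0 t\<bar>) \<in> borel_measurable lebesgue" and k: "?k \<in> borel_measurable lebesgue"
      by (rule lebesgue_of_borel; measurable)+
    have "(\<lambda>t. ennreal \<bar>rep_l0 g1 t\<bar>) \<in> borel_measurable lebesgue" by measurable
    then have m1: "(\<lambda>t. ?k t * ennreal \<bar>rep_l0 g1 t\<bar>) \<in> borel_measurable lebesgue"
      by (rule borel_measurable_times_ennreal[OF k])
    show ?thesis
      by (subst nn_integral_cmult[OF borel_measurable_add[OF m0 m1]], subst nn_integral_add[OF m0 m1]) (rule refl)
  qed
  also have "\<dots> < \<infinity>"
    using 0 1 by (simp add: nn_integral_completion ennreal_mult_less_top)
  finally show "(\<integral>\<^sup>+t. ennreal (J_kernel \<theta> b t * \<bar>rep_l0 g t\<bar>) \<partial>lebesgue) < \<infinity>" .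
qed

text \<open>One constant \<open>K\<close> for all \<open>f\<close>, \<open>g\<close> and
  \<open>m\<close>, whereas the definition of a functor gives a constant for each operator. The
  conclusion on finiteness makes \<open>enn2real\<close> faithful almost everywhere.\<close>

lemma conv_functor:
  assumes F: "interpolation_functor F"
  obtains K where "0 \<le> K" "exact_functor F \<Longrightarrow> K = 1"
    "\<And>f g m. f \<in> borel_measurable borel \<Longrightarrow> g \<in> borel_measurable borel \<Longrightarrow> (\<And>s. 0 \<le> f s) \<Longrightarrow> (\<And>s. 0 \<le> g s) \<Longrightarrow>
      \<rho> (\<lambda>s. ennreal (f s)) < \<infinity> \<Longrightarrow> abs_l0 g \<in> carr (F (L1_sp, fspace (assoc_norm \<rho>))) \<Longrightarrow>
      m \<in> borel_measurable lebesgue \<Longrightarrow> (\<And>t. \<bar>m t\<bar> \<le> 1) \<Longrightarrow>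
      (AE t in lborel. conv (\<lambda>s. ennreal (f s)) (\<lambda>s. ennreal (g s)) t < \<infinity>) \<and>
      abs_l0 (\<lambda>t. m t * enn2real (conv (\<lambda>s. ennreal (f s)) (\<lambda>s. ennreal (g s)) t)) \<in> carr (F (fspace \<rho>, Linf_sp)) \<and>
      nrm (F (fspace \<rho>, Linf_sp)) (abs_l0 (\<lambda>t. m t * enn2real (conv (\<lambda>s. ennreal (f s)) (\<lambda>s. ennreal (g s)) t)))
        \<le> K * enn2real (\<rho> (\<lambda>s. ennreal (f s))) * nrm (F (L1_sp, fspace (assoc_norm \<rho>))) (abs_l0 g)"
proof -
  let ?X = "(L1_sp, fspace (assoc_norm \<rho>))" and ?Y = "(fspace \<rho>, Linf_sp)"
  obtain K where K: "0 \<le> K" "exact_functor F \<Longrightarrow> K = 1"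
    "\<And>S c. 0 \<le> c \<Longrightarrow> linear_btw (sum_sp ?X) (sum_sp ?Y) S \<Longrightarrow> maps_with_bound c (fst ?X) (fst ?Y) S \<Longrightarrow>
      maps_with_bound c (snd ?X) (snd ?Y) S \<Longrightarrow> maps_with_bound (K * c) (F ?X) (F ?Y) S"
    using functor_uniform_bound[OF F couple_L1_assoc couple_ri_Linf] by blast
  show ?thesis
  proof (rule that[OF K(1,2)])
    fix f g m :: "real \<Rightarrow> real"
    assume f: "f \<in> borel_measurable borel" and g: "g \<in> borel_measurable borel" and nn: "\<And>s. 0 \<le> f s" "\<And>s. 0 \<le> g s"
      and fr: "\<rho> (\<lambda>s. ennreal (f s)) < \<infinity>" and gG: "abs_l0 g \<in> carr (F ?X)"
      and m: "m \<in> borel_measurable lebesgue" "\<And>t. \<bar>m t\<bar> \<le> 1"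
    define c where "c = enn2real (\<rho> (\<lambda>s. ennreal (f s)))"
    have c: "\<rho> (\<lambda>s. ennreal \<bar>f s\<bar>) \<le> ennreal c" "0 \<le> c" using fr nn by (auto simp: c_def)
    note B = conv_op_bounds[OF f c m]
    have "maps_with_bound (K * c) (F ?X) (F ?Y) (conv_op f m)"
      by (rule K(3)[OF c(2) B(3)]) (simp_all add: B(1,2))
    note M = maps_with_boundD[OF this gG, unfolded conv_op_nonneg[OF f g nn]]
    have gs: "abs_l0 g \<in> carr (sum_sp ?X)"
      using F couple_L1_assoc gG unfolding interpolation_functor_def cont_embedded_def by blast
    have bg: "AE s in lborel. ennreal \<bar>borel_rep (abs_l0 g) s\<bar> = ennreal (g s)"
      using borel_rep(2)[of "abs_l0 g"] rep_abs_l0[OF lebesgue_of_borel[OF g], unfolded AE_completion_iff]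
    proof eventually_elim
      case (elim s)
      then show ?case using nn(2)[of s] by simp
    qed
    have "conv (\<lambda>s. ennreal \<bar>f s\<bar>) (\<lambda>s. ennreal \<bar>borel_rep (abs_l0 g) s\<bar>) t = conv (\<lambda>s. ennreal (f s)) (\<lambda>s. ennreal (g s)) t" for t
      by (rule conv_cong_AE[OF _ bg]) (simp add: nn)
    with B(4)[OF gs] have "AE t in lborel. conv (\<lambda>s. ennreal (f s)) (\<lambda>s. ennreal (g s)) t < \<infinity>" by simp
    with M show "(AE t in lborel. conv (\<lambda>s. ennreal (f s)) (\<lambda>s. ennreal (g s)) t < \<infinity>) \<and>
      abs_l0 (\<lambda>t. m t * enn2real (conv (\<lambda>s. ennreal (f s)) (\<lambda>s. ennreal (g s)) t)) \<in> carr (F ?Y) \<and>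
      nrm (F ?Y) (abs_l0 (\<lambda>t. m t * enn2real (conv (\<lambda>s. ennreal (f s)) (\<lambda>s. ennreal (g s)) t)))
        \<le> K * enn2real (\<rho> (\<lambda>s. ennreal (f s))) * nrm (F ?X) (abs_l0 g)"
      by (simp add: c_def)
  qed
qed

end

section \<open>Bilinear operators between couples\<close>

lemma bilinear_btwD:
  assumes "bilinear_btw X Y Z T" "x \<in> carr X" "y \<in> carr Y"
  shows "T x y \<in> carr Z" "x' \<in> carr X \<Longrightarrow> T (x + x') y = T x y + T x' y"
    "y' \<in> carr Y \<Longrightarrow> T x (y + y') = T x y + T x y'"
    "T (c *\<^sub>R x) y = c *\<^sub>R T x y" "T x (c *\<^sub>R y) = c *\<^sub>R T x y"
  using assms by (auto simp: bilinear_btw_def)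

lemma bilinear_btw_left: "bilinear_btw X Y Z T \<Longrightarrow> y \<in> carr Y \<Longrightarrow> linear_btw X Z (\<lambda>x. T x y)"
  by (simp add: bilinear_btw_def linear_btw_def)

lemma bilinear_btw_right: "bilinear_btw X Y Z T \<Longrightarrow> x \<in> carr X \<Longrightarrow> linear_btw Y Z (T x)"
  by (simp add: bilinear_btw_def linear_btw_def)

lemma bounded_bilinear_btw_flip:
  assumes "bounded_bilinear_btw X Y Z T" shows "bounded_bilinear_btw Y X Z (\<lambda>y x. T x y)"
proof -
  obtain k where k: "bilinear_btw X Y Z T" "\<forall>x\<in>carr X. \<forall>y\<in>carr Y. nrm Z (T x y) \<le> k * nrm X x * nrm Y y"
    using assms by (auto simp: bounded_bilinear_btw_def)
  have "\<forall>y\<in>carr Y. \<forall>x\<in>carr X. nrm Z (T x y) \<le> k * nrm Y y * nrm X x"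
    using k(2) by (simp add: mult_ac)
  with k(1) show ?thesis unfolding bounded_bilinear_btw_def bilinear_btw_def by blast
qed

text \<open>Boundedness of the defining set makes the real supremum meaningful. Vectors of norm 0
  cannot be normalised and are handled through the constant \<open>k\<close>.\<close>

lemma bounded_bilinear_norm:
  assumes "normed_sp X" "normed_sp Y" "normed_sp Z" and T: "bounded_bilinear_btw X Y Z T"
  shows "0 \<le> bilinear_norm X Y Z T"
    and "x \<in> carr X \<Longrightarrow> y \<in> carr Y \<Longrightarrow> nrm Z (T x y) \<le> bilinear_norm X Y Z T * nrm X x * nrm Y y"
proof -
  interpret X: nsp X by standard fact
  interpret Y: nsp Y by standard fact
  interpret Z: nsp Z by standard fact
  obtain k where k: "bilinear_btw X Y Z T" "\<And>x y. x \<in> carr X \<Longrightarrow> y \<in> carr Y \<Longrightarrow> nrm Z (T x y) \<le> k * nrm X x * nrm Y y"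
    using T by (auto simp: bounded_bilinear_btw_def)
  have bdd: "bdd_above {nrm Z (T x y) | x y. x \<in> carr X \<and> nrm X x \<le> 1 \<and> y \<in> carr Y \<and> nrm Y y \<le> 1}"
  proof (rule bdd_aboveI[of _ "\<bar>k\<bar>"])
    fix v assume "v \<in> {nrm Z (T x y) | x y. x \<in> carr X \<and> nrm X x \<le> 1 \<and> y \<in> carr Y \<and> nrm Y y \<le> 1}"
    then obtain x y where v: "v = nrm Z (T x y)" "x \<in> carr X" "nrm X x \<le> 1" "y \<in> carr Y" "nrm Y y \<le> 1" by blast
    have "v \<le> k * (nrm X x * nrm Y y)" using k(2) v by (simp add: mult.assoc)
    also have "\<dots> \<le> \<bar>k\<bar> * (1 * 1)" using v by (intro mult_mono) auto
    finally show "v \<le> \<bar>k\<bar>" by simp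
  qed
  have up: "nrm Z (T x y) \<le> bilinear_norm X Y Z T"
    if "x \<in> carr X" "nrm X x \<le> 1" "y \<in> carr Y" "nrm Y y \<le> 1" for x y
    unfolding bilinear_norm_def using that by (intro cSup_upper[OF _ bdd]) blast
  show 0: "0 \<le> bilinear_norm X Y Z T"
    by (rule order_trans[OF Z.nrm_ge0[OF bilinear_btwD(1)[OF k(1) X.zero_mem Y.zero_mem]] up]) simp_all
  show "nrm Z (T x y) \<le> bilinear_norm X Y Z T * nrm X x * nrm Y y" if x: "x \<in> carr X" and y: "y \<in> carr Y"
  proof (cases "nrm X x = 0 \<or> nrm Y y = 0")
    case True
    then have "nrm Z (T x y) \<le> 0" using k(2)[OF x y] by auto
    then show ?thesis using True by auto
  next
    case False
    then have p: "0 < nrm X x" "0 < nrm Y y"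
      using X.nrm_ge0[OF x] Y.nrm_ge0[OF y] by (auto simp only: less_le)
    have "T ((1 / nrm X x) *\<^sub>R x) ((1 / nrm Y y) *\<^sub>R y) = (1 / nrm X x * (1 / nrm Y y)) *\<^sub>R T x y"
      using x y by (simp add: bilinear_btwD(4)[OF k(1)] bilinear_btwD(5)[OF k(1)])
    then have "1 / nrm X x * (1 / nrm Y y) * nrm Z (T x y) \<le> bilinear_norm X Y Z T"
      using up[of "(1 / nrm X x) *\<^sub>R x" "(1 / nrm Y y) *\<^sub>R y"] x y p bilinear_btwD(1)[OF k(1) x y]
      by (simp add: X.nrm_scale Y.nrm_scale Z.nrm_scale)
    then show ?thesis using p by (simp add: field_simps)
  qed
qed

text \<open>The enumeration \<open>e\<close> is a parameter so that exchanging the two factors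
  amounts to composing \<open>e\<close> with a swap.\<close>

definition dseries :: "(nat \<Rightarrow> nat \<times> nat) \<Rightarrow> ('a \<Rightarrow> 'b \<Rightarrow> 'c::real_vector) \<Rightarrow> (nat \<Rightarrow> real) \<Rightarrow> (nat \<Rightarrow> 'a) \<Rightarrow> (nat \<Rightarrow> real) \<Rightarrow> (nat \<Rightarrow> 'b) \<Rightarrow> nat \<Rightarrow> 'c" where
  "dseries e T \<alpha> x \<beta> y i = (\<alpha> (fst (e i)) * \<beta> (snd (e i))) *\<^sub>R T (x (fst (e i))) (y (snd (e i)))"

lemma dseries_flip: "dseries (prod.swap \<circ> e) (\<lambda>b a. T a b) \<beta> y \<alpha> x = dseries e T \<alpha> x \<beta> y"
  by (auto simp: dseries_def fun_eq_iff mult.commute)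

text \<open>
  \<open>(\<Sum> \<alpha>\<^sub>n x\<^sub>n, \<Sum> \<beta>\<^sub>m y\<^sub>m) \<mapsto> \<Sum> \<alpha>\<^sub>n \<beta>\<^sub>m T(x\<^sub>n, y\<^sub>m)\<close> when the two series converge in different end point
  spaces \<open>X\<^sub>i\<close> and \<open>Y\<^sub>j\<close>: sum over \<open>m\<close> first, using \<open>x\<^sub>n \<in> X\<^sub>j\<close>, then over \<open>n\<close>, using \<open>b \<in> Y\<^sub>i\<close>.
\<close>

lemma dseries_eq_rows:
  assumes X: "normed_sp Xi" and Zi: "normed_sp Zi" and Y: "normed_sp Yj" and Zj: "normed_sp Zj" and W: "normed_sp W"
    and Ti: "bounded_bilinear_btw Xi Yi Zi T" and Tj: "bounded_bilinear_btw Xj Yj Zj T"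
    and Wi: "\<And>f x. nsums Zi f x \<Longrightarrow> nsums W f x" and Wj: "\<And>f x. nsums Zj f x \<Longrightarrow> nsums W f x"
    and a: "nsums Xi (\<lambda>n. \<alpha> n *\<^sub>R x n) a" and b: "nsums Yj (\<lambda>m. \<beta> m *\<^sub>R y m) b" and bi: "b \<in> carr Yi"
    and x: "\<And>n. x n \<in> carr Xi" "\<And>n. x n \<in> carr Xj" and y: "\<And>m. y m \<in> carr Yj"
    and e: "bij e" and z: "nsums W (dseries e T \<alpha> x \<beta> y) z"
    and fin: "(\<Sum>i. ennreal (nrm W (dseries e T \<alpha> x \<beta> y i))) < \<infinity>"
  shows "z = T a b"
proof -
  interpret W: nsp W by standard (rule W)
  obtain ki where ki: "bilinear_btw Xi Yi Zi T" "\<And>x y. x \<in> carr Xi \<Longrightarrow> y \<in> carr Yi \<Longrightarrow> nrm Zi (T x y) \<le> ki * nrm Xi x * nrm Yi y"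
    using Ti by (auto simp: bounded_bilinear_btw_def)
  obtain kj where kj: "bilinear_btw Xj Yj Zj T" "\<And>x y. x \<in> carr Xj \<Longrightarrow> y \<in> carr Yj \<Longrightarrow> nrm Zj (T x y) \<le> kj * nrm Xj x * nrm Yj y"
    using Tj by (auto simp: bounded_bilinear_btw_def)
  have row: "nsums W (\<lambda>m. (\<alpha> n * \<beta> m) *\<^sub>R T (x n) (y m)) (\<alpha> n *\<^sub>R T (x n) b)" for n
  proof -
    have "nsums Zj (\<lambda>m. T (x n) (\<beta> m *\<^sub>R y m)) (T (x n) b)"
      by (rule nsums_map[OF Y Zj bilinear_btw_right[OF kj(1) x(2)] kj(2)[OF x(2)] b])
    then have "nsums W (\<lambda>m. \<beta> m *\<^sub>R T (x n) (y m)) (T (x n) b)"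
      by (intro Wj) (simp add: bilinear_btwD(5)[OF kj(1) x(2) y])
    from W.nsums_scale[OF this, of "\<alpha> n"] show ?thesis by simp
  qed
  have "nsums W (\<lambda>n. \<alpha> n *\<^sub>R T (x n) b) z"
  proof (rule W.nsums_rows[OF e, where f = "\<lambda>(n, m). (\<alpha> n * \<beta> m) *\<^sub>R T (x n) (y m)"])
    have eq: "(\<lambda>(n, m). (\<alpha> n * \<beta> m) *\<^sub>R T (x n) (y m)) (e i) = dseries e T \<alpha> x \<beta> y i" for i
      by (simp add: dseries_def split: prod.split)
    show "nsums W (\<lambda>i. (\<lambda>(n, m). (\<alpha> n * \<beta> m) *\<^sub>R T (x n) (y m)) (e i)) z" unfolding eq by (rule z)
    show "(\<Sum>i. ennreal (nrm W ((\<lambda>(n, m). (\<alpha> n * \<beta> m) *\<^sub>R T (x n) (y m)) (e i)))) < \<infinity>" unfolding eq by (rule fin)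
  qed (simp add: row)
  moreover have "nsums W (\<lambda>n. \<alpha> n *\<^sub>R T (x n) b) (T a b)"
  proof -
    have "nrm Zi (T x b) \<le> (ki * nrm Yi b) * nrm Xi x" if "x \<in> carr Xi" for x
      using ki(2)[OF that bi] by (simp add: mult_ac)
    then have "nsums Zi (\<lambda>n. T (\<alpha> n *\<^sub>R x n) b) (T a b)"
      by (rule nsums_map[OF X Zi bilinear_btw_left[OF ki(1) bi] _ a])
    then show ?thesis by (intro Wi) (simp add: bilinear_btwD(4)[OF ki(1) x(1) bi])
  qed
  ultimately show ?thesis by (rule W.nsums_unique)
qed

lemma bij_swap_comp: "bij e \<Longrightarrow> bij (prod.swap \<circ> e)"
  by (rule bij_comp) (simp_all add: bij_swap)

lemma dseries_eq_columns:
  assumes X: "normed_sp Xi" and Zi: "normed_sp Zi" and Y: "normed_sp Yj" and Zj: "normed_sp Zj" and W: "normed_sp W"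
    and Ti: "bounded_bilinear_btw Xi Yi Zi T" and Tj: "bounded_bilinear_btw Xj Yj Zj T"
    and Wi: "\<And>f x. nsums Zi f x \<Longrightarrow> nsums W f x" and Wj: "\<And>f x. nsums Zj f x \<Longrightarrow> nsums W f x"
    and a: "nsums Xi (\<lambda>n. \<alpha> n *\<^sub>R x n) a" and b: "nsums Yj (\<lambda>m. \<beta> m *\<^sub>R y m) b" and aj: "a \<in> carr Xj"
    and y: "\<And>n. y n \<in> carr Yi" "\<And>n. y n \<in> carr Yj" and x: "\<And>m. x m \<in> carr Xi"
    and e: "bij e" and z: "nsums W (dseries e T \<alpha> x \<beta> y) z"
    and fin: "(\<Sum>i. ennreal (nrm W (dseries e T \<alpha> x \<beta> y i))) < \<infinity>"
  shows "z = T a b"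
  by (rule dseries_eq_rows[OF Y Zj X Zi W bounded_bilinear_btw_flip[OF Tj] bounded_bilinear_btw_flip[OF Ti] Wj Wi b a aj
        y(2,1) x bij_swap_comp[OF e], unfolded dseries_flip, OF _ _ z fin]) simp_all

text \<open>For fixed \<open>y\<close> in \<open>B_0 \<inter> B_1\<close> this extends
  \<open>T(., y)\<close> from the end point spaces to \<open>A_0 + A_1\<close>, through an
  arbitrarily chosen decomposition of \<open>a\<close>.\<close>

definition bil_ext :: "'a::real_vector couple \<Rightarrow> ('a \<Rightarrow> 'b \<Rightarrow> 'c::real_vector) \<Rightarrow> 'a \<Rightarrow> 'b \<Rightarrow> 'c" where
  "bil_ext A T a y = (let p = (SOME p. fst p \<in> carr (fst A) \<and> snd p \<in> carr (snd A) \<and> a = fst p + snd p)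
     in T (fst p) y + T (snd p) y)"

locale bilin =
  fixes A :: "'a::real_vector couple" and B :: "'b::real_vector couple" and C :: "'c::real_vector couple"
    and T :: "'a \<Rightarrow> 'b \<Rightarrow> 'c"
  assumes cA: "compatible_couple A" and cB: "compatible_couple B" and cC: "compatible_couple C"
    and T0: "bounded_bilinear_btw (fst A) (fst B) (fst C) T" and T1: "bounded_bilinear_btw (snd A) (snd B) (snd C) T"
begin

sublocale A: couple A by standard (rule cA)
sublocale B: couple B by standard (rule cB)
sublocale C: couple C by standard (rule cC)

lemma bilinear0: "bilinear_btw (fst A) (fst B) (fst C) T" and bilinear1: "bilinear_btw (snd A) (snd B) (snd C) T"
  using T0 T1 by (auto simp: bounded_bilinear_btw_def)

definition T_norm :: real where
  "T_norm = max (bilinear_norm (fst A) (fst B) (fst C) T) (bilinear_norm (snd A) (snd B) (snd C) T)"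

lemma T_norm_nonneg: "0 \<le> T_norm"
  using bounded_bilinear_norm(1)[OF A.X0.normed B.X0.normed C.X0.normed T0] by (simp add: T_norm_def)

lemma T_bound0: "x \<in> carr (fst A) \<Longrightarrow> y \<in> carr (fst B) \<Longrightarrow> nrm (fst C) (T x y) \<le> T_norm * nrm (fst A) x * nrm (fst B) y"
  using bounded_bilinear_norm(2)[OF A.X0.normed B.X0.normed C.X0.normed T0]
  by (rule order_trans) (auto simp: T_norm_def mult.assoc intro!: mult_right_mono)

lemma T_bound1: "x \<in> carr (snd A) \<Longrightarrow> y \<in> carr (snd B) \<Longrightarrow> nrm (snd C) (T x y) \<le> T_norm * nrm (snd A) x * nrm (snd B) y"
  using bounded_bilinear_norm(2)[OF A.X1.normed B.X1.normed C.X1.normed T1]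
  by (rule order_trans) (auto simp: T_norm_def mult.assoc intro!: mult_right_mono)

lemma T_inter: "x \<in> carr (inter_sp A) \<Longrightarrow> y \<in> carr (inter_sp B) \<Longrightarrow> T x y \<in> carr (inter_sp C)"
  using bilinear_btwD(1)[OF bilinear0] bilinear_btwD(1)[OF bilinear1] by simp

lemma T_J_bound:
  assumes x: "x \<in> carr (inter_sp A)" and y: "y \<in> carr (inter_sp B)"
  shows "J_fun C (exp (s + t)) (T x y) \<le> T_norm * (J_fun A (exp s) x * J_fun B (exp t) y)"
proof -
  have J: "0 \<le> nrm (fst A) x" "0 \<le> nrm (snd A) x" "0 \<le> nrm (fst B) y" "0 \<le> nrm (snd B) y" using x y by auto
  have "nrm (fst C) (T x y) \<le> T_norm * (nrm (fst A) x * nrm (fst B) y)"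
    using T_bound0[of x y] x y by (simp add: mult.assoc)
  also have "\<dots> \<le> T_norm * (J_fun A (exp s) x * J_fun B (exp t) y)"
    using J T_norm_nonneg by (intro mult_left_mono mult_mono) (auto simp: J_fun_def le_max_iff_disj)
  finally have 0: "nrm (fst C) (T x y) \<le> T_norm * (J_fun A (exp s) x * J_fun B (exp t) y)" .
  have "exp (s + t) * nrm (snd C) (T x y) \<le> exp (s + t) * (T_norm * nrm (snd A) x * nrm (snd B) y)"
    using T_bound1[of x y] x y by (intro mult_left_mono) auto
  also have "\<dots> = T_norm * ((exp s * nrm (snd A) x) * (exp t * nrm (snd B) y))" by (simp add: exp_add mult_ac)
  also have "\<dots> \<le> T_norm * (J_fun A (exp s) x * J_fun B (exp t) y)"
    using J T_norm_nonneg by (intro mult_left_mono mult_mono) (auto simp: J_fun_def le_max_iff_disj)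
  finally show ?thesis using 0 unfolding J_fun_def[of C] by simp
qed

text \<open>Two decompositions of one element differ by \<open>a0 - fst p = snd p - a1\<close>,
  which lies in both end point spaces; \<open>T\<close> is a single function there, so the two
  extensions agree.\<close>

lemma bil_ext_eq:
  assumes a: "a0 \<in> carr (fst A)" "a1 \<in> carr (snd A)" and y: "y \<in> carr (inter_sp B)"
  shows "bil_ext A T (a0 + a1) y = T a0 y + T a1 y"
proof -
  have y0: "y \<in> carr (fst B)" and y1: "y \<in> carr (snd B)" using y by auto
  define p where "p = (SOME p. fst p \<in> carr (fst A) \<and> snd p \<in> carr (snd A) \<and> a0 + a1 = fst p + snd p)"
  have "\<exists>p. fst p \<in> carr (fst A) \<and> snd p \<in> carr (snd A) \<and> a0 + a1 = fst p + snd p"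
    using a by (intro exI[of _ "(a0, a1)"]) simp
  from someI_ex[OF this] have p: "fst p \<in> carr (fst A)" "snd p \<in> carr (snd A)" "a0 + a1 = fst p + snd p"
    by (auto simp: p_def)
  have "a0 - fst p = snd p - a1" using p(3) by (simp add: algebra_simps)
  moreover have "T (a0 - fst p) y = T a0 y - T (fst p) y"
    by (rule linear_btw_diff[OF A.X0.normed bilinear_btw_left[OF bilinear0 y0] a(1) p(1)])
  moreover have "T (snd p - a1) y = T (snd p) y - T a1 y"
    by (rule linear_btw_diff[OF A.X1.normed bilinear_btw_left[OF bilinear1 y1] p(2) a(2)])
  ultimately have "T a0 y - T (fst p) y = T (snd p) y - T a1 y" by simp
  then have "T a0 y + T a1 y = T (fst p) y + T (snd p) y" by (simp add: algebra_simps)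
  then show ?thesis by (simp add: bil_ext_def p_def[symmetric])
qed

lemma T_zero_left: "y \<in> carr (inter_sp B) \<Longrightarrow> T 0 y = 0"
  using bilinear_btwD(4)[OF bilinear0 A.X0.zero_mem, of y 0] by simp

lemma bil_ext0: "a \<in> carr (fst A) \<Longrightarrow> y \<in> carr (inter_sp B) \<Longrightarrow> bil_ext A T a y = T a y"
  using bil_ext_eq[of a 0 y] T_zero_left[of y] by simp

lemma bil_ext1: "a \<in> carr (snd A) \<Longrightarrow> y \<in> carr (inter_sp B) \<Longrightarrow> bil_ext A T a y = T a y"
  using bil_ext_eq[of 0 a y] T_zero_left[of y] by simp

lemma bil_ext_linear:
  assumes y: "y \<in> carr (inter_sp B)"
  shows "linear_btw (sum_sp A) (sum_sp C) (\<lambda>a. bil_ext A T a y)"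
  unfolding linear_btw_def
proof (intro conjI ballI allI)
  have y0: "y \<in> carr (fst B)" and y1: "y \<in> carr (snd B)" using y by auto
  fix a assume a: "a \<in> carr (sum_sp A)"
  then obtain a0 a1 where aa: "a0 \<in> carr (fst A)" "a1 \<in> carr (snd A)" "a = a0 + a1" by (auto simp: A.carr_sum)
  show "bil_ext A T a y \<in> carr (sum_sp C)"
    unfolding aa(3) bil_ext_eq[OF aa(1,2) y]
    by (intro C.mem_sum bilinear_btwD(1)[OF bilinear0 aa(1) y0] bilinear_btwD(1)[OF bilinear1 aa(2) y1])
  show "bil_ext A T (c *\<^sub>R a) y = c *\<^sub>R bil_ext A T a y" for c
  proof -
    have "bil_ext A T (c *\<^sub>R a) y = T (c *\<^sub>R a0) y + T (c *\<^sub>R a1) y"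
      unfolding aa(3) scaleR_add_right by (rule bil_ext_eq) (use aa y in auto)
    then show ?thesis
      unfolding aa(3) bil_ext_eq[OF aa(1,2) y]
      by (simp add: bilinear_btwD(4)[OF bilinear0 aa(1) y0] bilinear_btwD(4)[OF bilinear1 aa(2) y1] scaleR_add_right)
  qed
  fix a' assume a': "a' \<in> carr (sum_sp A)"
  then obtain a0' a1' where aa': "a0' \<in> carr (fst A)" "a1' \<in> carr (snd A)" "a' = a0' + a1'" by (auto simp: A.carr_sum)
  have "bil_ext A T (a + a') y = T (a0 + a0') y + T (a1 + a1') y"
    using bil_ext_eq[of "a0 + a0'" "a1 + a1'" y] aa aa' y by (simp add: algebra_simps)
  then show "bil_ext A T (a + a') y = bil_ext A T a y + bil_ext A T a' y"
    unfolding aa(3) aa'(3) bil_ext_eq[OF aa(1,2) y] bil_ext_eq[OF aa'(1,2) y]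
    by (simp add: bilinear_btwD(2)[OF bilinear0 aa(1) y0 aa'(1)] bilinear_btwD(2)[OF bilinear1 aa(2) y1 aa'(2)])
qed

text \<open>With \<open>y\<close> fixed, the extension is bounded at both end points with a common
  constant, hence by \<open>sum_bound\<close> from \<open>A_0 + A_1\<close> to
  \<open>C_0 + C_1\<close>, and may be applied termwise.\<close>

lemma bil_ext_nsums:
  assumes y: "y \<in> carr (inter_sp B)" and f: "nsums (sum_sp A) f a" and fi: "\<And>n. f n \<in> carr (inter_sp A)"
  shows "nsums (sum_sp C) (\<lambda>n. T (f n) y) (bil_ext A T a y)"
proof -
  let ?c = "T_norm * nrm (inter_sp B) y"
  have c: "0 \<le> ?c" using T_norm_nonneg y by (simp add: B.nrm_inter le_max_iff_disj)
  have m0: "maps_with_bound ?c (fst A) (fst C) (\<lambda>a. bil_ext A T a y)"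
    unfolding maps_with_bound_def
  proof
    fix a assume a: "a \<in> carr (fst A)"
    have "nrm (fst C) (T a y) \<le> T_norm * nrm (fst A) a * nrm (fst B) y" using a y by (intro T_bound0) auto
    also have "\<dots> \<le> T_norm * nrm (fst A) a * nrm (inter_sp B) y"
      using T_norm_nonneg a by (intro mult_left_mono) (auto simp: B.nrm_inter)
    finally show "bil_ext A T a y \<in> carr (fst C) \<and> nrm (fst C) (bil_ext A T a y) \<le> ?c * nrm (fst A) a"
      using bilinear_btwD(1)[OF bilinear0 a, of y] y by (simp add: bil_ext0[OF a y] mult_ac)
  qed
  have m1: "maps_with_bound ?c (snd A) (snd C) (\<lambda>a. bil_ext A T a y)"
    unfolding maps_with_bound_def
  proof
    fix a assume a: "a \<in> carr (snd A)"
    have "nrm (snd C) (T a y) \<le> T_norm * nrm (snd A) a * nrm (snd B) y" using a y by (intro T_bound1) auto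
    also have "\<dots> \<le> T_norm * nrm (snd A) a * nrm (inter_sp B) y"
      using T_norm_nonneg a by (intro mult_left_mono) (auto simp: B.nrm_inter)
    finally show "bil_ext A T a y \<in> carr (snd C) \<and> nrm (snd C) (bil_ext A T a y) \<le> ?c * nrm (snd A) a"
      using bilinear_btwD(1)[OF bilinear1 a, of y] y by (simp add: bil_ext1[OF a y] mult_ac)
  qed
  have "nsums (sum_sp C) (\<lambda>n. bil_ext A T (f n) y) (bil_ext A T a y)"
    by (rule nsums_map[OF A.normed_sum C.normed_sum bil_ext_linear[OF y] sum_bound[OF cA cC bil_ext_linear[OF y] m0 m1 c] f])
  moreover have "bil_ext A T (f n) y = T (f n) y" for n using fi[of n] by (intro bil_ext0[OF _ y]) simp
  ultimately show ?thesis by simp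
qed

lemma dseries_columns:
  assumes x: "\<And>n. x n \<in> carr (inter_sp A)" and y: "\<And>m. y m \<in> carr (inter_sp B)"
    and a: "nsums (sum_sp A) (\<lambda>n. \<alpha> n *\<^sub>R x n) a" and e: "bij e"
    and z: "nsums (sum_sp C) (dseries e T \<alpha> x \<beta> y) z"
    and fin: "(\<Sum>i. ennreal (nrm (sum_sp C) (dseries e T \<alpha> x \<beta> y i))) < \<infinity>"
  shows "nsums (sum_sp C) (\<lambda>m. \<beta> m *\<^sub>R bil_ext A T a (y m)) z"
proof (rule C.S.nsums_rows[OF bij_swap_comp[OF e], where f = "\<lambda>(m, n). (\<alpha> n * \<beta> m) *\<^sub>R T (x n) (y m)"])
  have eq: "(\<lambda>(m, n). (\<alpha> n * \<beta> m) *\<^sub>R T (x n) (y m)) ((prod.swap \<circ> e) i) = dseries e T \<alpha> x \<beta> y i" for i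
    by (simp add: dseries_def split: prod.split)
  show "nsums (sum_sp C) (\<lambda>i. (\<lambda>(m, n). (\<alpha> n * \<beta> m) *\<^sub>R T (x n) (y m)) ((prod.swap \<circ> e) i)) z"
    unfolding eq by (rule z)
  show "(\<Sum>i. ennreal (nrm (sum_sp C) ((\<lambda>(m, n). (\<alpha> n * \<beta> m) *\<^sub>R T (x n) (y m)) ((prod.swap \<circ> e) i)))) < \<infinity>"
    unfolding eq by (rule fin)
  fix m
  have ym: "y m \<in> carr (fst B)" using y[of m] by simp
  have "nsums (sum_sp C) (\<lambda>n. T (\<alpha> n *\<^sub>R x n) (y m)) (bil_ext A T a (y m))"
    by (rule bil_ext_nsums[OF y a A.I.scale_mem[OF x]])
  moreover have "T (\<alpha> n *\<^sub>R x n) (y m) = \<alpha> n *\<^sub>R T (x n) (y m)" for n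
    using x[of n] by (intro bilinear_btwD(4)[OF bilinear0 _ ym]) simp
  ultimately have "nsums (sum_sp C) (\<lambda>n. \<alpha> n *\<^sub>R T (x n) (y m)) (bil_ext A T a (y m))" by simp
  from C.S.nsums_scale[OF this, of "\<beta> m"]
  show "nsums (sum_sp C) (\<lambda>n. case (m, n) of (m, n) \<Rightarrow> (\<alpha> n * \<beta> m) *\<^sub>R T (x n) (y m)) (\<beta> m *\<^sub>R bil_ext A T a (y m))"
    by (simp add: mult.commute)
qed

text \<open>
  The value at \<open>(a, b)\<close> is read off a series of \<open>b\<close>, or of \<open>a\<close> if \<open>b\<close> has none; each of the two formulas
  is linear in the other argument, even where that argument has no admitted series.
\<close>

lemma bilinear_extension:
  fixes PA :: "'a \<Rightarrow> (nat \<Rightarrow> real) \<Rightarrow> (nat \<Rightarrow> 'a) \<Rightarrow> bool" and PB :: "'b \<Rightarrow> (nat \<Rightarrow> real) \<Rightarrow> (nat \<Rightarrow> 'b) \<Rightarrow> bool"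
  assumes PA: "\<And>a \<alpha> x. PA a \<alpha> x \<Longrightarrow> (\<forall>n. x n \<in> carr (inter_sp A)) \<and> nsums (sum_sp A) (\<lambda>n. \<alpha> n *\<^sub>R x n) a"
    and PB: "\<And>b \<beta> y. PB b \<beta> y \<Longrightarrow> (\<forall>n. y n \<in> carr (inter_sp B)) \<and> nsums (sum_sp B) (\<lambda>n. \<beta> n *\<^sub>R y n) b"
    and fin: "\<And>a \<alpha> x b \<beta> y. PA a \<alpha> x \<Longrightarrow> PB b \<beta> y \<Longrightarrow> (\<Sum>i. ennreal (nrm (sum_sp C) (dseries prod_decode T \<alpha> x \<beta> y i))) < \<infinity>"
  obtains T' where
    "\<And>a \<alpha> x b \<beta> y. PA a \<alpha> x \<Longrightarrow> PB b \<beta> y \<Longrightarrow> nsums (sum_sp C) (dseries prod_decode T \<alpha> x \<beta> y) (T' a b)"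
    "\<And>a a' b. \<exists>\<alpha> x. PA a \<alpha> x \<Longrightarrow> \<exists>\<alpha> x. PA a' \<alpha> x \<Longrightarrow> \<exists>\<beta> y. PB b \<beta> y \<Longrightarrow> T' (a + a') b = T' a b + T' a' b"
    "\<And>a b b'. \<exists>\<alpha> x. PA a \<alpha> x \<Longrightarrow> \<exists>\<beta> y. PB b \<beta> y \<Longrightarrow> \<exists>\<beta> y. PB b' \<beta> y \<Longrightarrow> T' a (b + b') = T' a b + T' a b'"
    "\<And>a b c. \<exists>\<alpha> x. PA a \<alpha> x \<Longrightarrow> \<exists>\<beta> y. PB b \<beta> y \<Longrightarrow> T' (c *\<^sub>R a) b = c *\<^sub>R T' a b \<and> T' a (c *\<^sub>R b) = c *\<^sub>R T' a b"
proof -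
  interpret flip: bilin B A C "\<lambda>b a. T a b"
    by standard (use cA cB cC T0 T1 in \<open>auto intro: bounded_bilinear_btw_flip\<close>)
  let ?TL = "bil_ext A T" and ?TR = "\<lambda>a b. bil_ext B (\<lambda>b a. T a b) b a"
  define SA where "SA a = (SOME p. PA a (fst p) (snd p))" for a
  define SB where "SB b = (SOME p. PB b (fst p) (snd p))" for b
  have SA: "PA a (fst (SA a)) (snd (SA a))" if "\<exists>\<alpha> x. PA a \<alpha> x" for a
    unfolding SA_def using that by (intro someI_ex[of "\<lambda>p. PA a (fst p) (snd p)"]) simp
  have SB: "PB b (fst (SB b)) (snd (SB b))" if "\<exists>\<beta> y. PB b \<beta> y" for b
    unfolding SB_def using that by (intro someI_ex[of "\<lambda>p. PB b (fst p) (snd p)"]) simp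
  define LL where "LL a \<beta> y z = nsums (sum_sp C) (\<lambda>m. \<beta> m *\<^sub>R ?TL a (y m)) z" for a and \<beta> :: "nat \<Rightarrow> real" and y :: "nat \<Rightarrow> 'b" and z
  define RR where "RR \<alpha> x b z = nsums (sum_sp C) (\<lambda>n. \<alpha> n *\<^sub>R ?TR (x n) b) z" for \<alpha> :: "nat \<Rightarrow> real" and x :: "nat \<Rightarrow> 'a" and b z
  define T' where "T' a b = (if \<exists>\<beta> y. PB b \<beta> y then (THE z. LL a (fst (SB b)) (snd (SB b)) z)
     else (THE z. RR (fst (SA a)) (snd (SA a)) b z))" for a b
  have LLu: "LL a \<beta> y z \<Longrightarrow> (THE z. LL a \<beta> y z) = z" for a \<beta> y z
    unfolding LL_def by (rule the_equality) (auto intro: C.S.nsums_unique)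
  have RRu: "RR \<alpha> x b z \<Longrightarrow> (THE z. RR \<alpha> x b z) = z" for \<alpha> x b z
    unfolding RR_def by (rule the_equality) (auto intro: C.S.nsums_unique)
  have ex: "\<exists>z. nsums (sum_sp C) (dseries prod_decode T \<alpha> x \<beta> y) z \<and> LL a \<beta> y z \<and> RR \<alpha> x b z"
    if a: "PA a \<alpha> x" and b: "PB b \<beta> y" for a \<alpha> x b \<beta> y
  proof -
    note f = fin[OF a b]
    have xi: "x n \<in> carr (inter_sp A)" and yi: "y n \<in> carr (inter_sp B)" for n using PA[OF a] PB[OF b] by auto
    have "dseries prod_decode T \<alpha> x \<beta> y i \<in> carr (sum_sp C)" for i
      unfolding dseries_def using T_inter[OF xi yi] by (intro C.S.scale_mem C.mem_sum0) auto
    then obtain z where z: "nsums (sum_sp C) (dseries prod_decode T \<alpha> x \<beta> y) z"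
      using banach_nsums[OF C.banach_sum _ f] by blast
    have "LL a \<beta> y z" unfolding LL_def
      using PA[OF a] by (intro dseries_columns[OF xi yi _ bij_prod_decode z f]) simp
    moreover have "RR \<alpha> x b z" unfolding RR_def
      using PB[OF b] by (intro flip.dseries_columns[OF yi xi _ bij_swap_comp[OF bij_prod_decode], unfolded dseries_flip, OF _ z f]) simp
    ultimately show ?thesis using z by blast
  qed
  have main: "nsums (sum_sp C) (dseries prod_decode T \<alpha> x \<beta> y) (T' a b) \<and> LL a \<beta> y (T' a b) \<and> RR \<alpha> x b (T' a b)"
    if a: "PA a \<alpha> x" and b: "PB b \<beta> y" for a \<alpha> x b \<beta> y
  proof -
    have eb: "\<exists>\<beta> y. PB b \<beta> y" using b by blast
    obtain z where z: "nsums (sum_sp C) (dseries prod_decode T \<alpha> x \<beta> y) z" "LL a \<beta> y z" "RR \<alpha> x b z"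
      using ex[OF a b] by blast
    \<comment> \<open>The chosen series of \<open>b\<close> in place of the given one. The form
      \<open>RR\<close> contains \<open>b\<close> itself and no series of it, so both double series
      have the same sum.\<close>
    obtain z' where z': "LL a (fst (SB b)) (snd (SB b)) z'" "RR \<alpha> x b z'" using ex[OF a SB[OF eb]] by blast
    have "z = z'" using z(3) z'(2) unfolding RR_def by (rule C.S.nsums_unique)
    moreover have "T' a b = z'" using eb LLu[OF z'(1)] by (simp add: T'_def)
    ultimately show ?thesis using z by simp
  qed
  have LLadd: "LL (a + a') \<beta> y (z + z')" if "LL a \<beta> y z" "LL a' \<beta> y z'" "a \<in> carr (sum_sp A)" "a' \<in> carr (sum_sp A)"
      "\<And>n. y n \<in> carr (inter_sp B)" for a a' \<beta> y z z'
    using C.S.nsums_add[OF that(1,2)[unfolded LL_def]] unfolding LL_def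
    by (simp add: linear_btwD(2)[OF bil_ext_linear[OF that(5)] that(3,4)] scaleR_add_right)
  have LLscale: "LL (c *\<^sub>R a) \<beta> y (c *\<^sub>R z)" if "LL a \<beta> y z" "a \<in> carr (sum_sp A)" "\<And>n. y n \<in> carr (inter_sp B)" for a \<beta> y z c
    using C.S.nsums_scale[OF that(1)[unfolded LL_def], of c] unfolding LL_def
    by (simp add: linear_btwD(3)[OF bil_ext_linear[OF that(3)] that(2)] mult.commute)
  have RRadd: "RR \<alpha> x (b + b') (z + z')" if "RR \<alpha> x b z" "RR \<alpha> x b' z'" "b \<in> carr (sum_sp B)" "b' \<in> carr (sum_sp B)"
      "\<And>n. x n \<in> carr (inter_sp A)" for b b' \<alpha> x z z'
    using C.S.nsums_add[OF that(1,2)[unfolded RR_def]] unfolding RR_def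
    by (simp add: linear_btwD(2)[OF flip.bil_ext_linear[OF that(5)] that(3,4)] scaleR_add_right)
  have RRscale: "RR \<alpha> x (c *\<^sub>R b) (c *\<^sub>R z)" if "RR \<alpha> x b z" "b \<in> carr (sum_sp B)" "\<And>n. x n \<in> carr (inter_sp A)" for b \<alpha> x z c
    using C.S.nsums_scale[OF that(1)[unfolded RR_def], of c] unfolding RR_def
    by (simp add: linear_btwD(3)[OF flip.bil_ext_linear[OF that(3)] that(2)] mult.commute)
  have T'L: "T' a b = z" if "\<exists>\<beta> y. PB b \<beta> y" "LL a (fst (SB b)) (snd (SB b)) z" for a b z
    using that(1) LLu[OF that(2)] by (simp add: T'_def)
  have T'R: "T' a b = z" if a: "\<exists>\<alpha> x. PA a \<alpha> x" and z: "RR (fst (SA a)) (snd (SA a)) b z" for a b z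
  proof (cases "\<exists>\<beta> y. PB b \<beta> y")
    case True
    have "RR (fst (SA a)) (snd (SA a)) b (T' a b)" using main[OF SA[OF a] SB[OF True]] by simp
    then show ?thesis using z unfolding RR_def by (rule C.S.nsums_unique)
  next
    case False
    then show ?thesis using RRu[OF z] by (simp add: T'_def)
  qed
  have sA: "a \<in> carr (sum_sp A)" if "\<exists>\<alpha> x. PA a \<alpha> x" for a using that PA nsumsD(2) by blast
  have sB: "b \<in> carr (sum_sp B)" if "\<exists>\<beta> y. PB b \<beta> y" for b using that PB nsumsD(2) by blast
  show ?thesis
  proof (rule that[of T'])
    show "nsums (sum_sp C) (dseries prod_decode T \<alpha> x \<beta> y) (T' a b)" if "PA a \<alpha> x" "PB b \<beta> y" for a \<alpha> x b \<beta> y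
      using main[OF that] by blast
    show "T' (a + a') b = T' a b + T' a' b" if a: "\<exists>\<alpha> x. PA a \<alpha> x" and a': "\<exists>\<alpha> x. PA a' \<alpha> x" and b: "\<exists>\<beta> y. PB b \<beta> y" for a a' b
      using main[OF SA[OF a] SB[OF b]] main[OF SA[OF a'] SB[OF b]] PB[OF SB[OF b]]
      by (intro T'L[OF b] LLadd sA[OF a] sA[OF a']) auto
    show "T' a (b + b') = T' a b + T' a b'" if a: "\<exists>\<alpha> x. PA a \<alpha> x" and b: "\<exists>\<beta> y. PB b \<beta> y" and b': "\<exists>\<beta> y. PB b' \<beta> y" for a b b'
      using main[OF SA[OF a] SB[OF b]] main[OF SA[OF a] SB[OF b']] PA[OF SA[OF a]]
      by (intro T'R[OF a] RRadd sB[OF b] sB[OF b']) auto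
    show "T' (c *\<^sub>R a) b = c *\<^sub>R T' a b \<and> T' a (c *\<^sub>R b) = c *\<^sub>R T' a b"
      if a: "\<exists>\<alpha> x. PA a \<alpha> x" and b: "\<exists>\<beta> y. PB b \<beta> y" for a b c
    proof
      show "T' (c *\<^sub>R a) b = c *\<^sub>R T' a b"
        using main[OF SA[OF a] SB[OF b]] PB[OF SB[OF b]] by (intro T'L[OF b] LLscale sA[OF a]) auto
      show "T' a (c *\<^sub>R b) = c *\<^sub>R T' a b"
        using main[OF SA[OF a] SB[OF b]] PA[OF SA[OF a]] by (intro T'R[OF a] RRscale sB[OF b]) auto
    qed
  qed
qed

text \<open>The coefficients split into four blocks. The diagonal ones are evaluated at a single end
  point. In the mixed ones the condition on the sums helps: if \<open>a0 + a1\<close> lies in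
  \<open>A_0\<close>, so does \<open>a1\<close>, and likewise for \<open>b1\<close>, so
  \<open>T\<close> is defined on every mixed pair.\<close>

lemma dseries_split_eq:
  assumes x: "\<And>n. x n \<in> carr (inter_sp A)" and y: "\<And>m. y m \<in> carr (inter_sp B)"
    and \<alpha>: "\<And>n. 0 \<le> \<alpha>0 n" "\<And>n. 0 \<le> \<alpha>1 n" and \<beta>: "\<And>n. 0 \<le> \<beta>0 n" "\<And>n. 0 \<le> \<beta>1 n"
    and a0: "nsums (fst A) (\<lambda>n. \<alpha>0 n *\<^sub>R x n) a0" and a1: "nsums (snd A) (\<lambda>n. \<alpha>1 n *\<^sub>R x n) a1"
    and b0': "nsums (fst B) (\<lambda>n. \<beta>0 n *\<^sub>R y n) b0" and b1': "nsums (snd B) (\<lambda>n. \<beta>1 n *\<^sub>R y n) b1"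
    and z: "nsums (sum_sp C) (dseries prod_decode T (\<lambda>n. \<alpha>0 n + \<alpha>1 n) x (\<lambda>n. \<beta>0 n + \<beta>1 n) y) z"
    and fin: "(\<Sum>i. ennreal (nrm (sum_sp C) (dseries prod_decode T (\<lambda>n. \<alpha>0 n + \<alpha>1 n) x (\<lambda>n. \<beta>0 n + \<beta>1 n) y i))) < \<infinity>"
    and cond: "a0 + a1 \<in> carr (fst A) \<and> b0 + b1 \<in> carr (fst B) \<or> a0 + a1 \<in> carr (snd A) \<and> b0 + b1 \<in> carr (snd B)"
  shows "z = T (a0 + a1) (b0 + b1)"
proof -
  let ?D = "\<lambda>\<alpha> \<beta>. dseries prod_decode T \<alpha> x \<beta> y"
  have xm: "x n \<in> carr (fst A)" "x n \<in> carr (snd A)" and ym: "y n \<in> carr (fst B)" "y n \<in> carr (snd B)" for n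
    using x[of n] y[of n] by auto
  have TC: "T (x n) (y m) \<in> carr (sum_sp C)" for n m using T_inter[OF x y, of n m] by (intro C.mem_sum0) simp
  \<comment> \<open>As all coefficients are nonnegative, each block is dominated termwise by the
    whole series and inherits its absolute convergence.\<close>
  have piece: "(\<Sum>i. ennreal (nrm (sum_sp C) (?D \<alpha>' \<beta>' i))) < \<infinity> \<and> (\<exists>z. nsums (sum_sp C) (?D \<alpha>' \<beta>') z)"
    if "\<And>n. 0 \<le> \<alpha>' n" "\<And>n. \<alpha>' n \<le> \<alpha>0 n + \<alpha>1 n" "\<And>n. 0 \<le> \<beta>' n" "\<And>n. \<beta>' n \<le> \<beta>0 n + \<beta>1 n" for \<alpha>' \<beta>'
  proof -
    have "(\<Sum>i. ennreal (nrm (sum_sp C) (?D \<alpha>' \<beta>' i))) \<le> (\<Sum>i. ennreal (nrm (sum_sp C) (?D (\<lambda>n. \<alpha>0 n + \<alpha>1 n) (\<lambda>n. \<beta>0 n + \<beta>1 n) i)))"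
    proof (intro suminf_le summableI ennreal_leI)
      fix i
      have "\<bar>\<alpha>' (fst (prod_decode i)) * \<beta>' (snd (prod_decode i))\<bar> \<le>
          \<bar>(\<alpha>0 (fst (prod_decode i)) + \<alpha>1 (fst (prod_decode i))) * (\<beta>0 (snd (prod_decode i)) + \<beta>1 (snd (prod_decode i)))\<bar>"
        using that \<alpha> \<beta> by (simp add: abs_mult mult_mono)
      then show "nrm (sum_sp C) (?D \<alpha>' \<beta>' i) \<le> nrm (sum_sp C) (?D (\<lambda>n. \<alpha>0 n + \<alpha>1 n) (\<lambda>n. \<beta>0 n + \<beta>1 n) i)"
        unfolding dseries_def C.S.nrm_scale[OF TC] by (rule mult_right_mono) (rule C.S.nrm_ge0[OF TC])
    qed
    then have f: "(\<Sum>i. ennreal (nrm (sum_sp C) (?D \<alpha>' \<beta>' i))) < \<infinity>" using fin by (rule order.strict_trans1)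
    have "?D \<alpha>' \<beta>' i \<in> carr (sum_sp C)" for i unfolding dseries_def by (rule C.S.scale_mem[OF TC])
    then show ?thesis using banach_nsums[OF C.banach_sum _ f] f by blast
  qed
  have p00: "(\<Sum>i. ennreal (nrm (sum_sp C) (?D \<alpha>0 \<beta>0 i))) < \<infinity> \<and> (\<exists>z. nsums (sum_sp C) (?D \<alpha>0 \<beta>0) z)"
    and p01: "(\<Sum>i. ennreal (nrm (sum_sp C) (?D \<alpha>0 \<beta>1 i))) < \<infinity> \<and> (\<exists>z. nsums (sum_sp C) (?D \<alpha>0 \<beta>1) z)"
    and p10: "(\<Sum>i. ennreal (nrm (sum_sp C) (?D \<alpha>1 \<beta>0 i))) < \<infinity> \<and> (\<exists>z. nsums (sum_sp C) (?D \<alpha>1 \<beta>0) z)"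
    and p11: "(\<Sum>i. ennreal (nrm (sum_sp C) (?D \<alpha>1 \<beta>1 i))) < \<infinity> \<and> (\<exists>z. nsums (sum_sp C) (?D \<alpha>1 \<beta>1) z)"
    using \<alpha> \<beta> by (intro piece; simp)+
  obtain z00 z01 z10 z11 where zz: "nsums (sum_sp C) (?D \<alpha>0 \<beta>0) z00" "nsums (sum_sp C) (?D \<alpha>0 \<beta>1) z01"
    "nsums (sum_sp C) (?D \<alpha>1 \<beta>0) z10" "nsums (sum_sp C) (?D \<alpha>1 \<beta>1) z11"
    using p00 p01 p10 p11 by blast
  have "(\<lambda>i. (?D \<alpha>0 \<beta>0 i + ?D \<alpha>0 \<beta>1 i) + (?D \<alpha>1 \<beta>0 i + ?D \<alpha>1 \<beta>1 i)) = ?D (\<lambda>n. \<alpha>0 n + \<alpha>1 n) (\<lambda>n. \<beta>0 n + \<beta>1 n)"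
    by (simp add: dseries_def fun_eq_iff algebra_simps)
  with C.S.nsums_add[OF C.S.nsums_add[OF zz(1,2)] C.S.nsums_add[OF zz(3,4)]]
  have "nsums (sum_sp C) (?D (\<lambda>n. \<alpha>0 n + \<alpha>1 n) (\<lambda>n. \<beta>0 n + \<beta>1 n)) ((z00 + z01) + (z10 + z11))" by simp
  then have zsum: "z = (z00 + z01) + (z10 + z11)" using z by (metis C.S.nsums_unique)
  have am: "a0 \<in> carr (fst A)" "a1 \<in> carr (snd A)" "b0 \<in> carr (fst B)" "b1 \<in> carr (snd B)"
    using a0 a1 b0' b1' nsumsD(2) by blast+
  note n = A.X0.normed A.X1.normed B.X0.normed B.X1.normed C.X0.normed C.X1.normed C.normed_sum
  have e00: "z00 = T a0 b0"
    by (rule dseries_eq_rows[OF n(1) n(5) n(3) n(5) n(7) T0 T0 C.nsums_sum0 C.nsums_sum0 a0 b0' am(3) xm(1) xm(1) ym(1) bij_prod_decode zz(1) conjunct1[OF p00]])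
  have e11: "z11 = T a1 b1"
    by (rule dseries_eq_rows[OF n(2) n(6) n(4) n(6) n(7) T1 T1 C.nsums_sum1 C.nsums_sum1 a1 b1' am(4) xm(2) xm(2) ym(2) bij_prod_decode zz(4) conjunct1[OF p11]])
  from cond show ?thesis
  proof (elim disjE conjE)
    assume a: "a0 + a1 \<in> carr (fst A)" and b: "b0 + b1 \<in> carr (fst B)"
    have a1': "a1 \<in> carr (fst A)" and b1'': "b1 \<in> carr (fst B)"
      using A.X0.diff_mem[OF a am(1)] B.X0.diff_mem[OF b am(3)] by simp_all
    have e01: "z01 = T a0 b1"
      by (rule dseries_eq_rows[OF n(1) n(5) n(4) n(6) n(7) T0 T1 C.nsums_sum0 C.nsums_sum1 a0 b1' b1'' xm(1) xm(2) ym(2) bij_prod_decode zz(2) conjunct1[OF p01]])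
    have e10: "z10 = T a1 b0"
      by (rule dseries_eq_columns[OF n(2) n(6) n(3) n(5) n(7) T1 T0 C.nsums_sum1 C.nsums_sum0 a1 b0' a1' ym(2) ym(1) xm(2) bij_prod_decode zz(3) conjunct1[OF p10]])
    show ?thesis
      unfolding zsum e00 e01 e10 e11 bilinear_btwD(2)[OF bilinear0 am(1) b a1'] bilinear_btwD(3)[OF bilinear0 am(1) am(3) b1'']
        bilinear_btwD(3)[OF bilinear0 a1' am(3) b1''] ..
  next
    assume a: "a0 + a1 \<in> carr (snd A)" and b: "b0 + b1 \<in> carr (snd B)"
    have a0'': "a0 \<in> carr (snd A)" and b0'': "b0 \<in> carr (snd B)"
      using A.X1.diff_mem[OF a am(2)] B.X1.diff_mem[OF b am(4)] by simp_all
    have e01: "z01 = T a0 b1"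
      by (rule dseries_eq_columns[OF n(1) n(5) n(4) n(6) n(7) T0 T1 C.nsums_sum0 C.nsums_sum1 a0 b1' a0'' ym(1) ym(2) xm(1) bij_prod_decode zz(2) conjunct1[OF p01]])
    have e10: "z10 = T a1 b0"
      by (rule dseries_eq_rows[OF n(2) n(6) n(3) n(5) n(7) T1 T0 C.nsums_sum1 C.nsums_sum0 a1 b0' b0'' xm(2) xm(1) ym(1) bij_prod_decode zz(3) conjunct1[OF p10]])
    show ?thesis
      unfolding zsum e00 e01 e10 e11 bilinear_btwD(2)[OF bilinear1 a0'' b am(2)] bilinear_btwD(3)[OF bilinear1 a0'' b0'' am(4)]
        bilinear_btwD(3)[OF bilinear1 am(2) b0'' am(4)] ..
  qed
qed

end

section \<open>Series representations of strongly measurable functions\<close>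

context couple
begin

lemma J_fun_nonneg: "x \<in> carr (inter_sp X) \<Longrightarrow> 0 \<le> J_fun X s x"
  unfolding J_fun_def by (rule max.coboundedI1) simp

lemma J_fun_zero: "J_fun X s 0 = 0"
  by (simp add: J_fun_def X0.nrm_zero X1.nrm_zero)

lemma J_fun_triangle:
  assumes "x \<in> carr (inter_sp X)" "y \<in> carr (inter_sp X)" "0 \<le> s"
  shows "J_fun X s (x + y) \<le> J_fun X s x + J_fun X s y"
  unfolding J_fun_def
proof (rule max.boundedI)
  have "nrm (fst X) (x + y) \<le> nrm (fst X) x + nrm (fst X) y" using assms by (intro X0.nrm_triangle) auto
  then show "nrm (fst X) (x + y) \<le> max (nrm (fst X) x) (s * nrm (snd X) x) + max (nrm (fst X) y) (s * nrm (snd X) y)"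
    by linarith
  have "s * nrm (snd X) (x + y) \<le> s * (nrm (snd X) x + nrm (snd X) y)"
    using assms by (intro mult_left_mono X1.nrm_triangle) auto
  then show "s * nrm (snd X) (x + y) \<le> max (nrm (fst X) x) (s * nrm (snd X) x) + max (nrm (fst X) y) (s * nrm (snd X) y)"
    unfolding distrib_left by linarith
qed

lemma J_fun_scale:
  assumes "x \<in> carr (inter_sp X)"
  shows "J_fun X s (c *\<^sub>R x) = \<bar>c\<bar> * J_fun X s x"
  using assms by (simp add: J_fun_def X0.nrm_scale X1.nrm_scale max_mult_distrib_left mult.left_commute)

lemma J_fun_le:
  assumes "x \<in> carr (inter_sp X)" "0 \<le> s"
  shows "J_fun X s x \<le> max 1 s * nrm (inter_sp X) x"
  unfolding J_fun_def
proof (rule max.boundedI)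
  have "1 * nrm (fst X) x \<le> max 1 s * nrm (inter_sp X) x"
    using assms by (intro mult_mono) (auto simp: nrm_inter)
  then show "nrm (fst X) x \<le> max 1 s * nrm (inter_sp X) x" by simp
  show "s * nrm (snd X) x \<le> max 1 s * nrm (inter_sp X) x"
    using assms by (intro mult_mono) (auto simp: nrm_inter)
qed

lemma J_fun_ge:
  assumes x: "x \<in> carr (inter_sp X)" and s: "0 \<le> s"
  shows "min 1 s * nrm (inter_sp X) x \<le> J_fun X s x"
proof -
  have "min 1 s * nrm (fst X) x \<le> 1 * nrm (fst X) x" using x by (intro mult_right_mono) auto
  moreover have "min 1 s * nrm (snd X) x \<le> s * nrm (snd X) x" using x by (intro mult_right_mono) auto
  ultimately have "max (min 1 s * nrm (fst X) x) (min 1 s * nrm (snd X) x) \<le> J_fun X s x"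
    unfolding J_fun_def by (intro max.mono) simp_all
  moreover have "0 \<le> min 1 s" using s by simp
  ultimately show ?thesis unfolding nrm_inter by (simp add: max_mult_distrib_left)
qed

text \<open>For negative \<open>t\<close> the minimum equals 1. Together with
  \<open>nrm1_le_J\<close> this is the split at 0 that lets the two halves of a series converge in
  the end point spaces.\<close>

lemma nrm0_le_J: "x \<in> carr (inter_sp X) \<Longrightarrow> t < 0 \<Longrightarrow> nrm (fst X) x \<le> min 1 (exp (- t)) * J_fun X (exp t) x"
  by (simp add: J_fun_def)

lemma nrm1_le_J:
  assumes "x \<in> carr (inter_sp X)" "0 \<le> t"
  shows "nrm (snd X) x \<le> min 1 (exp (- t)) * J_fun X (exp t) x"
proof -
  have "nrm (snd X) x = exp (- t) * (exp t * nrm (snd X) x)" by (simp add: exp_minus)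
  also have "\<dots> \<le> exp (- t) * J_fun X (exp t) x" unfolding J_fun_def by (intro mult_left_mono) auto
  also have "exp (- t) = min 1 (exp (- t))" using assms by (intro min_absorb2[symmetric]) simp
  finally show ?thesis .
qed

lemma nrm_sum_le_J:
  assumes x: "x \<in> carr (inter_sp X)"
  shows "nrm (sum_sp X) x \<le> min 1 (exp (- t)) * J_fun X (exp t) x"
proof (cases "t < 0")
  case True
  have "nrm (sum_sp X) x \<le> nrm (fst X) x" using x by (intro nrm_sum_le0) simp
  then show ?thesis using nrm0_le_J[OF x True] by linarith
next
  case False
  have "nrm (sum_sp X) x \<le> nrm (snd X) x" using x by (intro nrm_sum_le1) simp
  then show ?thesis using nrm1_le_J[OF x, of t] False by linarith
qed

lemma J_fun_measurable:
  assumes f: "strongly_measurable lebesgue (inter_sp X) f"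
  shows "(\<lambda>t. J_fun X (exp t) (f t)) \<in> borel_measurable (lebesgue :: real measure)"
proof -
  have "(\<lambda>t. nrm (fst X) (f t)) \<in> borel_measurable lebesgue"
    by (rule measurable_nrm_comp[OF normed_inter f]) (use X0.nrm_diff_abs_le in \<open>simp add: nrm_inter le_max_iff_disj\<close>)
  moreover have "(\<lambda>t. nrm (snd X) (f t)) \<in> borel_measurable lebesgue"
    by (rule measurable_nrm_comp[OF normed_inter f]) (use X1.nrm_diff_abs_le in \<open>simp add: nrm_inter le_max_iff_disj\<close>)
  moreover have "(exp :: real \<Rightarrow> real) \<in> borel_measurable lebesgue" by (rule lebesgue_of_borel) measurable
  ultimately show ?thesis unfolding J_fun_def by measurable
qed

end

text \<open>Borel sets, because their indicators will be convolved over \<open>lborel\<close>. The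
  condition for \<open>z n = 0\<close> is there so that every \<open>E n\<close> has finite measure:
  summability of \<open>|E n|\<close> times the norm of \<open>z n\<close> says nothing about terms
  with \<open>z n = 0\<close>.\<close>

definition J_series ::
  "'v::real_vector couple \<Rightarrow> real \<Rightarrow> (real \<Rightarrow> 'v) \<Rightarrow> (nat \<Rightarrow> real set) \<Rightarrow> (nat \<Rightarrow> 'v) \<Rightarrow> bool"
where
  "J_series X q u E z \<longleftrightarrow>
     (\<forall>n. E n \<in> sets borel \<and> z n \<in> carr (inter_sp X) \<and> (z n = 0 \<longrightarrow> E n = {})) \<and>
     (AE t in lborel. nsums (inter_sp X) (\<lambda>n. indicat_real (E n) t *\<^sub>R z n) (u (exp t)) \<and>
       (\<Sum>n. indicator (E n) t * ennreal (J_fun X (exp t) (z n))) \<le> ennreal (q * J_fun X (exp t) (u (exp t))))"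

lemma J_seriesD:
  assumes "J_series X q u E z"
  shows "E n \<in> sets borel" "z n \<in> carr (inter_sp X)" "z n = 0 \<Longrightarrow> E n = {}"
    "AE t in lborel. nsums (inter_sp X) (\<lambda>n. indicat_real (E n) t *\<^sub>R z n) (u (exp t))"
    "AE t in lborel. (\<Sum>n. indicator (E n) t * ennreal (J_fun X (exp t) (z n))) \<le> ennreal (q * J_fun X (exp t) (u (exp t)))"
  using assms unfolding J_series_def by auto

context couple
begin

lemma J_series_exists:
  assumes u: "strongly_measurable (lebesgue_on {0<..}) (inter_sp X) u" and q: "1 < q"
  obtains E z where "J_series X q u E z"
proof -
  let ?f = "\<lambda>t. u (exp t)"
  \<comment> \<open>Since \<open>exp(-|t|) * max(1, e^t) = min(1, e^t)\<close>, and this times the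
    norm of the intersection is at most \<open>J(e^t, .)\<close>, the excess of the series amounts
    to at most \<open>(q - 1) J\<close>.\<close>
  define \<eta> where "\<eta> t = (q - 1) * exp (- \<bar>t\<bar>)" for t :: real
  have f: "strongly_measurable lebesgue (inter_sp X) ?f" by (rule strongly_measurable_exp[OF u])
  have fc: "?f t \<in> carr (inter_sp X)" for t using f unfolding strongly_measurable_def by auto
  have "\<eta> \<in> borel_measurable borel" unfolding \<eta>_def by measurable
  then have \<eta>: "\<eta> \<in> borel_measurable lebesgue" "\<And>t. 0 < \<eta> t"
    using q by (auto simp: \<eta>_def intro: lebesgue_of_borel)
  obtain A z where A: "\<And>i. A i \<in> sets lebesgue" and z: "\<And>i. z i \<in> carr (inter_sp X)"
    and ae: "AE t in lebesgue. nsums (inter_sp X) (\<lambda>i. indicat_real (A i) t *\<^sub>R z i) (?f t) \<and>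
       (\<forall>N. seminorm_below (inter_sp X) N \<longrightarrow>
          (\<Sum>i. indicator (A i) t * ennreal (N (z i))) \<le> ennreal (N (?f t) + \<eta> t * nrm (inter_sp X) (?f t)))"
    using strongly_measurable_series[OF banach_inter f \<eta>] by blast
  \<comment> \<open>Each Lebesgue set is replaced by its Borel part, which changes it by a null set;
    only countably many sets are involved.\<close>
  define E where "E i = (if z i = 0 then {} else main_part lborel (A i))" for i
  have mp: "main_part lborel (A i) \<in> sets borel" for i using main_part_sets[OF A, of i] by simp
  have Eq: "AE t in lborel. \<forall>i. t \<in> A i \<longleftrightarrow> t \<in> main_part lborel (A i)"
  proof (subst AE_all_countable, rule allI)
    fix i
    obtain N where N: "N \<in> null_sets lborel" "null_part lborel (A i) \<subseteq> N" using null_part[OF A] by blast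
    have "A i = main_part lborel (A i) \<union> null_part lborel (A i)" using main_part_null_part_Un[OF A] by simp
    with N(2) have i: "t \<notin> N \<Longrightarrow> t \<in> A i \<longleftrightarrow> t \<in> main_part lborel (A i)" for t by blast
    show "AE t in lborel. t \<in> A i \<longleftrightarrow> t \<in> main_part lborel (A i)"
      using AE_not_in[OF N(1)] by eventually_elim (rule i)
  qed
  have "J_series X q u E z"
    unfolding J_series_def
  proof (intro conjI allI)
    show "E n \<in> sets borel" "z n = 0 \<longrightarrow> E n = {}" for n using mp by (auto simp: E_def)
    show "z n \<in> carr (inter_sp X)" for n by (rule z)
    show "AE t in lborel. nsums (inter_sp X) (\<lambda>n. indicat_real (E n) t *\<^sub>R z n) (?f t) \<and>
       (\<Sum>n. indicator (E n) t * ennreal (J_fun X (exp t) (z n))) \<le> ennreal (q * J_fun X (exp t) (?f t))"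
      using ae[unfolded AE_completion_iff] Eq
    proof eventually_elim
      case (elim t)
      define M where "M = max 1 (exp t)"
      have M: "0 < M" "1 \<le> M" by (auto simp: M_def)
      have eq: "indicat_real (A n) t *\<^sub>R z n = indicat_real (E n) t *\<^sub>R z n" for n
        using elim(2) by (auto simp: E_def indicator_def)
      \<comment> \<open>The divisor \<open>M\<close> makes \<open>J(e^t, .)\<close> smaller than the
        norm of the intersection, so that the bound for all seminorms applies to it at this
        \<open>t\<close>.\<close>
      have sb: "seminorm_below (inter_sp X) (\<lambda>x. J_fun X (exp t) x / M)"
        unfolding seminorm_below_def
      proof (intro conjI ballI)
        fix x y assume x: "x \<in> carr (inter_sp X)" and y: "y \<in> carr (inter_sp X)"
        show "0 \<le> J_fun X (exp t) x / M" using J_fun_nonneg[OF x] M by simp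
        show "J_fun X (exp t) x / M \<le> nrm (inter_sp X) x"
          using J_fun_le[OF x, of "exp t"] M by (simp add: M_def[symmetric] pos_divide_le_eq mult.commute)
        show "J_fun X (exp t) (x + y) / M \<le> J_fun X (exp t) x / M + J_fun X (exp t) y / M"
          unfolding add_divide_distrib[symmetric] using M by (intro divide_right_mono J_fun_triangle x y) auto
      qed
      have mm: "exp (- \<bar>t\<bar>) * M = min 1 (exp t)"
        by (cases "0 \<le> t") (simp_all add: M_def exp_minus max_def min_def)
      have "(\<Sum>n. indicator (E n) t * ennreal (J_fun X (exp t) (z n))) \<le>
          (\<Sum>n. ennreal M * (indicator (A n) t * ennreal (J_fun X (exp t) (z n) / M)))"
      proof (intro suminf_le summableI)
        fix n
        have "ennreal (J_fun X (exp t) (z n)) = ennreal M * ennreal (J_fun X (exp t) (z n) / M)"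
          using M J_fun_nonneg[OF z, of "exp t" n] by (simp add: ennreal_mult[symmetric])
        then show "indicator (E n) t * ennreal (J_fun X (exp t) (z n)) \<le>
          ennreal M * (indicator (A n) t * ennreal (J_fun X (exp t) (z n) / M))"
          using elim(2) by (auto simp: E_def indicator_def)
      qed
      also have "\<dots> = ennreal M * (\<Sum>n. indicator (A n) t * ennreal (J_fun X (exp t) (z n) / M))" by simp
      also have "\<dots> \<le> ennreal M * ennreal (J_fun X (exp t) (?f t) / M + \<eta> t * nrm (inter_sp X) (?f t))"
        using elim(1) sb by (intro mult_left_mono) auto
      also have "\<dots> = ennreal (M * (J_fun X (exp t) (?f t) / M + \<eta> t * nrm (inter_sp X) (?f t)))"
        using M \<eta>(2)[of t] J_fun_nonneg[OF fc, of "exp t" t] fc[of t]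
        by (intro ennreal_mult[symmetric] add_nonneg_nonneg mult_nonneg_nonneg divide_nonneg_nonneg I.nrm_ge0) auto
      also have "\<dots> \<le> ennreal (q * J_fun X (exp t) (?f t))"
      proof (rule ennreal_leI)
        have "M * (J_fun X (exp t) (?f t) / M + \<eta> t * nrm (inter_sp X) (?f t)) =
            J_fun X (exp t) (?f t) + (q - 1) * ((exp (- \<bar>t\<bar>) * M) * nrm (inter_sp X) (?f t))"
          using M by (simp add: \<eta>_def distrib_left mult_ac)
        also have "\<dots> \<le> J_fun X (exp t) (?f t) + (q - 1) * J_fun X (exp t) (?f t)"
          unfolding mm using q J_fun_ge[OF fc, of "exp t" t] by (intro add_left_mono mult_left_mono) auto
        also have "\<dots> = q * J_fun X (exp t) (?f t)" by (simp add: algebra_simps)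
        finally show "M * (J_fun X (exp t) (?f t) / M + \<eta> t * nrm (inter_sp X) (?f t)) \<le> q * J_fun X (exp t) (?f t)" .
      qed
      finally show ?case using elim(1) by (simp add: eq)
    qed
  qed
  then show ?thesis by (rule that)
qed

text \<open>Stated for a set \<open>D\<close> and numbers \<open>r n\<close> to cover three cases:
  the line with the norm of the sum, the negative half-line with the norm of \<open>X_0\<close>, and
  the nonnegative one with that of \<open>X_1\<close>.\<close>

lemma J_series_finite:
  assumes s: "J_series X q u E z" and q: "0 \<le> q" and u: "strongly_measurable lebesgue (inter_sp X) (\<lambda>t. u (exp t))"
    and fin: "(\<integral>\<^sup>+t. ennreal (min 1 (exp (- t)) * J_fun X (exp t) (u (exp t))) \<partial>lebesgue) < \<infinity>"
    and D: "D \<in> sets borel" and r: "\<And>n t. t \<in> D \<Longrightarrow> r n \<le> min 1 (exp (- t)) * J_fun X (exp t) (z n)"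
  shows "(\<Sum>n. emeasure lborel (E n \<inter> D) * ennreal (r n)) < \<infinity>"
proof -
  note [measurable] = J_seriesD(1)[OF s] D
  have uc: "u (exp t) \<in> carr (inter_sp X)" for t using u unfolding strongly_measurable_def by auto
  let ?k = "\<lambda>t. min 1 (exp (- t)) :: real"
  have [measurable]: "(\<lambda>t. J_fun X (exp t) x) \<in> borel_measurable borel" for x unfolding J_fun_def by measurable
  have "?k \<in> borel_measurable lebesgue" by (rule lebesgue_of_borel) measurable
  with J_fun_measurable[OF u] have m: "(\<lambda>t. ennreal (?k t * J_fun X (exp t) (u (exp t)))) \<in> borel_measurable lebesgue"
    by (intro measurable_compose[OF _ measurable_ennreal] borel_measurable_times)
  have "(\<Sum>n. emeasure lborel (E n \<inter> D) * ennreal (r n)) = (\<Sum>n. \<integral>\<^sup>+t. indicator (E n \<inter> D) t * ennreal (r n) \<partial>lborel)"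
    by (simp add: nn_integral_multc)
  also have "\<dots> \<le> (\<Sum>n. \<integral>\<^sup>+t. ennreal (?k t) * (indicator (E n) t * ennreal (J_fun X (exp t) (z n))) \<partial>lborel)"
  proof (intro suminf_le summableI nn_integral_mono)
    fix n t
    have "ennreal (r n) \<le> ennreal (?k t) * ennreal (J_fun X (exp t) (z n))" if "t \<in> D"
      using r[OF that, of n] J_fun_nonneg[OF J_seriesD(2)[OF s]] by (simp add: ennreal_mult[symmetric])
    then show "indicator (E n \<inter> D) t * ennreal (r n) \<le> ennreal (?k t) * (indicator (E n) t * ennreal (J_fun X (exp t) (z n)))"
      by (auto simp: indicator_def)
  qed
  also have "\<dots> = (\<integral>\<^sup>+t. (\<Sum>n. ennreal (?k t) * (indicator (E n) t * ennreal (J_fun X (exp t) (z n)))) \<partial>lborel)"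
    by (intro nn_integral_suminf[symmetric]) measurable
  also have "\<dots> = (\<integral>\<^sup>+t. (\<Sum>n. ennreal (?k t) * (indicator (E n) t * ennreal (J_fun X (exp t) (z n)))) \<partial>lebesgue)"
    by (rule nn_integral_completion[symmetric])
  also have "\<dots> \<le> (\<integral>\<^sup>+t. ennreal q * ennreal (?k t * J_fun X (exp t) (u (exp t))) \<partial>lebesgue)"
  proof (rule nn_integral_mono_AE)
    show "AE t in lebesgue. (\<Sum>n. ennreal (?k t) * (indicator (E n) t * ennreal (J_fun X (exp t) (z n)))) \<le>
      ennreal q * ennreal (?k t * J_fun X (exp t) (u (exp t)))"
      using AE_completion[OF J_seriesD(5)[OF s]]
    proof eventually_elim
      case (elim t)
      have nn: "0 \<le> J_fun X (exp t) (u (exp t))" by (rule J_fun_nonneg[OF uc])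
      have "(\<Sum>n. ennreal (?k t) * (indicator (E n) t * ennreal (J_fun X (exp t) (z n)))) =
        ennreal (?k t) * (\<Sum>n. indicator (E n) t * ennreal (J_fun X (exp t) (z n)))" by simp
      also have "\<dots> \<le> ennreal (?k t) * ennreal (q * J_fun X (exp t) (u (exp t)))" using elim by (rule mult_left_mono) simp
      also have "\<dots> = ennreal q * ennreal (?k t * J_fun X (exp t) (u (exp t)))"
        using q nn by (simp add: ennreal_mult[symmetric] mult.left_commute)
      finally show ?case .
    qed
  qed
  also have "\<dots> \<le> ennreal q * (\<integral>\<^sup>+t. ennreal (?k t * J_fun X (exp t) (u (exp t))) \<partial>lebesgue)"
    by (subst nn_integral_cmult[OF m]) simp
  also have "\<dots> < \<infinity>" using fin by (simp add: ennreal_mult_less_top)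
  finally show ?thesis .
qed

lemma J_series_sums:
  assumes s: "J_series X q u E z" and q: "0 \<le> q" and u: "strongly_measurable lebesgue (inter_sp X) (\<lambda>t. u (exp t))"
    and fin: "(\<integral>\<^sup>+t. ennreal (min 1 (exp (- t)) * J_fun X (exp t) (u (exp t))) \<partial>lebesgue) < \<infinity>"
  shows "emeasure lborel (E n) < \<infinity>"
    and "has_bochner_int lebesgue (sum_sp X) (\<lambda>t. u (exp t)) a \<Longrightarrow>
      nsums (sum_sp X) (\<lambda>n. measure lborel (E n) *\<^sub>R z n) a"
    and "\<exists>a0. nsums (fst X) (\<lambda>n. measure lborel (E n \<inter> {..<0}) *\<^sub>R z n) a0"
    and "\<exists>a1. nsums (snd X) (\<lambda>n. measure lborel (E n \<inter> {0..}) *\<^sub>R z n) a1"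
proof -
  note [measurable] = J_seriesD(1)[OF s]
  note fs = J_series_finite[OF s q u fin]
  note z = J_seriesD(2)[OF s]
  have uc: "u (exp t) \<in> carr (inter_sp X)" for t using u unfolding strongly_measurable_def by auto
  have zz: "z n \<in> carr (fst X)" "z n \<in> carr (snd X)" "z n \<in> carr (sum_sp X)" for n using z[of n] by simp_all
  have f: "(\<Sum>n. emeasure lborel (E n) * ennreal (nrm (sum_sp X) (z n))) < \<infinity>"
    using fs[of UNIV "\<lambda>n. nrm (sum_sp X) (z n)"] nrm_sum_le_J[OF z] by simp
  show Efin: "emeasure lborel (E n) < \<infinity>" for n
  proof (cases "z n = 0")
    case True
    then show ?thesis using J_seriesD(3)[OF s, of n] by simp
  next
    case False
    then have "nrm (sum_sp X) (z n) \<noteq> 0" using S.nrm_eq0[OF zz(3)] by simp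
    moreover have "emeasure lborel (E n) * ennreal (nrm (sum_sp X) (z n)) < \<infinity>"
      using f by (rule ennreal_suminf_lessD)
    ultimately show ?thesis using S.nrm_ge0[OF zz(3), of n] by (auto simp: ennreal_mult_less_top ennreal_eq_0_iff)
  qed
  have Dfin: "emeasure lborel (E n \<inter> D) < \<infinity>" if "D \<in> sets borel" for n D
    using that by (intro order.strict_trans1[OF emeasure_mono Efin]) auto
  have conv: "\<exists>x. nsums Y (\<lambda>n. measure lborel (E n \<inter> D) *\<^sub>R z n) x"
    if Y: "banach_sp Y" "\<And>n. z n \<in> carr Y" and D: "D \<in> sets borel"
      and S: "(\<Sum>n. emeasure lborel (E n \<inter> D) * ennreal (nrm Y (z n))) < \<infinity>" for Y D
  proof -
    interpret Y: nsp Y using Y(1) by unfold_locales (simp add: banach_sp_def)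
    have "ennreal (nrm Y (measure lborel (E n \<inter> D) *\<^sub>R z n)) = emeasure lborel (E n \<inter> D) * ennreal (nrm Y (z n))" for n
      using Dfin[OF D, of n] Y(2)[of n] by (simp add: Y.nrm_scale ennreal_mult emeasure_eq_ennreal_measure)
    then show ?thesis using S Y by (intro banach_nsums[OF Y(1)]) simp_all
  qed
  show "\<exists>a0. nsums (fst X) (\<lambda>n. measure lborel (E n \<inter> {..<0}) *\<^sub>R z n) a0"
    using nrm0_le_J[OF z] by (intro conv banach0 zz fs) auto
  show "\<exists>a1. nsums (snd X) (\<lambda>n. measure lborel (E n \<inter> {0..}) *\<^sub>R z n) a1"
    using nrm1_le_J[OF z] by (intro conv banach1 zz fs) auto
  assume a: "has_bochner_int lebesgue (sum_sp X) (\<lambda>t. u (exp t)) a"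
  obtain x where x: "nsums (sum_sp X) (\<lambda>n. measure lborel (E n) *\<^sub>R z n) x"
    using conv[OF banach_sum zz(3), of UNIV] f by auto
  have E: "E n \<in> sets lebesgue" for n using J_seriesD(1)[OF s, of n] by (intro sets_completionI_sets) simp
  have El: "emeasure lebesgue (E n) = emeasure lborel (E n)" "measure lebesgue (E n) = measure lborel (E n)" for n
    by (simp_all add: measure_completion)
  \<comment> \<open>The sum \<open>x\<close> of the series is also an integral of
    \<open>u(e^t)\<close>; uniqueness of the integral then gives \<open>x = a\<close>.\<close>
  have "has_bochner_int lebesgue (sum_sp X) (\<lambda>t. u (exp t)) x"
  proof (rule has_bochner_int_series[OF normed_sum, where c = "\<lambda>n. indicat_real (E n)" and B = "\<lambda>_. 1" and z = z])
    show "integrable lebesgue (indicat_real (E n))" for n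
      using E Efin[of n] El(1)[of n] by (intro integrable_real_indicator) simp_all
    show "AE t in lebesgue. nsums (sum_sp X) (\<lambda>i. indicat_real (E i) t *\<^sub>R z i) (u (exp t))"
      using AE_completion[OF J_seriesD(4)[OF s]] by eventually_elim (intro nsums_sum0 nsums_inter0)
    have "(\<integral>\<^sup>+t. ennreal \<bar>indicat_real (E i) t\<bar> \<partial>lebesgue) = emeasure lborel (E i)" for i
      using E[of i] by (simp add: El ennreal_indicator)
    then show "(\<Sum>i. (\<integral>\<^sup>+t. ennreal \<bar>indicat_real (E i) t\<bar> \<partial>lebesgue) * ennreal (nrm (sum_sp X) (z i))) < \<infinity>"
      using f by simp
    show "nsums (sum_sp X) (\<lambda>i. integral\<^sup>L lebesgue (indicat_real (E i)) *\<^sub>R z i) x"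
      using x E by (simp add: El)
    show "u (exp t) \<in> carr (sum_sp X)" for t using uc[of t] by simp
  qed (use zz in \<open>auto simp: indicator_def\<close>)
  from has_bochner_int_unique[OF normed_sum a this] x
  show "nsums (sum_sp X) (\<lambda>n. measure lborel (E n) *\<^sub>R z n) a" by simp
qed

end

section \<open>Pairs of representations\<close>

text \<open>\<open>max 0\<close> makes the Borel representative nonnegative at every point, as the
  convolution lemmas require, without changing the class of a nonnegative function.\<close>

definition borel_version :: "(real \<Rightarrow> real) \<Rightarrow> real \<Rightarrow> real" where
  "borel_version w t = max 0 (borel_rep (abs_l0 w) t)"

lemma borel_version_measurable [measurable]: "borel_version w \<in> borel_measurable borel"
  using borel_rep(1) unfolding borel_version_def by measurable

lemma borel_version_nonneg [simp]: "0 \<le> borel_version w t"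
  by (simp add: borel_version_def)

lemma borel_version_AE:
  assumes w: "w \<in> borel_measurable lebesgue" and nn: "\<And>t. 0 \<le> w t"
  shows "AE t in lborel. borel_version w t = w t"
  using rep_abs_l0[OF w, unfolded AE_completion_iff] borel_rep(2)[of "abs_l0 w"]
proof eventually_elim
  case (elim t)
  then show ?case using nn[of t] by (simp add: borel_version_def)
qed

lemma abs_l0_borel_version:
  assumes w: "w \<in> borel_measurable lebesgue" and nn: "\<And>t. 0 \<le> w t"
  shows "abs_l0 (borel_version w) = abs_l0 w"
  using AE_completion[OF borel_version_AE[OF w nn]] w
  by (intro abs_l0_eqI lebesgue_of_borel[OF borel_version_measurable])

lemma AE_translate_lborel:
  assumes "AE t in lborel. P (t::real)" shows "AE t in lborel. P (t + s)"
  using AE_reflect_lborel[OF AE_reflect_lborel[OF assms, of s], of 0] by (simp add: add.commute)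

lemma conv_sym:
  assumes "f \<in> borel_measurable borel" "g \<in> borel_measurable borel"
  shows "conv f g t = conv g f t"
  unfolding conv_commute[OF assms] by (simp add: conv_def mult.commute)

lemma conv_cmult:
  assumes [measurable]: "f \<in> borel_measurable borel" "g \<in> borel_measurable borel"
  shows "conv (\<lambda>s. c * f s) g t = c * conv f g t"
  unfolding conv_def mult.assoc by (rule nn_integral_cmult) measurable

text \<open>\<open>conv_F\<close> is the conclusion of \<open>conv_functor\<close>. With its
  constant \<open>K\<close> as a parameter, one argument covers exact functors, for which
  \<open>K = 1\<close>, and all others.\<close>

locale J_bilin = bilin A B C T + ri \<rho>
  for A :: "'a::real_vector couple" and B :: "'b::real_vector couple" and C :: "'c::real_vector couple"
    and T :: "'a \<Rightarrow> 'b \<Rightarrow> 'c" and \<rho> :: "(real \<Rightarrow> ennreal) \<Rightarrow> ennreal" +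
  fixes \<theta> :: real and \<phi> :: "real \<Rightarrow> real" and F :: "l0 couple \<Rightarrow> l0 nspace" and K :: real
  assumes \<theta>: "0 \<le> \<theta>" and \<phi>: "slowly_varying \<phi>" and F: "interpolation_functor F"
    and adm: "J_admissible \<theta> \<phi> (F (fspace \<rho>, Linf_sp))" and K: "0 \<le> K"
    and conv_F: "\<And>f g m. f \<in> borel_measurable borel \<Longrightarrow> g \<in> borel_measurable borel \<Longrightarrow> (\<And>s. 0 \<le> f s) \<Longrightarrow> (\<And>s. 0 \<le> g s) \<Longrightarrow>
      \<rho> (\<lambda>s. ennreal (f s)) < \<infinity> \<Longrightarrow> abs_l0 g \<in> carr (F (L1_sp, fspace (assoc_norm \<rho>))) \<Longrightarrow>
      m \<in> borel_measurable lebesgue \<Longrightarrow> (\<And>t. \<bar>m t\<bar> \<le> 1) \<Longrightarrow>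
      (AE t in lborel. conv (\<lambda>s. ennreal (f s)) (\<lambda>s. ennreal (g s)) t < \<infinity>) \<and>
      abs_l0 (\<lambda>t. m t * enn2real (conv (\<lambda>s. ennreal (f s)) (\<lambda>s. ennreal (g s)) t)) \<in> carr (F (fspace \<rho>, Linf_sp)) \<and>
      nrm (F (fspace \<rho>, Linf_sp)) (abs_l0 (\<lambda>t. m t * enn2real (conv (\<lambda>s. ennreal (f s)) (\<lambda>s. ennreal (g s)) t)))
        \<le> K * enn2real (\<rho> (\<lambda>s. ennreal (f s))) * nrm (F (L1_sp, fspace (assoc_norm \<rho>))) (abs_l0 g)"
begin

abbreviation "GA \<equiv> fspace \<rho>"
abbreviation "GB \<equiv> F (L1_sp, fspace (assoc_norm \<rho>))"
abbreviation "GC \<equiv> F (fspace \<rho>, Linf_sp)"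
abbreviation "repA \<equiv> J_rep A \<theta> \<phi> GA"
abbreviation "repB \<equiv> J_rep B \<theta> (m_fun \<phi>) GB"
abbreviation "repC \<equiv> J_rep C \<theta> \<phi> GC"
abbreviation "jA u \<equiv> J_weighted A \<theta> \<phi> u"
abbreviation "jB v \<equiv> J_weighted B \<theta> (m_fun \<phi>) v"
abbreviation "hA u s \<equiv> ennreal (borel_version (jA u) s)"
abbreviation "hB v s \<equiv> ennreal (borel_version (jB v) s)"

lemma \<phi>_pos: "0 < \<phi> (exp t)" using slowly_varying_pos[OF \<phi>] by simp

lemma \<phi>_measurable: "(\<lambda>t. \<phi> (exp t)) \<in> borel_measurable lebesgue"
  using \<phi> by (intro exp_measurable_comp) (simp add: slowly_varying_def)

definition \<kappa> :: "real \<Rightarrow> ennreal" where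
  "\<kappa> = (SOME h. h \<in> borel_measurable borel \<and> (AE t in lborel. ennreal (J_kernel \<theta> \<phi> t) = h t))"

lemma \<kappa>: "\<kappa> \<in> borel_measurable borel" "AE t in lborel. ennreal (J_kernel \<theta> \<phi> t) = \<kappa> t"
proof -
  have "(\<lambda>t. min 1 (exp (- t)) * exp (\<theta> * t)) \<in> borel_measurable lebesgue" by (rule lebesgue_of_borel) measurable
  then have "J_kernel \<theta> \<phi> \<in> borel_measurable lebesgue"
    unfolding J_kernel_def using \<phi>_measurable by (intro borel_measurable_divide)
  then have "(\<lambda>t. ennreal (J_kernel \<theta> \<phi> t)) \<in> borel_measurable lebesgue"
    by (rule measurable_compose[OF _ measurable_ennreal])
  from completion_ex_borel_measurable[OF this]
  have "\<exists>h. h \<in> borel_measurable borel \<and> (AE t in lborel. ennreal (J_kernel \<theta> \<phi> t) = h t)" by auto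
  from someI_ex[OF this] show "\<kappa> \<in> borel_measurable borel" "AE t in lborel. ennreal (J_kernel \<theta> \<phi> t) = \<kappa> t"
    unfolding \<kappa>_def by auto
qed

declare \<kappa>(1) [measurable]

text \<open>The convolution lies in \<open>F(E, L^\<infinity>)\<close> by \<open>conv_F\<close> with
  multiplier 1, and admissibility is exactly integrability against the kernel there.\<close>

lemma kernel_conv_finite:
  assumes [measurable]: "f \<in> borel_measurable borel" "g \<in> borel_measurable borel"
    and nn: "\<And>s. 0 \<le> f s" "\<And>s. 0 \<le> g s"
    and f: "\<rho> (\<lambda>s. ennreal (f s)) < \<infinity>" and g: "abs_l0 g \<in> carr GB"
  shows "(\<integral>\<^sup>+t. \<kappa> t * conv (\<lambda>s. ennreal (f s)) (\<lambda>s. ennreal (g s)) t \<partial>lborel) < \<infinity>"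
proof -
  let ?c = "conv (\<lambda>s. ennreal (f s)) (\<lambda>s. ennreal (g s))"
  note * = conv_F[OF assms(1,2) nn f g, of "\<lambda>_. 1", simplified]
  have m: "(\<lambda>t. enn2real (?c t)) \<in> borel_measurable lebesgue" by (rule lebesgue_of_borel) measurable
  have "(\<integral>\<^sup>+t. \<kappa> t * ?c t \<partial>lborel) = (\<integral>\<^sup>+t. \<kappa> t * ?c t \<partial>lebesgue)" by (rule nn_integral_completion[symmetric])
  also have "\<dots> = (\<integral>\<^sup>+t. ennreal (J_kernel \<theta> \<phi> t * \<bar>rep_l0 (abs_l0 (\<lambda>t. enn2real (?c t))) t\<bar>) \<partial>lebesgue)"
  proof (rule nn_integral_cong_AE)
    have "AE t in lborel. ?c t < \<infinity>" using * by simp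
    from AE_completion[OF this] AE_completion[OF \<kappa>(2)] rep_abs_l0[OF m]
    show "AE t in lebesgue. \<kappa> t * ?c t = ennreal (J_kernel \<theta> \<phi> t * \<bar>rep_l0 (abs_l0 (\<lambda>t. enn2real (?c t))) t\<bar>)"
    proof eventually_elim
      case (elim t)
      have "0 \<le> J_kernel \<theta> \<phi> t" using \<phi>_pos[of t] by (simp add: J_kernel_def)
      then show ?case unfolding elim(3) using elim(1) elim(2)[symmetric] by (simp add: ennreal_mult)
    qed
  qed
  also have "\<dots> < \<infinity>" using adm * unfolding J_admissible_iff by blast
  finally show ?thesis .
qed

text \<open>The weight \<open>b\<close> will be \<open>\<phi>\<close> for the first factor and
  \<open>m_fun \<phi>\<close> for the second; only the shift estimate for its kernel
  differs.\<close>

lemma kernel_shift_finite: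
  assumes w: "w \<in> borel_measurable lebesgue" "\<And>t. 0 \<le> w t" and b: "\<And>t. 0 < b (exp t)" and c: "0 < c"
    and sh: "\<And>s t. s \<in> {0..1} \<Longrightarrow> J_kernel \<theta> b t \<le> c * J_kernel \<theta> \<phi> (t + s)"
    and k: "(\<lambda>t. J_kernel \<theta> b t * w t) \<in> borel_measurable lebesgue"
    and fin: "(\<integral>\<^sup>+t. \<kappa> t * conv (indicator {0..1}) (\<lambda>s. ennreal (borel_version w s)) t \<partial>lborel) < \<infinity>"
  shows "(\<integral>\<^sup>+t. ennreal (J_kernel \<theta> b t * w t) \<partial>lebesgue) < \<infinity>"
proof -
  let ?h = "borel_version (\<lambda>t. J_kernel \<theta> b t * w t)"
  have nn: "0 \<le> J_kernel \<theta> b t" for t using b[of t] by (simp add: J_kernel_def)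
  then have knn: "0 \<le> J_kernel \<theta> b t * w t" for t using w(2)[of t] by simp
  note h = borel_version_AE[OF k knn]
  have "(\<integral>\<^sup>+t. ennreal (J_kernel \<theta> b t * w t) \<partial>lebesgue) = (\<integral>\<^sup>+t. ennreal (?h t) \<partial>lebesgue)"
    using AE_completion[OF h] by (intro nn_integral_cong_AE) (auto elim: eventually_mono)
  also have "\<dots> = (\<integral>\<^sup>+t. ennreal (?h t) \<partial>lborel)" by (rule nn_integral_completion)
  also have "\<dots> \<le> ennreal c * (\<integral>\<^sup>+t. \<kappa> t * conv (indicator {0..1}) (\<lambda>s. ennreal (borel_version w s)) t \<partial>lborel)"
  proof (rule nn_integral_shift_conv)
    fix s :: real assume s: "s \<in> {0..1}"
    show "AE t in lborel. ennreal (?h t) \<le> ennreal c * (\<kappa> (t + s) * ennreal (borel_version w t))"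
      using h borel_version_AE[OF w] AE_translate_lborel[OF \<kappa>(2), of s]
    proof eventually_elim
      case (elim t)
      have "0 \<le> J_kernel \<theta> \<phi> (t + s)" using \<phi>_pos[of "t + s"] by (simp add: J_kernel_def)
      moreover have "J_kernel \<theta> b t * w t \<le> c * J_kernel \<theta> \<phi> (t + s) * w t"
        using sh[OF s] w(2) by (intro mult_right_mono) auto
      then have "ennreal (J_kernel \<theta> b t * w t) \<le> ennreal (c * J_kernel \<theta> \<phi> (t + s) * w t)" by (rule ennreal_leI)
      ultimately show ?case
        unfolding elim(1,2) elim(3)[symmetric] using c w(2)[of t] by (simp add: ennreal_mult mult.assoc)
    qed
  qed measurable
  also have "\<dots> < \<infinity>" using fin by (simp add: ennreal_mult_less_top)
  finally show ?thesis .
qed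

text \<open>The indicator can stand in for either factor of a convolution: it lies in
  \<open>E\<close>, and in \<open>L^1 \<inter> E'\<close>, which every functor keeps. Thus each
  factor alone can be tested against the kernel.\<close>

lemma unit_indicator:
  shows "\<rho> (\<lambda>s. ennreal (indicat_real {0..1} s)) < \<infinity>" and "abs_l0 (indicat_real {0..1}) \<in> carr GB"
proof -
  have m: "indicat_real {0..1::real} \<in> borel_measurable lebesgue" by (rule lebesgue_of_borel) measurable
  show "\<rho> (\<lambda>s. ennreal (indicat_real {0..1} s)) < \<infinity>"
    unfolding ennreal_indicator by (rule indicator_finite) auto
  interpret L: fnorm "\<lambda>f. \<integral>\<^sup>+t. f t \<partial>lebesgue" by (rule fnorm_L1)
  interpret P: couple "(L1_sp, fspace (assoc_norm \<rho>))" by standard (rule couple_L1_assoc)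
  have 1: "abs_l0 (indicat_real {0..1}) \<in> carr L1_sp"
    unfolding L1_sp_def L.carr_iff L.l0norm_abs[OF m] by (simp add: ennreal_indicator)
  obtain K' where K': "0 < K'" "\<And>f. f \<in> borel_measurable lebesgue \<Longrightarrow> (\<integral>\<^sup>+t\<in>{- real 1..real 1}. f t \<partial>lebesgue) \<le> ennreal K' * \<rho> f"
    using loc[of 1] by blast
  have "assoc_norm \<rho> (\<lambda>t. ennreal \<bar>indicat_real {0..1} t\<bar>) \<le> ennreal K'"
    unfolding assoc_norm_def
  proof (rule SUP_least)
    fix f assume f: "f \<in> {f \<in> borel_measurable lebesgue. \<rho> f \<le> 1}"
    have "(\<integral>\<^sup>+t. f t * ennreal \<bar>indicat_real {0..1} t\<bar> \<partial>lebesgue) \<le> (\<integral>\<^sup>+t\<in>{- real 1..real 1}. f t \<partial>lebesgue)"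
      by (intro nn_integral_mono) (auto simp: indicator_def)
    also have "\<dots> \<le> ennreal K' * \<rho> f" using f by (intro K'(2)) simp
    also have "\<dots> \<le> ennreal K' * 1" using f by (intro mult_left_mono) auto
    finally show "(\<integral>\<^sup>+t. f t * ennreal \<bar>indicat_real {0..1} t\<bar> \<partial>lebesgue) \<le> ennreal K'" by simp
  qed
  then have "abs_l0 (indicat_real {0..1}) \<in> carr (fspace (assoc_norm \<rho>))"
    unfolding assoc.carr_iff assoc.l0norm_abs[OF m] by (rule order.strict_trans1) simp
  with 1 have "abs_l0 (indicat_real {0..1}) \<in> carr (inter_sp (L1_sp, fspace (assoc_norm \<rho>)))" by simp
  then show "abs_l0 (indicat_real {0..1}) \<in> carr GB"
    using F couple_L1_assoc unfolding interpolation_functor_def cont_embedded_def by blast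
qed

lemma repA_facts:
  assumes u: "repA a u"
  shows "strongly_measurable lebesgue (inter_sp A) (\<lambda>t. u (exp t))" "u (exp t) \<in> carr (inter_sp A)"
    "0 \<le> jA u t" "AE t in lborel. borel_version (jA u) t = jA u t"
    "\<rho> (hA u) < \<infinity>" "enn2real (\<rho> (hA u)) = nrm GA (abs_l0 (jA u))"
    "(\<integral>\<^sup>+t. ennreal (min 1 (exp (- t)) * J_fun A (exp t) (u (exp t))) \<partial>lebesgue) < \<infinity>"
proof -
  show sm: "strongly_measurable lebesgue (inter_sp A) (\<lambda>t. u (exp t))"
    using u by (intro strongly_measurable_exp) (simp add: J_rep_def)
  show uc: "u (exp t) \<in> carr (inter_sp A)" for t using sm unfolding strongly_measurable_def by auto
  show nn: "0 \<le> jA u t" for t using A.J_fun_nonneg[OF uc] \<phi>_pos[of t] by (simp add: J_weighted_def)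
  have m: "jA u \<in> borel_measurable lebesgue" using u by (simp add: J_rep_def)
  show ae: "AE t in lborel. borel_version (jA u) t = jA u t" by (rule borel_version_AE[OF m nn])
  have eq: "\<rho> (hA u) = l0norm (abs_l0 (jA u))"
    unfolding l0norm_abs[OF m]
  proof (rule cong_AE)
    show "hA u \<in> borel_measurable lebesgue" by (rule lebesgue_of_borel) measurable
    show "(\<lambda>t. ennreal \<bar>jA u t\<bar>) \<in> borel_measurable lebesgue" using m by measurable
    show "AE t in lebesgue. hA u t = ennreal \<bar>jA u t\<bar>" using AE_completion[OF ae] nn by (auto elim: eventually_mono)
  qed
  show fin: "\<rho> (hA u) < \<infinity>" unfolding eq carr_iff[symmetric] using u by (simp add: J_rep_def)
  show "enn2real (\<rho> (hA u)) = nrm GA (abs_l0 (jA u))" unfolding eq nrm_eq ..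
  obtain c where c: "0 < c" "\<And>s t. s \<in> {0..1} \<Longrightarrow> J_kernel \<theta> \<phi> t \<le> c * J_kernel \<theta> \<phi> (t + s)"
    using J_kernel_shift_same[OF \<phi> \<theta>] by blast
  \<comment> \<open>The weights cancel. What is left bounds the norm of \<open>u(e^t)\<close> in
    \<open>A_0 + A_1\<close>, and its measurability follows from that of the J-functional.\<close>
  have k: "J_kernel \<theta> \<phi> t * jA u t = min 1 (exp (- t)) * J_fun A (exp t) (u (exp t))" for t
    using \<phi>_pos[of t] by (simp add: J_kernel_def J_weighted_def exp_minus)
  have "(\<lambda>t. min 1 (exp (- t))) \<in> borel_measurable (lebesgue :: real measure)" by (rule lebesgue_of_borel) measurable
  then have km: "(\<lambda>t. J_kernel \<theta> \<phi> t * jA u t) \<in> borel_measurable lebesgue"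
    unfolding k using A.J_fun_measurable[OF sm] by (intro borel_measurable_times)
  have "conv (indicator {0..1}) (hA u) t = conv (hA u) (\<lambda>s. ennreal (indicat_real {0..1} s)) t" for t
    unfolding ennreal_indicator by (rule conv_sym) measurable
  then have "(\<integral>\<^sup>+t. \<kappa> t * conv (indicator {0..1}) (hA u) t \<partial>lborel) < \<infinity>"
    using kernel_conv_finite[OF _ _ _ _ fin unit_indicator(2)] by simp
  from kernel_shift_finite[OF m nn \<phi>_pos c km this]
  show "(\<integral>\<^sup>+t. ennreal (min 1 (exp (- t)) * J_fun A (exp t) (u (exp t))) \<partial>lebesgue) < \<infinity>" unfolding k .
qed

lemma repB_facts:
  assumes v: "repB b v"
  shows "strongly_measurable lebesgue (inter_sp B) (\<lambda>t. v (exp t))" "v (exp t) \<in> carr (inter_sp B)"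
    "0 \<le> jB v t" "AE t in lborel. borel_version (jB v) t = jB v t"
    "abs_l0 (borel_version (jB v)) = abs_l0 (jB v)" "abs_l0 (borel_version (jB v)) \<in> carr GB"
    "(\<integral>\<^sup>+t. ennreal (min 1 (exp (- t)) * J_fun B (exp t) (v (exp t))) \<partial>lebesgue) < \<infinity>"
proof -
  show sm: "strongly_measurable lebesgue (inter_sp B) (\<lambda>t. v (exp t))"
    using v by (intro strongly_measurable_exp) (simp add: J_rep_def)
  show vc: "v (exp t) \<in> carr (inter_sp B)" for t using sm unfolding strongly_measurable_def by auto
  show nn: "0 \<le> jB v t" for t
    using B.J_fun_nonneg[OF vc] m_fun_bounds(2)[OF \<phi>, of t] by (simp add: J_weighted_def)
  have m: "jB v \<in> borel_measurable lebesgue" using v by (simp add: J_rep_def)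
  show "AE t in lborel. borel_version (jB v) t = jB v t" by (rule borel_version_AE[OF m nn])
  show eq: "abs_l0 (borel_version (jB v)) = abs_l0 (jB v)" by (rule abs_l0_borel_version[OF m nn])
  show G: "abs_l0 (borel_version (jB v)) \<in> carr GB" using v unfolding eq by (simp add: J_rep_def)
  obtain c where c: "0 < c" "\<And>s t. s \<in> {0..1} \<Longrightarrow> J_kernel \<theta> (m_fun \<phi>) t \<le> c * J_kernel \<theta> \<phi> (t + s)"
    using J_kernel_shift_m[OF \<phi> \<theta>] by blast
  have k: "J_kernel \<theta> (m_fun \<phi>) t * jB v t = min 1 (exp (- t)) * J_fun B (exp t) (v (exp t))" for t
    using m_fun_bounds(2)[OF \<phi>, of t] by (simp add: J_kernel_def J_weighted_def exp_minus)
  have "(\<lambda>t. min 1 (exp (- t))) \<in> borel_measurable (lebesgue :: real measure)" by (rule lebesgue_of_borel) measurable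
  then have km: "(\<lambda>t. J_kernel \<theta> (m_fun \<phi>) t * jB v t) \<in> borel_measurable lebesgue"
    unfolding k using B.J_fun_measurable[OF sm] by (intro borel_measurable_times)
  have "(\<integral>\<^sup>+t. \<kappa> t * conv (indicator {0..1}) (hB v) t \<partial>lborel) < \<infinity>"
    using kernel_conv_finite[OF _ _ _ _ unit_indicator(1) G] by (simp add: ennreal_indicator)
  from kernel_shift_finite[OF m nn m_fun_bounds(2)[OF \<phi>] c km this]
  show "(\<integral>\<^sup>+t. ennreal (min 1 (exp (- t)) * J_fun B (exp t) (v (exp t))) \<partial>lebesgue) < \<infinity>" unfolding k .
qed

text \<open>Reciprocal form of the inequality between \<open>\<phi>\<close> and
  \<open>m_fun \<phi>\<close>: multiplying the weights removed from the two factors gives at most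
  the weight removed from the product.\<close>

lemma weight_le: "exp (\<theta> * s) / \<phi> (exp s) * (exp (\<theta> * t) / m_fun \<phi> (exp t)) \<le> exp (\<theta> * (s + t)) / \<phi> (exp (s + t))"
proof -
  have m: "0 < m_fun \<phi> (exp t)" by (rule m_fun_bounds(2)[OF \<phi>])
  have "\<phi> (exp (s + t)) \<le> m_fun \<phi> (exp t) * \<phi> (exp s)"
    using m_fun_bounds(1)[OF \<phi>, of "exp s" t] by (simp add: exp_add mult.commute)
  then have "exp (\<theta> * (s + t)) / (m_fun \<phi> (exp t) * \<phi> (exp s)) \<le> exp (\<theta> * (s + t)) / \<phi> (exp (s + t))"
    using m \<phi>_pos by (intro divide_left_mono) auto
  then show ?thesis by (simp add: distrib_left exp_add mult.commute)
qed

section \<open>The product of two series and its convolved coefficients\<close>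

definition cpair :: "(nat \<Rightarrow> real set) \<Rightarrow> (nat \<Rightarrow> real set) \<Rightarrow> nat \<Rightarrow> real \<Rightarrow> ennreal" where
  "cpair E H i = conv (indicator (E (fst (prod_decode i)))) (indicator (H (snd (prod_decode i))))"

definition Tpair :: "(nat \<Rightarrow> 'a) \<Rightarrow> (nat \<Rightarrow> 'b) \<Rightarrow> nat \<Rightarrow> 'c" where
  "Tpair x y i = T (x (fst (prod_decode i))) (y (snd (prod_decode i)))"

lemma suminf_prod_decode_product:
  "(\<Sum>i. f (fst (prod_decode i)) * g (snd (prod_decode i))) = (\<Sum>n. f n) * (\<Sum>m. g m :: ennreal)"
proof -
  have "(\<Sum>i. (\<lambda>p. f (fst p) * g (snd p)) (prod_decode i)) = (\<Sum>n. f n * (\<Sum>m. g m))"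
    by (rule suminf_ennreal_2dimen) simp
  then show ?thesis by (simp add: mult.commute)
qed

lemma weight_nonneg: "0 \<le> T_norm * q\<^sup>2 * (exp (\<theta> * r) / \<phi> (exp r))"
  using T_norm_nonneg \<phi>_pos[of r] by simp

text \<open>Under the integral over \<open>s\<close> the estimate for \<open>T\<close> separates the
  two indices, so the sum over pairs factors into two sums. Each is at most \<open>q\<close> times a
  J-functional, which explains \<open>q\<^sup>2\<close>; \<open>weight_le\<close> then moves all
  weights to the point \<open>r\<close>.\<close>

lemma cpair_sum_le:
  assumes u: "repA a u" and E: "J_series A q u E x" and v: "repB b v" and H: "J_series B q v H y" and q: "0 \<le> q"
  shows "(\<Sum>i. cpair E H i r * ennreal (J_fun C (exp r) (Tpair x y i))) \<le>
    ennreal (T_norm * q\<^sup>2 * (exp (\<theta> * r) / \<phi> (exp r))) * conv (hA u) (hB v) r"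
proof -
  note [measurable] = J_seriesD(1)[OF E] J_seriesD(1)[OF H]
  define f where "f n s = indicator (E n) s * ennreal (J_fun A (exp s) (x n))" for n s
  define g where "g m s = indicator (H m) s * ennreal (J_fun B (exp s) (y m))" for m s
  have xi: "x n \<in> carr (inter_sp A)" and yi: "y n \<in> carr (inter_sp B)" for n
    using J_seriesD(2)[OF E] J_seriesD(2)[OF H] by blast+
  have [measurable]: "(\<lambda>t. J_fun A (exp t) z) \<in> borel_measurable borel" "(\<lambda>t. J_fun B (exp t) z') \<in> borel_measurable borel"
    for z z' unfolding J_fun_def by measurable
  have [measurable]: "f n \<in> borel_measurable borel" "g n \<in> borel_measurable borel" for n
    unfolding f_def g_def by measurable
  have term_le: "cpair E H i r * ennreal (J_fun C (exp r) (Tpair x y i)) \<le>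
    (\<integral>\<^sup>+s. ennreal T_norm * (f (fst (prod_decode i)) s * g (snd (prod_decode i)) (r - s)) \<partial>lborel)" for i
  proof -
    obtain n m where nm: "prod_decode i = (n, m)" by (cases "prod_decode i")
    have "cpair E H i r * ennreal (J_fun C (exp r) (Tpair x y i)) =
      (\<integral>\<^sup>+s. indicator (E n) s * indicator (H m) (r - s) * ennreal (J_fun C (exp r) (T (x n) (y m))) \<partial>lborel)"
      unfolding cpair_def conv_def Tpair_def nm by (subst nn_integral_multc) simp_all
    also have "\<dots> \<le> (\<integral>\<^sup>+s. ennreal T_norm * (f n s * g m (r - s)) \<partial>lborel)"
    proof (rule nn_integral_mono)
      fix s
      have "ennreal (J_fun C (exp r) (T (x n) (y m))) \<le> ennreal (T_norm * (J_fun A (exp s) (x n) * J_fun B (exp (r - s)) (y m)))"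
        using T_J_bound[OF xi yi, of s "r - s" n m] by (intro ennreal_leI) simp
      also have "\<dots> = ennreal T_norm * (ennreal (J_fun A (exp s) (x n)) * ennreal (J_fun B (exp (r - s)) (y m)))"
        using A.J_fun_nonneg[OF xi] B.J_fun_nonneg[OF yi] T_norm_nonneg by (simp add: ennreal_mult)
      finally show "indicator (E n) s * indicator (H m) (r - s) * ennreal (J_fun C (exp r) (T (x n) (y m))) \<le>
          ennreal T_norm * (f n s * g m (r - s))"
        by (auto simp: f_def g_def indicator_def)
    qed
    finally show ?thesis by (simp add: nm)
  qed
  have "(\<Sum>i. cpair E H i r * ennreal (J_fun C (exp r) (Tpair x y i))) \<le>
    (\<Sum>i. \<integral>\<^sup>+s. ennreal T_norm * (f (fst (prod_decode i)) s * g (snd (prod_decode i)) (r - s)) \<partial>lborel)"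
    by (intro Series.suminf_le term_le) auto
  also have "\<dots> = (\<integral>\<^sup>+s. (\<Sum>i. ennreal T_norm * (f (fst (prod_decode i)) s * g (snd (prod_decode i)) (r - s))) \<partial>lborel)"
    by (intro nn_integral_suminf[symmetric]) measurable
  also have "\<dots> = (\<integral>\<^sup>+s. ennreal T_norm * ((\<Sum>n. f n s) * (\<Sum>m. g m (r - s))) \<partial>lborel)"
    by (simp add: suminf_prod_decode_product[of "\<lambda>n. f n _" "\<lambda>m. g m (r - _)"])
  also have "\<dots> \<le> (\<integral>\<^sup>+s. ennreal (T_norm * q\<^sup>2 * (exp (\<theta> * r) / \<phi> (exp r))) * (hA u s * hB v (r - s)) \<partial>lborel)"
  proof (rule nn_integral_mono_AE)
    show "AE s in lborel. ennreal T_norm * ((\<Sum>n. f n s) * (\<Sum>m. g m (r - s))) \<le>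
      ennreal (T_norm * q\<^sup>2 * (exp (\<theta> * r) / \<phi> (exp r))) * (hA u s * hB v (r - s))"
      using J_seriesD(5)[OF E] repA_facts(4)[OF u] AE_reflect_lborel[OF J_seriesD(5)[OF H], of r]
        AE_reflect_lborel[OF repB_facts(4)[OF v], of r]
    proof eventually_elim
      case (elim s)
      define ja jb where "ja = jA u s" and "jb = jB v (r - s)"
      define wa wb where "wa = exp (\<theta> * s) / \<phi> (exp s)" and "wb = exp (\<theta> * (r - s)) / m_fun \<phi> (exp (r - s))"
      have nn: "0 \<le> ja" "0 \<le> jb" unfolding ja_def jb_def by (rule repA_facts(3)[OF u] repB_facts(3)[OF v])+
      have ua: "J_fun A (exp s) (u (exp s)) = wa * ja"
        using \<phi>_pos[of s] by (simp add: ja_def wa_def J_weighted_def exp_minus)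
      have vb: "J_fun B (exp (r - s)) (v (exp (r - s))) = wb * jb"
        using m_fun_bounds(2)[OF \<phi>, of "r - s"] by (simp add: jb_def wb_def J_weighted_def mult_exp_exp)
      have wnn: "0 \<le> wa" "0 \<le> wb" using \<phi>_pos[of s] m_fun_bounds(2)[OF \<phi>, of "r - s"] by (simp_all add: wa_def wb_def)
      have w: "wa * wb \<le> exp (\<theta> * r) / \<phi> (exp r)" using weight_le[of s "r - s"] by (simp add: wa_def wb_def)
      have "ennreal T_norm * ((\<Sum>n. f n s) * (\<Sum>m. g m (r - s))) \<le> ennreal T_norm * (ennreal (q * (wa * ja)) * ennreal (q * (wb * jb)))"
        using elim(1,3) unfolding f_def g_def ua vb by (intro mult_left_mono mult_mono) auto
      also have "\<dots> = ennreal (T_norm * q\<^sup>2 * (wa * wb) * (ja * jb))"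
        using T_norm_nonneg q wnn nn by (simp add: ennreal_mult[symmetric] power2_eq_square mult_ac)
      also have "\<dots> \<le> ennreal (T_norm * q\<^sup>2 * (exp (\<theta> * r) / \<phi> (exp r)) * (ja * jb))"
        using T_norm_nonneg nn w by (intro ennreal_leI mult_right_mono mult_left_mono) auto
      also have "\<dots> = ennreal (T_norm * q\<^sup>2 * (exp (\<theta> * r) / \<phi> (exp r))) * (ennreal ja * ennreal jb)"
        by (simp only: ennreal_mult[OF weight_nonneg mult_nonneg_nonneg[OF nn]] ennreal_mult[OF nn])
      finally show ?case unfolding elim(2,4) ja_def jb_def .
    qed
  qed
  also have "\<dots> = ennreal (T_norm * q\<^sup>2 * (exp (\<theta> * r) / \<phi> (exp r))) * conv (hA u) (hB v) r"
    unfolding conv_def by (rule nn_integral_cmult) measurable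
  finally show ?thesis .
qed

lemma cpair_facts:
  assumes u: "repA a u" and E: "J_series A q u E x" and v: "repB b v" and H: "J_series B q v H y" and q: "0 \<le> q"
  shows "cpair E H i \<in> borel_measurable borel"
    and "cpair E H i r \<le> ennreal (measure lborel (E (fst (prod_decode i))))"
    and "(\<integral>\<^sup>+r. cpair E H i r \<partial>lborel) =
      ennreal (measure lborel (E (fst (prod_decode i))) * measure lborel (H (snd (prod_decode i))))"
    and "Tpair x y i \<in> carr (inter_sp C)"
proof -
  note [measurable] = J_seriesD(1)[OF E] J_seriesD(1)[OF H]
  show "cpair E H i \<in> borel_measurable borel" unfolding cpair_def by measurable
  have Ef: "emeasure lborel (E n) = ennreal (measure lborel (E n))" for n
    using A.J_series_sums(1)[OF E q repA_facts(1,7)[OF u], of n] by (intro emeasure_eq_ennreal_measure) auto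
  have Hf: "emeasure lborel (H n) = ennreal (measure lborel (H n))" for n
    using B.J_series_sums(1)[OF H q repB_facts(1,7)[OF v], of n] by (intro emeasure_eq_ennreal_measure) auto
  have "cpair E H i r \<le> (\<integral>\<^sup>+s. indicator (E (fst (prod_decode i))) s \<partial>lborel)"
    unfolding cpair_def conv_def by (intro nn_integral_mono) (auto simp: indicator_def)
  then show "cpair E H i r \<le> ennreal (measure lborel (E (fst (prod_decode i))))" by (simp add: Ef)
  show "(\<integral>\<^sup>+r. cpair E H i r \<partial>lborel) =
      ennreal (measure lborel (E (fst (prod_decode i))) * measure lborel (H (snd (prod_decode i))))"
    unfolding cpair_def by (subst conv_integral) (simp_all add: Ef Hf ennreal_mult)
  show "Tpair x y i \<in> carr (inter_sp C)"
    unfolding Tpair_def by (intro T_inter J_seriesD(2)[OF E] J_seriesD(2)[OF H])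
qed

lemma dseries_Tpair:
  "dseries prod_decode T \<alpha> x \<beta> y i = (\<alpha> (fst (prod_decode i)) * \<beta> (snd (prod_decode i))) *\<^sub>R Tpair x y i"
  by (simp add: dseries_def Tpair_def)

lemma pair_conv_AE:
  assumes u: "repA a u" and v: "repB b v"
  shows "AE r in lborel. conv (hA u) (hB v) r < \<infinity>"
  using conv_F[OF _ _ _ _ repA_facts(5)[OF u] repB_facts(6)[OF v], of "\<lambda>_. 1"] by simp

text \<open>The coefficient \<open>|E n| |H m|\<close> is the total mass of a convolution of
  indicators. Under that integral the norm in \<open>C_0 + C_1\<close> may be bounded by
  \<open>min(1, e^(-r)) J(e^r, .)\<close> with \<open>r\<close> varying, which leads to the kernel
  integral of a convolution.\<close>

lemma dseries_finite:
  assumes u: "repA a u" and E: "J_series A q u E x" and v: "repB b v" and H: "J_series B q v H y" and q: "0 \<le> q"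
  shows "(\<Sum>i. ennreal (nrm (sum_sp C) (dseries prod_decode T (\<lambda>n. measure lborel (E n)) x (\<lambda>m. measure lborel (H m)) y i))) < \<infinity>"
proof -
  note cf = cpair_facts[OF u E v H q]
  note [measurable] = cf(1)
  let ?k = "\<lambda>t. min 1 (exp (- t)) :: real"
  have [measurable]: "(\<lambda>t. J_fun C (exp t) z) \<in> borel_measurable borel" for z unfolding J_fun_def by measurable
  have "(\<Sum>i. ennreal (nrm (sum_sp C) (dseries prod_decode T (\<lambda>n. measure lborel (E n)) x (\<lambda>m. measure lborel (H m)) y i))) =
    (\<Sum>i. \<integral>\<^sup>+r. cpair E H i r * ennreal (nrm (sum_sp C) (Tpair x y i)) \<partial>lborel)"
  proof (rule suminf_cong)
    fix i
    have "Tpair x y i \<in> carr (sum_sp C)" using cf(4)[of i] by simp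
    then show "ennreal (nrm (sum_sp C) (dseries prod_decode T (\<lambda>n. measure lborel (E n)) x (\<lambda>m. measure lborel (H m)) y i)) =
      (\<integral>\<^sup>+r. cpair E H i r * ennreal (nrm (sum_sp C) (Tpair x y i)) \<partial>lborel)"
      by (simp add: dseries_Tpair C.S.nrm_scale nn_integral_multc cf(3) ennreal_mult)
  qed
  also have "\<dots> \<le> (\<Sum>i. \<integral>\<^sup>+r. ennreal (?k r) * (cpair E H i r * ennreal (J_fun C (exp r) (Tpair x y i))) \<partial>lborel)"
  proof (intro Series.suminf_le summableI nn_integral_mono)
    fix i r
    have "ennreal (nrm (sum_sp C) (Tpair x y i)) \<le> ennreal (?k r * J_fun C (exp r) (Tpair x y i))"
      by (intro ennreal_leI C.nrm_sum_le_J cf(4))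
    also have "\<dots> = ennreal (?k r) * ennreal (J_fun C (exp r) (Tpair x y i))"
      using C.J_fun_nonneg[OF cf(4)] by (simp add: ennreal_mult)
    finally have "cpair E H i r * ennreal (nrm (sum_sp C) (Tpair x y i)) \<le>
        cpair E H i r * (ennreal (?k r) * ennreal (J_fun C (exp r) (Tpair x y i)))" by (rule mult_left_mono) simp
    then show "cpair E H i r * ennreal (nrm (sum_sp C) (Tpair x y i)) \<le>
        ennreal (?k r) * (cpair E H i r * ennreal (J_fun C (exp r) (Tpair x y i)))" by (simp only: mult.left_commute)
  qed
  also have "\<dots> = (\<integral>\<^sup>+r. (\<Sum>i. ennreal (?k r) * (cpair E H i r * ennreal (J_fun C (exp r) (Tpair x y i)))) \<partial>lborel)"
    by (intro nn_integral_suminf[symmetric]) measurable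
  also have "\<dots> \<le> (\<integral>\<^sup>+r. ennreal (T_norm * q\<^sup>2) * (\<kappa> r * conv (hA u) (hB v) r) \<partial>lborel)"
  proof (rule nn_integral_mono_AE)
    show "AE r in lborel. (\<Sum>i. ennreal (?k r) * (cpair E H i r * ennreal (J_fun C (exp r) (Tpair x y i)))) \<le>
      ennreal (T_norm * q\<^sup>2) * (\<kappa> r * conv (hA u) (hB v) r)"
      using \<kappa>(2)
    proof eventually_elim
      case (elim r)
      have "(\<Sum>i. ennreal (?k r) * (cpair E H i r * ennreal (J_fun C (exp r) (Tpair x y i)))) =
        ennreal (?k r) * (\<Sum>i. cpair E H i r * ennreal (J_fun C (exp r) (Tpair x y i)))" by simp
      also have "\<dots> \<le> ennreal (?k r) * (ennreal (T_norm * q\<^sup>2 * (exp (\<theta> * r) / \<phi> (exp r))) * conv (hA u) (hB v) r)"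
        by (intro mult_left_mono cpair_sum_le[OF u E v H q]) simp
      also have "\<dots> = ennreal (?k r * (T_norm * q\<^sup>2 * (exp (\<theta> * r) / \<phi> (exp r)))) * conv (hA u) (hB v) r"
        by (subst ennreal_mult[OF _ weight_nonneg]) (simp_all only: mult.assoc, simp)
      also have "?k r * (T_norm * q\<^sup>2 * (exp (\<theta> * r) / \<phi> (exp r))) = T_norm * q\<^sup>2 * J_kernel \<theta> \<phi> r"
        by (simp add: J_kernel_def)
      also have "ennreal (T_norm * q\<^sup>2 * J_kernel \<theta> \<phi> r) = ennreal (T_norm * q\<^sup>2) * \<kappa> r"
        unfolding elim[symmetric] using T_norm_nonneg \<phi>_pos[of r] by (intro ennreal_mult) (auto simp: J_kernel_def)
      finally show ?case by (simp only: mult.assoc)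
    qed
  qed
  also have "\<dots> = ennreal (T_norm * q\<^sup>2) * (\<integral>\<^sup>+r. \<kappa> r * conv (hA u) (hB v) r \<partial>lborel)"
    by (rule nn_integral_cmult) measurable
  also have "\<dots> < \<infinity>"
    using kernel_conv_finite[OF _ _ _ _ repA_facts(5)[OF u] repB_facts(6)[OF v]] by (simp add: ennreal_mult_less_top)
  finally show ?thesis .
qed

end

text \<open>A series with factor \<open>q <= 2\<close> is also one with factor 2. The operator is
  defined through the latter, the norm estimate uses \<open>q\<close> close to 1.\<close>

lemma (in couple) J_series_mono:
  assumes s: "J_series X q u E z" and q: "q \<le> q'" and u: "\<And>t. u (exp t) \<in> carr (inter_sp X)"
  shows "J_series X q' u E z"
  unfolding J_series_def
proof (intro conjI allI)
  show "AE t in lborel. nsums (inter_sp X) (\<lambda>n. indicat_real (E n) t *\<^sub>R z n) (u (exp t)) \<and>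
    (\<Sum>n. indicator (E n) t * ennreal (J_fun X (exp t) (z n))) \<le> ennreal (q' * J_fun X (exp t) (u (exp t)))"
    using J_seriesD(4,5)[OF s]
  proof eventually_elim
    case (elim t)
    have "q * J_fun X (exp t) (u (exp t)) \<le> q' * J_fun X (exp t) (u (exp t))"
      by (intro mult_right_mono q J_fun_nonneg u)
    then show ?case using elim(1) by (intro conjI order_trans[OF elim(2)] ennreal_leI)
  qed
qed (use J_seriesD(1-3)[OF s] in auto)

lemma measure_split:
  fixes E :: "real set"
  assumes "E \<in> sets borel" "emeasure lborel E < \<infinity>"
  shows "measure lborel E = measure lborel (E \<inter> {..<0}) + measure lborel (E \<inter> {0..})"
proof -
  have "E = (E \<inter> {..<0}) \<union> (E \<inter> {0..})" by auto
  moreover have "emeasure lborel (E \<inter> D) \<noteq> \<infinity>" if "D \<in> sets borel" for D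
    using assms that order.strict_trans1[OF emeasure_mono[of "E \<inter> D" E lborel] assms(2)] by auto
  ultimately show ?thesis
    using assms(1) by (subst (1) \<open>E = _\<close>, intro measure_Union) auto
qed

lemma sigma_finite_lebesgue: "sigma_finite_measure (lebesgue :: real measure)"
proof
  obtain A :: "real set set" where A: "countable A" "A \<subseteq> sets lborel" "\<Union>A = space lborel" "\<forall>a\<in>A. emeasure lborel a \<noteq> \<infinity>"
    using lborel.sigma_finite_countable by blast
  show "\<exists>A::real set set. countable A \<and> A \<subseteq> sets lebesgue \<and> \<Union>A = space lebesgue \<and> (\<forall>a\<in>A. emeasure lebesgue a \<noteq> \<infinity>)"
    using A by (intro exI[of _ A]) (auto intro: sets_completionI_sets)
qed

lemma AE_pair_fst_snd:
  assumes N: "sigma_finite_measure N" and M: "sigma_finite_measure M"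
    and P: "AE s in M. P s" and Q: "AE t in N. Q t"
  shows "AE p in M \<Otimes>\<^sub>M N. P (fst p) \<and> Q (snd p)"
proof -
  interpret N: sigma_finite_measure N by (rule N)
  obtain U where U: "U \<in> null_sets M" "{s \<in> space M. \<not> P s} \<subseteq> U" using P unfolding eventually_ae_filter by auto
  obtain V where V: "V \<in> null_sets N" "{t \<in> space N. \<not> Q t} \<subseteq> V" using Q unfolding eventually_ae_filter by auto
  have "U \<times> space N \<in> null_sets (M \<Otimes>\<^sub>M N)" "space M \<times> V \<in> null_sets (M \<Otimes>\<^sub>M N)"
    using U(1) V(1) by (auto simp: null_sets_def N.emeasure_pair_measure_Times)
  then have "(U \<times> space N) \<union> (space M \<times> V) \<in> null_sets (M \<Otimes>\<^sub>M N)" by (rule null_sets.Un)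
  then show ?thesis
    by (rule AE_I') (use U(2) V(2) in \<open>auto simp: space_pair_measure\<close>)
qed

text \<open>Used at a single pair of points, where both series converge absolutely in the first end
  point spaces. The double series then converges in \<open>C_0\<close>, and summing it by columns
  gives its value.\<close>

lemma (in bilin) T_expand:
  assumes x: "\<And>n. x n \<in> carr (inter_sp A)" and y: "\<And>m. y m \<in> carr (inter_sp B)"
    and a: "nsums (inter_sp A) (\<lambda>n. \<alpha> n *\<^sub>R x n) a" and b: "nsums (inter_sp B) (\<lambda>m. \<beta> m *\<^sub>R y m) b"
    and fa: "(\<Sum>n. ennreal (nrm (fst A) (\<alpha> n *\<^sub>R x n))) < \<infinity>" and fb: "(\<Sum>m. ennreal (nrm (fst B) (\<beta> m *\<^sub>R y m))) < \<infinity>"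
  shows "nsums (sum_sp C) (dseries prod_decode T \<alpha> x \<beta> y) (T a b)"
proof -
  let ?d = "dseries prod_decode T \<alpha> x \<beta> y"
  have aI: "a \<in> carr (inter_sp A)" using a nsumsD(2) by blast
  have x0: "\<alpha> n *\<^sub>R x n \<in> carr (fst A)" and y0: "\<beta> n *\<^sub>R y n \<in> carr (fst B)" for n using x[of n] y[of n] by simp_all
  have d: "?d i = T (\<alpha> (fst (prod_decode i)) *\<^sub>R x (fst (prod_decode i))) (\<beta> (snd (prod_decode i)) *\<^sub>R y (snd (prod_decode i)))" for i
    using bilinear_btwD(4,5)[OF bilinear0] x y by (simp add: dseries_def)
  have dm: "?d i \<in> carr (fst C)" for i unfolding d by (rule bilinear_btwD(1)[OF bilinear0 x0 y0])
  have "(\<Sum>i. ennreal (nrm (fst C) (?d i))) \<le> (\<Sum>i. ennreal T_norm *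
      (ennreal (nrm (fst A) (\<alpha> (fst (prod_decode i)) *\<^sub>R x (fst (prod_decode i)))) *
       ennreal (nrm (fst B) (\<beta> (snd (prod_decode i)) *\<^sub>R y (snd (prod_decode i))))))"
  proof (intro suminf_le summableI)
    fix i
    have "ennreal (nrm (fst C) (?d i)) \<le> ennreal (T_norm * nrm (fst A) (\<alpha> (fst (prod_decode i)) *\<^sub>R x (fst (prod_decode i))) *
       nrm (fst B) (\<beta> (snd (prod_decode i)) *\<^sub>R y (snd (prod_decode i))))"
      unfolding d by (intro ennreal_leI T_bound0 x0 y0)
    then show "ennreal (nrm (fst C) (?d i)) \<le> ennreal T_norm *
      (ennreal (nrm (fst A) (\<alpha> (fst (prod_decode i)) *\<^sub>R x (fst (prod_decode i)))) *
       ennreal (nrm (fst B) (\<beta> (snd (prod_decode i)) *\<^sub>R y (snd (prod_decode i)))))"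
      by (simp only: ennreal_mult T_norm_nonneg A.X0.nrm_ge0[OF x0] B.X0.nrm_ge0[OF y0] mult_nonneg_nonneg mult.assoc)
  qed
  also have "\<dots> = ennreal T_norm * ((\<Sum>n. ennreal (nrm (fst A) (\<alpha> n *\<^sub>R x n))) * (\<Sum>m. ennreal (nrm (fst B) (\<beta> m *\<^sub>R y m))))"
  proof -
    have "(\<Sum>i. (\<lambda>p. ennreal (nrm (fst A) (\<alpha> (fst p) *\<^sub>R x (fst p))) * ennreal (nrm (fst B) (\<beta> (snd p) *\<^sub>R y (snd p)))) (prod_decode i)) =
      (\<Sum>n. ennreal (nrm (fst A) (\<alpha> n *\<^sub>R x n)) * (\<Sum>m. ennreal (nrm (fst B) (\<beta> m *\<^sub>R y m))))"
      by (rule suminf_ennreal_2dimen) simp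
    then show ?thesis by simp
  qed
  also have "\<dots> < \<infinity>" using fa fb by (simp add: ennreal_mult_less_top)
  finally have fin0: "(\<Sum>i. ennreal (nrm (fst C) (?d i))) < \<infinity>" .
  obtain z where z0: "nsums (fst C) ?d z" using banach_nsums[OF C.banach0 dm fin0] by blast
  have z: "nsums (sum_sp C) ?d z" by (rule C.nsums_sum0[OF z0])
  have "(\<Sum>i. ennreal (nrm (sum_sp C) (?d i))) \<le> (\<Sum>i. ennreal (nrm (fst C) (?d i)))"
    by (intro suminf_le summableI ennreal_leI C.nrm_sum_le0 dm)
  then have fin: "(\<Sum>i. ennreal (nrm (sum_sp C) (?d i))) < \<infinity>" using fin0 by (rule order.strict_trans1)
  have "nsums (sum_sp C) (\<lambda>m. \<beta> m *\<^sub>R bil_ext A T a (y m)) z"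
    by (rule dseries_columns[OF x y A.nsums_sum0[OF A.nsums_inter0[OF a]] bij_prod_decode z fin])
  moreover have "bil_ext A T a (y m) = T a (y m)" for m using aI by (intro bil_ext0 y) simp
  moreover have "nsums (fst C) (\<lambda>m. T a (\<beta> m *\<^sub>R y m)) (T a b)"
  proof (rule nsums_map[OF B.X0.normed C.X0.normed])
    show "linear_btw (fst B) (fst C) (T a)" using aI by (intro bilinear_btw_right[OF bilinear0]) simp
    show "nrm (fst C) (T a y) \<le> (T_norm * nrm (fst A) a) * nrm (fst B) y" if "y \<in> carr (fst B)" for y
      using aI that by (intro T_bound0) simp_all
  qed (rule B.nsums_inter0[OF b])
  then have "nsums (sum_sp C) (\<lambda>m. \<beta> m *\<^sub>R T a (y m)) (T a b)"
    using bilinear_btwD(5)[OF bilinear0] aI y by (intro C.nsums_sum0) simp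
  ultimately have "z = T a b" by (auto intro: C.S.nsums_unique)
  with z show ?thesis by simp
qed

context J_bilin
begin

lemma pair_rep:
  assumes u: "repA a u" and E: "J_series A q u E x" and v: "repB b v" and H: "J_series B q v H y" and q: "0 \<le> q"
    and z: "nsums (sum_sp C) (dseries prod_decode T (\<lambda>n. measure lborel (E n)) x (\<lambda>m. measure lborel (H m)) y) z"
  obtains w where "repC z w"
    "nrm GC (abs_l0 (J_weighted C \<theta> \<phi> w)) \<le> K * (T_norm * q\<^sup>2) * nrm GA (abs_l0 (jA u)) * nrm GB (abs_l0 (jB v))"
proof -
  note cf = cpair_facts[OF u E v H q]
  note [measurable] = cf(1)
  let ?T = "Tpair x y" and ?h = "conv (hA u) (hB v)"
  define c where "c i r = enn2real (cpair E H i r)" for i r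
  define Bd where "Bd i = measure lborel (E (fst (prod_decode i)))" for i
  have [measurable]: "c i \<in> borel_measurable borel" for i unfolding c_def by measurable
  have ce: "ennreal (c i r) = cpair E H i r" "0 \<le> c i r" for i r
    unfolding c_def using cf(2)[of i r] by (auto intro!: ennreal_enn2real order.strict_trans1[OF cf(2)])
  have cB: "\<bar>c i r\<bar> \<le> Bd i" for i r
    using cf(2)[of i r] ce(2)[of i r] unfolding ce(1)[symmetric] Bd_def by (simp add: ennreal_le_iff)
  \<comment> \<open>The default 0 keeps \<open>W\<close> in the intersection at every
    \<open>r\<close>; it can occur only where the convolution of the two weighted functionals is
    infinite.\<close>
  define W where "W r = (if \<exists>z. nsums (inter_sp C) (\<lambda>i. c i r *\<^sub>R ?T i) z
      then SOME z. nsums (inter_sp C) (\<lambda>i. c i r *\<^sub>R ?T i) z else 0)" for r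
  have W: "nsums (inter_sp C) (\<lambda>i. c i r *\<^sub>R ?T i) (W r)" if "nsums (inter_sp C) (\<lambda>i. c i r *\<^sub>R ?T i) z'" for r z'
    using that someI[of "nsums (inter_sp C) (\<lambda>i. c i r *\<^sub>R ?T i)"] unfolding W_def by auto
  have Wc: "W r \<in> carr (inter_sp C)" for r
  proof (cases "\<exists>z. nsums (inter_sp C) (\<lambda>i. c i r *\<^sub>R ?T i) z")
    case True
    then show ?thesis using W nsumsD(2) by blast
  qed (simp add: W_def)
  \<comment> \<open>A finite convolution at \<open>r\<close> bounds the sum of the J-functionals,
    and \<open>min(1, e^r)\<close> times the norm of the intersection is at most
    \<open>J(e^r, .)\<close>; so the series converges in \<open>C_0 \<inter> C_1\<close>.\<close>
  have good: "nsums (inter_sp C) (\<lambda>i. c i r *\<^sub>R ?T i) (W r) \<and>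
      ennreal (J_fun C (exp r) (W r)) \<le> ennreal (T_norm * q\<^sup>2 * (exp (\<theta> * r) / \<phi> (exp r))) * ?h r" if h: "?h r < \<infinity>" for r
  proof -
    have J: "ennreal (J_fun C (exp r) (c i r *\<^sub>R ?T i)) = cpair E H i r * ennreal (J_fun C (exp r) (?T i))" for i
      using C.J_fun_nonneg[OF cf(4)] by (simp add: C.J_fun_scale[OF cf(4)] ce ennreal_mult)
    have S: "(\<Sum>i. ennreal (J_fun C (exp r) (c i r *\<^sub>R ?T i))) \<le> ennreal (T_norm * q\<^sup>2 * (exp (\<theta> * r) / \<phi> (exp r))) * ?h r"
      unfolding J by (rule cpair_sum_le[OF u E v H q])
    also have "\<dots> < \<infinity>" using h by (simp add: ennreal_mult_less_top)
    finally have Sf: "(\<Sum>i. ennreal (J_fun C (exp r) (c i r *\<^sub>R ?T i))) < \<infinity>" .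
    have cT: "c i r *\<^sub>R ?T i \<in> carr (inter_sp C)" for i by (intro C.I.scale_mem cf(4))
    have mp: "0 < min 1 (exp r)" by simp
    have "(\<Sum>i. ennreal (nrm (inter_sp C) (c i r *\<^sub>R ?T i))) \<le>
      (\<Sum>i. ennreal (1 / min 1 (exp r)) * ennreal (J_fun C (exp r) (c i r *\<^sub>R ?T i)))"
    proof (intro Series.suminf_le summableI)
      fix i
      have "nrm (inter_sp C) (c i r *\<^sub>R ?T i) \<le> 1 / min 1 (exp r) * J_fun C (exp r) (c i r *\<^sub>R ?T i)"
        using C.J_fun_ge[OF cT, of "exp r" i] mp by (simp add: pos_le_divide_eq mult.commute)
      then show "ennreal (nrm (inter_sp C) (c i r *\<^sub>R ?T i)) \<le> ennreal (1 / min 1 (exp r)) * ennreal (J_fun C (exp r) (c i r *\<^sub>R ?T i))"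
        using mp C.J_fun_nonneg[OF cT] by (subst ennreal_mult[symmetric]) (auto intro: ennreal_leI)
    qed
    also have "\<dots> < \<infinity>" using Sf by (simp add: ennreal_mult_less_top)
    finally obtain z' where "nsums (inter_sp C) (\<lambda>i. c i r *\<^sub>R ?T i) z'"
      using banach_nsums[OF C.banach_inter, of "\<lambda>i. c i r *\<^sub>R ?T i"] cT by blast
    from W[OF this] have Wr: "nsums (inter_sp C) (\<lambda>i. c i r *\<^sub>R ?T i) (W r)" .
    have "ennreal (J_fun C (exp r) (W r)) \<le> (\<Sum>i. ennreal (J_fun C (exp r) (c i r *\<^sub>R ?T i)))"
      by (rule C.I.nsums_seminorm_le[OF Wr]) (auto intro: C.J_fun_triangle C.J_fun_le C.J_fun_nonneg)
    from Wr order_trans[OF this S] show ?thesis by (rule conjI)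
  qed
  have AEgood: "AE r in lborel. ?h r < \<infinity>" by (rule pair_conv_AE[OF u v])
  define w where "w s = W (ln s)" for s
  have wexp: "w (exp r) = W r" for r by (simp add: w_def)
  have sm: "strongly_measurable (lebesgue_on {0<..}) (inter_sp C) w"
  proof (rule strongly_measurable_bounded_series[OF C.normed_inter _ _ cf(4), where c = "\<lambda>i s. c i (ln s)" and B = Bd])
    show "(\<lambda>s. c i (ln s)) \<in> borel_measurable (lebesgue_on {0<..})" for i
      by (rule measurable_restrict_space1, rule lebesgue_of_borel) measurable
    have "AE r in lebesgue. nsums (inter_sp C) (\<lambda>i. c i r *\<^sub>R ?T i) (W r)"
      using AE_completion[OF AEgood] by eventually_elim (use good in blast)
    from AE_ln[OF this] show "AE s in lebesgue_on {0<..}. nsums (inter_sp C) (\<lambda>i. c i (ln s) *\<^sub>R ?T i) (w s)"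
      unfolding w_def .
  qed (simp_all add: cB w_def Wc del: C.carr_inter)
  have cint: "(\<integral>\<^sup>+r. ennreal \<bar>c i r\<bar> \<partial>lebesgue) =
      ennreal (measure lborel (E (fst (prod_decode i))) * measure lborel (H (snd (prod_decode i))))" for i
    using cf(3)[of i] by (simp add: ce nn_integral_completion abs_of_nonneg)
  have bi: "has_bochner_int lebesgue (sum_sp C) (\<lambda>t. w (exp t)) z"
    unfolding wexp
  proof (rule has_bochner_int_series[OF C.normed_sum, where c = c and B = Bd and z = ?T])
    have cm: "c i \<in> borel_measurable lebesgue" for i by (rule lebesgue_of_borel) measurable
    show "integrable lebesgue (c i)" for i
      using cm cint[of i] by (intro integrableI_bounded) simp_all
    show "\<bar>c i t\<bar> \<le> Bd i" for i t by (rule cB)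
    show "?T i \<in> carr (sum_sp C)" for i using cf(4)[of i] by simp
    show "W t \<in> carr (sum_sp C)" for t using Wc[of t] by simp
    show "AE r in lebesgue. nsums (sum_sp C) (\<lambda>i. c i r *\<^sub>R ?T i) (W r)"
      using AE_completion[OF AEgood] by eventually_elim (use good C.nsums_sum0 C.nsums_inter0 in blast)
    show "(\<Sum>i. (\<integral>\<^sup>+t. ennreal \<bar>c i t\<bar> \<partial>lebesgue) * ennreal (nrm (sum_sp C) (?T i))) < \<infinity>"
    proof -
      have "(\<integral>\<^sup>+t. ennreal \<bar>c i t\<bar> \<partial>lebesgue) * ennreal (nrm (sum_sp C) (?T i)) =
        ennreal (nrm (sum_sp C) (dseries prod_decode T (\<lambda>n. measure lborel (E n)) x (\<lambda>m. measure lborel (H m)) y i))" for i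
        using cf(4)[of i] unfolding dseries_Tpair cint by (simp add: C.S.nrm_scale ennreal_mult)
      then show ?thesis using dseries_finite[OF u E v H q] by simp
    qed
    have "integral\<^sup>L lebesgue (c i) = measure lborel (E (fst (prod_decode i))) * measure lborel (H (snd (prod_decode i)))" for i
      by (rule integral_eq_nn_integral[THEN trans]) (use cm cint[of i] ce(2) in \<open>simp_all add: abs_of_nonneg\<close>)
    then show "nsums (sum_sp C) (\<lambda>i. integral\<^sup>L lebesgue (c i) *\<^sub>R ?T i) z"
      using z by (simp add: dseries_Tpair[abs_def])
  qed
  have smexp: "strongly_measurable lebesgue (inter_sp C) (\<lambda>t. w (exp t))" by (rule strongly_measurable_exp[OF sm])
  have "(\<lambda>t. exp (- \<theta> * t)) \<in> borel_measurable (lebesgue :: real measure)" by (rule lebesgue_of_borel) measurable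
  then have Jm: "J_weighted C \<theta> \<phi> w \<in> borel_measurable lebesgue"
    unfolding J_weighted_def using C.J_fun_measurable[OF smexp] \<phi>_measurable by (intro borel_measurable_times)
  have Jnn: "0 \<le> J_weighted C \<theta> \<phi> w r" for r
    using C.J_fun_nonneg[OF Wc, of "exp r" r] \<phi>_pos[of r] by (simp add: J_weighted_def wexp)
  define D where "D = T_norm * q\<^sup>2"
  have D: "0 \<le> D" using T_norm_nonneg by (simp add: D_def)
  \<comment> \<open>The constant is absorbed into the first factor. The weighted J-functional of
    \<open>w\<close> then lies below the convolution \<open>Cv\<close> almost everywhere, with no
    factor left over.\<close>
  define f where "f s = D * borel_version (jA u) s" for s
  have fm[measurable]: "f \<in> borel_measurable borel" unfolding f_def by measurable
  have f0: "0 \<le> f s" for s using D by (simp add: f_def)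
  have fe: "ennreal (f s) = ennreal D * hA u s" for s using D by (simp add: f_def ennreal_mult)
  have hAm: "hA u \<in> borel_measurable lebesgue" by (rule lebesgue_of_borel) measurable
  have \<rho>f: "\<rho> (\<lambda>s. ennreal (f s)) = ennreal D * \<rho> (hA u)" unfolding fe by (rule hom[OF hAm D])
  define Cv where "Cv r = enn2real (conv (\<lambda>s. ennreal (f s)) (hB v) r)" for r
  have cvf: "conv (\<lambda>s. ennreal (f s)) (hB v) r = ennreal D * ?h r" for r unfolding fe by (rule conv_cmult) measurable
  have "Cv \<in> borel_measurable borel" unfolding Cv_def by measurable
  then have Cvm: "Cv \<in> borel_measurable lebesgue" by (rule lebesgue_of_borel)
  \<comment> \<open>The quotient recovers the weighted J-functional from \<open>Cv\<close>. The
    minimum keeps \<open>|m| <= 1\<close> also on the exceptional null set; where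
    \<open>Cv r = 0\<close> the quotient is 0 by convention, which is right since the functional
    lies below \<open>Cv\<close>.\<close>
  define m where "m r = min 1 (J_weighted C \<theta> \<phi> w r / Cv r)" for r
  have Cv0: "0 \<le> Cv r" for r by (simp add: Cv_def)
  have mm: "m \<in> borel_measurable lebesgue" unfolding m_def using Jm Cvm by measurable
  have m1: "\<bar>m r\<bar> \<le> 1" for r using Jnn[of r] Cv0[of r] by (simp add: m_def)
  have "AE r in lborel. J_weighted C \<theta> \<phi> w r = m r * Cv r"
    using AEgood
  proof eventually_elim
    case (elim r)
    have g: "ennreal (J_fun C (exp r) (W r)) \<le> ennreal (T_norm * q\<^sup>2 * (exp (\<theta> * r) / \<phi> (exp r))) * ?h r" using good[OF elim] by simp
    have "ennreal (J_weighted C \<theta> \<phi> w r) = ennreal (exp (- \<theta> * r) * \<phi> (exp r)) * ennreal (J_fun C (exp r) (W r))"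
      using \<phi>_pos[of r] C.J_fun_nonneg[OF Wc, of "exp r" r] by (simp add: J_weighted_def wexp ennreal_mult)
    also have "\<dots> \<le> ennreal (exp (- \<theta> * r) * \<phi> (exp r)) * (ennreal (T_norm * q\<^sup>2 * (exp (\<theta> * r) / \<phi> (exp r))) * ?h r)"
      using g by (rule mult_left_mono) simp
    also have "\<dots> = ennreal ((exp (- \<theta> * r) * \<phi> (exp r)) * (T_norm * q\<^sup>2 * (exp (\<theta> * r) / \<phi> (exp r)))) * ?h r"
      using \<phi>_pos[of r] by (subst ennreal_mult[OF _ weight_nonneg]) (simp_all only: mult.assoc, simp)
    also have "(exp (- \<theta> * r) * \<phi> (exp r)) * (T_norm * q\<^sup>2 * (exp (\<theta> * r) / \<phi> (exp r))) = D"
      using \<phi>_pos[of r] by (simp add: D_def exp_minus)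
    also have "ennreal D * ?h r = ennreal (Cv r)"
      unfolding Cv_def cvf using elim by (intro ennreal_enn2real[symmetric]) (simp add: ennreal_mult_less_top)
    finally have "J_weighted C \<theta> \<phi> w r \<le> Cv r" using Cv0 by (simp add: ennreal_le_iff)
    then show ?case using Jnn[of r] Cv0[of r] by (cases "Cv r = 0") (simp_all add: m_def min_def divide_le_eq)
  qed
  from AE_completion[OF this] have eq: "abs_l0 (J_weighted C \<theta> \<phi> w) = abs_l0 (\<lambda>r. m r * Cv r)"
    using Jm mm Cvm by (intro abs_l0_eqI borel_measurable_times)
  have "\<rho> (\<lambda>s. ennreal (f s)) < \<infinity>" unfolding \<rho>f using repA_facts(5)[OF u] by (simp add: ennreal_mult_less_top)
  note cF = conv_F[OF fm borel_version_measurable f0 borel_version_nonneg this repB_facts(6)[OF v] mm m1, folded Cv_def]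
  show ?thesis
  proof (rule that)
    show "repC z w" unfolding J_rep_def using sm bi Jm cF eq by simp
    have "enn2real (\<rho> (\<lambda>s. ennreal (f s))) = D * nrm GA (abs_l0 (jA u))"
      unfolding \<rho>f enn2real_mult repA_facts(6)[OF u] using D by simp
    then show "nrm GC (abs_l0 (J_weighted C \<theta> \<phi> w)) \<le> K * (T_norm * q\<^sup>2) * nrm GA (abs_l0 (jA u)) * nrm GB (abs_l0 (jB v))"
      using cF unfolding eq repB_facts(5)[OF v] D_def by (simp add: mult.assoc)
  qed
qed

text \<open>The terms are those of \<open>pair_rep\<close>, with indicators of rectangles in place
  of the convolved indicators. Both kinds of coefficient have integral \<open>|E n| |H m|\<close>,
  so the double integral has the same value \<open>z\<close>.\<close>

lemma pair_double_integral:
  assumes u: "repA a u" and E: "J_series A q u E x" and v: "repB b v" and H: "J_series B q v H y" and q: "0 \<le> q"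
    and z: "nsums (sum_sp C) (dseries prod_decode T (\<lambda>n. measure lborel (E n)) x (\<lambda>m. measure lborel (H m)) y) z"
  shows "has_bochner_int (lebesgue \<Otimes>\<^sub>M lebesgue) (sum_sp C) (\<lambda>(s, t). T (u (exp s)) (v (exp t))) z"
proof -
  interpret L: sigma_finite_measure "lebesgue :: real measure" by (rule sigma_finite_lebesgue)
  note cf = cpair_facts[OF u E v H q]
  note xI = J_seriesD(2)[OF E] and yI = J_seriesD(2)[OF H]
  have El: "E n \<in> sets lebesgue" "H n \<in> sets lebesgue" for n
    using J_seriesD(1)[OF E, of n] J_seriesD(1)[OF H, of n] by (auto intro: sets_completionI_sets)
  have Ee: "emeasure lebesgue (E n) = emeasure lborel (E n)" "emeasure lebesgue (H n) = emeasure lborel (H n)" for n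
    using J_seriesD(1)[OF E, of n] J_seriesD(1)[OF H, of n] by simp_all
  have Ef: "emeasure lborel (E n) = ennreal (measure lborel (E n))" for n
    using A.J_series_sums(1)[OF E q repA_facts(1,7)[OF u], of n] by (intro emeasure_eq_ennreal_measure) auto
  have Hf: "emeasure lborel (H n) = ennreal (measure lborel (H n))" for n
    using B.J_series_sums(1)[OF H q repB_facts(1,7)[OF v], of n] by (intro emeasure_eq_ennreal_measure) auto
  define R where "R i = E (fst (prod_decode i)) \<times> H (snd (prod_decode i))" for i
  let ?M = "lebesgue \<Otimes>\<^sub>M lebesgue :: (real \<times> real) measure"
  let ?\<mu> = "\<lambda>i. measure lborel (E (fst (prod_decode i))) * measure lborel (H (snd (prod_decode i)))"
  have Rs: "R i \<in> sets ?M" for i unfolding R_def by (intro pair_measureI El)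
  have Re: "emeasure ?M (R i) = ennreal (?\<mu> i)" for i
    unfolding R_def L.emeasure_pair_measure_Times[OF El] Ee Ef Hf
    by (simp add: ennreal_mult)
  show ?thesis
  proof (rule has_bochner_int_series[OF C.normed_sum, where c = "\<lambda>i. indicat_real (R i)" and B = "\<lambda>_. 1" and z = "Tpair x y"])
    show "integrable ?M (indicat_real (R i))" for i
      using Rs Re by (intro integrable_real_indicator) simp_all
    show "\<bar>indicat_real (R i) t\<bar> \<le> 1" for i t by (simp add: indicator_def)
    show "Tpair x y i \<in> carr (sum_sp C)" for i using cf(4)[of i] by simp
    show "(case p of (s, t) \<Rightarrow> T (u (exp s)) (v (exp t))) \<in> carr (sum_sp C)" for p
    proof -
      obtain s t where p: "p = (s, t)" by (cases p)
      have "T (u (exp s)) (v (exp t)) \<in> carr (inter_sp C)" by (intro T_inter repA_facts(2)[OF u] repB_facts(2)[OF v])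
      then show ?thesis by (simp add: p)
    qed
    have fin: "(\<integral>\<^sup>+p. ennreal \<bar>indicat_real (R i) p\<bar> \<partial>?M) = ennreal (?\<mu> i)" for i
      using Rs[of i] Re[of i] by (simp add: ennreal_indicator)
    have "(\<integral>\<^sup>+p. ennreal \<bar>indicat_real (R i) p\<bar> \<partial>?M) * ennreal (nrm (sum_sp C) (Tpair x y i)) =
      ennreal (nrm (sum_sp C) (dseries prod_decode T (\<lambda>n. measure lborel (E n)) x (\<lambda>m. measure lborel (H m)) y i))" for i
      using cf(4)[of i] unfolding fin dseries_Tpair by (simp add: C.S.nrm_scale ennreal_mult)
    then show "(\<Sum>i. (\<integral>\<^sup>+p. ennreal \<bar>indicat_real (R i) p\<bar> \<partial>?M) * ennreal (nrm (sum_sp C) (Tpair x y i))) < \<infinity>"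
      using dseries_finite[OF u E v H q] by simp
    have "integral\<^sup>L ?M (indicat_real (R i)) = ?\<mu> i" for i
      using Rs[of i] Re[of i] by (simp add: measure_def)
    then show "nsums (sum_sp C) (\<lambda>i. integral\<^sup>L ?M (indicat_real (R i)) *\<^sub>R Tpair x y i) z"
      using z by (simp add: dseries_Tpair[abs_def])
    have "AE p in ?M. (nsums (inter_sp A) (\<lambda>n. indicat_real (E n) (fst p) *\<^sub>R x n) (u (exp (fst p))) \<and>
        (\<Sum>n. indicator (E n) (fst p) * ennreal (J_fun A (exp (fst p)) (x n))) \<le> ennreal (q * J_fun A (exp (fst p)) (u (exp (fst p))))) \<and>
      (nsums (inter_sp B) (\<lambda>n. indicat_real (H n) (snd p) *\<^sub>R y n) (v (exp (snd p))) \<and>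
        (\<Sum>n. indicator (H n) (snd p) * ennreal (J_fun B (exp (snd p)) (y n))) \<le> ennreal (q * J_fun B (exp (snd p)) (v (exp (snd p)))))"
      using E H by (intro AE_pair_fst_snd sigma_finite_lebesgue AE_completion) (simp_all add: J_series_def)
    then show "AE p in ?M. nsums (sum_sp C) (\<lambda>i. indicat_real (R i) p *\<^sub>R Tpair x y i) (case p of (s, t) \<Rightarrow> T (u (exp s)) (v (exp t)))"
    proof eventually_elim
      case (elim p)
      obtain s t where p: "p = (s, t)" by (cases p)
      have fa: "(\<Sum>n. ennreal (nrm (fst A) (indicat_real (E n) s *\<^sub>R x n))) < \<infinity>"
      proof (rule order.strict_trans1)
        show "(\<Sum>n. ennreal (nrm (fst A) (indicat_real (E n) s *\<^sub>R x n))) \<le> (\<Sum>n. indicator (E n) s * ennreal (J_fun A (exp s) (x n)))"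
          by (intro Series.suminf_le summableI) (auto simp: indicator_def J_fun_def A.X0.nrm_zero intro: ennreal_leI)
        show "(\<Sum>n. indicator (E n) s * ennreal (J_fun A (exp s) (x n))) < \<infinity>"
          using elim p by (auto intro: order.strict_trans1[OF _ ennreal_less_top])
      qed
      have fb: "(\<Sum>n. ennreal (nrm (fst B) (indicat_real (H n) t *\<^sub>R y n))) < \<infinity>"
      proof (rule order.strict_trans1)
        show "(\<Sum>n. ennreal (nrm (fst B) (indicat_real (H n) t *\<^sub>R y n))) \<le> (\<Sum>n. indicator (H n) t * ennreal (J_fun B (exp t) (y n)))"
          by (intro Series.suminf_le summableI) (auto simp: indicator_def J_fun_def B.X0.nrm_zero intro: ennreal_leI)
        show "(\<Sum>n. indicator (H n) t * ennreal (J_fun B (exp t) (y n))) < \<infinity>"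
          using elim p by (auto intro: order.strict_trans1[OF _ ennreal_less_top])
      qed
      have "nsums (sum_sp C) (dseries prod_decode T (\<lambda>n. indicat_real (E n) s) x (\<lambda>m. indicat_real (H m) t) y) (T (u (exp s)) (v (exp t)))"
        using elim p by (intro T_expand xI yI fa fb) simp_all
      moreover have "dseries prod_decode T (\<lambda>n. indicat_real (E n) s) x (\<lambda>m. indicat_real (H m) t) y =
          (\<lambda>i. indicat_real (R i) p *\<^sub>R Tpair x y i)"
        by (rule ext) (simp add: dseries_Tpair R_def p indicator_times)
      ultimately show ?case by (simp add: p)
    qed
  qed
qed

text \<open>Cutting every \<open>E n\<close> and \<open>H m\<close> at 0 splits both series into
  parts that converge in the end point spaces; by uniqueness of sums the parts add up to
  \<open>a\<close> and \<open>b\<close>, and \<open>dseries_split_eq\<close> applies.\<close>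

lemma pair_agree:
  assumes u: "repA a u" and E: "J_series A q u E x" and v: "repB b v" and H: "J_series B q v H y" and q: "0 \<le> q"
    and z: "nsums (sum_sp C) (dseries prod_decode T (\<lambda>n. measure lborel (E n)) x (\<lambda>m. measure lborel (H m)) y) z"
    and cond: "a \<in> carr (fst A) \<and> b \<in> carr (fst B) \<or> a \<in> carr (snd A) \<and> b \<in> carr (snd B)"
  shows "z = T a b"
proof -
  note SA = A.J_series_sums[OF E q repA_facts(1,7)[OF u]] and SB = B.J_series_sums[OF H q repB_facts(1,7)[OF v]]
  let ?E0 = "\<lambda>n. measure lborel (E n \<inter> {..<0})" and ?E1 = "\<lambda>n. measure lborel (E n \<inter> {0..})"
  let ?H0 = "\<lambda>n. measure lborel (H n \<inter> {..<0})" and ?H1 = "\<lambda>n. measure lborel (H n \<inter> {0..})"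
  have mE: "measure lborel (E n) = ?E0 n + ?E1 n" and mH: "measure lborel (H n) = ?H0 n + ?H1 n" for n
    by (rule measure_split[OF J_seriesD(1)[OF E] SA(1)] measure_split[OF J_seriesD(1)[OF H] SB(1)])+
  obtain a0 a1 where a01: "nsums (fst A) (\<lambda>n. ?E0 n *\<^sub>R x n) a0" "nsums (snd A) (\<lambda>n. ?E1 n *\<^sub>R x n) a1"
    using SA(3,4) by blast
  obtain b0 b1 where b01: "nsums (fst B) (\<lambda>n. ?H0 n *\<^sub>R y n) b0" "nsums (snd B) (\<lambda>n. ?H1 n *\<^sub>R y n) b1"
    using SB(3,4) by blast
  have "nsums (sum_sp A) (\<lambda>n. (?E0 n + ?E1 n) *\<^sub>R x n) (a0 + a1)"
    unfolding scaleR_add_left by (intro A.S.nsums_add A.nsums_sum0 A.nsums_sum1 a01)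
  with SA(2) u have a: "a0 + a1 = a" unfolding mE J_rep_def by (auto intro: A.S.nsums_unique)
  have "nsums (sum_sp B) (\<lambda>n. (?H0 n + ?H1 n) *\<^sub>R y n) (b0 + b1)"
    unfolding scaleR_add_left by (intro B.S.nsums_add B.nsums_sum0 B.nsums_sum1 b01)
  with SB(2) v have b: "b0 + b1 = b" unfolding mH J_rep_def by (auto intro: B.S.nsums_unique)
  have "z = T (a0 + a1) (b0 + b1)"
    by (rule dseries_split_eq[OF J_seriesD(2)[OF E] J_seriesD(2)[OF H] _ _ _ _ a01 b01])
      (use z dseries_finite[OF u E v H q] cond in \<open>simp_all add: mE[symmetric] mH[symmetric] a b\<close>)
  then show ?thesis unfolding a b .
qed

end

section \<open>The norm on J-spaces\<close>

lemma Inf_mult_lower: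
  fixes S :: "real set"
  assumes S: "S \<noteq> {}" "\<And>s. s \<in> S \<Longrightarrow> 0 \<le> s" and c: "0 \<le> c" and N: "\<And>s. s \<in> S \<Longrightarrow> N \<le> c * s"
  shows "N \<le> c * Inf S"
proof (cases "c = 0")
  case True
  obtain s where "s \<in> S" using S(1) by blast
  from N[OF this] True show ?thesis by simp
next
  case False
  with c have c: "0 < c" by simp
  have "N / c \<le> Inf S" using S(1) N c by (intro cInf_greatest) (auto simp: pos_divide_le_eq mult.commute)
  then show ?thesis using c by (simp add: pos_divide_le_eq mult.commute)
qed

lemma J_space_carr: "a \<in> carr (J_space X \<theta> b G) \<longleftrightarrow> (\<exists>u. J_rep X \<theta> b G a u)"
  by (simp add: J_space_def)

lemma J_space_nrm_le:
  assumes G: "normed_sp G" and u: "J_rep X \<theta> b G a u"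
  shows "nrm (J_space X \<theta> b G) a \<le> nrm G (abs_l0 (J_weighted X \<theta> b u))"
proof -
  interpret G: nsp G by standard (rule G)
  have "bdd_below {nrm G (abs_l0 (J_weighted X \<theta> b u)) | u. J_rep X \<theta> b G a u}"
    by (intro bdd_belowI[of _ 0]) (auto simp: J_rep_def)
  then show ?thesis unfolding J_space_def using u by (auto intro: cInf_lower)
qed

lemma J_space_nrm_greatest:
  assumes G: "normed_sp G" and a: "a \<in> carr (J_space X \<theta> b G)" and c: "0 \<le> c"
    and N: "\<And>u. J_rep X \<theta> b G a u \<Longrightarrow> N \<le> c * nrm G (abs_l0 (J_weighted X \<theta> b u))"
  shows "N \<le> c * nrm (J_space X \<theta> b G) a"
proof -
  interpret G: nsp G by standard (rule G)
  have "N \<le> c * Inf {nrm G (abs_l0 (J_weighted X \<theta> b u)) | u. J_rep X \<theta> b G a u}"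
    using a N by (intro Inf_mult_lower c) (auto simp: J_space_carr J_rep_def)
  then show ?thesis by (simp add: J_space_def)
qed

lemma J_space_nrm_nonneg:
  assumes G: "normed_sp G" and a: "a \<in> carr (J_space X \<theta> b G)"
  shows "0 \<le> nrm (J_space X \<theta> b G) a"
proof -
  interpret G: nsp G by standard (rule G)
  have "0 \<le> 1 * nrm (J_space X \<theta> b G) a" by (rule J_space_nrm_greatest[OF G a]) (auto simp: J_rep_def)
  then show ?thesis by simp
qed

lemma (in couple) J_rep_zero:
  assumes G: "normed_sp G" shows "J_rep X \<theta> b G 0 (\<lambda>_. 0)"
proof -
  interpret G: nsp G by standard (rule G)
  have I0: "nsums (inter_sp X) (\<lambda>i. (\<lambda>_ _. 0) i t *\<^sub>R (\<lambda>_. 0) i) 0" for t :: real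
    by (simp add: nsums_def nlim_def I.nrm_zero I.zero_mem del: carr_inter)
  have S0: "nsums (sum_sp X) (\<lambda>i. 0 *\<^sub>R (\<lambda>_. 0) i) 0"
    by (simp add: nsums_def nlim_def S.nrm_zero)
  have "strongly_measurable (lebesgue_on {0<..}) (inter_sp X) (\<lambda>_. 0)"
    by (rule strongly_measurable_bounded_series[OF normed_inter, where c = "\<lambda>_ _. 0" and B = "\<lambda>_. 0" and z = "\<lambda>_. 0"])
      (use I0 I.zero_mem in \<open>simp_all del: carr_inter\<close>)
  moreover have "has_bochner_int (lebesgue :: real measure) (sum_sp X) (\<lambda>_. 0) 0"
    by (rule has_bochner_int_series[OF normed_sum, where c = "\<lambda>_ _. 0" and B = "\<lambda>_. 0" and z = "\<lambda>_. 0"])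
      (use S0 in simp_all)
  moreover have "J_weighted X \<theta> b (\<lambda>_. 0) = (\<lambda>_. 0)" by (simp add: J_weighted_def J_fun_zero fun_eq_iff)
  ultimately show ?thesis by (simp add: J_rep_def abs_l0_zero)
qed

lemma (in couple) J_space_zero:
  assumes G: "normed_sp G"
  shows "0 \<in> carr (J_space X \<theta> b G)" "nrm (J_space X \<theta> b G) 0 \<le> 1"
proof -
  interpret G: nsp G by standard (rule G)
  show "0 \<in> carr (J_space X \<theta> b G)" using J_rep_zero[OF G] unfolding J_space_carr by blast
  have "J_weighted X \<theta> b (\<lambda>_. 0) = (\<lambda>_. 0)" by (simp add: J_weighted_def J_fun_zero fun_eq_iff)
  then show "nrm (J_space X \<theta> b G) 0 \<le> 1"
    using J_space_nrm_le[OF G J_rep_zero[OF G, of \<theta> b]] by (simp add: abs_l0_zero G.nrm_zero)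
qed

text \<open>Taken along \<open>q = 1 + 1/(n+1)\<close>, which runs through \<open>(1, 2]\<close> and
  tends to 1.\<close>

lemma le_of_squares:
  fixes N X :: real
  assumes "\<And>q. 1 < q \<Longrightarrow> q \<le> 2 \<Longrightarrow> N \<le> q\<^sup>2 * X"
  shows "N \<le> X"
proof (rule LIMSEQ_le_const)
  have "(\<lambda>n. (1 + 1 / (real n + 1))\<^sup>2 * X) \<longlonglongrightarrow> (1 + 0)\<^sup>2 * X"
    by (intro tendsto_intros inverse_Suc_LIMSEQ)
  then show "(\<lambda>n. (1 + 1 / (real n + 1))\<^sup>2 * X) \<longlonglongrightarrow> X" by simp
  show "\<exists>k. \<forall>n\<ge>k. N \<le> (1 + 1 / (real n + 1))\<^sup>2 * X"
    by (intro exI[of _ 0] allI impI assms) simp_all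
qed

section \<open>The operator on J-spaces\<close>

context J_bilin
begin

abbreviation "SA \<equiv> J_space A \<theta> \<phi> GA"
abbreviation "SB \<equiv> J_space B \<theta> (m_fun \<phi>) GB"
abbreviation "SC \<equiv> J_space C \<theta> \<phi> GC"

text \<open>The factor is fixed at 2 so that the operator does not depend on \<open>q\<close>; by
  \<open>J_series_mono\<close> all series with \<open>1 < q <= 2\<close> are included.\<close>

definition seriesA :: "'a \<Rightarrow> (nat \<Rightarrow> real) \<Rightarrow> (nat \<Rightarrow> 'a) \<Rightarrow> bool" where
  "seriesA a \<alpha> x \<longleftrightarrow> (\<exists>u E. repA a u \<and> J_series A 2 u E x \<and> \<alpha> = (\<lambda>n. measure lborel (E n)))"

definition seriesB :: "'b \<Rightarrow> (nat \<Rightarrow> real) \<Rightarrow> (nat \<Rightarrow> 'b) \<Rightarrow> bool" where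
  "seriesB b \<beta> y \<longleftrightarrow> (\<exists>v H. repB b v \<and> J_series B 2 v H y \<and> \<beta> = (\<lambda>n. measure lborel (H n)))"

lemma seriesA_ex: assumes "a \<in> carr SA" shows "\<exists>\<alpha> x. seriesA a \<alpha> x"
proof -
  obtain u where u: "repA a u" using assms by (auto simp: J_space_carr)
  obtain E x where "J_series A 2 u E x" using A.J_series_exists[of u 2] u by (auto simp: J_rep_def)
  with u show ?thesis unfolding seriesA_def by blast
qed

lemma seriesB_ex: assumes "b \<in> carr SB" shows "\<exists>\<beta> y. seriesB b \<beta> y"
proof -
  obtain v where v: "repB b v" using assms by (auto simp: J_space_carr)
  obtain H y where "J_series B 2 v H y" using B.J_series_exists[of v 2] v by (auto simp: J_rep_def)
  with v show ?thesis unfolding seriesB_def by blast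
qed

lemma normed_G: "normed_sp GA" "normed_sp GB" "normed_sp GC"
  using F couple_L1_assoc couple_ri_Linf normed_fspace
  unfolding interpolation_functor_def banach_sp_def by blast+

lemma bilinear_operator_on_J_spaces:
  obtains T' where "J_extension A B C T \<theta> \<phi> GA (m_fun \<phi>) GB T'" "bilinear_btw SA SB SC T'"
    "\<And>a b. a \<in> carr SA \<Longrightarrow> b \<in> carr SB \<Longrightarrow> nrm SC (T' a b) \<le> K * T_norm * nrm SA a * nrm SB b"
proof -
  obtain T' where T': "\<And>a \<alpha> x b \<beta> y. seriesA a \<alpha> x \<Longrightarrow> seriesB b \<beta> y \<Longrightarrow> nsums (sum_sp C) (dseries prod_decode T \<alpha> x \<beta> y) (T' a b)"
    "\<And>a a' b. \<exists>\<alpha> x. seriesA a \<alpha> x \<Longrightarrow> \<exists>\<alpha> x. seriesA a' \<alpha> x \<Longrightarrow> \<exists>\<beta> y. seriesB b \<beta> y \<Longrightarrow> T' (a + a') b = T' a b + T' a' b"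
    "\<And>a b b'. \<exists>\<alpha> x. seriesA a \<alpha> x \<Longrightarrow> \<exists>\<beta> y. seriesB b \<beta> y \<Longrightarrow> \<exists>\<beta> y. seriesB b' \<beta> y \<Longrightarrow> T' a (b + b') = T' a b + T' a b'"
    "\<And>a b c. \<exists>\<alpha> x. seriesA a \<alpha> x \<Longrightarrow> \<exists>\<beta> y. seriesB b \<beta> y \<Longrightarrow> T' (c *\<^sub>R a) b = c *\<^sub>R T' a b \<and> T' a (c *\<^sub>R b) = c *\<^sub>R T' a b"
  proof (rule bilinear_extension[of seriesA seriesB])
    show "(\<forall>n. x n \<in> carr (inter_sp A)) \<and> nsums (sum_sp A) (\<lambda>n. \<alpha> n *\<^sub>R x n) a" if P: "seriesA a \<alpha> x" for a \<alpha> x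
    proof -
      obtain u E where u: "repA a u" and E: "J_series A 2 u E x" and \<alpha>: "\<alpha> = (\<lambda>n. measure lborel (E n))"
        using P unfolding seriesA_def by blast
      have "has_bochner_int lebesgue (sum_sp A) (\<lambda>t. u (exp t)) a" using u by (simp add: J_rep_def)
      from A.J_series_sums(2)[OF E _ repA_facts(1,7)[OF u] this] J_seriesD(2)[OF E] show ?thesis unfolding \<alpha> by simp
    qed
    show "(\<forall>n. y n \<in> carr (inter_sp B)) \<and> nsums (sum_sp B) (\<lambda>n. \<beta> n *\<^sub>R y n) b" if P: "seriesB b \<beta> y" for b \<beta> y
    proof -
      obtain v H where v: "repB b v" and H: "J_series B 2 v H y" and \<beta>: "\<beta> = (\<lambda>n. measure lborel (H n))"
        using P unfolding seriesB_def by blast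
      have "has_bochner_int lebesgue (sum_sp B) (\<lambda>t. v (exp t)) b" using v by (simp add: J_rep_def)
      from B.J_series_sums(2)[OF H _ repB_facts(1,7)[OF v] this] J_seriesD(2)[OF H] show ?thesis unfolding \<beta> by simp
    qed
    show "(\<Sum>i. ennreal (nrm (sum_sp C) (dseries prod_decode T \<alpha> x \<beta> y i))) < \<infinity>" if P: "seriesA a \<alpha> x" "seriesB b \<beta> y" for a \<alpha> x b \<beta> y
    proof -
      obtain u E where u: "repA a u" "J_series A 2 u E x" and \<alpha>: "\<alpha> = (\<lambda>n. measure lborel (E n))"
        using P unfolding seriesA_def by blast
      obtain v H where v: "repB b v" "J_series B 2 v H y" and \<beta>: "\<beta> = (\<lambda>n. measure lborel (H n))"
        using P unfolding seriesB_def by blast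
      show ?thesis unfolding \<alpha> \<beta> by (rule dseries_finite[OF u v]) simp
    qed
  qed blast
  \<comment> \<open>For any two representations and any \<open>q\<close> in \<open>(1, 2]\<close>
    there are series for that \<open>q\<close> whose product has the sum \<open>T' a b\<close>, a
    value that involves neither the representations nor \<open>q\<close>.\<close>
  have sums: "\<exists>E x H y. J_series A q u E x \<and> J_series B q v H y \<and>
      nsums (sum_sp C) (dseries prod_decode T (\<lambda>n. measure lborel (E n)) x (\<lambda>m. measure lborel (H m)) y) (T' a b)"
    if u: "repA a u" and v: "repB b v" and q: "1 < q" "q \<le> 2" for a u b v q
  proof -
    obtain E x where E: "J_series A q u E x" using A.J_series_exists[of u q] u q by (auto simp: J_rep_def)
    obtain H y where H: "J_series B q v H y" using B.J_series_exists[of v q] v q by (auto simp: J_rep_def)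
    have "seriesA a (\<lambda>n. measure lborel (E n)) x"
      unfolding seriesA_def using u A.J_series_mono[OF E q(2) repA_facts(2)[OF u]] by blast
    moreover have "seriesB b (\<lambda>m. measure lborel (H m)) y"
      unfolding seriesB_def using v B.J_series_mono[OF H q(2) repB_facts(2)[OF v]] by blast
    ultimately show ?thesis using E H T'(1) by blast
  qed
  show ?thesis
  proof (rule that)
    show "J_extension A B C T \<theta> \<phi> GA (m_fun \<phi>) GB T'"
      unfolding J_extension_def
    proof (intro conjI ballI allI impI)
      fix a b assume a: "a \<in> carr SA" and b: "b \<in> carr SB"
        and cond: "a \<in> carr (fst A) \<and> b \<in> carr (fst B) \<or> a \<in> carr (snd A) \<and> b \<in> carr (snd B)"
      obtain u v where u: "repA a u" and v: "repB b v" using a b by (auto simp: J_space_carr)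
      obtain E x H y where E: "J_series A 2 u E x" and H: "J_series B 2 v H y"
        and z: "nsums (sum_sp C) (dseries prod_decode T (\<lambda>n. measure lborel (E n)) x (\<lambda>m. measure lborel (H m)) y) (T' a b)"
        using sums[OF u v, of 2] by auto
      show "T' a b = T a b" by (rule pair_agree[OF u E v H _ z cond]) simp
    next
      fix a b u v assume u: "repA a u" and v: "repB b v"
      obtain E x H y where E: "J_series A 2 u E x" and H: "J_series B 2 v H y"
        and z: "nsums (sum_sp C) (dseries prod_decode T (\<lambda>n. measure lborel (E n)) x (\<lambda>m. measure lborel (H m)) y) (T' a b)"
        using sums[OF u v, of 2] by auto
      show "has_bochner_int (lebesgue \<Otimes>\<^sub>M lebesgue) (sum_sp C) (\<lambda>(s, t). T (u (exp s)) (v (exp t))) (T' a b)"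
        by (rule pair_double_integral[OF u E v H _ z]) simp
    qed
    have rep: "\<exists>w. repC (T' a b) w \<and> nrm GC (abs_l0 (J_weighted C \<theta> \<phi> w)) \<le>
        K * (T_norm * q\<^sup>2) * nrm GA (abs_l0 (jA u)) * nrm GB (abs_l0 (jB v))"
      if u: "repA a u" and v: "repB b v" and q: "1 < q" "q \<le> 2" for a u b v q
    proof -
      obtain E x H y where E: "J_series A q u E x" and H: "J_series B q v H y"
        and z: "nsums (sum_sp C) (dseries prod_decode T (\<lambda>n. measure lborel (E n)) x (\<lambda>m. measure lborel (H m)) y) (T' a b)"
        using sums[OF u v q] by auto
      show ?thesis by (rule pair_rep[OF u E v H _ z]) (use q in auto)
    qed
    show "bilinear_btw SA SB SC T'"
      unfolding bilinear_btw_def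
    proof (intro conjI ballI allI)
      fix a b assume a: "a \<in> carr SA" and b: "b \<in> carr SB"
      obtain u v where u: "repA a u" and v: "repB b v" using a b by (auto simp: J_space_carr)
      show "T' a b \<in> carr SC" using rep[OF u v, of 2] by (auto simp: J_space_carr)
      show "T' (c *\<^sub>R a) b = c *\<^sub>R T' a b" "T' a (c *\<^sub>R b) = c *\<^sub>R T' a b" for c
        using T'(4) seriesA_ex[OF a] seriesB_ex[OF b] by blast+
      show "T' (a + a') b = T' a b + T' a' b" if "a' \<in> carr SA" for a'
        by (rule T'(2)[OF seriesA_ex[OF a] seriesA_ex[OF that] seriesB_ex[OF b]])
      show "T' a (b + b') = T' a b + T' a b'" if "b' \<in> carr SB" for b'
        by (rule T'(3)[OF seriesA_ex[OF a] seriesB_ex[OF b] seriesB_ex[OF that]])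
    qed
    fix a b assume a: "a \<in> carr SA" and b: "b \<in> carr SB"
    interpret GA: nsp GA by standard (rule normed_G)
    interpret GB: nsp GB by standard (rule normed_G)
    \<comment> \<open>With \<open>T' a b\<close> fixed, \<open>q\<close> tends to 1 for each pair of
      representations; the two infima are taken afterwards, first over \<open>v\<close> and then
      over \<open>u\<close>.\<close>
    have uv: "nrm SC (T' a b) \<le> K * T_norm * nrm GA (abs_l0 (jA u)) * nrm GB (abs_l0 (jB v))"
      if u: "repA a u" and v: "repB b v" for u v
    proof (rule le_of_squares)
      fix q :: real assume q: "1 < q" "q \<le> 2"
      obtain w where w: "repC (T' a b) w" "nrm GC (abs_l0 (J_weighted C \<theta> \<phi> w)) \<le>
        K * (T_norm * q\<^sup>2) * nrm GA (abs_l0 (jA u)) * nrm GB (abs_l0 (jB v))" using rep[OF u v q] by blast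
      show "nrm SC (T' a b) \<le> q\<^sup>2 * (K * T_norm * nrm GA (abs_l0 (jA u)) * nrm GB (abs_l0 (jB v)))"
        using order_trans[OF J_space_nrm_le[OF normed_G(3) w(1)] w(2)] by (simp add: mult_ac)
    qed
    have u: "nrm SC (T' a b) \<le> K * T_norm * nrm GA (abs_l0 (jA u)) * nrm SB b" if u: "repA a u" for u
    proof (rule J_space_nrm_greatest[OF normed_G(2) b _ uv[OF u]])
      have "abs_l0 (jA u) \<in> carr GA" using u by (simp add: J_rep_def)
      then show "0 \<le> K * T_norm * nrm GA (abs_l0 (jA u))" using K T_norm_nonneg by simp
    qed
    have "nrm SC (T' a b) \<le> K * T_norm * nrm SB b * nrm SA a"
    proof (rule J_space_nrm_greatest[OF normed_G(1) a])
      show "0 \<le> K * T_norm * nrm SB b" using K T_norm_nonneg J_space_nrm_nonneg[OF normed_G(2) b] by simp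
      show "nrm SC (T' a b) \<le> K * T_norm * nrm SB b * nrm GA (abs_l0 (jA u))" if "repA a u" for u
        using u[OF that] by (simp add: mult_ac)
    qed
    then show "nrm SC (T' a b) \<le> K * T_norm * nrm SA a * nrm SB b" by (simp add: mult_ac)
  qed
qed

lemma bilinear_norm_le:
  assumes K1: "K = 1" and T': "\<And>a b. a \<in> carr SA \<Longrightarrow> b \<in> carr SB \<Longrightarrow> nrm SC (T' a b) \<le> K * T_norm * nrm SA a * nrm SB b"
  shows "bilinear_norm SA SB SC T' \<le> T_norm"
  unfolding bilinear_norm_def
proof (rule cSup_least)
  show "{nrm SC (T' x y) |x y. x \<in> carr SA \<and> nrm SA x \<le> 1 \<and> y \<in> carr SB \<and> nrm SB y \<le> 1} \<noteq> {}"
  proof (rule ex_in_conv[THEN iffD1], rule exI[of _ "nrm SC (T' 0 0)"], rule CollectI, intro exI conjI)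
    show "nrm SC (T' 0 0) = nrm SC (T' 0 0)" ..
  qed (rule A.J_space_zero[OF normed_G(1)] B.J_space_zero[OF normed_G(2)])+
  fix N assume "N \<in> {nrm SC (T' x y) |x y. x \<in> carr SA \<and> nrm SA x \<le> 1 \<and> y \<in> carr SB \<and> nrm SB y \<le> 1}"
  then obtain a b where ab: "a \<in> carr SA" "nrm SA a \<le> 1" "b \<in> carr SB" "nrm SB b \<le> 1" "N = nrm SC (T' a b)" by blast
  have "N \<le> T_norm * (nrm SA a * nrm SB b)" using T'[OF ab(1,3)] K1 by (simp add: ab(5) mult.assoc)
  also have "\<dots> \<le> T_norm * (1 * 1)"
    using ab T_norm_nonneg J_space_nrm_nonneg[OF normed_G(2) ab(3)] by (intro mult_left_mono mult_mono) auto
  finally show "N \<le> T_norm" by simp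
qed

end

theorem theorem3p5:
  fixes A :: "'a::real_vector couple"
    and B :: "'b::real_vector couple"
    and C :: "'c::real_vector couple"
    and T :: "'a \<Rightarrow> 'b \<Rightarrow> 'c"
    and \<theta> :: real
    and \<phi> :: "real \<Rightarrow> real"
    and \<rho> :: "(real \<Rightarrow> ennreal) \<Rightarrow> ennreal"
    and F :: "l0 couple \<Rightarrow> l0 nspace"
  assumes "compatible_couple A" and "compatible_couple B" and "compatible_couple C"
    and "bounded_bilinear_btw (fst A) (fst B) (fst C) T"
    and "bounded_bilinear_btw (snd A) (snd B) (snd C) T"
    and "0 \<le> \<theta>" and "\<theta> \<le> 1"
    and "slowly_varying \<phi>"
    and "ri_norm \<rho>"
    and "interpolation_functor F"
    and endpoint: "\<theta> = 0 \<or> \<theta> = 1 \<Longrightarrow> J_admissible \<theta> \<phi> (F (fspace \<rho>, Linf_sp))"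
  shows "\<exists>T'.
      J_extension A B C T
        \<theta> \<phi> (fspace \<rho>) (m_fun \<phi>) (F (L1_sp, fspace (assoc_norm \<rho>))) T' \<and>
      bounded_bilinear_btw
        (J_space A \<theta> \<phi> (fspace \<rho>))
        (J_space B \<theta> (m_fun \<phi>) (F (L1_sp, fspace (assoc_norm \<rho>))))
        (J_space C \<theta> \<phi> (F (fspace \<rho>, Linf_sp))) T' \<and>
      (exact_functor F \<longrightarrow>
        bilinear_norm
          (J_space A \<theta> \<phi> (fspace \<rho>))
          (J_space B \<theta> (m_fun \<phi>) (F (L1_sp, fspace (assoc_norm \<rho>))))
          (J_space C \<theta> \<phi> (F (fspace \<rho>, Linf_sp))) T'
        \<le> max (bilinear_norm (fst A) (fst B) (fst C) T) (bilinear_norm (snd A) (snd B) (snd C) T))"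
proof -
  interpret r: ri \<rho> by standard (rule assms)
  \<comment> \<open>Inside the interval the decay of the kernel proves admissibility; at
    \<open>\<theta> = 0\<close> and \<open>\<theta> = 1\<close> there is decay on one side only, and
    the hypothesis takes over.\<close>
  have adm: "J_admissible \<theta> \<phi> (F (fspace \<rho>, Linf_sp))"
  proof (cases "\<theta> = 0 \<or> \<theta> = 1")
    case False
    then show ?thesis using assms by (intro r.J_admissible_interior) auto
  qed (rule endpoint)
  show ?thesis
  proof (rule r.conv_functor[OF \<open>interpolation_functor F\<close>], goal_cases)
    case (1 K)
    interpret J_bilin A B C T \<rho> \<theta> \<phi> F K
    proof (intro J_bilin.intro bilin.intro J_bilin_axioms.intro)
      show "ri \<rho>" by (rule r.ri_axioms)
    qed (fact assms adm 1)+
    obtain T' where T': "J_extension A B C T \<theta> \<phi> GA (m_fun \<phi>) GB T'" "bilinear_btw SA SB SC T'"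
      "\<And>a b. a \<in> carr SA \<Longrightarrow> b \<in> carr SB \<Longrightarrow> nrm SC (T' a b) \<le> K * T_norm * nrm SA a * nrm SB b"
      using bilinear_operator_on_J_spaces by blast
    have "bounded_bilinear_btw SA SB SC T'" unfolding bounded_bilinear_btw_def using T'(2,3) by blast
    moreover have "exact_functor F \<Longrightarrow> bilinear_norm SA SB SC T' \<le> T_norm" using bilinear_norm_le[OF 1(2) T'(3)] .
    ultimately show ?case using T'(1) unfolding T_norm_def by blast
  qed
qed

end
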